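(* Assume $\lambda(N)/N\to\lambda<1$ as $N\to\infty$, and $\mathbf{q}^{d(N)}(0)\to\mathbf{q}^\infty$ in $\mathcal{S}$ as $N\to\infty$. For the JSQ$(d(N))$ scheme with $d(N)\to\infty$ as $N\to\infty$, any subsequence of the sequence of processes $\{\mathbf{q}^{d(N)}(t)\}_{t\ge 0}$ has a further subsequence that converges weakly with respect to the Skorohod $J_1$ topology to a limit $\{\mathbf{q}(t)\}_{t\ge 0}$ satisfying the system of integral equations $$q_i(t)=q_i^\infty+\lambda\int_0^t p_{i-1}(\mathbf{q}(s))\,ds-\int_0^t\big(q_i(s)-q_{i+1}(s)\big)\,ds,\qquad i=1,\dots,b,$$ where the coefficients $p_i(\cdot)$ are as defined in the context.
   Context: Model: the $N$-th system has $N$ parallel identical single-server queues and one dispatcher. Tasks with independent unit-mean exponential service requirements arrive as a Poisson process of rate $\lambda(N)$. On arrival, a task is immediately assigned to a server with the shortest queue among $d(N)$ servers selected uniformly at random (without replacement), $1\le d(N)\le N$ (the JSQ$(d(N))$ scheme; $d(N)=N$ is the ordinary JSQ policy). Each server has buffer capacity $b$ ($1\le b\le\infty$, including the task in service); a task assigned to a server with $b$ pending tasks is permanently discarded. $Q_i^{d(N)}(t)$ is the number of servers with queue length at least $i$ (including the task in service) at time $t$, $i=1,\dots,b$, and $q_i^{d(N)}(t)=Q_i^{d(N)}(t)/N$, $\mathbf{q}^{d(N)}(t)=(q_1^{d(N)}(t),\dots,q_b^{d(N)}(t))$. When $b=\infty$, "$i=1,\dots,b$" means all $i\ge1$; when $b<\infty$,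 $q_{b+1}\equiv 0$. $\mathcal{S}=\{\mathbf{q}\in[0,1]^b: q_i\le q_{i-1}\text{ for } i=2,\dots,b,\ \sum_{i=1}^b q_i<\infty\}$, equipped with the $\ell_1$ topology. For $\mathbf{q}\in\mathcal{S}$ let $m(\mathbf{q})=\min\{i\ge 0: q_{i+1}<1\}$. If $m(\mathbf{q})=0$, then $p_0(\mathbf{q})=1$ and $p_i(\mathbf{q})=0$ for all $i\ge1$. If $m(\mathbf{q})>0$ and $\lambda\le 1-q_{m(\mathbf{q})+1}$, then $p_{m(\mathbf{q})-1}(\mathbf{q})=1$ and $p_i(\mathbf{q})=0$ for all $i\neq m(\mathbf{q})-1$. If $m(\mathbf{q})>0$ and $\lambda>1-q_{m(\mathbf{q})+1}$, then $p_{m(\mathbf{q})-1}(\mathbf{q})=(1-q_{m(\mathbf{q})+1})/\lambda$, $p_{m(\mathbf{q})}(\mathbf{q})=1-p_{m(\mathbf{q})-1}(\mathbf{q})$, and $p_i(\mathbf{q})=0$ for all other $i$. *)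

theory Defs
  imports "HOL-Probability.Probability" "HOL-Library.Extended_Nat"
begin

section \<open>Skorohod space and weak convergence\<close>

text \<open>Paths are indexed by the time set \<open>{0..}\<close>; they are extensional functions, so that two paths
  are equal iff they agree at all nonnegative times.\<close>

definition time_changes :: "(real \<Rightarrow> real) set" where
  "time_changes = {\<mu>. strict_mono_on {0..} \<mu> \<and> \<mu> ` {0..} = {0..}}"

context Metric_space
begin

definition cadlag_paths :: "(real \<Rightarrow> 'a) set" where
  "cadlag_paths = {x \<in> {0..} \<rightarrow>\<^sub>E M.
     (\<forall>t\<ge>0. limitin mtopology x (x t) (at_right t)) \<and>
     (\<forall>t>0. \<exists>l. limitin mtopology x l (at_left t))}"

text \<open>The \<open>J\<^sub>1\<close> topology on \<open>D([0,\<infinity>), M)\<close>. By definition \<open>y\<^sub>n \<rightarrow> x\<close> iff for every horizon \<open>T\<close> there are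
  time changes \<open>\<mu>\<^sub>n\<close> with \<open>\<bar>\<mu>\<^sub>n t - t\<bar> \<rightarrow> 0\<close> and \<open>d (y\<^sub>n t) (x (\<mu>\<^sub>n t)) \<rightarrow> 0\<close> uniformly on \<open>{0..T}\<close>; this is
  the standard description of \<open>J\<^sub>1\<close> convergence on the half line (Ethier and Kurtz, Markov Processes,
  Proposition 3.5.3(c); Jacod and Shiryaev, Theorem VI.1.14). The sets below are the corresponding
  basic neighbourhoods (not necessarily open) of \<open>x\<close>.\<close>

definition J1_nhd :: "(real \<Rightarrow> 'a) \<Rightarrow> real \<Rightarrow> real \<Rightarrow> (real \<Rightarrow> 'a) set" where
  "J1_nhd x T \<epsilon> = {y \<in> cadlag_paths.
     \<exists>\<mu>\<in>time_changes. \<forall>t\<in>{0..T}. \<bar>\<mu> t - t\<bar> < \<epsilon> \<and> d (y t) (x (\<mu> t)) < \<epsilon>}"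

definition skorohod_J1 :: "(real \<Rightarrow> 'a) topology" where
  "skorohod_J1 = topology (\<lambda>U. U \<subseteq> cadlag_paths \<and> (\<forall>x\<in>U. \<exists>T>0. \<exists>\<epsilon>>0. J1_nhd x T \<epsilon> \<subseteq> U))"

lemma J1_nhd_mono:
  assumes "T \<le> T'" "\<epsilon>' \<le> \<epsilon>"
  shows "J1_nhd x T' \<epsilon>' \<subseteq> J1_nhd x T \<epsilon>"
proof
  fix y assume "y \<in> J1_nhd x T' \<epsilon>'"
  then obtain \<mu> where y: "y \<in> cadlag_paths" and \<mu>: "\<mu> \<in> time_changes"
    and c: "\<And>t. t \<in> {0..T'} \<Longrightarrow> \<bar>\<mu> t - t\<bar> < \<epsilon>' \<and> d (y t) (x (\<mu> t)) < \<epsilon>'"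
    unfolding J1_nhd_def by blast
  have "\<bar>\<mu> t - t\<bar> < \<epsilon> \<and> d (y t) (x (\<mu> t)) < \<epsilon>" if "t \<in> {0..T}" for t
    using c[of t] that assms by simp
  with y \<mu> show "y \<in> J1_nhd x T \<epsilon>" unfolding J1_nhd_def by blast
qed

lemma openin_skorohod_J1:
  "openin skorohod_J1 U \<longleftrightarrow> U \<subseteq> cadlag_paths \<and> (\<forall>x\<in>U. \<exists>T>0. \<exists>\<epsilon>>0. J1_nhd x T \<epsilon> \<subseteq> U)"
proof -
  let ?O = "\<lambda>U. U \<subseteq> cadlag_paths \<and> (\<forall>x\<in>U. \<exists>T>0. \<exists>\<epsilon>>0. J1_nhd x T \<epsilon> \<subseteq> U)"
  have "istopology ?O"
    unfolding istopology_def
  proof (intro conjI allI impI ballI)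
    fix U V x assume U: "?O U" and V: "?O V" and x: "x \<in> U \<inter> V"
    obtain T \<epsilon> where 1: "T > 0" "\<epsilon> > 0" "J1_nhd x T \<epsilon> \<subseteq> U" using U x by blast
    obtain T' \<epsilon>' where 2: "T' > 0" "\<epsilon>' > 0" "J1_nhd x T' \<epsilon>' \<subseteq> V" using V x by blast
    have "J1_nhd x (max T T') (min \<epsilon> \<epsilon>') \<subseteq> U"
      by (rule order_trans[OF J1_nhd_mono 1(3)]) auto
    moreover have "J1_nhd x (max T T') (min \<epsilon> \<epsilon>') \<subseteq> V"
      by (rule order_trans[OF J1_nhd_mono 2(3)]) auto
    moreover have "max T T' > 0" "min \<epsilon> \<epsilon>' > 0" using 1 2 by auto
    ultimately show "\<exists>T>0. \<exists>\<epsilon>>0. J1_nhd x T \<epsilon> \<subseteq> U \<inter> V" by (meson Int_greatest)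
  next
    fix U V assume "?O U" "?O V"
    then show "U \<inter> V \<subseteq> cadlag_paths" by blast
  next
    fix K assume K: "\<forall>U\<in>K. ?O U"
    then show "\<Union> K \<subseteq> cadlag_paths" by blast
    fix x assume "x \<in> \<Union> K"
    then obtain U where U: "U \<in> K" "x \<in> U" by blast
    then obtain T \<epsilon> where "T > 0" "\<epsilon> > 0" "J1_nhd x T \<epsilon> \<subseteq> U" using K by meson
    then show "\<exists>T>0. \<exists>\<epsilon>>0. J1_nhd x T \<epsilon> \<subseteq> \<Union> K" using U(1) by (meson Union_upper order_trans)
  qed
  then show ?thesis
    by (simp add: skorohod_J1_def topology_inverse')
qed

end

definition borel_of :: "'a topology \<Rightarrow> 'a measure" where
  "borel_of X = sigma (topspace X) {U. openin X U}"

text \<open>The random elements \<open>Y n\<close> of \<open>X\<close>, defined on the probability spaces \<open>\<Omega> n\<close>, converge weakly to the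
  Borel probability measure \<open>P\<close>.\<close>

definition converges_weakly ::
  "'a topology \<Rightarrow> (nat \<Rightarrow> 'w measure) \<Rightarrow> (nat \<Rightarrow> 'w \<Rightarrow> 'a) \<Rightarrow> 'a measure \<Rightarrow> bool" where
  "converges_weakly X \<Omega> Y P \<longleftrightarrow>
     (\<forall>n. Y n \<in> \<Omega> n \<rightarrow>\<^sub>M borel_of X) \<and>
     prob_space P \<and> sets P = sets (borel_of X) \<and>
     (\<forall>f. continuous_map X euclideanreal f \<longrightarrow> bounded (f ` topspace X) \<longrightarrow>
        (\<lambda>n. \<integral>\<omega>. f (Y n \<omega>) \<partial>\<Omega> n) \<longlonglongrightarrow> (\<integral>x. f x \<partial>P))"

section \<open>Occupancy states\<close>

text \<open>An occupancy state \<open>(q\<^sub>1, \<dots>, q\<^sub>b)\<close> is encoded as a function on \<open>nat\<close> by \<open>q\<^sub>0 = 1\<close> (every server has queue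
  length at least 0) and \<open>q\<^sub>i = 0\<close> for \<open>i > b\<close>. The additional coordinates are constant and so do
  not contribute to the \<open>\<ell>\<^sub>1\<close> distance.\<close>

definition occupancy_states :: "enat \<Rightarrow> (nat \<Rightarrow> real) set" where
  "occupancy_states b = {q. q 0 = 1 \<and> (\<forall>i. 0 \<le> q i \<and> q i \<le> 1) \<and> (\<forall>i. q (Suc i) \<le> q i) \<and>
     (\<forall>i. b < enat i \<longrightarrow> q i = 0) \<and> summable q}"

definition l1_dist :: "(nat \<Rightarrow> real) \<Rightarrow> (nat \<Rightarrow> real) \<Rightarrow> real" where
  "l1_dist x y = (\<Sum>\<^sub>\<infinity>i. \<bar>x i - y i\<bar>)"

lemma l1_dist_summable:
  assumes "x \<in> occupancy_states b" "y \<in> occupancy_states b"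
  shows "(\<lambda>i. \<bar>x i - y i\<bar>) summable_on UNIV"
proof (rule summable_on_comparison_test[where f = "\<lambda>i. x i + y i"])
  have "x summable_on UNIV" "y summable_on UNIV"
    using assms by (auto simp: occupancy_states_def intro!: summable_nonneg_imp_summable_on)
  then show "(\<lambda>i. x i + y i) summable_on UNIV" by (rule summable_on_add)
  fix i show "\<bar>x i - y i\<bar> \<le> x i + y i"
  proof -
    have "0 \<le> x i" "0 \<le> y i" using assms by (simp_all add: occupancy_states_def)
    then show ?thesis by simp
  qed
qed auto

lemma Metric_space_occupancy_states: "Metric_space (occupancy_states b) l1_dist"
proof
  show "0 \<le> l1_dist x y" for x y
    by (simp add: l1_dist_def infsum_nonneg)
  show "l1_dist x y = l1_dist y x" for x y
    by (simp add: l1_dist_def abs_minus_commute)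
  show "l1_dist x y = 0 \<longleftrightarrow> x = y" if "x \<in> occupancy_states b" "y \<in> occupancy_states b" for x y
  proof
    assume "l1_dist x y = 0"
    then have "\<bar>x i - y i\<bar> = 0" for i
      using nonneg_infsum_le_0D[OF _ l1_dist_summable[OF that], of i]
      by (simp add: l1_dist_def)
    then show "x = y" by (simp add: fun_eq_iff)
  qed (simp add: l1_dist_def)
  show "l1_dist x z \<le> l1_dist x y + l1_dist y z"
    if "x \<in> occupancy_states b" "y \<in> occupancy_states b" "z \<in> occupancy_states b" for x y z
  proof -
    note s = l1_dist_summable[OF that(1,2)] l1_dist_summable[OF that(2,3)]
    have "l1_dist x z \<le> (\<Sum>\<^sub>\<infinity>i. \<bar>x i - y i\<bar> + \<bar>y i - z i\<bar>)"
      unfolding l1_dist_def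
      by (intro infsum_mono l1_dist_summable[OF that(1,3)] summable_on_add s) linarith
    also have "\<dots> = l1_dist x y + l1_dist y z"
      unfolding l1_dist_def by (rule infsum_add[OF s])
    finally show ?thesis .
  qed
qed

abbreviation skorohod_occupancy :: "enat \<Rightarrow> (real \<Rightarrow> nat \<Rightarrow> real) topology" where
  "skorohod_occupancy b \<equiv> Metric_space.skorohod_J1 (occupancy_states b) l1_dist"

section \<open>The JSQ(d) system\<close>

text \<open>Sample paths are a function of the following data, for a system of \<open>N\<close> servers \<open>0, \<dots>, N - 1\<close>:
  \<^item> \<open>x0 ! j\<close>, the initial queue length of server \<open>j\<close>;
  \<^item> \<open>\<rho> j l\<close>, the (remaining) service requirement of the \<open>l\<close>-th initial task of server \<open>j\<close>;
  \<^item> \<open>\<tau> k\<close>, the time between the arrivals of the tasks \<open>k - 1\<close> and \<open>k\<close> (or \<open>0\<close> and task \<open>0\<close>);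
  \<^item> \<open>\<sigma> k\<close>, the service requirement of task \<open>k\<close>;
  \<^item> \<open>L k\<close>, the servers sampled on the arrival of task \<open>k\<close>, listed in random order.

  Servers work at unit speed in order of arrival. A task admitted to a server is recorded as a
  triple of server, arrival time and departure time (the initial tasks with arrival time 0).\<close>

type_synonym task = "nat \<times> real \<times> real"

definition arrival_time :: "(nat \<Rightarrow> real) \<Rightarrow> nat \<Rightarrow> real" where
  "arrival_time \<tau> k = (\<Sum>i\<le>k. \<tau> i)"

definition queue_length :: "task list \<Rightarrow> nat \<Rightarrow> real \<Rightarrow> nat" where
  "queue_length h j t = length (filter (\<lambda>(s, a, u). s = j \<and> a \<le> t \<and> t < u) h)"

definition free_from :: "task list \<Rightarrow> nat \<Rightarrow> real" where
  "free_from h j = Max (insert 0 {u. \<exists>a. (j, a, u) \<in> set h})"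

text \<open>\<open>arg_min_list\<close> selects the first minimiser in the list. As \<open>L k\<close> is in random order, this
  breaks ties among the shortest sampled queues uniformly at random.\<close>

primrec tasks ::
  "nat \<Rightarrow> enat \<Rightarrow> nat list \<Rightarrow> (nat \<Rightarrow> nat \<Rightarrow> real) \<Rightarrow> (nat \<Rightarrow> real) \<Rightarrow> (nat \<Rightarrow> real) \<Rightarrow>
    (nat \<Rightarrow> nat list) \<Rightarrow> nat \<Rightarrow> task list" where
  "tasks N b x0 \<rho> \<tau> \<sigma> L 0 =
     concat (map (\<lambda>j. map (\<lambda>l. (j, 0, \<Sum>i\<le>l. \<rho> j i)) [0..<x0 ! j]) [0..<N])"
| "tasks N b x0 \<rho> \<tau> \<sigma> L (Suc k) =
     (let h = tasks N b x0 \<rho> \<tau> \<sigma> L k;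
          T = arrival_time \<tau> k;
          j = arg_min_list (\<lambda>s. queue_length h s T) (L k)
      in if enat (queue_length h j T) < b then h @ [(j, T, max T (free_from h j) + \<sigma> k)] else h)"

definition occupancy_path ::
  "nat \<Rightarrow> enat \<Rightarrow> nat list \<Rightarrow> (nat \<Rightarrow> nat \<Rightarrow> real) \<Rightarrow> (nat \<Rightarrow> real) \<Rightarrow> (nat \<Rightarrow> real) \<Rightarrow>
    (nat \<Rightarrow> nat list) \<Rightarrow> real \<Rightarrow> nat \<Rightarrow> real" where
  "occupancy_path N b x0 \<rho> \<tau> \<sigma> L = (\<lambda>t\<in>{0..}. \<lambda>i.
     let h = tasks N b x0 \<rho> \<tau> \<sigma> L (card {k. arrival_time \<tau> k \<le> t})
     in real (card {j. j < N \<and> i \<le> queue_length h j t}) / real N)"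

datatype source = Initial | Residual nat nat | Interarrival nat | Service nat | Sample nat

text \<open>The positivity and divergence assumptions on the times hold almost surely by the distributional
  assumptions; they are imposed on every sample point in order that all sample paths lie in
  Skorohod space.\<close>

locale jsq_system = prob_space M for M :: "'w measure" +
  fixes N d :: nat and b :: enat and rate :: real
    and x0 :: "'w \<Rightarrow> nat list"
    and \<rho> :: "'w \<Rightarrow> nat \<Rightarrow> nat \<Rightarrow> real"
    and \<tau> \<sigma> :: "'w \<Rightarrow> nat \<Rightarrow> real"
    and L :: "'w \<Rightarrow> nat \<Rightarrow> nat list"
  assumes d_pos: "1 \<le> d" and d_le: "d \<le> N" and b_pos: "1 \<le> b" and rate_pos: "0 < rate"
    and initial_random: "x0 \<in> M \<rightarrow>\<^sub>M count_space UNIV"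
    and initial_length: "\<omega> \<in> space M \<Longrightarrow> length (x0 \<omega>) = N"
    and initial_le: "\<omega> \<in> space M \<Longrightarrow> j < N \<Longrightarrow> enat (x0 \<omega> ! j) \<le> b"
    and residual: "distributed M lborel (\<lambda>\<omega>. \<rho> \<omega> j l) (exponential_density 1)"
    and interarrival: "distributed M lborel (\<lambda>\<omega>. \<tau> \<omega> k) (exponential_density rate)"
    and service: "distributed M lborel (\<lambda>\<omega>. \<sigma> \<omega> k) (exponential_density 1)"
    and sample_random: "(\<lambda>\<omega>. L \<omega> k) \<in> M \<rightarrow>\<^sub>M count_space UNIV"
    and sample: "distr M (count_space UNIV) (\<lambda>\<omega>. L \<omega> k) =
      measure_pmf (pmf_of_set {s. length s = d \<and> distinct s \<and> set s \<subseteq> {..<N}})"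
    and independent: "indep_sets
      (\<lambda>a. sets (case a of
          Initial \<Rightarrow> vimage_algebra (space M) x0 (count_space UNIV)
        | Residual j l \<Rightarrow> vimage_algebra (space M) (\<lambda>\<omega>. \<rho> \<omega> j l) borel
        | Interarrival k \<Rightarrow> vimage_algebra (space M) (\<lambda>\<omega>. \<tau> \<omega> k) borel
        | Service k \<Rightarrow> vimage_algebra (space M) (\<lambda>\<omega>. \<sigma> \<omega> k) borel
        | Sample k \<Rightarrow> vimage_algebra (space M) (\<lambda>\<omega>. L \<omega> k) (count_space UNIV))) UNIV"
    and residual_pos: "\<omega> \<in> space M \<Longrightarrow> 0 < \<rho> \<omega> j l"
    and interarrival_pos: "\<omega> \<in> space M \<Longrightarrow> 0 < \<tau> \<omega> k"
    and service_pos: "\<omega> \<in> space M \<Longrightarrow> 0 < \<sigma> \<omega> k"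
    and arrivals_diverge: "\<omega> \<in> space M \<Longrightarrow> filterlim (arrival_time (\<tau> \<omega>)) at_top sequentially"

section \<open>Fluid limit\<close>

text \<open>\<open>full_level q\<close> and \<open>assign_frac \<lambda> q i\<close> are \<open>m(q)\<close> and \<open>p\<^sub>i(q)\<close>. In \<open>fluid_solution\<close> the coordinate
  \<open>q s (b + 1)\<close> vanishes for paths in \<open>occupancy_states b\<close>.\<close>

definition full_level :: "(nat \<Rightarrow> real) \<Rightarrow> nat" where
  "full_level q = (LEAST i. q (i + 1) < 1)"

definition assign_frac :: "real \<Rightarrow> (nat \<Rightarrow> real) \<Rightarrow> nat \<Rightarrow> real" where
  "assign_frac lam q i =
     (let m = full_level q in
      if m = 0 then (if i = 0 then 1 else 0)
      else if lam \<le> 1 - q (m + 1) then (if i = m - 1 then 1 else 0)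
      else if i = m - 1 then (1 - q (m + 1)) / lam
      else if i = m then 1 - (1 - q (m + 1)) / lam
      else 0)"

definition fluid_solution :: "enat \<Rightarrow> real \<Rightarrow> (nat \<Rightarrow> real) \<Rightarrow> (real \<Rightarrow> nat \<Rightarrow> real) \<Rightarrow> bool" where
  "fluid_solution b lam qinf q \<longleftrightarrow>
     (\<forall>i t. 1 \<le> i \<and> enat i \<le> b \<and> 0 \<le> t \<longrightarrow>
        set_integrable lborel {0..t} (\<lambda>s. assign_frac lam (q s) (i - 1)) \<and>
        set_integrable lborel {0..t} (\<lambda>s. q s i - q s (i + 1)) \<and>
        q t i = qinf i + lam * (LINT s:{0..t}|lborel. assign_frac lam (q s) (i - 1))
                  - (LINT s:{0..t}|lborel. q s i - q s (i + 1)))"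

end

theory Submission
  imports Defs
begin

text \<open>
  The limit is the same deterministic path for every subsequence, and no compactness argument is needed: it suffices to show that the occupancy processes converge in probability, uniformly on
  bounded time intervals, to the fluid path. Since this path is continuous, uniform convergence implies \<open>J\<^sub>1\<close> convergence, and
  the limit law is a point mass (\<open>converges_weakly_to_point\<close>).

  This path is found and shown to be unique by a reflected form of the fluid equations. Let \<open>y i t\<close> be the amount of arrivals up to time \<open>t\<close> that
  overflow level \<open>i\<close>, that is, are offered only queues of length at least \<open>i\<close>. Then level \<open>i\<close> gains \<open>y (i - 1) - y i\<close>
  and loses \<open>\<integral> x i - x (i + 1)\<close>. When the number of sampled servers tends to infinity, \<open>y i\<close> can grow only while \<open>x i = 1\<close>,
  so it is the regulator that keeps \<open>x i\<close> below the barrier \<open>1\<close>. Reflection is non-expansive, only finitely many levels can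
  be full because the total mass is bounded, and an exponentially weighted bound shows that any two approximate solutions
  with the same initial state, in the sense of \<open>near_solution\<close>, are close (\<open>near_solution_compare\<close>). Consequently approximate solutions converge to
  a path (\<open>near_solution_limit\<close>), in \<open>\<ell>\<^sub>1\<close> because their tails are small (\<open>near_solution_converges\<close>). For the limit,
  \<open>regulator_density\<close> computes the density of \<open>y i\<close>: on the set where level \<open>i\<close> is full, it is the inflow minus the outflow
  of the level. This gives the coefficients \<open>p\<^sub>i\<close> (\<open>fluid_solution\<close>); that level \<open>i\<close> cannot stay full at the times with
  \<open>lam < 1 - x (i + 1)\<close> is \<open>full_level_capacity\<close>.

  It remains to see that the occupancy process is an approximate solution with high probability. On the level of sample paths,
  the counts satisfy a balance equation (\<open>level_balance\<close>), and three laws of large numbers turn it into the fluid equation.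
  The arrivals are close to their mean by Chebyshev's inequality for the Erlang arrival times. An arrival that overflows level
  \<open>i\<close> although a fraction \<open>\<epsilon>\<close> of the queues is shorter has a sample that misses these queues, with probability at
  most \<open>(1 - \<epsilon>)\<^sup>d\<close> (\<open>bad_overflow_unlikely\<close>). The departures from level \<open>i\<close> are close to the time that queues spend at
  this level, since their difference has second moment at most \<open>N t\<close> (\<open>compensated_second_moment\<close>).

  The last bound is obtained without martingales for the filtration of the process. For an exponential requirement \<open>X\<close>,
  \<open>E \<phi>(X) = E \<integral>\<^sub>0\<^sup>X \<phi>(x) dx\<close> (\<open>departure_rate\<close>). Applied to one task with all other data fixed, the right-hand side shortens the
  requirement of the task to \<open>x\<close>. By causality nothing changes before the shortened task departs, so if \<open>\<phi>\<close> depends only on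
  what happens up to this departure, the integral is over the period in which the task is served in the original system.
  Summed over all tasks, this is an integral over the time during which the servers are busy (\<open>sum_over_shortenings\<close>), that is,
  the compensator of the departures.
\<close>

section \<open>Approximate solutions of the fluid equations\<close>

text \<open>A pair \<open>(x, y)\<close> satisfies, up to \<open>\<delta>\<close>, the fluid equations in reflected form: \<open>y i t\<close> is the amount of
  arrivals during \<open>[0, t]\<close> that are offered only queues of length at least \<open>i\<close>, so \<open>y (i - 1) - y i\<close> is the flow
  into level \<open>i\<close>, and \<open>y i\<close> may grow only while \<open>x i\<close> is at the barrier \<open>1\<close>. The sixth clause expresses this
  without derivatives, in a form that survives small perturbations: up to \<open>\<delta>\<close>, the value \<open>y i t\<close> was
  already attained at a time when \<open>x i\<close> was within \<open>\<delta>\<close> of \<open>1\<close>. The last clause bounds the tails, which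
  departures can only decrease.\<close>

definition near_solution ::
  "enat \<Rightarrow> real \<Rightarrow> (nat \<Rightarrow> real) \<Rightarrow> real \<Rightarrow> nat \<Rightarrow> real \<Rightarrow> (real \<Rightarrow> nat \<Rightarrow> real) \<Rightarrow> (nat \<Rightarrow> real \<Rightarrow> real) \<Rightarrow> bool"
where
  "near_solution b lam q0 T n \<delta> x y \<longleftrightarrow>
     (\<forall>i. (\<lambda>s. x s i) \<in> borel_measurable borel) \<and>
     (\<forall>t\<in>{0..T}. x t \<in> occupancy_states b) \<and>
     (\<forall>t\<in>{0..T}. \<forall>i. 1 \<le> i \<and> i \<le> n \<and> enat i \<le> b \<longrightarrow>
        \<bar>x t i - (q0 i + y (i - 1) t - y i t - (LINT s:{0..t}|lborel. x s i - x s (i + 1)))\<bar> \<le> \<delta>) \<and>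
     (\<forall>t\<in>{0..T}. \<bar>y 0 t - lam * t\<bar> \<le> \<delta>) \<and>
     (\<forall>i s t. i \<le> n \<and> enat i \<le> b \<and> 0 \<le> s \<and> s \<le> t \<and> t \<le> T \<longrightarrow>
        0 \<le> y i s \<and> y i s \<le> y 0 s \<and> y i s \<le> y i t \<and> y i t - y i s \<le> y 0 t - y 0 s) \<and>
     (\<forall>t\<in>{0..T}. \<forall>i. 1 \<le> i \<and> i \<le> n \<and> enat i \<le> b \<longrightarrow>
        y i t \<le> \<delta> \<or> (\<exists>s\<in>{0..t}. 1 - \<delta> \<le> x s i \<and> y i t \<le> y i s + \<delta>)) \<and>
     (\<forall>t\<in>{0..T}. \<forall>m J. m \<le> n \<and> enat m \<le> b \<longrightarrow>
        (\<Sum>i\<in>{m<..J}. x t i) \<le> (\<Sum>i. q0 (i + m + 1)) + \<delta> + y m t)"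

lemma near_solution_mono:
  assumes "near_solution b lam q0 T n \<delta> x y" "T' \<le> T" "n' \<le> n" "\<delta> \<le> \<delta>'"
  shows "near_solution b lam q0 T' n' \<delta>' x y"
proof -
  note * = assms(1)[unfolded near_solution_def]
  have eq: "\<bar>x t i - (q0 i + y (i - 1) t - y i t - (LINT s:{0..t}|lborel. x s i - x s (i + 1)))\<bar> \<le> \<delta>'"
    if "t \<in> {0..T'}" "1 \<le> i" "i \<le> n'" "enat i \<le> b" for t i
  proof -
    have "\<bar>x t i - (q0 i + y (i - 1) t - y i t - (LINT s:{0..t}|lborel. x s i - x s (i + 1)))\<bar> \<le> \<delta>"
      using * that assms by auto
    then show ?thesis using assms(4) by linarith
  qed
  have arr: "\<bar>y 0 t - lam * t\<bar> \<le> \<delta>'" if "t \<in> {0..T'}" for t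
  proof -
    have "\<bar>y 0 t - lam * t\<bar> \<le> \<delta>" using * that assms by auto
    then show ?thesis using assms(4) by linarith
  qed
  have bar: "y i t \<le> \<delta>' \<or> (\<exists>s\<in>{0..t}. 1 - \<delta>' \<le> x s i \<and> y i t \<le> y i s + \<delta>')"
    if "t \<in> {0..T'}" "1 \<le> i" "i \<le> n'" "enat i \<le> b" for t i
  proof -
    have "y i t \<le> \<delta> \<or> (\<exists>s\<in>{0..t}. 1 - \<delta> \<le> x s i \<and> y i t \<le> y i s + \<delta>)"
      using * that assms by auto
    then show ?thesis
    proof
      assume "\<exists>s\<in>{0..t}. 1 - \<delta> \<le> x s i \<and> y i t \<le> y i s + \<delta>"
      then obtain s where s: "s \<in> {0..t}" "1 - \<delta> \<le> x s i" "y i t \<le> y i s + \<delta>" by blast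
      have "1 - \<delta>' \<le> x s i" "y i t \<le> y i s + \<delta>'" using s(2,3) assms(4) by linarith+
      with s(1) show ?thesis by blast
    qed (use assms(4) in linarith)
  qed
  have tail: "(\<Sum>i\<in>{m<..J}. x t i) \<le> (\<Sum>i. q0 (i + m + 1)) + \<delta>' + y m t"
    if "t \<in> {0..T'}" "m \<le> n'" "enat m \<le> b" for t m J
  proof -
    have "(\<Sum>i\<in>{m<..J}. x t i) \<le> (\<Sum>i. q0 (i + m + 1)) + \<delta> + y m t"
      using * that assms by auto
    then show ?thesis using assms(4) by linarith
  qed
  have occ: "\<forall>t\<in>{0..T'}. x t \<in> occupancy_states b" using * assms by auto
  have mono: "\<forall>i s t. i \<le> n' \<and> enat i \<le> b \<and> 0 \<le> s \<and> s \<le> t \<and> t \<le> T' \<longrightarrow>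
        0 \<le> y i s \<and> y i s \<le> y 0 s \<and> y i s \<le> y i t \<and> y i t - y i s \<le> y 0 t - y 0 s"
    using * assms(2,3) by (meson order_trans)
  have meas: "\<forall>i. (\<lambda>s. x s i) \<in> borel_measurable borel" using * by auto
  show ?thesis unfolding near_solution_def
    by (intro conjI meas occ mono) (use eq arr bar tail in blast)+
qed

lemma near_solution_measurable:
  "near_solution b lam q0 T n \<delta> x y \<Longrightarrow> (\<lambda>s. x s i) \<in> borel_measurable borel"
  by (simp add: near_solution_def)

lemma near_solution_occ:
  "near_solution b lam q0 T n \<delta> x y \<Longrightarrow> t \<in> {0..T} \<Longrightarrow> x t \<in> occupancy_states b"
  by (simp add: near_solution_def)

lemma near_solution_eq:
  "near_solution b lam q0 T n \<delta> x y \<Longrightarrow> t \<in> {0..T} \<Longrightarrow> 1 \<le> i \<Longrightarrow> i \<le> n \<Longrightarrow> enat i \<le> b \<Longrightarrow>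
   \<bar>x t i - (q0 i + y (i - 1) t - y i t - (LINT s:{0..t}|lborel. x s i - x s (i + 1)))\<bar> \<le> \<delta>"
  by (simp add: near_solution_def)

lemma near_solution_arrivals:
  "near_solution b lam q0 T n \<delta> x y \<Longrightarrow> t \<in> {0..T} \<Longrightarrow> \<bar>y 0 t - lam * t\<bar> \<le> \<delta>"
  by (simp add: near_solution_def)

lemma near_solution_overflow:
  assumes "near_solution b lam q0 T n \<delta> x y" "i \<le> n" "enat i \<le> b" "0 \<le> s" "s \<le> t" "t \<le> T"
  shows "0 \<le> y i s" "y i s \<le> y i t" "y i t - y i s \<le> y 0 t - y 0 s" "y i s \<le> y 0 s"
  using assms by (auto simp: near_solution_def)

lemma near_solution_barrier:
  assumes "near_solution b lam q0 T n \<delta> x y" "t \<in> {0..T}" "1 \<le> i" "i \<le> n" "enat i \<le> b"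
  shows "y i t \<le> \<delta> \<or> (\<exists>s\<in>{0..t}. 1 - \<delta> \<le> x s i \<and> y i t \<le> y i s + \<delta>)"
  using assms by (auto simp: near_solution_def)

lemma near_solution_tail:
  "near_solution b lam q0 T n \<delta> x y \<Longrightarrow> t \<in> {0..T} \<Longrightarrow> m \<le> n \<Longrightarrow> enat m \<le> b \<Longrightarrow>
   (\<Sum>i\<in>{m<..J}. x t i) \<le> (\<Sum>i. q0 (i + m + 1)) + \<delta> + y m t"
  by (simp add: near_solution_def)

lemma occupancy_states_bounds:
  assumes "q \<in> occupancy_states b"
  shows "0 \<le> q i" "q i \<le> 1" "q 0 = 1" "b < enat i \<Longrightarrow> q i = 0" "summable q"
  using assms by (auto simp: occupancy_states_def)

lemma occupancy_states_antimono:
  assumes "q \<in> occupancy_states b" "i \<le> j" shows "q j \<le> q i"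
proof -
  have "decseq q" using assms(1) by (intro decseq_SucI) (simp add: occupancy_states_def)
  then show ?thesis using assms(2) by (simp add: decseq_def)
qed

text \<open>Level \<open>i\<close> cannot be full when \<open>i\<close> exceeds the total mass.\<close>

lemma near_solution_level_le:
  assumes ns: "near_solution b lam q0 T n \<delta> x y" and t: "t \<in> {0..T}" and i: "1 \<le> i"
    and \<delta>: "\<delta> \<le> 1" and lam: "0 \<le> lam"
  shows "real i * x t i \<le> (\<Sum>i. q0 (i + 1)) + 2 + lam * T"
proof -
  have occ: "x t \<in> occupancy_states b" using near_solution_occ[OF ns t] .
  have "real i * x t i = (\<Sum>j\<in>{0<..i}. x t i)" by simp
  also have "\<dots> \<le> (\<Sum>j\<in>{0<..i}. x t j)"
    by (intro sum_mono occupancy_states_antimono[OF occ]) auto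
  also have "\<dots> \<le> (\<Sum>i. q0 (i + 1)) + \<delta> + y 0 t"
    using near_solution_tail[OF ns t, of 0 i] by (simp add: enat_0)
  also have "\<dots> \<le> (\<Sum>i. q0 (i + 1)) + 2 + lam * T"
  proof -
    have "lam * t \<le> lam * T" using t lam by (simp add: mult_left_mono)
    then show ?thesis using near_solution_arrivals[OF ns t] \<delta> by linarith
  qed
  finally show ?thesis .
qed

section \<open>Stability of the fluid equations\<close>

lemma integral_diff_le:
  fixes f g h :: "real \<Rightarrow> real"
  assumes "set_integrable lborel {0..t} f" "set_integrable lborel {0..t} g" "set_integrable lborel {0..t} h"
    and "\<And>s. s \<in> {0..t} \<Longrightarrow> \<bar>f s - g s\<bar> \<le> h s"
  shows "\<bar>(LINT s:{0..t}|lborel. f s) - (LINT s:{0..t}|lborel. g s)\<bar> \<le> (LINT s:{0..t}|lborel. h s)"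
proof -
  have *: "set_integrable lborel {0..t} (\<lambda>s. f s - g s)"
    using assms by (intro set_integral_diff)
  have "\<bar>LINT s:{0..t}|lborel. f s - g s\<bar> \<le> (LINT s:{0..t}|lborel. \<bar>f s - g s\<bar>)"
    using set_integral_norm_bound[OF *] by simp
  also have "\<dots> \<le> (LINT s:{0..t}|lborel. h s)"
    using assms by (intro set_integral_mono set_integrable_abs *) auto
  finally show ?thesis using assms by (simp add: set_integral_diff)
qed

lemma set_integrable_bounded:
  fixes f :: "real \<Rightarrow> real"
  assumes "f \<in> borel_measurable borel" "\<And>s. s \<in> {a..c} \<Longrightarrow> \<bar>f s\<bar> \<le> B"
  shows "set_integrable lborel {a..c} f"
  unfolding set_integrable_def
proof (rule integrableI_bounded_set[where A = "{a..c}" and B = "\<bar>B\<bar>"])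
  show "(\<lambda>x. indicat_real {a..c} x *\<^sub>R f x) \<in> borel_measurable lborel" using assms(1) by measurable
qed (use assms(2) in \<open>force simp: indicator_def emeasure_lborel_Icc_eq\<close>)+

lemma LINT_exp_le:
  assumes "0 < (\<beta>::real)" "0 \<le> t"
  shows "(LINT s:{0..t}|lborel. exp (\<beta> * s)) \<le> exp (\<beta> * t) / \<beta>"
proof -
  have "((\<lambda>s. exp (\<beta> * s)) has_integral (exp (\<beta> * t) / \<beta> - exp (\<beta> * 0) / \<beta>)) {0..t}"
    using assms by (intro fundamental_theorem_of_calculus)
      (auto intro!: derivative_eq_intros simp: has_real_derivative_iff_has_vector_derivative[symmetric])
  moreover have "set_integrable lborel {0..t} (\<lambda>s. exp (\<beta> * s))"
    by (intro borel_integrable_atLeastAtMost') (intro continuous_intros)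
  ultimately have "(LINT s:{0..t}|lborel. exp (\<beta> * s)) = exp (\<beta> * t) / \<beta> - exp (\<beta> * 0) / \<beta>"
    by (simp add: set_borel_integral_eq_integral(2) integral_unique)
  then show ?thesis using assms by simp
qed

text \<open>The reflection at the barrier is non-expansive: if \<open>y\<close> is close to its value at a time \<open>s\<close> with
  \<open>x s\<close> close to \<open>1\<close>, then \<open>y - y' \<le> (x + y) - (x' + y')\<close> at \<open>s\<close>, as \<open>x' \<le> 1\<close>.\<close>

lemma near_solution_overflow_diff:
  assumes ns: "near_solution b lam q0 T n \<delta> x y" and ns': "near_solution b lam q0 T n \<delta>' x' y'"
    and i: "1 \<le> i" "i \<le> n" "enat i \<le> b" and t: "t \<in> {0..T}" and B: "0 \<le> B"
    and w: "\<And>s. s \<in> {0..t} \<Longrightarrow> (x s i + y i s) - (x' s i + y' i s) \<le> B"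
  shows "y i t - y' i t \<le> B + 2 * \<delta>"
proof -
  have "\<bar>y 0 t - lam * t\<bar> \<le> \<delta>" by (rule near_solution_arrivals[OF ns t])
  then have \<delta>: "0 \<le> \<delta>" by linarith
  consider "y i t \<le> \<delta>" | s where "s \<in> {0..t}" "1 - \<delta> \<le> x s i" "y i t \<le> y i s + \<delta>"
    using near_solution_barrier[OF ns t i] by blast
  then show ?thesis
  proof cases
    case 1
    have "0 \<le> y' i t" using near_solution_overflow(1)[OF ns', of i t t] i t by auto
    with 1 B \<delta> show ?thesis by linarith
  next
    case (2 s)
    have "x' s \<in> occupancy_states b" using near_solution_occ[OF ns'] 2 t by auto
    then have "x' s i \<le> 1" by (rule occupancy_states_bounds)
    moreover have "y' i s \<le> y' i t"
      using near_solution_overflow(2)[OF ns' i(2,3), of s t] 2 t by auto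
    ultimately show ?thesis using w[of s] 2 by auto
  qed
qed

text \<open>Passing from \<open>y (i - 1)\<close> to \<open>y i\<close> adds one integral term, by the balance equation and the non-expansiveness of
  the reflection, and above the last level \<open>m\<close> that can be full all overflows are at most \<open>\<delta>\<close>. So the error is a sum of
  at most \<open>m\<close> integral terms, and the exponential weight makes these contribute at most half of the a priori bound
  \<open>Z\<close>. The constants do not depend on the number \<open>n\<close> of levels compared.\<close>

lemma near_solution_compare_step:
  fixes m n :: nat
  defines "\<beta> \<equiv> 4 * (2 * real m + 1)"
  assumes ns: "near_solution b lam q0 T n \<delta> x y" and ns': "near_solution b lam q0 T n \<delta> x' y'"
    and T: "0 \<le> T" and \<delta>: "0 \<le> \<delta>" and Z: "0 \<le> Z" and \<eta>: "0 \<le> \<eta>"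
    and top: "\<And>s. s \<in> {0..T} \<Longrightarrow> x s (n + 1) \<le> \<eta> \<and> x' s (n + 1) \<le> \<eta>"
    and full: "\<And>i s. m < i \<Longrightarrow> s \<in> {0..T} \<Longrightarrow> x s i < 1 - \<delta> \<and> x' s i < 1 - \<delta>"
    and apriori: "\<And>i s. s \<in> {0..T} \<Longrightarrow> 1 \<le> i \<Longrightarrow> i \<le> n \<Longrightarrow> enat i \<le> b \<Longrightarrow> \<bar>x s i - x' s i\<bar> \<le> Z * exp (\<beta> * s)"
    and t: "t \<in> {0..T}" and i: "i \<le> n" "enat i \<le> b"
  defines "A \<equiv> (8 * real m + 8) * (\<delta> + \<eta> * T)"
  shows "1 \<le> i \<Longrightarrow> \<bar>x t i - x' t i\<bar> \<le> A + Z * exp (\<beta> * t) / 2"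
    and "\<bar>y i t - y' i t\<bar> \<le> A + Z * exp (\<beta> * t) / 2"
proof -
  have \<beta>: "0 < \<beta>" by (simp add: \<beta>_def)
  define G where "G t = 2 * Z * exp (\<beta> * t) / \<beta> + \<eta> * T" for t
  have G0: "0 \<le> G t" for t using Z \<eta> T \<beta> by (simp add: G_def)
  have Gmono: "G s \<le> G t" if "s \<le> t" for s t
    using that Z \<beta> by (simp add: G_def divide_right_mono mult_left_mono)
  note occ = near_solution_occ[OF ns] and occ' = near_solution_occ[OF ns']
  have meas: "(\<lambda>s. x s i) \<in> borel_measurable borel" "(\<lambda>s. x' s i) \<in> borel_measurable borel" for i
    using near_solution_measurable ns ns' by blast+
  have int: "\<bar>(LINT s:{0..t}|lborel. x s i - x s (i + 1)) - (LINT s:{0..t}|lborel. x' s i - x' s (i + 1))\<bar> \<le> G t"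
    if t: "t \<in> {0..T}" and i: "1 \<le> i" "i \<le> n" "enat i \<le> b" for t i
  proof -
    have "\<bar>(LINT s:{0..t}|lborel. x s i - x s (i + 1)) - (LINT s:{0..t}|lborel. x' s i - x' s (i + 1))\<bar>
       \<le> (LINT s:{0..t}|lborel. 2 * Z * exp (\<beta> * s) + \<eta>)"
    proof (rule integral_diff_le)
      show "set_integrable lborel {0..t} (\<lambda>s. x s i - x s (i + 1))"
      proof (rule set_integrable_bounded[where B = 1])
        show "\<bar>x s i - x s (i + 1)\<bar> \<le> 1" if "s \<in> {0..t}" for s
          using occupancy_states_bounds(1,2)[OF occ, of s i] occupancy_states_bounds(1,2)[OF occ, of s "i+1"] that t
          by auto
      qed (use meas in measurable)
      show "set_integrable lborel {0..t} (\<lambda>s. x' s i - x' s (i + 1))"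
      proof (rule set_integrable_bounded[where B = 1])
        show "\<bar>x' s i - x' s (i + 1)\<bar> \<le> 1" if "s \<in> {0..t}" for s
          using occupancy_states_bounds(1,2)[OF occ', of s i] occupancy_states_bounds(1,2)[OF occ', of s "i+1"] that t
          by auto
      qed (use meas in measurable)
      show "set_integrable lborel {0..t} (\<lambda>s. 2 * Z * exp (\<beta> * s) + \<eta>)"
        by (intro borel_integrable_atLeastAtMost') (intro continuous_intros)
      fix s assume s: "s \<in> {0..t}"
      then have sT: "s \<in> {0..T}" using t by auto
      have 1: "\<bar>x s i - x' s i\<bar> \<le> Z * exp (\<beta> * s)" using apriori[OF sT i] .
      have ZE: "0 \<le> Z * exp (\<beta> * s)" using Z by simp
      have 2: "\<bar>x s (i+1) - x' s (i+1)\<bar> \<le> Z * exp (\<beta> * s) + \<eta>"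
      proof -
        consider "b < enat (i+1)" | "i = n" | "i + 1 \<le> n" "enat (i+1) \<le> b"
          using i by (metis Suc_eq_plus1 Suc_leI le_neq_implies_less not_le)
        then show ?thesis
        proof cases
          case 1
          then have "x s (i+1) = 0" "x' s (i+1) = 0"
            using occupancy_states_bounds(4)[OF occ[OF sT]] occupancy_states_bounds(4)[OF occ'[OF sT]] by auto
          then show ?thesis using ZE \<eta> by simp
        next
          case 2
          then show ?thesis
            using top[OF sT] occupancy_states_bounds(1)[OF occ[OF sT]] occupancy_states_bounds(1)[OF occ'[OF sT]] ZE
            by (smt (verit, best))
        next
          case 3
          then show ?thesis using apriori[OF sT, of "i+1"] \<eta> by auto
        qed
      qed
      show "\<bar>(x s i - x s (i+1)) - (x' s i - x' s (i+1))\<bar> \<le> 2 * Z * exp (\<beta> * s) + \<eta>"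
        using 1 2 by linarith
    qed
    also have "\<dots> = 2 * Z * (LINT s:{0..t}|lborel. exp (\<beta> * s)) + \<eta> * t"
    proof -
      have "set_integrable lborel {0..t} (\<lambda>s. 2 * Z * exp (\<beta> * s))"
        by (intro borel_integrable_atLeastAtMost') (intro continuous_intros)
      moreover have "set_integrable lborel {0..t} (\<lambda>s. \<eta>)"
        by (intro borel_integrable_atLeastAtMost') (intro continuous_intros)
      moreover have "(LINT s:{0..t}|lborel. \<eta>) = \<eta> * t" using t by (simp add: set_integral_const)
      ultimately show ?thesis by (simp add: set_integral_add)
    qed
    also have "\<dots> \<le> 2 * Z * (exp (\<beta> * t) / \<beta>) + \<eta> * T"
      using LINT_exp_le[OF \<beta>, of t] t Z \<eta> by (intro add_mono mult_left_mono) auto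
    finally show ?thesis by (simp add: G_def)
  qed
  have w: "\<bar>(x t i + y i t) - (x' t i + y' i t)\<bar> \<le> 2 * \<delta> + \<bar>y (i-1) t - y' (i-1) t\<bar> + G t"
    if "t \<in> {0..T}" "1 \<le> i" "i \<le> n" "enat i \<le> b" for t i
    using near_solution_eq[OF ns that] near_solution_eq[OF ns' that] int[OF that] by linarith
  have step: "\<bar>y i t - y' i t\<bar> \<le> 2 * \<delta> + real i * (4 * \<delta> + G t)"
    if "i \<le> n" "enat i \<le> b" "t \<in> {0..T}" for i t
    using that
  proof (induction i arbitrary: t)
    case 0
    then show ?case
      using near_solution_arrivals[OF ns, of t] near_solution_arrivals[OF ns', of t] by auto
  next
    case (Suc i)
    have IH: "\<bar>y i s - y' i s\<bar> \<le> 2 * \<delta> + real i * (4 * \<delta> + G s)" if "s \<in> {0..T}" for s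
    proof (rule Suc.IH)
      show "enat i \<le> b" using Suc.prems(2) by (meson Suc_n_not_le_n enat_ord_simps(1) linorder_linear order_trans)
    qed (use Suc.prems that in auto)
    let ?B = "2 * \<delta> + (2 * \<delta> + real i * (4 * \<delta> + G t)) + G t"
    have wB: "\<bar>(x s (Suc i) + y (Suc i) s) - (x' s (Suc i) + y' (Suc i) s)\<bar> \<le> ?B" if s: "s \<in> {0..t}" for s
    proof -
      have sT: "s \<in> {0..T}" using s Suc.prems by auto
      have "real i * (4 * \<delta> + G s) \<le> real i * (4 * \<delta> + G t)"
        using Gmono[of s t] s by (intro mult_left_mono) auto
      then show ?thesis using w[OF sT, of "Suc i"] IH[OF sT] Suc.prems Gmono[of s t] s by auto
    qed
    have B0: "0 \<le> ?B" using \<delta> G0[of t] by simp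
    have "y (Suc i) t - y' (Suc i) t \<le> ?B + 2 * \<delta>"
      by (rule near_solution_overflow_diff[OF ns ns' _ Suc.prems(1,2,3) B0])
        (use wB in \<open>auto simp: abs_le_iff\<close>)
    moreover have "y' (Suc i) t - y (Suc i) t \<le> ?B + 2 * \<delta>"
    proof (rule near_solution_overflow_diff[OF ns' ns _ Suc.prems(1,2,3) B0])
      fix s assume "s \<in> {0..t}"
      from wB[OF this] show "x' s (Suc i) + y' (Suc i) s - (x s (Suc i) + y (Suc i) s) \<le> ?B" by linarith
    qed auto
    ultimately have "\<bar>y (Suc i) t - y' (Suc i) t\<bar> \<le> ?B + 2 * \<delta>" by linarith
    also have "\<dots> = 2 * \<delta> + real (Suc i) * (4 * \<delta> + G t)" by (simp add: algebra_simps)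
    finally show ?case .
  qed
  have yb: "\<bar>y i t - y' i t\<bar> \<le> 2 * \<delta> + real m * (4 * \<delta> + G t)"
    if "i \<le> n" "enat i \<le> b" "t \<in> {0..T}" for i t
  proof (cases "i \<le> m")
    case True
    then have "real i * (4 * \<delta> + G t) \<le> real m * (4 * \<delta> + G t)"
      using \<delta> G0[of t] by (intro mult_right_mono) auto
    then show ?thesis using step[OF that] by linarith
  next
    case False
    then have i: "1 \<le> i" "m < i" by auto
    have "y i t \<le> \<delta>"
      using near_solution_barrier[OF ns that(3) i(1) that(1,2)] full[OF i(2)] that(3) by force
    moreover have "y' i t \<le> \<delta>"
      using near_solution_barrier[OF ns' that(3) i(1) that(1,2)] full[OF i(2)] that(3) by force
    moreover have "0 \<le> y i t" "0 \<le> y' i t"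
      using near_solution_overflow(1)[OF ns that(1,2), of t t] near_solution_overflow(1)[OF ns' that(1,2), of t t] that
      by auto
    moreover have "0 \<le> real m * (4 * \<delta> + G t)" using \<delta> G0[of t] by simp
    ultimately show ?thesis using \<delta> by (simp add: abs_if)
  qed
  let ?R = "6 * \<delta> + 2 * (real m * (4 * \<delta> + G t)) + G t"
  define P where "P = 2 * Z * exp (\<beta> * t) / \<beta>"
  have "2 * real m + 1 = \<beta> / 4" by (simp add: \<beta>_def)
  then have "(2 * real m + 1) * P = \<beta> / 4 * P" by (simp only:)
  also have "\<dots> = Z * exp (\<beta> * t) / 2" using \<beta> by (simp add: P_def)
  finally have P: "(2 * real m + 1) * P = Z * exp (\<beta> * t) / 2" .
  have "?R = (8 * real m + 6) * \<delta> + (2 * real m + 1) * (\<eta> * T) + (2 * real m + 1) * P"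
    unfolding G_def P_def[symmetric] by (simp add: algebra_simps)
  also have "\<dots> = (8 * real m + 6) * \<delta> + (2 * real m + 1) * (\<eta> * T) + Z * exp (\<beta> * t) / 2"
    by (simp only: P)
  also have "\<dots> \<le> (8 * real m + 8) * \<delta> + (8 * real m + 8) * (\<eta> * T) + Z * exp (\<beta> * t) / 2"
    using \<delta> \<eta> T by (intro add_mono mult_right_mono) auto
  finally have R: "?R \<le> A + Z * exp (\<beta> * t) / 2" by (simp add: A_def algebra_simps)
  have m0: "0 \<le> real m * (4 * \<delta> + G t)" using \<delta> G0[of t] by simp
  show "\<bar>y i t - y' i t\<bar> \<le> A + Z * exp (\<beta> * t) / 2"
    using yb[OF i t] R \<delta> m0 G0[of t] by linarith
  assume i1: "1 \<le> i"
  have "enat (i - 1) \<le> b" using i(2) by (meson diff_le_self enat_ord_simps(1) order_trans)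
  then have "\<bar>y (i-1) t - y' (i-1) t\<bar> \<le> 2 * \<delta> + real m * (4 * \<delta> + G t)"
    using yb[of "i - 1" t] i t by auto
  then show "\<bar>x t i - x' t i\<bar> \<le> A + Z * exp (\<beta> * t) / 2"
  proof -
    define J where "J = (LINT s:{0..t}|lborel. x s i - x s (i + 1))"
    define J' where "J' = (LINT s:{0..t}|lborel. x' s i - x' s (i + 1))"
    have eqs: "\<bar>x t i - (q0 i + y (i - 1) t - y i t - J)\<bar> \<le> \<delta>"
      "\<bar>x' t i - (q0 i + y' (i - 1) t - y' i t - J')\<bar> \<le> \<delta>" "\<bar>J - J'\<bar> \<le> G t"
      unfolding J_def J'_def using near_solution_eq[OF ns t i1 i] near_solution_eq[OF ns' t i1 i] int[OF t i1 i] by blast+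
    have "\<bar>x t i - x' t i\<bar> \<le> 2 * \<delta> + \<bar>y (i - 1) t - y' (i - 1) t\<bar> + \<bar>y i t - y' i t\<bar> + \<bar>J - J'\<bar>"
      using eqs(1,2) by (simp add: abs_le_iff) linarith
    with yb[OF i t] eqs(3) R \<open>\<bar>y (i-1) t - y' (i-1) t\<bar> \<le> _\<close> show ?thesis by linarith
  qed
qed

text \<open>The least weighted bound \<open>Z\<close> of the differences satisfies \<open>Z \<le> A + Z / 2\<close> by the previous lemma, so
  \<open>Z \<le> 2 A\<close>. As level \<open>i\<close> carries at most \<open>C / i\<close>, no level beyond \<open>2 C\<close> is ever full, and cutting the system off after level \<open>n\<close>
  costs a term of order \<open>1 / (n + 1)\<close>.\<close>

lemma near_solution_compare:
  assumes lam: "0 \<le> lam" and T: "0 \<le> T" and q0: "0 \<le> (\<Sum>i. q0 (i + 1))"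
  shows "\<exists>K\<ge>0. \<forall>n \<delta> x y x' y'. 0 \<le> \<delta> \<longrightarrow> \<delta> \<le> 1/4 \<longrightarrow>
     near_solution b lam q0 T n \<delta> x y \<longrightarrow> near_solution b lam q0 T n \<delta> x' y' \<longrightarrow>
     (\<forall>t\<in>{0..T}. \<forall>i\<le>n. \<bar>x t i - x' t i\<bar> \<le> K * (\<delta> + 1 / real (n + 1)) \<and>
        (enat i \<le> b \<longrightarrow> \<bar>y i t - y' i t\<bar> \<le> K * (\<delta> + 1 / real (n + 1))))"
proof -
  define C where "C = (\<Sum>i. q0 (i + 1)) + 2 + lam * T"
  have C: "2 \<le> C" unfolding C_def using lam T q0 by simp
  define m where "m = nat \<lceil>2 * C\<rceil>"
  have m: "2 * C \<le> real m" unfolding m_def by linarith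
  define \<beta> where "\<beta> = 4 * (2 * real m + 1)"
  define A0 where "A0 = (8 * real m + 8) * (1 + C * T)"
  define K where "K = 2 * A0 * exp (\<beta> * T)"
  have A0: "0 \<le> A0" unfolding A0_def using C T by simp
  have K0: "0 \<le> K" unfolding K_def using A0 by simp
  have lvl: "x t i \<le> C / real i" if "near_solution b lam q0 T n \<delta> x y" "t \<in> {0..T}" "1 \<le> i" "\<delta> \<le> 1/4" for n \<delta> x y t i
    using near_solution_level_le[OF that(1,2,3) _ lam] that(3,4) by (simp add: C_def field_simps)
  have "\<bar>x t i - x' t i\<bar> \<le> K * (\<delta> + 1 / real (n + 1)) \<and>
        (enat i \<le> b \<longrightarrow> \<bar>y i t - y' i t\<bar> \<le> K * (\<delta> + 1 / real (n + 1)))"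
    if \<delta>: "0 \<le> \<delta>" "\<delta> \<le> 1/4" and ns: "near_solution b lam q0 T n \<delta> x y" "near_solution b lam q0 T n \<delta> x' y'"
      and t: "t \<in> {0..T}" and i: "i \<le> n" for n \<delta> x y x' y' t i
  proof -
    define \<eta> where "\<eta> = C / real (n + 1)"
    have \<eta>: "0 \<le> \<eta>" unfolding \<eta>_def using C by simp
    define A where "A = (8 * real m + 8) * (\<delta> + \<eta> * T)"
    have A: "0 \<le> A" unfolding A_def using \<delta> \<eta> T by simp
    have A_le: "A \<le> A0 * (\<delta> + 1 / real (n + 1))"
    proof -
      have "\<delta> + \<eta> * T \<le> (1 + C * T) * (\<delta> + 1 / real (n + 1))"
      proof -
        have "0 \<le> C * T * \<delta> + 1 / real (n + 1)" using \<delta> C T by (intro add_nonneg_nonneg) auto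
        then show ?thesis unfolding \<eta>_def by (simp add: algebra_simps add_divide_distrib)
      qed
      then show ?thesis unfolding A_def A0_def by (simp add: mult_left_mono mult.assoc)
    qed
    have top: "x s (n + 1) \<le> \<eta> \<and> x' s (n + 1) \<le> \<eta>" if "s \<in> {0..T}" for s
      unfolding \<eta>_def using lvl[OF ns(1) that, of "n+1"] lvl[OF ns(2) that, of "n+1"] \<delta> by auto
    have full: "x s i < 1 - \<delta> \<and> x' s i < 1 - \<delta>" if "m < i" "s \<in> {0..T}" for i s
    proof -
      have i: "2 * C < real i" using m that by linarith
      then have "C / real i < 1 / 2" using C by (simp add: field_simps)
      moreover have "1 \<le> i" using that by simp
      ultimately show ?thesis
        using lvl[OF ns(1) that(2), of i] lvl[OF ns(2) that(2), of i] \<delta> by (intro conjI) linarith+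
    qed
    note occ = near_solution_occ[OF ns(1)] and occ' = near_solution_occ[OF ns(2)]
    define L where "L = {i. 1 \<le> i \<and> i \<le> n \<and> enat i \<le> b}"
    define F where "F = (\<lambda>(s, i). exp (- \<beta> * s) * \<bar>x s i - x' s i\<bar>)"
    define Z where "Z = Sup (insert 0 (F ` ({0..T} \<times> L)))"
    have F1: "F (s, i) \<le> 1" if "s \<in> {0..T}" for s i
    proof -
      have "\<bar>x s i - x' s i\<bar> \<le> 1"
        using occupancy_states_bounds(1,2)[OF occ[OF that], of i] occupancy_states_bounds(1,2)[OF occ'[OF that], of i] by auto
      moreover have "exp (- \<beta> * s) \<le> 1"
      proof -
        have "0 \<le> \<beta> * s" using that by (intro mult_nonneg_nonneg) (auto simp: \<beta>_def)
        then show ?thesis by simp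
      qed
      ultimately show ?thesis unfolding F_def by (simp add: mult_le_one)
    qed
    have bdd: "bdd_above (insert 0 (F ` ({0..T} \<times> L)))"
      by (rule bdd_aboveI[where M = 1]) (use F1 in auto)
    have Z: "0 \<le> Z" unfolding Z_def by (rule cSup_upper[OF _ bdd]) simp
    have apriori: "\<bar>x s i - x' s i\<bar> \<le> Z * exp (\<beta> * s)" if "s \<in> {0..T}" "1 \<le> i" "i \<le> n" "enat i \<le> b" for i s
    proof -
      have "F (s, i) \<le> Z" unfolding Z_def using that by (intro cSup_upper[OF _ bdd]) (auto simp: L_def)
      then have "exp (- \<beta> * s) * \<bar>x s i - x' s i\<bar> * exp (\<beta> * s) \<le> Z * exp (\<beta> * s)"
        unfolding F_def by (intro mult_right_mono) auto
      then show ?thesis by (simp add: exp_minus field_simps)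
    qed
    have step: "\<bar>y i t - y' i t\<bar> \<le> A + Z * exp (\<beta> * t) / 2" "1 \<le> i \<Longrightarrow> \<bar>x t i - x' t i\<bar> \<le> A + Z * exp (\<beta> * t) / 2"
      if "t \<in> {0..T}" "i \<le> n" "enat i \<le> b" for t i
      unfolding A_def \<beta>_def
      by (rule near_solution_compare_step[OF ns T \<delta>(1) Z \<eta> _ _ _ that];
          (assumption | (rule top full apriori[unfolded \<beta>_def]; assumption)))+
    have "Z \<le> A + Z / 2"
      unfolding Z_def
    proof (rule cSup_least)
      fix z assume "z \<in> insert 0 (F ` ({0..T} \<times> L))"
      then consider "z = 0" | s i where "s \<in> {0..T}" "i \<in> L" "z = F (s, i)" by auto
      then have "z \<le> A + Z / 2"
      proof cases
        case (2 s i)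
        have "\<bar>x s i - x' s i\<bar> \<le> A + Z * exp (\<beta> * s) / 2"
          using 2 by (intro step(2)) (auto simp: L_def)
        then have "z \<le> exp (- \<beta> * s) * (A + Z * exp (\<beta> * s) / 2)"
          unfolding 2 F_def by (simp add: mult_left_mono)
        also have "\<dots> = exp (- \<beta> * s) * A + Z / 2" by (simp add: exp_minus field_simps)
        also have "\<dots> \<le> A + Z / 2"
        proof -
          have "0 \<le> \<beta> * s" using 2 by (intro mult_nonneg_nonneg) (auto simp: \<beta>_def)
          then show ?thesis using A by (intro add_right_mono mult_left_le_one_le) auto
        qed
        finally show ?thesis .
      qed (use A Z in simp)
      then show "z \<le> A + Sup (insert 0 (F ` ({0..T} \<times> L))) / 2" by (simp add: Z_def)
    qed simp
    then have ZA: "Z \<le> 2 * A" by simp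
    have bound: "A + Z * exp (\<beta> * t) / 2 \<le> K * (\<delta> + 1 / real (n + 1))"
    proof -
      have "exp (\<beta> * t) \<le> exp (\<beta> * T)" using t by (simp add: \<beta>_def)
      moreover have "1 \<le> exp (\<beta> * T)" using T by (simp add: \<beta>_def)
      ultimately have "A + Z * exp (\<beta> * t) / 2 \<le> A * exp (\<beta> * T) + (2 * A) * exp (\<beta> * T) / 2"
        using A Z ZA by (intro add_mono divide_right_mono mult_mono) (auto simp: mult_le_cancel_left1)
      also have "\<dots> = A * (2 * exp (\<beta> * T))" by simp
      also have "\<dots> \<le> A0 * (\<delta> + 1 / real (n + 1)) * (2 * exp (\<beta> * T))"
        using A_le by (intro mult_right_mono) auto
      finally show ?thesis unfolding K_def by (simp add: algebra_simps)
    qed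
    have "\<bar>y i t - y' i t\<bar> \<le> K * (\<delta> + 1 / real (n + 1))" if "enat i \<le> b"
      using step(1)[of t i] t i that bound by linarith
    moreover have "\<bar>x t i - x' t i\<bar> \<le> K * (\<delta> + 1 / real (n + 1))"
    proof -
      have R0: "0 \<le> K * (\<delta> + 1 / real (n + 1))" using K0 \<delta> by simp
      consider "i = 0" | "b < enat i" | "1 \<le> i" "enat i \<le> b" by force
      then show ?thesis
      proof cases
        case 1
        then show ?thesis using R0 occupancy_states_bounds(3)[OF occ[OF t]] occupancy_states_bounds(3)[OF occ'[OF t]] by simp
      next
        case 2
        then show ?thesis using R0 occupancy_states_bounds(4)[OF occ[OF t] 2] occupancy_states_bounds(4)[OF occ'[OF t] 2] by simp
      next
        case 3
        then show ?thesis using step(2)[of t i] t i bound by linarith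
      qed
    qed
    ultimately show ?thesis by blast
  qed
  with K0 show ?thesis by blast
qed

section \<open>Existence of the fluid path\<close>

text \<open>The comparison makes such a sequence Cauchy, uniformly on bounded time intervals, and every clause passes to
  the limit with an error that tends to \<open>0\<close>.\<close>

lemma near_solution_limit:
  assumes lam: "0 \<le> lam" and q0: "q0 \<in> occupancy_states b"
    and X: "\<And>n. near_solution b lam q0 (real n) n (1 / real (n + 4)) (X n) (Y n)"
  shows "\<exists>x y. x \<in> extensional {0..} \<and> (\<forall>T n. \<forall>\<delta>>0. near_solution b lam q0 T n \<delta> x y)"
proof -
  have q0s: "0 \<le> (\<Sum>i. q0 (i + 1))"
    using occupancy_states_bounds[OF q0] by (intro suminf_nonneg) (auto simp: summable_Suc_iff)
  define close where "close T K \<longleftrightarrow> 0 \<le> K \<and> (\<forall>n \<delta> x y x' y'. 0 \<le> \<delta> \<longrightarrow> \<delta> \<le> 1/4 \<longrightarrow>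
     near_solution b lam q0 T n \<delta> x y \<longrightarrow> near_solution b lam q0 T n \<delta> x' y' \<longrightarrow>
     (\<forall>t\<in>{0..T}. \<forall>i\<le>n. \<bar>x t i - x' t i\<bar> \<le> K * (\<delta> + 1 / real (n + 1)) \<and>
        (enat i \<le> b \<longrightarrow> \<bar>y i t - y' i t\<bar> \<le> K * (\<delta> + 1 / real (n + 1)))))" for T K
  have "\<forall>T\<ge>0. \<exists>K. close T K"
    unfolding close_def using near_solution_compare[OF lam _ q0s] by blast
  then obtain K where K: "\<And>T. 0 \<le> T \<Longrightarrow> close T (K T)" by metis
  have K0: "0 \<le> K T" if "0 \<le> T" for T using K[OF that] by (simp add: close_def)
  define e where "e T n = K T * (2 / real (n + 1))" for T n
  have e_lim: "(\<lambda>n. e T n) \<longlonglongrightarrow> 0" for T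
    unfolding e_def by real_asymp
  have XX: "\<bar>X n t i - X m t i\<bar> \<le> e T n \<and> (enat i \<le> b \<longrightarrow> \<bar>Y n i t - Y m i t\<bar> \<le> e T n)"
    if "T \<le> real n" "n \<le> m" "t \<in> {0..T}" "i \<le> n" for n m t i T
  proof -
    have T: "0 \<le> T" using that by auto
    have 1: "near_solution b lam q0 T n (1 / real (n + 4)) (X n) (Y n)"
      by (rule near_solution_mono[OF X[of n]]) (use that in auto)
    have 2: "near_solution b lam q0 T n (1 / real (n + 4)) (X m) (Y m)"
      by (rule near_solution_mono[OF X[of m]]) (use that in \<open>auto simp: frac_le\<close>)
    have "1 / real (n + 4) \<le> 1 / 4" by (simp add: field_simps)
    then have *: "\<bar>X n t i - X m t i\<bar> \<le> K T * (1 / real (n + 4) + 1 / real (n + 1)) \<and>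
        (enat i \<le> b \<longrightarrow> \<bar>Y n i t - Y m i t\<bar> \<le> K T * (1 / real (n + 4) + 1 / real (n + 1)))"
      using K[OF T] 1 2 that(3,4) unfolding close_def by (metis divide_nonneg_nonneg of_nat_0_le_iff zero_le_one)
    have "1 / real (n + 4) \<le> 1 / real (n + 1)" by (intro divide_left_mono) auto
    then have "1 / real (n + 4) + 1 / real (n + 1) \<le> 2 / real (n + 1)" by linarith
    then have "K T * (1 / real (n + 4) + 1 / real (n + 1)) \<le> e T n"
      unfolding e_def by (intro mult_left_mono K0 T)
    with * show ?thesis by force
  qed
  have cauchy: "Cauchy a" if a: "\<And>n m. k \<le> n \<Longrightarrow> n \<le> m \<Longrightarrow> \<bar>a n - a m\<bar> \<le> e T n" for a :: "nat \<Rightarrow> real" and k T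
  proof (rule CauchyI')
    fix \<epsilon> :: real assume "0 < \<epsilon>"
    then have "eventually (\<lambda>n. e T n < \<epsilon>) sequentially" by (rule order_tendstoD[OF e_lim])
    then obtain N1 where N1: "\<And>n. N1 \<le> n \<Longrightarrow> e T n < \<epsilon>" by (auto simp: eventually_sequentially)
    show "\<exists>M. \<forall>m\<ge>M. \<forall>n>m. dist (a m) (a n) < \<epsilon>"
    proof (intro exI allI impI)
      fix m n assume mn: "max k N1 \<le> m" "m < n"
      have "\<bar>a m - a n\<bar> \<le> e T m" by (rule a) (use mn in auto)
      also have "\<dots> < \<epsilon>" by (rule N1) (use mn in auto)
      finally show "dist (a m) (a n) < \<epsilon>" by (simp add: dist_real_def)
    qed
  qed
  have large: "\<exists>N0. T \<le> real N0 \<and> i \<le> N0" for T and i :: nat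
    by (metis le_cases order_trans of_nat_mono real_arch_simple)
  have convX: "convergent (\<lambda>n. X n t i)" if t: "0 \<le> t" for t i
  proof -
    obtain N0 where N0: "t \<le> real N0" "i \<le> N0" using large by blast
    have "Cauchy (\<lambda>n. X n t i)"
    proof (rule cauchy[where k = N0 and T = t])
      fix n m assume "N0 \<le> n" "n \<le> m"
      then show "\<bar>X n t i - X m t i\<bar> \<le> e t n" using XX[of t n m t i] N0 t by auto
    qed
    then show ?thesis by (simp add: Cauchy_convergent_iff)
  qed
  have convY: "convergent (\<lambda>n. Y n i t)" if t: "0 \<le> t" and i: "enat i \<le> b" for t i
  proof -
    obtain N0 where N0: "t \<le> real N0" "i \<le> N0" using large by blast
    have "Cauchy (\<lambda>n. Y n i t)"
    proof (rule cauchy[where k = N0 and T = t])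
      fix n m assume "N0 \<le> n" "n \<le> m"
      then show "\<bar>Y n i t - Y m i t\<bar> \<le> e t n" using XX[of t n m t i] N0 t i by auto
    qed
    then show ?thesis by (simp add: Cauchy_convergent_iff)
  qed
  define x where "x = (\<lambda>t\<in>{0..}. \<lambda>i. lim (\<lambda>n. X n t i))"
  define y where "y i t = lim (\<lambda>n. Y n i t)" for i t
  have limX: "(\<lambda>n. X n t i) \<longlonglongrightarrow> x t i" if "0 \<le> t" for t i
    using convX[OF that] that by (simp add: x_def convergent_LIMSEQ_iff)
  have limY: "(\<lambda>n. Y n i t) \<longlonglongrightarrow> y i t" if "0 \<le> t" "enat i \<le> b" for t i
    using convY[OF that] by (simp add: y_def convergent_LIMSEQ_iff)
  have unifX: "\<bar>X n t i - x t i\<bar> \<le> e T n" if "T \<le> real n" "t \<in> {0..T}" "i \<le> n" for n t i T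
  proof (rule LIMSEQ_le_const2)
    show "(\<lambda>m. \<bar>X n t i - X m t i\<bar>) \<longlonglongrightarrow> \<bar>X n t i - x t i\<bar>"
      using that by (intro tendsto_intros limX) auto
    show "\<exists>N. \<forall>m\<ge>N. \<bar>X n t i - X m t i\<bar> \<le> e T n" using XX that by blast
  qed
  have unifY: "\<bar>Y n i t - y i t\<bar> \<le> e T n" if "T \<le> real n" "t \<in> {0..T}" "i \<le> n" "enat i \<le> b" for n t i T
  proof (rule LIMSEQ_le_const2)
    show "(\<lambda>m. \<bar>Y n i t - Y m i t\<bar>) \<longlonglongrightarrow> \<bar>Y n i t - y i t\<bar>"
      using that by (intro tendsto_intros limY) auto
    show "\<exists>N. \<forall>m\<ge>N. \<bar>Y n i t - Y m i t\<bar> \<le> e T n" using XX that by blast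
  qed
  have near: "near_solution b lam q0 t m (1 / real (n + 4)) (X n) (Y n)" if "t \<le> real n" "m \<le> n" for t m n
    by (rule near_solution_mono[OF X[of n]]) (use that in auto)
  have small: "(\<lambda>n. 1 / real (n + 4)) \<longlonglongrightarrow> 0" by real_asymp
  have meas: "(\<lambda>s. x s i) \<in> borel_measurable borel" for i
  proof -
    have "(\<lambda>s. if 0 \<le> s then x s i else undefined i) \<in> borel_measurable borel"
    proof (rule borel_measurable_LIMSEQ_real)
      show "(\<lambda>s. if 0 \<le> s then X n s i else undefined i) \<in> borel_measurable borel" for n
        using near_solution_measurable[OF X[of n], of i] by measurable
    qed (use limX in auto)
    moreover have "(\<lambda>s. if 0 \<le> s then x s i else undefined i) = (\<lambda>s. x s i)"
      by (auto simp: fun_eq_iff x_def)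
    ultimately show ?thesis by simp
  qed
  have eqs: "\<exists>N0. \<forall>n\<ge>N0. t \<le> real n \<and> i \<le> n \<and> m \<le> n" for t and i m :: nat
    using large[of t "max i m"] by (meson max.bounded_iff of_nat_mono order_trans)
  have tailx: "(\<Sum>i\<in>{m<..J}. x t i) \<le> (\<Sum>i. q0 (i + m + 1)) + y m t" if t: "0 \<le> t" and m: "enat m \<le> b" for t m J
  proof (rule LIMSEQ_le)
    show "(\<lambda>n. \<Sum>i\<in>{m<..J}. X n t i) \<longlonglongrightarrow> (\<Sum>i\<in>{m<..J}. x t i)" by (intro tendsto_intros limX t)
    have "(\<lambda>n. (\<Sum>i. q0 (i + m + 1)) + 1 / real (n + 4) + Y n m t) \<longlonglongrightarrow> (\<Sum>i. q0 (i + m + 1)) + 0 + y m t"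
      by (intro tendsto_intros limY t m small)
    then show "(\<lambda>n. (\<Sum>i. q0 (i + m + 1)) + 1 / real (n + 4) + Y n m t) \<longlonglongrightarrow> (\<Sum>i. q0 (i + m + 1)) + y m t" by simp
    obtain N0 where N0: "\<forall>n\<ge>N0. t \<le> real n \<and> m \<le> n \<and> m \<le> n" using eqs by blast
    show "\<exists>N. \<forall>n\<ge>N. (\<Sum>i\<in>{m<..J}. X n t i) \<le> (\<Sum>i. q0 (i + m + 1)) + 1 / real (n + 4) + Y n m t"
    proof (intro exI allI impI)
      fix n assume "N0 \<le> n"
      then show "(\<Sum>i\<in>{m<..J}. X n t i) \<le> (\<Sum>i. q0 (i + m + 1)) + 1 / real (n + 4) + Y n m t"
        using N0 near_solution_tail[OF near[of t n m], of t m J] t m by auto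
    qed
  qed
  have occ: "x t \<in> occupancy_states b" if t: "0 \<le> t" for t
  proof -
    obtain N0 where N0: "\<forall>n\<ge>N0. t \<le> real n \<and> 0 \<le> n \<and> 0 \<le> n" using eqs by blast
    have Xocc: "X n t \<in> occupancy_states b" if "N0 \<le> n" for n
      using near_solution_occ[OF X[of n]] N0 that t by auto
    have "x t 0 = 1"
    proof (rule LIMSEQ_unique[OF limX[OF t]])
      show "(\<lambda>n. X n t 0) \<longlonglongrightarrow> 1"
        by (rule tendsto_eventually) (use Xocc occupancy_states_bounds(3) in \<open>auto simp: eventually_sequentially\<close>)
    qed
    moreover have "x t i = 0" if "b < enat i" for i
    proof (rule LIMSEQ_unique[OF limX[OF t]])
      show "(\<lambda>n. X n t i) \<longlonglongrightarrow> 0"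
        by (rule tendsto_eventually) (use Xocc occupancy_states_bounds(4)[OF _ that] in \<open>auto simp: eventually_sequentially\<close>)
    qed
    moreover have nn: "0 \<le> x t i" for i
      by (rule LIMSEQ_le_const[OF limX[OF t]]) (use Xocc occupancy_states_bounds in blast)
    moreover have "x t i \<le> 1" for i
      by (rule LIMSEQ_le_const2[OF limX[OF t]]) (use Xocc occupancy_states_bounds in blast)
    moreover have "x t (Suc i) \<le> x t i" for i
      by (rule LIMSEQ_le[OF limX[OF t] limX[OF t]]) (use Xocc occupancy_states_antimono[of _ b i "Suc i"] in auto)
    moreover have "summable (x t)"
    proof -
      have "summable (\<lambda>i. x t (Suc i))"
      proof (rule summableI_nonneg_bounded)
        fix n
        have "(\<Sum>i<n. x t (Suc i)) = (\<Sum>i\<in>{0<..n}. x t i)"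
          by (rule sum.reindex_bij_witness[of _ "\<lambda>i. i - 1" Suc]) auto
        also have "\<dots> \<le> (\<Sum>i. q0 (i + 0 + 1)) + y 0 t" by (rule tailx[OF t]) (simp add: enat_0)
        finally show "(\<Sum>i<n. x t (Suc i)) \<le> (\<Sum>i. q0 (i + 0 + 1)) + y 0 t" .
      qed (rule nn)
      then show ?thesis by (simp add: summable_Suc_iff)
    qed
    ultimately show ?thesis by (simp add: occupancy_states_def)
  qed
  have eq: "x t i = q0 i + y (i - 1) t - y i t - (LINT s:{0..t}|lborel. x s i - x s (i + 1))"
    if t: "0 \<le> t" and i: "1 \<le> i" "enat i \<le> b" for t i
  proof -
    have i': "enat (i - 1) \<le> b" using i(2) by (meson diff_le_self enat_ord_simps(1) order_trans)
    obtain N0 where N0: "\<forall>n\<ge>N0. t \<le> real n \<and> i \<le> n \<and> i \<le> n" using eqs by blast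
    have "(\<lambda>n. LINT s:{0..t}|lborel. X (n + N0) s i - X (n + N0) s (i + 1)) \<longlonglongrightarrow> (LINT s:{0..t}|lborel. x s i - x s (i + 1))"
      unfolding set_lebesgue_integral_def
    proof (rule integral_dominated_convergence[where w = "indicat_real {0..t}"])
      show "(\<lambda>s. indicat_real {0..t} s *\<^sub>R (x s i - x s (i + 1))) \<in> borel_measurable lborel" using meas by measurable
      show "(\<lambda>s. indicat_real {0..t} s *\<^sub>R (X (n+N0) s i - X (n+N0) s (i + 1))) \<in> borel_measurable lborel" for n
        using near_solution_measurable[OF X] by measurable
      show "integrable lborel (indicat_real {0..t})" by (simp add: emeasure_lborel_Icc_eq)
      show "AE s in lborel. (\<lambda>n. indicat_real {0..t} s *\<^sub>R (X (n+N0) s i - X (n+N0) s (i + 1))) \<longlonglongrightarrow> indicat_real {0..t} s *\<^sub>R (x s i - x s (i + 1))"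
      proof (rule AE_I2)
        fix s
        show "(\<lambda>n. indicat_real {0..t} s *\<^sub>R (X (n+N0) s i - X (n+N0) s (i + 1))) \<longlonglongrightarrow> indicat_real {0..t} s *\<^sub>R (x s i - x s (i + 1))"
        proof (cases "s \<in> {0..t}")
          case True
          then show ?thesis by (intro tendsto_intros LIMSEQ_ignore_initial_segment[OF limX]) auto
        qed simp
      qed
      show "AE s in lborel. norm (indicat_real {0..t} s *\<^sub>R (X (n+N0) s i - X (n+N0) s (i + 1))) \<le> indicat_real {0..t} s" for n
      proof (rule AE_I2)
        fix s
        show "norm (indicat_real {0..t} s *\<^sub>R (X (n+N0) s i - X (n+N0) s (i + 1))) \<le> indicat_real {0..t} s"
        proof (cases "s \<in> {0..t}")
          case True
          have "t \<le> real (n + N0)" using N0 by auto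
          then have "X (n+N0) s \<in> occupancy_states b" using near_solution_occ[OF X[of "n+N0"], of s] True by auto
          from occupancy_states_bounds(1,2)[OF this, of i] occupancy_states_bounds(1,2)[OF this, of "i+1"]
          show ?thesis using True by auto
        qed simp
      qed
    qed
    then have "(\<lambda>n. LINT s:{0..t}|lborel. X n s i - X n s (i + 1)) \<longlonglongrightarrow> (LINT s:{0..t}|lborel. x s i - x s (i + 1))"
      by (rule LIMSEQ_offset)
    then have "(\<lambda>n. \<bar>X n t i - (q0 i + Y n (i - 1) t - Y n i t - (LINT s:{0..t}|lborel. X n s i - X n s (i + 1)))\<bar>)
      \<longlonglongrightarrow> \<bar>x t i - (q0 i + y (i - 1) t - y i t - (LINT s:{0..t}|lborel. x s i - x s (i + 1)))\<bar>"
      by (intro tendsto_intros limX limY t i i')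
    then have "\<bar>x t i - (q0 i + y (i - 1) t - y i t - (LINT s:{0..t}|lborel. x s i - x s (i + 1)))\<bar> \<le> 0"
    proof (rule LIMSEQ_le[OF _ small], intro exI allI impI)
      fix n assume "N0 \<le> n"
      then show "\<bar>X n t i - (q0 i + Y n (i - 1) t - Y n i t - (LINT s:{0..t}|lborel. X n s i - X n s (i + 1)))\<bar> \<le> 1 / real (n + 4)"
        using N0 t by (intro near_solution_eq[OF near[of t n n]] i) auto
    qed
    then show ?thesis by linarith
  qed
  have arr: "y 0 t = lam * t" if t: "0 \<le> t" for t
  proof -
    obtain N0 where N0: "\<forall>n\<ge>N0. t \<le> real n \<and> 0 \<le> n \<and> 0 \<le> n" using eqs by blast
    have "(\<lambda>n. \<bar>Y n 0 t - lam * t\<bar>) \<longlonglongrightarrow> \<bar>y 0 t - lam * t\<bar>"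
      by (intro tendsto_intros limY t) (simp add: enat_0)
    then have "\<bar>y 0 t - lam * t\<bar> \<le> 0"
    proof (rule LIMSEQ_le[OF _ small], intro exI allI impI)
      fix n assume "N0 \<le> n"
      then show "\<bar>Y n 0 t - lam * t\<bar> \<le> 1 / real (n + 4)"
        using N0 t by (intro near_solution_arrivals[OF near[of t n n]]) auto
    qed
    then show ?thesis by linarith
  qed
  have mono: "0 \<le> y i s \<and> y i s \<le> y 0 s \<and> y i s \<le> y i t \<and> y i t - y i s \<le> y 0 t - y 0 s"
    if i: "enat i \<le> b" and s: "0 \<le> s" "s \<le> t" for i s t
  proof -
    obtain N0 where N0: "\<forall>n\<ge>N0. t \<le> real n \<and> i \<le> n \<and> i \<le> n" using eqs by blast
    have t: "0 \<le> t" using s by simp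
    have b0: "enat 0 \<le> b" by (simp add: enat_0)
    have *: "0 \<le> Y n i s" "Y n i s \<le> Y n 0 s" "Y n i s \<le> Y n i t" "Y n i t - Y n i s \<le> Y n 0 t - Y n 0 s"
      if "N0 \<le> n" for n
      using near_solution_overflow[OF X[of n], of i s t] N0 that i s by auto
    have "0 \<le> y i s" by (rule LIMSEQ_le_const[OF limY[OF s(1) i]]) (use * in blast)
    moreover have "y i s \<le> y 0 s" by (rule LIMSEQ_le[OF limY[OF s(1) i] limY[OF s(1) b0]]) (use * in blast)
    moreover have "y i s \<le> y i t" by (rule LIMSEQ_le[OF limY[OF s(1) i] limY[OF t i]]) (use * in blast)
    moreover have "y i t - y i s \<le> y 0 t - y 0 s"
      by (rule LIMSEQ_le[OF tendsto_diff[OF limY[OF t i] limY[OF s(1) i]] tendsto_diff[OF limY[OF t b0] limY[OF s(1) b0]]])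
        (use * in blast)
    ultimately show ?thesis by blast
  qed
  have bar: "y i t \<le> \<delta> \<or> (\<exists>s\<in>{0..t}. 1 - \<delta> \<le> x s i \<and> y i t \<le> y i s + \<delta>)"
    if t: "0 \<le> t" and i: "1 \<le> i" "enat i \<le> b" and \<delta>: "0 < \<delta>" for t i \<delta>
  proof -
    have "eventually (\<lambda>n. e t n < \<delta> / 4) sequentially" "eventually (\<lambda>n. 1 / real (n + 4) < \<delta> / 4) sequentially"
      using \<delta> by (intro order_tendstoD[OF e_lim] order_tendstoD[OF small]; simp)+
    moreover have "eventually (\<lambda>n. t \<le> real n \<and> i \<le> n) sequentially"
      using eqs[of t i i] by (auto simp: eventually_sequentially)
    ultimately have "eventually (\<lambda>n. e t n < \<delta> / 4 \<and> 1 / real (n + 4) < \<delta> / 4 \<and> t \<le> real n \<and> i \<le> n) sequentially"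
      by eventually_elim auto
    then obtain n where n: "e t n < \<delta> / 4" "1 / real (n + 4) < \<delta> / 4" "t \<le> real n" "i \<le> n"
      by (auto simp: eventually_sequentially)
    have ty: "\<bar>Y n i s - y i s\<bar> < \<delta> / 4" if "s \<in> {0..t}" for s
      using unifY[OF n(3) that n(4) i(2)] n(1) by linarith
    consider "Y n i t \<le> 1 / real (n + 4)" |
      s where "s \<in> {0..t}" "1 - 1 / real (n + 4) \<le> X n s i" "Y n i t \<le> Y n i s + 1 / real (n + 4)"
      using near_solution_barrier[OF near[OF n(3,4)], of t i] t i by auto
    then show ?thesis
    proof cases
      case 1
      have "\<bar>Y n i t - y i t\<bar> < \<delta> / 4" by (rule ty) (use t in auto)
      with 1 n(2) \<delta> show ?thesis by linarith
    next
      case (2 s)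
      have "\<bar>Y n i t - y i t\<bar> < \<delta> / 4" by (rule ty) (use t in auto)
      moreover note ty[OF 2(1)] unifX[OF n(3) 2(1) n(4)]
      ultimately have "1 - \<delta> \<le> x s i" "y i t \<le> y i s + \<delta>" using 2(2,3) n(1,2) \<delta> by linarith+
      with 2(1) show ?thesis by blast
    qed
  qed
  have "near_solution b lam q0 T n \<delta> x y" if \<delta>: "0 < \<delta>" for T n \<delta>
    unfolding near_solution_def
  proof (intro conjI allI ballI impI)
    fix t m J assume "t \<in> {0..T}" "m \<le> n \<and> enat m \<le> b"
    then show "(\<Sum>i\<in>{m<..J}. x t i) \<le> (\<Sum>i. q0 (i + m + 1)) + \<delta> + y m t"
      using tailx[of t m J] \<delta> by auto
  next
    fix t i assume "t \<in> {0..T}" "1 \<le> i \<and> i \<le> n \<and> enat i \<le> b"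
    then show "\<bar>x t i - (q0 i + y (i - 1) t - y i t - (LINT s:{0..t}|lborel. x s i - x s (i + 1)))\<bar> \<le> \<delta>"
      using eq[of t i] \<delta> by auto
  next
    fix t i assume "t \<in> {0..T}" "1 \<le> i \<and> i \<le> n \<and> enat i \<le> b"
    then show "y i t \<le> \<delta> \<or> (\<exists>s\<in>{0..t}. 1 - \<delta> \<le> x s i \<and> y i t \<le> y i s + \<delta>)"
      using bar \<delta> by auto
  qed (use meas occ arr mono \<delta> in auto)
  moreover have "x \<in> extensional {0..}" by (simp add: x_def)
  ultimately show ?thesis by blast
qed

section \<open>The fluid path solves the integral equations\<close>

text \<open>Increments of second order mean a vanishing derivative. This replaces the product rule for functions that are
  integrals of merely measurable functions.\<close>

lemma constant_if_quadratic_increments: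
  fixes f :: "real \<Rightarrow> real"
  assumes "\<And>s. s \<in> {0..T} \<Longrightarrow> \<exists>C. \<exists>\<epsilon>>0. \<forall>t\<in>{0..T}. \<bar>t - s\<bar> < \<epsilon> \<longrightarrow> \<bar>f t - f s\<bar> \<le> C * (t - s)\<^sup>2"
    and t: "t \<in> {0..T}"
  shows "f t = f 0"
proof -
  have "(f has_field_derivative 0) (at s within {0..T})" if s: "s \<in> {0..T}" for s
  proof -
    obtain C \<epsilon> where \<epsilon>: "0 < \<epsilon>" and C: "\<And>t. t \<in> {0..T} \<Longrightarrow> \<bar>t - s\<bar> < \<epsilon> \<Longrightarrow> \<bar>f t - f s\<bar> \<le> C * (t - s)\<^sup>2"
      using assms(1)[OF s] by blast
    have "((\<lambda>t. (f t - f s) / (t - s)) \<longlongrightarrow> 0) (at s within {0..T})"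
    proof (rule Lim_null_comparison)
      show "\<forall>\<^sub>F t in at s within {0..T}. norm ((f t - f s) / (t - s)) \<le> \<bar>C\<bar> * \<bar>t - s\<bar>"
        unfolding eventually_at
      proof (intro exI conjI ballI impI)
        fix t assume t: "t \<in> {0..T}" "t \<noteq> s \<and> dist t s < \<epsilon>"
        then have "\<bar>f t - f s\<bar> \<le> C * (t - s)\<^sup>2" using C by (auto simp: dist_real_def)
        also have "\<dots> \<le> \<bar>C\<bar> * (t - s)\<^sup>2" by (intro mult_right_mono) auto
        also have "\<dots> = \<bar>C\<bar> * \<bar>t - s\<bar> * \<bar>t - s\<bar>" by (simp add: power2_eq_square)
        finally show "norm ((f t - f s) / (t - s)) \<le> \<bar>C\<bar> * \<bar>t - s\<bar>"
          using t by (simp add: abs_divide pos_divide_le_eq)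
      qed (use \<epsilon> in auto)
      have "((\<lambda>t. \<bar>C\<bar> * \<bar>t - s\<bar>) \<longlongrightarrow> \<bar>C\<bar> * \<bar>s - s\<bar>) (at s within {0..T})" by (intro tendsto_intros)
      then show "((\<lambda>t. \<bar>C\<bar> * \<bar>t - s\<bar>) \<longlongrightarrow> 0) (at s within {0..T})" by simp
    qed
    then show ?thesis by (simp add: has_field_derivative_iff)
  qed
  then obtain c where "\<forall>s\<in>{0..T}. f s = c"
    using has_field_derivative_zero_constant[of "{0..T}" f] by auto
  then show ?thesis using t by auto
qed

lemma power_first_order:
  fixes a c :: real
  assumes "0 \<le> a" "a \<le> 1" "0 \<le> c" "c \<le> 1"
  shows "\<bar>a ^ Suc n - c ^ Suc n - real (Suc n) * c ^ n * (a - c)\<bar> \<le> (real (Suc n))\<^sup>2 * (a - c)\<^sup>2"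
proof (induction n)
  case (Suc n)
  have "a ^ Suc (Suc n) - c ^ Suc (Suc n) - real (Suc (Suc n)) * c ^ Suc n * (a - c) =
    a * (a ^ Suc n - c ^ Suc n - real (Suc n) * c ^ n * (a - c)) + real (Suc n) * c ^ n * (a - c)\<^sup>2"
    by (simp add: algebra_simps power2_eq_square)
  also have "\<bar>\<dots>\<bar> \<le> \<bar>a\<bar> * \<bar>a ^ Suc n - c ^ Suc n - real (Suc n) * c ^ n * (a - c)\<bar> + real (Suc n) * c ^ n * (a - c)\<^sup>2"
    by (rule order_trans[OF abs_triangle_ineq]) (use assms in \<open>simp add: abs_mult\<close>)
  also have "\<dots> \<le> 1 * ((real (Suc n))\<^sup>2 * (a - c)\<^sup>2) + real (Suc n) * 1 * (a - c)\<^sup>2"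
    using assms by (intro add_mono mult_mono Suc power_le_one) auto
  also have "\<dots> \<le> (real (Suc (Suc n)))\<^sup>2 * (a - c)\<^sup>2"
  proof -
    have "(real (Suc n))\<^sup>2 + real (Suc n) \<le> (real (Suc (Suc n)))\<^sup>2" by (simp add: power2_eq_square algebra_simps)
    from mult_right_mono[OF this, of "(a - c)\<^sup>2"] show ?thesis by (simp add: algebra_simps)
  qed
  finally show ?case .
qed simp

lemma LINT_split:
  fixes f :: "real \<Rightarrow> real"
  assumes f: "f \<in> borel_measurable borel" and B: "\<And>s. s \<ge> 0 \<Longrightarrow> \<bar>f s\<bar> \<le> B" and st: "0 \<le> s" "s \<le> t"
  shows "(LINT r:{0..t}|lborel. f r) - (LINT r:{0..s}|lborel. f r) = (LINT r:{s..t}|lborel. f r)"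
proof -
  have i: "set_integrable lborel {a..c} f" if "0 \<le> a" for a c
    by (rule set_integrable_bounded[OF f, where B = B]) (use B that in auto)
  have "integral {0..s} f + integral {s..t} f = integral {0..t} f"
    by (intro Henstock_Kurzweil_Integration.integral_combine st set_borel_integral_eq_integral(1)[OF i]) simp
  then show ?thesis using i st by (simp add: set_borel_integral_eq_integral(2))
qed

lemma LINT_abs_le:
  fixes f :: "real \<Rightarrow> real"
  assumes f: "f \<in> borel_measurable borel" and B: "\<And>r. r \<in> {s..t} \<Longrightarrow> \<bar>f r\<bar> \<le> B" and st: "s \<le> t"
  shows "\<bar>LINT r:{s..t}|lborel. f r\<bar> \<le> B * (t - s)"
proof -
  have i: "set_integrable lborel {s..t} f" by (rule set_integrable_bounded[OF f B])
  have c: "set_integrable lborel {s..t} (\<lambda>_. B)" by (rule set_integrable_bounded[where B = "\<bar>B\<bar>"]) auto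
  have "\<bar>LINT r:{s..t}|lborel. f r\<bar> \<le> (LINT r:{s..t}|lborel. \<bar>f r\<bar>)"
    using set_integral_norm_bound[OF i] by simp
  also have "\<dots> \<le> (LINT r:{s..t}|lborel. B)"
    using B by (intro set_integral_mono set_integrable_abs i c) auto
  also have "\<dots> = B * (t - s)" using st by (simp add: set_integral_const)
  finally show ?thesis .
qed

lemma LINT_point: "(LINT s:{a..a::real}|lborel. f s :: real) = 0"
  unfolding set_lebesgue_integral_def
proof (rule integral_eq_zero_AE)
  show "AE s in lborel. indicat_real {a..a} s *\<^sub>R f s = 0"
    using AE_lborel_singleton[of a] by eventually_elim (auto simp: indicator_def)
qed

text \<open>Let \<open>x = x 0 + \<integral> f - Y\<close> be reflected at the barrier \<open>1\<close> by the regulator \<open>Y\<close>. Then \<open>Y\<close> has the density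
  \<open>f\<close> on the set where \<open>x\<close> is at the barrier. For the proof, \<open>x\<^sup>n\<^sup>+\<^sup>1 / (n + 1) = \<integral> x\<^sup>n f - Y\<close> up to a
  constant, since \<open>x\<^sup>n = 1\<close> wherever \<open>Y\<close> grows; and \<open>x\<^sup>n\<close> converges to the indicator of \<open>x = 1\<close> as
  \<open>n \<rightarrow> \<infinity>\<close>.\<close>

lemma regulator_density:
  fixes x Y f :: "real \<Rightarrow> real"
  assumes f: "f \<in> borel_measurable borel" and B: "\<And>s. 0 \<le> s \<Longrightarrow> \<bar>f s\<bar> \<le> B"
    and xm: "x \<in> borel_measurable borel" and x01: "\<And>s. 0 \<le> s \<Longrightarrow> 0 \<le> x s \<and> x s \<le> 1"
    and Y: "\<And>s t. 0 \<le> s \<Longrightarrow> s \<le> t \<Longrightarrow> 0 \<le> Y t - Y s \<and> Y t - Y s \<le> L * (t - s)"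
    and eq: "\<And>t. 0 \<le> t \<Longrightarrow> x t = x 0 + (LINT s:{0..t}|lborel. f s) - (Y t - Y 0)"
    and const: "\<And>s t. 0 \<le> s \<Longrightarrow> s \<le> t \<Longrightarrow> (\<forall>r\<in>{s..t}. x r < 1) \<Longrightarrow> Y t = Y s"
    and t: "0 \<le> t"
  shows "Y t - Y 0 = (LINT s:{0..t}|lborel. (if x s = 1 then f s else 0))"
proof -
  have B0: "0 \<le> B" using B[of 0] by auto
  have L0: "0 \<le> L" using Y[of 0 1] by auto
  have dx: "x v - x u = (LINT s:{u..v}|lborel. f s) - (Y v - Y u)" if "0 \<le> u" "u \<le> v" for u v
    using eq[of u] eq[of v] LINT_split[OF f B that] that by auto
  have lip: "\<bar>x v - x u\<bar> \<le> (B + L) * \<bar>v - u\<bar>" if uv: "0 \<le> u" "0 \<le> v" for u v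
  proof -
    have *: "\<bar>x v - x u\<bar> \<le> (B + L) * (v - u)" if "0 \<le> u" "u \<le> v" for u v
    proof -
      have "\<bar>LINT s:{u..v}|lborel. f s\<bar> \<le> B * (v - u)" by (rule LINT_abs_le[OF f]) (use B that in auto)
      moreover have "(B + L) * (v - u) = B * (v - u) + L * (v - u)" by (simp add: algebra_simps)
      ultimately show ?thesis using dx[OF that] Y[OF that] by linarith
    qed
    show ?thesis using *[of u v] *[of v u] uv by (cases "u \<le> v") (auto simp: abs_minus_commute)
  qed
  define \<zeta> where "\<zeta> n t = x t ^ Suc n / real (Suc n) - (LINT s:{0..t}|lborel. x s ^ n * f s) + Y t" for n t
  have xnf: "(\<lambda>s. x s ^ n * f s) \<in> borel_measurable borel" for n using xm f by measurable
  have xnB: "\<bar>x s ^ n * f s\<bar> \<le> B" if "0 \<le> s" for s n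
  proof -
    have "\<bar>x s ^ n\<bar> * \<bar>f s\<bar> \<le> 1 * B" using B[OF that] x01[OF that] by (intro mult_mono) (auto simp: power_le_one)
    then show ?thesis by (simp add: abs_mult)
  qed
  \<comment> \<open>The increment of \<open>\<zeta>\<close> is of second order except for one term. This term vanishes where \<open>Y\<close> is constant, and elsewhere
    \<open>x\<close> is close to the barrier, so that its factor \<open>1 - x\<^sup>n\<close> is small.\<close>
  have incr: "\<bar>\<zeta> n v - \<zeta> n u - (1 - x w ^ n) * (Y v - Y u)\<bar> \<le> (real (Suc n) * (B + L)\<^sup>2 + real n * (B + L) * B) * (v - u)\<^sup>2"
    if uv: "0 \<le> u" "u \<le> v" and w: "w = u \<or> w = v" for u v w n
  proof -
    have w0: "0 \<le> w" using uv w by auto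
    have wd: "\<bar>r - w\<bar> \<le> v - u" if "r \<in> {u..v}" for r using that w by auto
    define R1 where "R1 = (x v ^ Suc n - x u ^ Suc n) / real (Suc n) - x w ^ n * (x v - x u)"
    define R2 where "R2 = (LINT s:{u..v}|lborel. x s ^ n * f s) - x w ^ n * (LINT s:{u..v}|lborel. f s)"
    have "\<zeta> n v - \<zeta> n u = (x v ^ Suc n - x u ^ Suc n) / real (Suc n) - (LINT s:{u..v}|lborel. x s ^ n * f s) + (Y v - Y u)"
      using LINT_split[OF xnf xnB uv, of n] by (simp add: \<zeta>_def diff_divide_distrib del: power_Suc of_nat_Suc)
    moreover have "(1 - x w ^ n) * (Y v - Y u) = (Y v - Y u) - x w ^ n * (Y v - Y u)"
      by (simp add: left_diff_distrib)
    moreover have "x w ^ n * (Y v - Y u) = x w ^ n * (LINT s:{u..v}|lborel. f s) - x w ^ n * (x v - x u)"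
      using dx[OF uv] by (simp add: right_diff_distrib[symmetric])
    ultimately have "\<zeta> n v - \<zeta> n u - (1 - x w ^ n) * (Y v - Y u) = R1 - R2"
      unfolding R1_def R2_def by (simp del: power_Suc of_nat_Suc)
    moreover have "\<bar>R1\<bar> \<le> real (Suc n) * (B + L)\<^sup>2 * (v - u)\<^sup>2"
    proof -
      have "\<bar>x v ^ Suc n - x u ^ Suc n - real (Suc n) * x w ^ n * (x v - x u)\<bar> \<le> (real (Suc n))\<^sup>2 * (x v - x u)\<^sup>2"
      proof (cases "w = u")
        case True
        then show ?thesis using power_first_order[of "x v" "x u" n] x01 uv by auto
      next
        case False
        then have "w = v" using w by auto
        have "x v ^ Suc n - x u ^ Suc n - real (Suc n) * x v ^ n * (x v - x u) = - (x u ^ Suc n - x v ^ Suc n - real (Suc n) * x v ^ n * (x u - x v))"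
          by (simp add: algebra_simps)
        then show ?thesis
          using power_first_order[of "x u" "x v" n] x01 uv \<open>w = v\<close> by (simp add: power2_commute del: power_Suc)
      qed
      then have "\<bar>R1\<bar> * real (Suc n) \<le> (real (Suc n))\<^sup>2 * (x v - x u)\<^sup>2"
      proof -
        have "R1 * real (Suc n) = x v ^ Suc n - x u ^ Suc n - real (Suc n) * x w ^ n * (x v - x u)"
          unfolding R1_def by (simp add: field_simps del: power_Suc)
        then have "\<bar>R1\<bar> * real (Suc n) = \<bar>x v ^ Suc n - x u ^ Suc n - real (Suc n) * x w ^ n * (x v - x u)\<bar>"
          by (metis abs_mult abs_of_nat)
        then show ?thesis
          using \<open>\<bar>x v ^ Suc n - x u ^ Suc n - real (Suc n) * x w ^ n * (x v - x u)\<bar> \<le> (real (Suc n))\<^sup>2 * (x v - x u)\<^sup>2\<close>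
          by (simp only:)
      qed
      then have "real (Suc n) * \<bar>R1\<bar> \<le> real (Suc n) * (real (Suc n) * (x v - x u)\<^sup>2)"
        by (simp only: power2_eq_square[of "real (Suc n)"] mult.assoc mult.commute[of "\<bar>R1\<bar>"])
      then have "\<bar>R1\<bar> \<le> real (Suc n) * (x v - x u)\<^sup>2" by (rule mult_left_le_imp_le) simp
      also have "\<dots> \<le> real (Suc n) * ((B + L) * (v - u))\<^sup>2"
        using lip[of u v] uv B0 L0 by (intro mult_left_mono) (auto simp: abs_le_square_iff[symmetric])
      finally show ?thesis by (simp add: power_mult_distrib mult.assoc)
    qed
    moreover have "\<bar>R2\<bar> \<le> real n * (B + L) * B * (v - u)\<^sup>2"
    proof -
      have i: "set_integrable lborel {u..v} f" "set_integrable lborel {u..v} (\<lambda>s. x s ^ n * f s)"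
        by (rule set_integrable_bounded[where B = B], use f xnf B xnB uv in auto)+
      have "R2 = (LINT s:{u..v}|lborel. (x s ^ n - x w ^ n) * f s)"
      proof -
        have "set_integrable lborel {u..v} (\<lambda>s. x w ^ n * f s)" using i(1) by simp
        then have "(LINT s:{u..v}|lborel. x s ^ n * f s - x w ^ n * f s) = R2"
          unfolding R2_def using i(2) by (subst set_integral_diff) auto
        then show ?thesis by (simp add: algebra_simps)
      qed
      also have "\<bar>\<dots>\<bar> \<le> (real n * ((B + L) * (v - u)) * B) * (v - u)"
      proof (rule LINT_abs_le)
        fix s assume s: "s \<in> {u..v}"
        then have s0: "0 \<le> s" using uv by auto
        have "\<bar>x s ^ n - x w ^ n\<bar> \<le> real n * \<bar>x s - x w\<bar>"
          using norm_power_diff[of "x s" "x w" n] x01[OF s0] x01[OF w0] by auto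
        also have "\<dots> \<le> real n * ((B + L) * (v - u))"
          using lip[OF w0 s0] wd[OF s] B0 L0 by (intro mult_left_mono order_trans[OF lip[OF w0 s0]]) auto
        finally have "\<bar>x s ^ n - x w ^ n\<bar> * \<bar>f s\<bar> \<le> real n * ((B + L) * (v - u)) * B"
          using B[OF s0] by (intro mult_mono) auto
        then show "\<bar>(x s ^ n - x w ^ n) * f s\<bar> \<le> real n * ((B + L) * (v - u)) * B" by (simp add: abs_mult)
      qed (use xm f uv in measurable)
      finally show ?thesis by (simp add: power2_eq_square mult_ac)
    qed
    ultimately show ?thesis by (simp add: algebra_simps)
  qed
  have \<zeta>const: "\<zeta> n t = \<zeta> n 0" for n
  proof (rule constant_if_quadratic_increments[where T = t])
    fix s assume s: "s \<in> {0..t}"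
    define C where "C = real (Suc n) * (B + L)\<^sup>2 + real n * (B + L) * B"
    define \<epsilon> where "\<epsilon> = (if x s = 1 then 1 else (1 - x s) / (B + L + 1))"
    have \<epsilon>: "0 < \<epsilon>" using x01[of s] s B0 L0 by (auto simp: \<epsilon>_def)
    have zero: "(1 - x s ^ n) * (Y (max s r) - Y (min s r)) = 0" if r: "r \<in> {0..t}" "\<bar>r - s\<bar> < \<epsilon>" for r
    proof (cases "x s = 1")
      case False
      then have \<epsilon>': "\<epsilon> * (B + L + 1) = 1 - x s" using B0 L0 by (simp add: \<epsilon>_def)
      have "Y (max s r) = Y (min s r)"
      proof (rule const)
        show "\<forall>v\<in>{min s r..max s r}. x v < 1"
        proof
          fix v assume v: "v \<in> {min s r..max s r}"
          have "\<bar>x v - x s\<bar> \<le> (B + L) * \<bar>v - s\<bar>" by (rule lip) (use v s r in auto)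
          also have "\<dots> \<le> (B + L) * \<bar>r - s\<bar>" using v B0 L0 by (intro mult_left_mono) auto
          also have "\<dots> \<le> (B + L + 1) * \<bar>r - s\<bar>" by (intro mult_right_mono) auto
          also have "\<dots> < (B + L + 1) * \<epsilon>" using r B0 L0 by (intro mult_strict_left_mono) auto
          finally show "x v < 1" using \<epsilon>' by (simp add: mult.commute)
        qed
      qed (use s r in auto)
      then show ?thesis by simp
    qed simp
    show "\<exists>C. \<exists>\<epsilon>>0. \<forall>r\<in>{0..t}. \<bar>r - s\<bar> < \<epsilon> \<longrightarrow> \<bar>\<zeta> n r - \<zeta> n s\<bar> \<le> C * (r - s)\<^sup>2"
    proof (intro exI conjI ballI impI)
      fix r assume r: "r \<in> {0..t}" "\<bar>r - s\<bar> < \<epsilon>"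
      have "\<bar>\<zeta> n (max s r) - \<zeta> n (min s r) - (1 - x s ^ n) * (Y (max s r) - Y (min s r))\<bar> \<le> C * (max s r - min s r)\<^sup>2"
        unfolding C_def by (rule incr) (use s r in auto)
      then show "\<bar>\<zeta> n r - \<zeta> n s\<bar> \<le> C * (r - s)\<^sup>2"
        using zero[OF r] by (cases "s \<le> r") (auto simp: max_def min_def power2_commute abs_minus_commute)
    qed (rule \<epsilon>)
  qed (use t in auto)
  have key: "(LINT s:{0..t}|lborel. x s ^ n * f s) = x t ^ Suc n / real (Suc n) - x 0 ^ Suc n / real (Suc n) + (Y t - Y 0)" for n
    using \<zeta>const[of n] LINT_point[of 0 "\<lambda>s. x s ^ n * f s"] unfolding \<zeta>_def by simp
  have lim1: "(\<lambda>n. x u ^ Suc n / real (Suc n)) \<longlonglongrightarrow> 0" if "0 \<le> u" for u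
  proof (rule tendsto_sandwich)
    show "\<forall>\<^sub>F n in sequentially. 0 \<le> x u ^ Suc n / real (Suc n)" using x01[OF that] by (auto intro!: always_eventually)
    show "\<forall>\<^sub>F n in sequentially. x u ^ Suc n / real (Suc n) \<le> 1 / real (Suc n)"
      using x01[OF that] by (intro always_eventually allI divide_right_mono power_le_one) auto
    show "(\<lambda>n. 1 / real (Suc n)) \<longlonglongrightarrow> 0" by real_asymp
  qed simp
  have "(\<lambda>n. LINT s:{0..t}|lborel. x s ^ n * f s) \<longlonglongrightarrow> 0 - 0 + (Y t - Y 0)"
    unfolding key by (intro tendsto_intros lim1 t) simp
  moreover have "(\<lambda>n. LINT s:{0..t}|lborel. x s ^ n * f s) \<longlonglongrightarrow> (LINT s:{0..t}|lborel. (if x s = 1 then f s else 0))"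
    unfolding set_lebesgue_integral_def
  proof (rule integral_dominated_convergence[where w = "\<lambda>s. indicat_real {0..t} s * B"])
    show "(\<lambda>s. indicat_real {0..t} s *\<^sub>R (if x s = 1 then f s else 0)) \<in> borel_measurable lborel" using xm f by measurable
    show "(\<lambda>s. indicat_real {0..t} s *\<^sub>R (x s ^ n * f s)) \<in> borel_measurable lborel" for n using xm f by measurable
    show "integrable lborel (\<lambda>s. indicat_real {0..t} s * B)" by (simp add: emeasure_lborel_Icc_eq)
    show "AE s in lborel. norm (indicat_real {0..t} s *\<^sub>R (x s ^ n * f s)) \<le> indicat_real {0..t} s * B" for n
      by (rule AE_I2) (use xnB in \<open>auto simp: indicator_def\<close>)
    show "AE s in lborel. (\<lambda>n. indicat_real {0..t} s *\<^sub>R (x s ^ n * f s)) \<longlonglongrightarrow> indicat_real {0..t} s *\<^sub>R (if x s = 1 then f s else 0)"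
    proof (rule AE_I2)
      fix s
      show "(\<lambda>n. indicat_real {0..t} s *\<^sub>R (x s ^ n * f s)) \<longlonglongrightarrow> indicat_real {0..t} s *\<^sub>R (if x s = 1 then f s else 0)"
      proof (cases "s \<in> {0..t}")
        case True
        have "(\<lambda>n. x s ^ n * f s) \<longlonglongrightarrow> (if x s = 1 then f s else 0)"
        proof (cases "x s = 1")
          case False
          then have "(\<lambda>n. x s ^ n) \<longlonglongrightarrow> 0" using x01[of s] True by (intro LIMSEQ_realpow_zero) auto
          from tendsto_mult_right[OF this, of "f s"] show ?thesis using False by simp
        qed simp
        then show ?thesis using True by simp
      qed simp
    qed
  qed
  ultimately show ?thesis using LIMSEQ_unique by fastforce
qed

locale fluid_path =
  fixes b :: enat and lam :: real and q0 :: "nat \<Rightarrow> real" and x :: "real \<Rightarrow> nat \<Rightarrow> real" and y :: "nat \<Rightarrow> real \<Rightarrow> real"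
  assumes near: "\<And>T n \<delta>. 0 < \<delta> \<Longrightarrow> near_solution b lam q0 T n \<delta> x y"
    and lam: "0 \<le> lam" "lam < 1" and q0: "q0 \<in> occupancy_states b" and x_ext: "x \<in> extensional {0..}"
begin

lemma path_measurable: "(\<lambda>s. x s i) \<in> borel_measurable borel"
  using near_solution_measurable[OF near[of 1]] by simp

lemma path_occ: "0 \<le> t \<Longrightarrow> x t \<in> occupancy_states b"
  using near_solution_occ[OF near[of 1 t], of t] by simp

lemma path_01: "0 \<le> t \<Longrightarrow> 0 \<le> x t i" "0 \<le> t \<Longrightarrow> x t i \<le> 1"
  using occupancy_states_bounds[OF path_occ] by auto

lemma zero_if_small: "(\<And>\<delta>::real. 0 < \<delta> \<Longrightarrow> \<bar>a\<bar> \<le> \<delta>) \<Longrightarrow> a = 0"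
  by (metis abs_le_zero_iff field_le_epsilon add_0)

lemma path_eq:
  assumes "0 \<le> t" "1 \<le> i" "enat i \<le> b"
  shows "x t i = q0 i + y (i - 1) t - y i t - (LINT s:{0..t}|lborel. x s i - x s (i + 1))"
proof -
  have "x t i - (q0 i + y (i - 1) t - y i t - (LINT s:{0..t}|lborel. x s i - x s (i + 1))) = 0"
    by (rule zero_if_small, rule near_solution_eq[OF near[of _ t i]]) (use assms in auto)
  then show ?thesis by simp
qed

lemma path_arrivals: assumes "0 \<le> t" shows "y 0 t = lam * t"
proof -
  have "y 0 t - lam * t = 0"
    by (rule zero_if_small, rule near_solution_arrivals[OF near[of _ t 0]]) (use assms in auto)
  then show ?thesis by simp
qed

lemma overflow:
  assumes "enat i \<le> b" "0 \<le> s" "s \<le> t"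
  shows "0 \<le> y i t - y i s" "y i t - y i s \<le> lam * (t - s)" "y i 0 = 0"
proof -
  have n: "near_solution b lam q0 t i 1 x y" by (rule near) simp
  show "0 \<le> y i t - y i s" using near_solution_overflow[OF n, of i s t] assms by auto
  show "y i t - y i s \<le> lam * (t - s)"
    using near_solution_overflow(3)[OF n, of i s t] assms path_arrivals[of s] path_arrivals[of t] by (auto simp: algebra_simps)
  show "y i 0 = 0"
    using near_solution_overflow(1,4)[OF n, of i 0 t] assms path_arrivals[of 0] by auto
qed

lemma departure_rate_bounded:
  assumes "0 \<le> s" shows "\<bar>x s i - x s (i + 1)\<bar> \<le> 1"
  using path_01[OF assms, of i] path_01[OF assms, of "i+1"] by auto

lemma path_lipschitz:
  assumes "0 \<le> s" "0 \<le> t"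
  shows "\<bar>x t i - x s i\<bar> \<le> 3 * \<bar>t - s\<bar>"
proof -
  have *: "\<bar>x t i - x s i\<bar> \<le> 3 * (t - s)" if st: "0 \<le> s" "s \<le> t" for s t
  proof -
    consider "i = 0" | "b < enat i" | "1 \<le> i" "enat i \<le> b" by force
    then show ?thesis
    proof cases
      case 1
      then show ?thesis using occupancy_states_bounds(3)[OF path_occ] st by simp
    next
      case 2
      then show ?thesis using occupancy_states_bounds(4)[OF path_occ] st by simp
    next
      case 3
      have i': "enat (i - 1) \<le> b" using 3(2) by (meson diff_le_self enat_ord_simps(1) order_trans)
      let ?f = "\<lambda>s. x s i - x s (i + 1)"
      have m: "?f \<in> borel_measurable borel" using path_measurable by measurable
      have "\<bar>LINT r:{s..t}|lborel. ?f r\<bar> \<le> 1 * (t - s)"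
        by (rule LINT_abs_le[OF m]) (use departure_rate_bounded st in auto)
      moreover have "(LINT r:{0..t}|lborel. ?f r) - (LINT r:{0..s}|lborel. ?f r) = (LINT r:{s..t}|lborel. ?f r)"
        by (rule LINT_split[OF m departure_rate_bounded st])
      moreover have "lam * (t - s) \<le> 1 * (t - s)" using lam st by (intro mult_right_mono) auto
      ultimately show ?thesis
        using path_eq[of s i] path_eq[of t i] overflow(1,2)[OF 3(2) st] overflow(1,2)[OF i' st] st 3 by linarith
    qed
  qed
  show ?thesis using *[of s t] *[of t s] assms by (cases "s \<le> t") (auto simp: abs_minus_commute)
qed

text \<open>The continuous path stays a positive distance below the barrier on \<open>[s, t]\<close>. For smaller \<open>\<delta>\<close>, the barrier
  clause can therefore only refer to a time before \<open>s\<close>.\<close>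

lemma overflow_constant:
  assumes i: "1 \<le> i" "enat i \<le> b" and st: "0 \<le> s" "s \<le> t" and x1: "\<forall>r\<in>{s..t}. x r i < 1"
  shows "y i t = y i s"
proof -
  have "continuous_on {s..t} (\<lambda>r. x r i)"
  proof (rule lipschitz_on_continuous_on)
    show "3-lipschitz_on {s..t} (\<lambda>r. x r i)"
      by (rule lipschitz_onI) (use path_lipschitz st in \<open>auto simp: dist_real_def\<close>)
  qed
  then obtain v where v: "v \<in> {s..t}" "\<And>r. r \<in> {s..t} \<Longrightarrow> x r i \<le> x v i"
    using continuous_attains_sup[of "{s..t}" "\<lambda>r. x r i"] st by auto
  have "y i t - y i s = 0"
  proof (rule zero_if_small)
    fix \<delta> :: real assume \<delta>: "0 < \<delta>"
    define \<delta>' where "\<delta>' = min \<delta> ((1 - x v i) / 2)"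
    have \<delta>': "0 < \<delta>'" "\<delta>' \<le> \<delta>" using \<delta> x1 v(1) by (auto simp: \<delta>'_def)
    have small: "x r i < 1 - \<delta>'" if "r \<in> {s..t}" for r
    proof -
      have "\<delta>' \<le> (1 - x v i) / 2" unfolding \<delta>'_def by (rule min.cobounded2)
      moreover have "0 < 1 - x v i" using x1 v(1) by auto
      then have "x v i < 1 - (1 - x v i) / 2" by (simp add: field_simps)
      moreover note v(2)[OF that]
      ultimately show ?thesis by linarith
    qed
    have "0 \<le> y i s" using overflow[OF i(2), of 0 s] st by auto
    moreover have "y i t \<le> \<delta>' \<or> (\<exists>r\<in>{0..t}. 1 - \<delta>' \<le> x r i \<and> y i t \<le> y i r + \<delta>')"
      by (rule near_solution_barrier[OF near[OF \<delta>'(1)] _ i(1) _ i(2), of t t i]) (use st in auto)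
    moreover have "y i r \<le> y i s" if r: "r \<in> {0..t}" "1 - \<delta>' \<le> x r i" for r
    proof -
      have "r < s" using small[of r] r by force
      then show ?thesis using overflow(1)[OF i(2), of r s] r by auto
    qed
    ultimately have "y i t \<le> y i s + \<delta>'" by force
    then show "\<bar>y i t - y i s\<bar> \<le> \<delta>" using overflow(1)[OF i(2) st] \<delta>' by auto
  qed
  then show ?thesis by simp
qed

lemma path_initial: "x 0 i = q0 i"
proof -
  consider "i = 0" | "b < enat i" | "1 \<le> i" "enat i \<le> b" by force
  then show ?thesis
  proof cases
    case 1
    then show ?thesis using occupancy_states_bounds(3)[OF path_occ] occupancy_states_bounds(3)[OF q0] by simp
  next
    case 2
    then show ?thesis using occupancy_states_bounds(4)[OF path_occ] occupancy_states_bounds(4)[OF q0] by simp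
  next
    case 3
    have i': "enat (i - 1) \<le> b" using 3(2) by (meson diff_le_self enat_ord_simps(1) order_trans)
    have "(LINT s:{0..0}|lborel. x s i - x s (i + 1)) = 0" by (rule LINT_point)
    then show ?thesis using path_eq[of 0 i] overflow(3)[OF i', of 0 0] overflow(3)[OF 3(2), of 0 0] 3 by auto
  qed
qed

text \<open>When level \<open>i \<ge> 1\<close> is full, so is level \<open>i - 1\<close>, and the arrivals not needed to compensate the
  departures from level \<open>i\<close> pass on.\<close>

definition overflow_rate :: "nat \<Rightarrow> real \<Rightarrow> real" where
  "overflow_rate i s = (if i = 0 then lam else if x s i = 1 then lam - 1 + x s (i + 1) else 0)"

lemma overflow_rate_measurable: "overflow_rate i \<in> borel_measurable borel"
  unfolding overflow_rate_def using path_measurable by measurable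

lemma overflow_rate_bounded: "0 \<le> s \<Longrightarrow> \<bar>overflow_rate i s\<bar> \<le> 1"
  using path_01[of s "i+1"] lam by (auto simp: overflow_rate_def)

text \<open>Level \<open>i\<close> is driven by \<open>y (i - 1)\<close> and reflected by the regulator \<open>y i\<close>, so the densities follow by induction over the
  levels.\<close>

lemma overflow_eq_integral:
  assumes "enat i \<le> b" "0 \<le> t"
  shows "y i t = (LINT s:{0..t}|lborel. overflow_rate i s)"
  using assms
proof (induction i arbitrary: t)
  case 0
  then show ?case by (simp add: overflow_rate_def path_arrivals set_integral_const)
next
  case (Suc i)
  have i': "enat i \<le> b" using Suc.prems(1) by (meson Suc_n_not_le_n enat_ord_simps(1) linorder_linear order_trans)
  let ?i = "Suc i"
  let ?f = "\<lambda>s. overflow_rate i s - (x s ?i - x s (?i + 1))"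
  have fm: "?f \<in> borel_measurable borel" using path_measurable overflow_rate_measurable by measurable
  have fB: "\<bar>?f s\<bar> \<le> 2" if "0 \<le> s" for s
    using overflow_rate_bounded[OF that, of i] departure_rate_bounded[OF that, of ?i] by linarith
  have "y ?i t - y ?i 0 = (LINT s:{0..t}|lborel. (if x s ?i = 1 then ?f s else 0))"
  proof (rule regulator_density[OF fm fB])
    show "(\<lambda>s. x s ?i) \<in> borel_measurable borel" by (rule path_measurable)
    show "0 \<le> x s ?i \<and> x s ?i \<le> 1" if "0 \<le> s" for s using path_01[OF that] by blast
    show "0 \<le> y ?i t - y ?i s \<and> y ?i t - y ?i s \<le> lam * (t - s)" if "0 \<le> s" "s \<le> t" for s t
      using overflow[OF Suc.prems(1) that] by blast
    show "y ?i t = y ?i s" if "0 \<le> s" "s \<le> t" "\<forall>r\<in>{s..t}. x r ?i < 1" for s t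
      by (rule overflow_constant[OF _ Suc.prems(1) that]) simp
    show "0 \<le> t" by (rule Suc.prems)
    fix t :: real assume t: "0 \<le> t"
    have i1: "set_integrable lborel {0..t} (overflow_rate i)"
      by (rule set_integrable_bounded[OF overflow_rate_measurable overflow_rate_bounded]) simp
    have i2: "set_integrable lborel {0..t} (\<lambda>s. x s ?i - x s (?i + 1))"
      by (rule set_integrable_bounded[where B = 1]) (use path_measurable departure_rate_bounded in \<open>auto intro!: borel_measurable_diff\<close>)
    have "(LINT s:{0..t}|lborel. ?f s) = y i t - (LINT s:{0..t}|lborel. x s ?i - x s (?i + 1))"
      using i1 i2 Suc.IH[OF i' t] by (simp add: set_integral_diff)
    then show "x t ?i = x 0 ?i + (LINT s:{0..t}|lborel. ?f s) - (y ?i t - y ?i 0)"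
      using path_eq[OF t, of ?i] path_initial[of ?i] overflow(3)[OF Suc.prems(1), of 0 0] Suc.prems(1) by simp
  qed
  also have "\<dots> = (LINT s:{0..t}|lborel. overflow_rate ?i s)"
  proof (rule set_lebesgue_integral_cong)
    show "\<forall>s. s \<in> {0..t} \<longrightarrow> (if x s ?i = 1 then ?f s else 0) = overflow_rate ?i s"
    proof (intro allI impI)
      fix s assume "s \<in> {0..t}"
      then have s: "0 \<le> s" by simp
      have "x s i = 1" if "x s ?i = 1"
        using occupancy_states_antimono[OF path_occ[OF s], of i ?i] path_01(2)[OF s, of i] that by simp
      then show "(if x s ?i = 1 then ?f s else 0) = overflow_rate ?i s" by (auto simp: overflow_rate_def)
    qed
  qed simp
  finally show ?case using overflow(3)[OF Suc.prems(1), of 0 0] by simp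
qed

text \<open>Level \<open>i\<close> cannot stay full while fewer arrivals come than tasks depart. Let \<open>h = max 0 (1 - lam - x (i + 1))\<close>. Where
  \<open>h > 0\<close>, the nondecreasing \<open>y i\<close> has a density that is not positive, so it is locally constant; hence
  \<open>\<integral> h dy\<^sub>i = 0\<close>. The density of this integral is \<open>- h\<^sup>2\<close> on the set where level \<open>i\<close> is full.\<close>

lemma full_level_capacity:
  assumes i: "1 \<le> i" "enat i \<le> b" and t: "0 \<le> t"
  shows "AE s in lborel. s \<in> {0..t} \<longrightarrow> x s i = 1 \<longrightarrow> 1 - lam \<le> x s (i + 1)"
proof -
  define h where "h s = max 0 (1 - lam - x s (i + 1))" for s
  let ?g = "overflow_rate i"
  note gm = overflow_rate_measurable[of i] and gB = overflow_rate_bounded[of _ i]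
  have hm: "h \<in> borel_measurable borel" unfolding h_def using path_measurable by measurable
  have hB: "\<bar>h s\<bar> \<le> 1" if "0 \<le> s" for s unfolding h_def using path_01[OF that, of "i+1"] lam by auto
  have hlip: "\<bar>h s - h r\<bar> \<le> 3 * \<bar>s - r\<bar>" if "0 \<le> s" "0 \<le> r" for s r
    using path_lipschitz[OF that(2,1), of "i+1"] unfolding h_def by linarith
  have hgm: "(\<lambda>s. h s * ?g s) \<in> borel_measurable borel" using hm gm by measurable
  have hgB: "\<bar>h s * ?g s\<bar> \<le> 1" if "0 \<le> s" for s
    using mult_mono[OF hB[OF that] gB[OF that]] by (simp add: abs_mult)
  define W where "W t = (LINT s:{0..t}|lborel. h s * ?g s)" for t
  have gint: "set_integrable lborel {u..v} ?g" if "0 \<le> u" for u v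
    by (rule set_integrable_bounded[OF gm gB]) (use that in auto)
  have hgint: "set_integrable lborel {u..v} (\<lambda>s. h s * ?g s)" if "0 \<le> u" for u v
    by (rule set_integrable_bounded[OF hgm hgB]) (use that in auto)
  have yd: "y i v - y i u = (LINT s:{u..v}|lborel. ?g s)" if "0 \<le> u" "u \<le> v" for u v
    using LINT_split[OF gm gB that] overflow_eq_integral[OF i(2)] that by auto
  have "W t = W 0"
  proof (rule constant_if_quadratic_increments[where T = t])
    fix s assume s: "s \<in> {0..t}"
    define \<epsilon> where "\<epsilon> = (if h s = 0 then 1 else h s / 3)"
    have h0: "0 \<le> h s" by (simp add: h_def)
    have \<epsilon>: "0 < \<epsilon>" using h0 by (auto simp: \<epsilon>_def)
    show "\<exists>C. \<exists>\<epsilon>>0. \<forall>r\<in>{0..t}. \<bar>r - s\<bar> < \<epsilon> \<longrightarrow> \<bar>W r - W s\<bar> \<le> C * (r - s)\<^sup>2"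
    proof (intro exI conjI ballI impI)
      fix r assume r: "r \<in> {0..t}" "\<bar>r - s\<bar> < \<epsilon>"
      define u where "u = min s r"
      define v where "v = max s r"
      have uv: "0 \<le> u" "u \<le> v" using s r by (auto simp: u_def v_def)
      have hy: "h s * (y i v - y i u) = 0"
      proof (cases "h s = 0")
        case False
        have "(LINT w:{u..v}|lborel. ?g w) \<le> (LINT w:{u..v}|lborel. 0)"
        proof (rule set_integral_mono)
          fix w assume w: "w \<in> {u..v}"
          have "\<bar>h s - h w\<bar> \<le> 3 * \<bar>s - w\<bar>" by (rule hlip) (use s w uv in auto)
          also have "\<dots> \<le> 3 * \<bar>r - s\<bar>" using w by (auto simp: u_def v_def)
          also have "\<dots> < h s" using r(2) False by (simp add: \<epsilon>_def)
          finally have "0 < h w" by linarith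
          then have "x w (i + 1) < 1 - lam" by (auto simp: h_def max_def split: if_splits)
          then show "?g w \<le> 0" using i by (auto simp: overflow_rate_def)
        qed (use gint uv set_integrable_bounded[of "\<lambda>_. 0" u v 0] in auto)
        then have "y i v - y i u \<le> 0" using yd[OF uv] by simp
        then show ?thesis using overflow(1)[OF i(2) uv] by simp
      qed simp
      have "W v - W u = (LINT w:{u..v}|lborel. h w * ?g w)"
        unfolding W_def by (rule LINT_split[OF hgm hgB uv])
      also have "\<dots> = (LINT w:{u..v}|lborel. h w * ?g w) - h s * (y i v - y i u)" using hy by simp
      also have "\<dots> = (LINT w:{u..v}|lborel. (h w - h s) * ?g w)"
      proof -
        have "set_integrable lborel {u..v} (\<lambda>w. h s * ?g w)" using gint uv by simp
        then have "(LINT w:{u..v}|lborel. h w * ?g w - h s * ?g w) = (LINT w:{u..v}|lborel. h w * ?g w) - h s * (LINT w:{u..v}|lborel. ?g w)"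
          using hgint uv by (subst set_integral_diff) auto
        then show ?thesis using yd[OF uv] by (simp add: algebra_simps)
      qed
      also have "\<bar>\<dots>\<bar> \<le> (3 * (v - u)) * (v - u)"
      proof (rule LINT_abs_le)
        show "(\<lambda>w. (h w - h s) * ?g w) \<in> borel_measurable borel" using hm gm by measurable
        fix w assume w: "w \<in> {u..v}"
        have "\<bar>h w - h s\<bar> \<le> 3 * \<bar>w - s\<bar>" by (rule hlip) (use s w uv in auto)
        also have "\<dots> \<le> 3 * (v - u)" using w by (cases "s \<le> r") (auto simp: u_def v_def)
        finally have "\<bar>h w - h s\<bar> * \<bar>?g w\<bar> \<le> 3 * (v - u) * 1"
          using gB[of w] w uv by (intro mult_mono) auto
        then show "\<bar>(h w - h s) * ?g w\<bar> \<le> 3 * (v - u)" by (simp add: abs_mult)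
      qed (rule uv)
      finally show "\<bar>W r - W s\<bar> \<le> 3 * (r - s)\<^sup>2"
        unfolding u_def v_def
        by (cases "s \<le> r") (auto simp: max_def min_def power2_eq_square abs_minus_commute algebra_simps)
    qed (rule \<epsilon>)
  qed (use t in auto)
  moreover have "W 0 = 0" unfolding W_def by (rule LINT_point)
  ultimately have "(LINT s|lborel. - (indicat_real {0..t} s *\<^sub>R (h s * ?g s))) = 0"
    by (simp add: W_def set_lebesgue_integral_def)
  moreover have nn: "0 \<le> - (indicat_real {0..t} s *\<^sub>R (h s * ?g s))" for s
    using i by (auto simp: overflow_rate_def h_def indicator_def max_def mult_nonneg_nonpos)
  moreover have "integrable lborel (\<lambda>s. - (indicat_real {0..t} s *\<^sub>R (h s * ?g s)))"
    using hgint[of 0 t] unfolding set_integrable_def by simp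
  ultimately have "AE s in lborel. - (indicat_real {0..t} s *\<^sub>R (h s * ?g s)) = 0"
    by (subst (asm) integral_nonneg_eq_0_iff_AE) auto
  then show ?thesis
    by eventually_elim (use i in \<open>auto simp: overflow_rate_def h_def max_def indicator_def split: if_splits\<close>)
qed

end

context fluid_path
begin

lemma full_level_props:
  assumes "q \<in> occupancy_states b"
  shows "q (full_level q + 1) < 1" "\<And>i. i \<le> full_level q \<Longrightarrow> q i = 1"
proof -
  have "\<exists>i. q (i + 1) < 1"
  proof (rule ccontr)
    assume "\<not> ?thesis"
    then have "1 \<le> q (i + 1)" for i by (simp add: not_less)
    moreover have "q \<longlonglongrightarrow> 0" using occupancy_states_bounds(5)[OF assms] by (rule summable_LIMSEQ_zero)
    then have "(\<lambda>i. q (i + 1)) \<longlonglongrightarrow> 0" by (rule LIMSEQ_ignore_initial_segment)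
    ultimately have "1 \<le> (0::real)" by (intro LIMSEQ_le_const) auto
    then show False by simp
  qed
  then show "q (full_level q + 1) < 1" unfolding full_level_def by (rule LeastI_ex)
  show "q i = 1" if "i \<le> full_level q" for i
  proof (cases i)
    case (Suc j)
    then have "\<not> q (j + 1) < 1" using that unfolding full_level_def by (intro not_less_Least) simp
    then show ?thesis using occupancy_states_bounds(2)[OF assms, of i] Suc by simp
  qed (use occupancy_states_bounds(3)[OF assms] in simp)
qed

lemma assign_frac_measurable: "(\<lambda>s. assign_frac lam (x s) i) \<in> borel_measurable borel"
proof -
  have fl[measurable]: "(\<lambda>s. full_level (x s)) \<in> measurable borel (count_space UNIV)"
    unfolding full_level_def using path_measurable by measurable
  have [measurable]: "(\<lambda>s. x s (full_level (x s) + 1)) \<in> borel_measurable borel"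
    by (rule measurable_compose_countable[OF _ fl]) (use path_measurable in measurable)
  show ?thesis unfolding assign_frac_def Let_def by measurable
qed

lemma assign_frac_bounded:
  assumes "0 \<le> s" shows "\<bar>assign_frac lam (x s) i\<bar> \<le> 1"
  using path_01[OF assms, of "Suc (full_level (x s))"] lam
  by (auto simp: assign_frac_def Let_def field_simps)

text \<open>The capacity bound excludes, for almost all times, the case in which the overflow rate and the assignment
  probabilities differ.\<close>

lemma assign_frac_eq_overflow_rate:
  assumes s: "0 \<le> s" and i: "1 \<le> i" "enat i \<le> b"
    and cap: "\<And>j. 1 \<le> j \<Longrightarrow> enat j \<le> b \<Longrightarrow> x s j = 1 \<Longrightarrow> 1 - lam \<le> x s (j + 1)"
  shows "lam * assign_frac lam (x s) (i - 1) = overflow_rate (i - 1) s - overflow_rate i s"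
proof -
  define m where "m = full_level (x s)"
  have lt: "x s (m + 1) < 1" and full: "\<And>j. j \<le> m \<Longrightarrow> x s j = 1"
    unfolding m_def using full_level_props[OF path_occ[OF s]] by auto
  have notfull: "x s j \<noteq> 1" if "m < j" for j
    using occupancy_states_antimono[OF path_occ[OF s], of "m + 1" j] that lt by auto
  have mb: "enat m \<le> b"
    using occupancy_states_bounds(4)[OF path_occ[OF s], of m] full[of m] by force
  have rate: "overflow_rate j s = (if j < m then lam else if j = m \<and> 0 < m then lam - 1 + x s (m + 1) else if j = 0 then lam else 0)" for j
    using full[of j] full[of "j + 1"] notfull[of j] by (auto simp: overflow_rate_def)
  have capm: "1 - lam \<le> x s (m + 1)" if "0 < m"
    using cap[of m] full[of m] mb that by auto
  show ?thesis
  proof (cases "m = 0")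
    case True
    then show ?thesis using i by (cases "i = 1") (auto simp: assign_frac_def Let_def rate m_def[symmetric])
  next
    case False
    then have c: "1 - x s (m + 1) \<le> lam" using capm by simp
    have "lam * assign_frac lam (x s) (i - 1) =
      (if i - 1 = m - 1 then 1 - x s (m + 1) else if i - 1 = m then lam - (1 - x s (m + 1)) else 0)"
    proof (cases "lam \<le> 1 - x s (m + 1)")
      case True
      then show ?thesis using c False by (auto simp: assign_frac_def Let_def m_def[symmetric])
    next
      case 2: False
      then have "lam \<noteq> 0" using lt by auto
      then show ?thesis using 2 False by (auto simp: assign_frac_def Let_def m_def[symmetric] field_simps)
    qed
    also have "\<dots> = overflow_rate (i - 1) s - overflow_rate i s"
      using i False unfolding rate by auto
    finally show ?thesis .
  qed
qed

theorem fluid_solution: "fluid_solution b lam q0 x"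
  unfolding fluid_solution_def
proof (intro allI impI)
  fix i t assume "1 \<le> i \<and> enat i \<le> b \<and> 0 \<le> (t::real)"
  then have i: "1 \<le> i" "enat i \<le> b" and t: "0 \<le> t" by auto
  have i': "enat (i - 1) \<le> b" using i(2) by (meson diff_le_self enat_ord_simps(1) order_trans)
  have int: "set_integrable lborel {0..t} (\<lambda>s. assign_frac lam (x s) (i - 1))"
    by (rule set_integrable_bounded[OF assign_frac_measurable assign_frac_bounded]) simp
  have int2: "set_integrable lborel {0..t} (\<lambda>s. x s i - x s (i + 1))"
    by (rule set_integrable_bounded[where B = 1]) (use path_measurable departure_rate_bounded in \<open>auto intro!: borel_measurable_diff\<close>)
  have g: "set_integrable lborel {0..t} (overflow_rate j)" for j
    by (rule set_integrable_bounded[OF overflow_rate_measurable overflow_rate_bounded]) simp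
  have "AE s in lborel. \<forall>j. 1 \<le> j \<and> enat j \<le> b \<longrightarrow> s \<in> {0..t} \<longrightarrow> x s j = 1 \<longrightarrow> 1 - lam \<le> x s (j + 1)"
    unfolding AE_all_countable using full_level_capacity[OF _ _ t] by auto
  then have ae: "AE s in lborel. indicat_real {0..t} s *\<^sub>R (lam * assign_frac lam (x s) (i - 1)) =
      indicat_real {0..t} s *\<^sub>R (overflow_rate (i - 1) s - overflow_rate i s)"
  proof eventually_elim
    case (elim s)
    then show ?case using assign_frac_eq_overflow_rate[OF _ i, of s] by (auto simp: indicator_def)
  qed
  have "lam * (LINT s:{0..t}|lborel. assign_frac lam (x s) (i - 1)) = (LINT s:{0..t}|lborel. lam * assign_frac lam (x s) (i - 1))"
    by simp
  also have "\<dots> = (LINT s:{0..t}|lborel. overflow_rate (i - 1) s - overflow_rate i s)"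
    unfolding set_lebesgue_integral_def
    by (rule integral_cong_AE[OF _ _ ae]) (use assign_frac_measurable overflow_rate_measurable in measurable)
  also have "\<dots> = y (i - 1) t - y i t"
    using overflow_eq_integral[OF i' t] overflow_eq_integral[OF i(2) t] g by (simp add: set_integral_diff)
  finally have "lam * (LINT s:{0..t}|lborel. assign_frac lam (x s) (i - 1)) = y (i - 1) t - y i t" .
  then show "set_integrable lborel {0..t} (\<lambda>s. assign_frac lam (x s) (i - 1)) \<and>
        set_integrable lborel {0..t} (\<lambda>s. x s i - x s (i + 1)) \<and>
        x t i = q0 i + lam * (LINT s:{0..t}|lborel. assign_frac lam (x s) (i - 1))
                  - (LINT s:{0..t}|lborel. x s i - x s (i + 1))"
    using int int2 path_eq[OF t i] by simp
qed

end

section \<open>Approximate solutions are close in \<open>\<ell>\<^sub>1\<close>\<close>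

lemma l1_dist_le_tails:
  assumes u: "u \<in> occupancy_states b" and v: "v \<in> occupancy_states b"
    and U: "\<And>J. (\<Sum>i\<in>{m<..J}. u i) \<le> U" and V: "\<And>J. (\<Sum>i\<in>{m<..J}. v i) \<le> V"
  shows "l1_dist u v \<le> (\<Sum>i\<le>m. \<bar>u i - v i\<bar>) + U + V"
  unfolding l1_dist_def
proof (rule infsum_le_finite_sums[OF l1_dist_summable[OF u v]])
  fix F :: "nat set" assume F: "finite F"
  then obtain J where J: "\<And>i. i \<in> F \<Longrightarrow> i \<le> J" using finite_nat_set_iff_bounded_le[of F] by auto
  have "(\<Sum>i\<in>F. \<bar>u i - v i\<bar>) \<le> (\<Sum>i\<in>{..m} \<union> {m<..J}. \<bar>u i - v i\<bar>)"
    by (rule sum_mono2) (use J in force)+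
  also have "\<dots> = (\<Sum>i\<le>m. \<bar>u i - v i\<bar>) + (\<Sum>i\<in>{m<..J}. \<bar>u i - v i\<bar>)"
    by (rule sum.union_disjoint) auto
  also have "(\<Sum>i\<in>{m<..J}. \<bar>u i - v i\<bar>) \<le> (\<Sum>i\<in>{m<..J}. u i + v i)"
  proof (rule sum_mono)
    fix i
    have "0 \<le> u i" "0 \<le> v i" using occupancy_states_bounds(1)[OF u] occupancy_states_bounds(1)[OF v] by blast+
    then show "\<bar>u i - v i\<bar> \<le> u i + v i" by linarith
  qed
  also have "\<dots> \<le> U + V" unfolding sum.distrib by (intro add_mono U V)
  finally show "(\<Sum>i\<in>F. \<bar>u i - v i\<bar>) \<le> (\<Sum>i\<le>m. \<bar>u i - v i\<bar>) + U + V" by simp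
qed

text \<open>A level \<open>m\<close> beyond twice a bound of the total mass is never full. Its overflow is therefore at most \<open>\<delta>\<close>, and the tail
  above it hardly exceeds the initial tail.\<close>

lemma near_solution_small_tail:
  assumes q0: "q0 \<in> occupancy_states b" and lam: "0 \<le> lam" and T: "0 \<le> T" and \<epsilon>: "0 < \<epsilon>"
  shows "\<exists>m. \<forall>\<delta> n x y t J. \<delta> \<le> \<epsilon> / 4 \<longrightarrow> \<delta> \<le> 1 / 4 \<longrightarrow> m \<le> n \<longrightarrow> t \<in> {0..T} \<longrightarrow> near_solution b lam q0 T n \<delta> x y \<longrightarrow>
    (\<Sum>i\<in>{m<..J}. x t i) \<le> \<epsilon>"
proof -
  define C where "C = (\<Sum>i. q0 (i + 1)) + 2 + lam * T"
  have "0 \<le> (\<Sum>i. q0 (i + 1))"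
    using occupancy_states_bounds[OF q0] by (intro suminf_nonneg) (auto simp: summable_Suc_iff)
  then have C: "2 \<le> C" unfolding C_def using lam T by simp
  have "\<exists>N. \<forall>n\<ge>N. norm (\<Sum>i. q0 (i + n)) < \<epsilon> / 2"
    by (rule suminf_exist_split) (use \<epsilon> occupancy_states_bounds(5)[OF q0] in auto)
  then obtain N where N: "\<And>n. N \<le> n \<Longrightarrow> \<bar>\<Sum>i. q0 (i + n)\<bar> < \<epsilon> / 2" by auto
  define m where "m = max N (nat \<lceil>2 * C\<rceil>)"
  have m2: "2 * C \<le> real m" unfolding m_def by linarith
  have "(\<Sum>i\<in>{m<..J}. x t i) \<le> \<epsilon>"
    if \<delta>: "\<delta> \<le> \<epsilon> / 4" "\<delta> \<le> 1 / 4" and mn: "m \<le> n" and t: "t \<in> {0..T}" and ns: "near_solution b lam q0 T n \<delta> x y" for \<delta> n x y t J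
  proof (cases "enat m \<le> b")
    case False
    have "(\<Sum>i\<in>{m<..J}. x t i) = 0"
    proof (rule sum.neutral, rule ballI)
      fix i assume "i \<in> {m<..J}"
      then have "b < enat i" using False by (meson enat_ord_simps(2) greaterThanAtMost_iff less_trans not_le)
      then show "x t i = 0" by (rule occupancy_states_bounds(4)[OF near_solution_occ[OF ns t]])
    qed
    then show ?thesis using \<epsilon> by simp
  next
    case True
    have m1: "1 \<le> m" using m2 C by linarith
    have "x s m < 1 - \<delta>" if s: "s \<in> {0..t}" for s
    proof -
      have "real m * x s m \<le> C"
        unfolding C_def by (rule near_solution_level_le[OF ns _ m1 _ lam]) (use s t \<delta> in auto)
      then have "2 * C * x s m \<le> C"
        using m2 occupancy_states_bounds(1)[OF near_solution_occ[OF ns], of s m] s t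
        by (smt (verit, ccfv_SIG) atLeastAtMost_iff mult_right_mono)
      then have "x s m \<le> 1 / 2" using C by (simp add: field_simps)
      then show ?thesis using \<delta> by linarith
    qed
    then have "y m t \<le> \<delta>"
      using near_solution_barrier[OF ns t m1 mn True] by force
    moreover have "(\<Sum>i\<in>{m<..J}. x t i) \<le> (\<Sum>i. q0 (i + m + 1)) + \<delta> + y m t"
      by (rule near_solution_tail[OF ns t mn True])
    moreover have "(\<Sum>i. q0 (i + m + 1)) < \<epsilon> / 2"
    proof -
      have "\<bar>\<Sum>i. q0 (i + (m + 1))\<bar> < \<epsilon> / 2" by (rule N) (simp add: m_def)
      then show ?thesis unfolding add.assoc by linarith
    qed
    ultimately show ?thesis using \<delta> by linarith
  qed
  then show ?thesis by blast
qed

lemma (in fluid_path) near_solution_converges: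
  assumes T: "0 \<le> T" and \<epsilon>: "0 < \<epsilon>"
  shows "\<exists>n. \<exists>\<delta>>0. \<forall>x' y'. near_solution b lam q0 T n \<delta> x' y' \<longrightarrow> (\<forall>t\<in>{0..T}. l1_dist (x' t) (x t) < \<epsilon>)"
proof -
  have q0s: "0 \<le> (\<Sum>i. q0 (i + 1))"
    using occupancy_states_bounds[OF q0] by (intro suminf_nonneg) (auto simp: summable_Suc_iff)
  obtain K where K: "0 \<le> K" "\<And>n \<delta> x y x' y' t i. 0 \<le> \<delta> \<Longrightarrow> \<delta> \<le> 1/4 \<Longrightarrow>
     near_solution b lam q0 T n \<delta> x y \<Longrightarrow> near_solution b lam q0 T n \<delta> x' y' \<Longrightarrow> t \<in> {0..T} \<Longrightarrow> i \<le> n \<Longrightarrow>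
     \<bar>x t i - x' t i\<bar> \<le> K * (\<delta> + 1 / real (n + 1))"
    using near_solution_compare[OF lam(1) T q0s, of b] by metis
  have \<epsilon>4: "0 < \<epsilon> / 4" using \<epsilon> by simp
  obtain m where m: "\<And>\<delta> n x y t J. \<delta> \<le> \<epsilon> / 4 / 4 \<Longrightarrow> \<delta> \<le> 1 / 4 \<Longrightarrow> m \<le> n \<Longrightarrow> t \<in> {0..T} \<Longrightarrow>
      near_solution b lam q0 T n \<delta> x y \<Longrightarrow> (\<Sum>i\<in>{m<..J}. x t i) \<le> \<epsilon> / 4"
    using near_solution_small_tail[OF q0 lam(1) T \<epsilon>4] by metis
  define \<eta> where "\<eta> = \<epsilon> / (8 * (real m + 1) * (K + 1))"
  have \<eta>: "0 < \<eta>" unfolding \<eta>_def using \<epsilon> K by simp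
  define \<delta> where "\<delta> = min \<eta> (min (\<epsilon> / 4 / 4) (1 / 4))"
  have \<delta>: "0 < \<delta>" "\<delta> \<le> \<eta>" "\<delta> \<le> \<epsilon> / 4 / 4" "\<delta> \<le> 1 / 4" using \<eta> \<epsilon> by (auto simp: \<delta>_def)
  obtain n0 where n0: "1 / real (Suc n0) < \<eta>" using \<eta> nat_approx_posE by blast
  define n where "n = max m n0"
  have n: "m \<le> n" "1 / real (n + 1) \<le> \<eta>"
  proof -
    have "1 / real (n + 1) \<le> 1 / real (Suc n0)" by (intro divide_left_mono) (auto simp: n_def)
    then show "1 / real (n + 1) \<le> \<eta>" using n0 by linarith
  qed (simp add: n_def)
  have "l1_dist (x' t) (x t) < \<epsilon>" if ns': "near_solution b lam q0 T n \<delta> x' y'" and t: "t \<in> {0..T}" for x' y' t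
  proof -
    note ns = near[OF \<delta>(1), of T n]
    have "l1_dist (x' t) (x t) \<le> (\<Sum>i\<le>m. \<bar>x' t i - x t i\<bar>) + \<epsilon> / 4 + \<epsilon> / 4"
      by (rule l1_dist_le_tails[OF near_solution_occ[OF ns' t] near_solution_occ[OF ns t]
        m[OF \<delta>(3,4) n(1) t ns'] m[OF \<delta>(3,4) n(1) t ns]])
    also have "(\<Sum>i\<le>m. \<bar>x' t i - x t i\<bar>) \<le> (\<Sum>i\<le>m. (K + 1) * (2 * \<eta>))"
    proof (rule sum_mono)
      fix i assume "i \<in> {..m}"
      then have "\<bar>x' t i - x t i\<bar> \<le> K * (\<delta> + 1 / real (n + 1))"
        using n(1) by (intro K(2)[OF _ \<delta>(4) ns' ns t]) (use \<delta> in auto)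
      also have "\<dots> \<le> (K + 1) * (2 * \<eta>)" using K(1) \<delta> n by (intro mult_mono) auto
      finally show "\<bar>x' t i - x t i\<bar> \<le> (K + 1) * (2 * \<eta>)" .
    qed
    also have "\<dots> = \<eta> * (8 * (real m + 1) * (K + 1)) / 4" by (simp add: algebra_simps)
    also have "\<eta> * (8 * (real m + 1) * (K + 1)) = \<epsilon>" unfolding \<eta>_def using K(1) by simp
    finally show ?thesis using \<epsilon> by simp
  qed
  then show ?thesis using \<delta>(1) by blast
qed

lemma (in fluid_path) path_continuous:
  assumes t: "0 \<le> t" and \<epsilon>: "0 < \<epsilon>"
  shows "\<exists>\<delta>>0. \<forall>s\<ge>0. \<bar>s - t\<bar> < \<delta> \<longrightarrow> l1_dist (x s) (x t) < \<epsilon>"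
proof -
  have \<epsilon>4: "0 < \<epsilon> / 4" using \<epsilon> by simp
  have T: "0 \<le> t + 1" using t by simp
  obtain m where m: "\<And>\<delta> n x y s J. \<delta> \<le> \<epsilon> / 4 / 4 \<Longrightarrow> \<delta> \<le> 1 / 4 \<Longrightarrow> m \<le> n \<Longrightarrow> s \<in> {0..t+1} \<Longrightarrow>
      near_solution b lam q0 (t+1) n \<delta> x y \<Longrightarrow> (\<Sum>i\<in>{m<..J}. x s i) \<le> \<epsilon> / 4"
    using near_solution_small_tail[OF q0 lam(1) T \<epsilon>4] by metis
  have tail: "(\<Sum>i\<in>{m<..J}. x s i) \<le> \<epsilon> / 4" if "s \<in> {0..t+1}" for s J
    by (rule m[OF _ _ order_refl that near[of "min (\<epsilon>/4/4) (1/4)"]]) (use \<epsilon> in auto)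
  define \<delta> where "\<delta> = min 1 (\<epsilon> / (12 * (real m + 1)))"
  have \<delta>: "0 < \<delta>" "\<delta> \<le> 1" "\<delta> \<le> \<epsilon> / (12 * (real m + 1))" using \<epsilon> by (auto simp: \<delta>_def)
  have "l1_dist (x s) (x t) < \<epsilon>" if s: "0 \<le> s" "\<bar>s - t\<bar> < \<delta>" for s
  proof -
    have "l1_dist (x s) (x t) \<le> (\<Sum>i\<le>m. \<bar>x s i - x t i\<bar>) + \<epsilon> / 4 + \<epsilon> / 4"
      by (rule l1_dist_le_tails[OF path_occ[OF s(1)] path_occ[OF t] tail tail]) (use s t \<delta> in auto)
    also have "(\<Sum>i\<le>m. \<bar>x s i - x t i\<bar>) \<le> (\<Sum>i\<le>m. \<epsilon> / (4 * (real m + 1)))"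
    proof (rule sum_mono)
      fix i
      have "\<bar>x s i - x t i\<bar> \<le> 3 * \<bar>s - t\<bar>" by (rule path_lipschitz) (use s t in auto)
      also have "\<dots> \<le> 3 * (\<epsilon> / (12 * (real m + 1)))" using s \<delta> by (intro mult_left_mono) linarith+
      also have "\<dots> = \<epsilon> / (4 * (real m + 1))" by (simp add: field_simps)
      finally show "\<bar>x s i - x t i\<bar> \<le> \<epsilon> / (4 * (real m + 1))" .
    qed
    also have "\<dots> = \<epsilon> / 4" by (simp add: field_simps)
    finally show ?thesis using \<epsilon> by simp
  qed
  then show ?thesis using \<delta>(1) by blast
qed

section \<open>The Skorohod topology near continuous paths\<close>

context Metric_space
begin

lemma topspace_skorohod_J1: "topspace skorohod_J1 = cadlag_paths"
proof
  show "topspace skorohod_J1 \<subseteq> cadlag_paths"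
    using openin_skorohod_J1[of "topspace skorohod_J1"] by auto
  have "openin skorohod_J1 cadlag_paths"
    unfolding openin_skorohod_J1 by (auto simp: J1_nhd_def intro!: exI[of _ 1])
  then show "cadlag_paths \<subseteq> topspace skorohod_J1" by (rule openin_subset)
qed

lemma cadlag_pathsD: "x \<in> cadlag_paths \<Longrightarrow> 0 \<le> t \<Longrightarrow> x t \<in> M"
  by (auto simp: cadlag_paths_def)

lemma cadlag_pathsI:
  assumes "x \<in> extensional {0..}" "\<And>t. 0 \<le> t \<Longrightarrow> x t \<in> M"
    and right: "\<And>t \<epsilon>. 0 \<le> t \<Longrightarrow> 0 < \<epsilon> \<Longrightarrow> \<exists>\<delta>>0. \<forall>s. t < s \<longrightarrow> s < t + \<delta> \<longrightarrow> d (x s) (x t) < \<epsilon>"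
    and left: "\<And>t. 0 < t \<Longrightarrow> \<exists>l\<in>M. \<forall>\<epsilon>>0. \<exists>\<delta>>0. \<forall>s. t - \<delta> < s \<longrightarrow> s < t \<longrightarrow> d (x s) l < \<epsilon>"
  shows "x \<in> cadlag_paths"
  unfolding cadlag_paths_def
proof (intro CollectI conjI allI impI)
  show "x \<in> {0..} \<rightarrow>\<^sub>E M" using assms(1,2) by (auto simp: PiE_def)
  fix t :: real assume t: "0 \<le> t"
  show "limitin mtopology x (x t) (at_right t)"
    unfolding limitin_metric
  proof (intro conjI allI impI assms(2) t)
    fix \<epsilon> :: real assume "0 < \<epsilon>"
    then obtain \<delta> where \<delta>: "0 < \<delta>" "\<And>s. t < s \<Longrightarrow> s < t + \<delta> \<Longrightarrow> d (x s) (x t) < \<epsilon>" using right[OF t] by metis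
    show "\<forall>\<^sub>F s in at_right t. x s \<in> M \<and> d (x s) (x t) < \<epsilon>"
      unfolding eventually_at_right_field using \<delta> assms(2) t by (intro exI[of _ "t + \<delta>"]) auto
  qed
next
  fix t :: real assume t: "0 < t"
  then obtain l where l: "l \<in> M" "\<And>\<epsilon>. 0 < \<epsilon> \<Longrightarrow> \<exists>\<delta>>0. \<forall>s. t - \<delta> < s \<longrightarrow> s < t \<longrightarrow> d (x s) l < \<epsilon>" using left by metis
  show "\<exists>l. limitin mtopology x l (at_left t)"
    unfolding limitin_metric
  proof (intro exI[of _ l] conjI allI impI l(1))
    fix \<epsilon> :: real assume "0 < \<epsilon>"
    then obtain \<delta> where \<delta>: "0 < \<delta>" "\<And>s. t - \<delta> < s \<Longrightarrow> s < t \<Longrightarrow> d (x s) l < \<epsilon>" using l(2) by metis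
    show "\<forall>\<^sub>F s in at_left t. x s \<in> M \<and> d (x s) l < \<epsilon>"
      unfolding eventually_at_left_field using \<delta> assms(2) t by (intro exI[of _ "max 0 (t - \<delta>)"]) auto
  qed
qed

text \<open>A continuous path is separated from every other path, because time changes that move points little also
  move its values little.\<close>

lemma closedin_continuous_path:
  assumes q: "q \<in> cadlag_paths"
    and cont: "\<And>t \<epsilon>. 0 \<le> t \<Longrightarrow> 0 < \<epsilon> \<Longrightarrow> \<exists>\<delta>>0. \<forall>s\<ge>0. \<bar>s - t\<bar> < \<delta> \<longrightarrow> d (q s) (q t) < \<epsilon>"
  shows "closedin skorohod_J1 {q}"
  unfolding closedin_def topspace_skorohod_J1 openin_skorohod_J1
proof (intro conjI ballI)
  fix x assume "x \<in> cadlag_paths - {q}"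
  then have x: "x \<in> cadlag_paths" "x \<noteq> q" by auto
  then obtain t where "x t \<noteq> q t" by (auto simp: fun_eq_iff)
  moreover have "x s = q s" if "s < 0" for s
    using x(1) q that by (auto simp: cadlag_paths_def PiE_def extensional_def)
  ultimately have t: "0 \<le> t" "x t \<noteq> q t" by (meson not_less)+
  have M: "x t \<in> M" "q t \<in> M" using cadlag_pathsD x(1) q t(1) by auto
  define \<epsilon> where "\<epsilon> = d (x t) (q t) / 2"
  have \<epsilon>: "0 < \<epsilon>" using M t(2) by (simp add: \<epsilon>_def)
  obtain \<delta> where \<delta>: "0 < \<delta>" "\<And>s. 0 \<le> s \<Longrightarrow> \<bar>s - t\<bar> < \<delta> \<Longrightarrow> d (q s) (q t) < \<epsilon>" using cont[OF t(1) \<epsilon>] by metis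
  have "q \<notin> J1_nhd x (t + \<delta>) (min \<delta> \<epsilon>)"
  proof
    assume "q \<in> J1_nhd x (t + \<delta>) (min \<delta> \<epsilon>)"
    then obtain \<mu> where \<mu>: "\<mu> \<in> time_changes"
      and c: "\<And>s. s \<in> {0..t + \<delta>} \<Longrightarrow> \<bar>\<mu> s - s\<bar> < min \<delta> \<epsilon> \<and> d (q s) (x (\<mu> s)) < min \<delta> \<epsilon>"
      unfolding J1_nhd_def by auto
    have "t \<in> \<mu> ` {0..}" using \<mu> t(1) by (simp add: time_changes_def)
    then obtain s where s: "0 \<le> s" "\<mu> s = t" by auto
    have st: "s \<le> t + \<delta>"
    proof (rule ccontr)
      assume "\<not> s \<le> t + \<delta>"
      then have "\<mu> (t + \<delta>) < \<mu> s"
        using \<mu> t(1) \<delta>(1) by (auto simp: time_changes_def strict_mono_on_def)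
      moreover have "\<bar>\<mu> (t + \<delta>) - (t + \<delta>)\<bar> < \<delta>" using c[of "t + \<delta>"] t(1) \<delta>(1) by auto
      ultimately show False using s(2) by linarith
    qed
    have "\<bar>s - t\<bar> < \<delta>" "d (q s) (x t) < \<epsilon>" using c[of s] s st by auto
    moreover have "d (x t) (q t) \<le> d (x t) (q s) + d (q s) (q t)"
      using M cadlag_pathsD[OF q s(1)] by (intro triangle) auto
    ultimately show False using \<delta>(2)[OF s(1)] by (simp add: \<epsilon>_def commute)
  qed
  then have "J1_nhd x (t + \<delta>) (min \<delta> \<epsilon>) \<subseteq> cadlag_paths - {q}" by (auto simp: J1_nhd_def)
  moreover have "0 < t + \<delta>" "0 < min \<delta> \<epsilon>" using t(1) \<delta>(1) \<epsilon> by auto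
  ultimately show "\<exists>T>0. \<exists>\<epsilon>>0. J1_nhd x T \<epsilon> \<subseteq> cadlag_paths - {q}" by blast
qed (use q in auto)

lemma id_time_change: "(\<lambda>t. t) \<in> time_changes"
  by (simp add: time_changes_def strict_mono_on_def)

lemma uniformly_close_in_J1_nhd:
  assumes "y \<in> cadlag_paths" "0 < \<epsilon>" "\<And>t. t \<in> {0..T} \<Longrightarrow> d (y t) (x t) < \<epsilon>"
  shows "y \<in> J1_nhd x T \<epsilon>"
  unfolding J1_nhd_def using assms by (auto intro!: bexI[OF _ id_time_change])

lemma J1_nhd_trans:
  assumes z: "z \<in> J1_nhd y T \<epsilon>" and y: "y \<in> J1_nhd x T' \<epsilon>'" and T: "T + \<epsilon> \<le> T'" and x: "x \<in> cadlag_paths"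
  shows "z \<in> J1_nhd x T (\<epsilon> + \<epsilon>')"
proof -
  obtain \<mu> where \<mu>: "\<mu> \<in> time_changes" "\<And>t. t \<in> {0..T} \<Longrightarrow> \<bar>\<mu> t - t\<bar> < \<epsilon> \<and> d (z t) (y (\<mu> t)) < \<epsilon>"
    using z unfolding J1_nhd_def by auto
  obtain \<nu> where \<nu>: "\<nu> \<in> time_changes" "\<And>t. t \<in> {0..T'} \<Longrightarrow> \<bar>\<nu> t - t\<bar> < \<epsilon>' \<and> d (y t) (x (\<nu> t)) < \<epsilon>'"
    using y unfolding J1_nhd_def by auto
  have zy: "z \<in> cadlag_paths" "y \<in> cadlag_paths" using z y unfolding J1_nhd_def by auto
  have nn: "0 \<le> \<mu> t" "0 \<le> \<nu> t" if "0 \<le> t" for t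
    using \<mu>(1) \<nu>(1) that unfolding time_changes_def by force+
  have "(\<lambda>t. \<nu> (\<mu> t)) \<in> time_changes"
  proof -
    have "strict_mono_on {0..} (\<lambda>t. \<nu> (\<mu> t))"
      using \<mu>(1) \<nu>(1) nn by (auto simp: time_changes_def strict_mono_on_def)
    moreover have "(\<lambda>t. \<nu> (\<mu> t)) ` {0..} = \<nu> ` \<mu> ` {0..}" by auto
    ultimately show ?thesis using \<mu>(1) \<nu>(1) by (simp add: time_changes_def)
  qed
  moreover have "\<bar>\<nu> (\<mu> t) - t\<bar> < \<epsilon> + \<epsilon>' \<and> d (z t) (x (\<nu> (\<mu> t))) < \<epsilon> + \<epsilon>'" if t: "t \<in> {0..T}" for t
  proof -
    have \<mu>t: "\<mu> t \<in> {0..T'}" using \<mu>(2)[OF t] nn(1)[of t] t T by auto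
    have "d (z t) (x (\<nu> (\<mu> t))) \<le> d (z t) (y (\<mu> t)) + d (y (\<mu> t)) (x (\<nu> (\<mu> t)))"
      using t nn by (intro triangle cadlag_pathsD[OF zy(1)] cadlag_pathsD[OF zy(2)] cadlag_pathsD[OF x]) auto
    then show ?thesis using \<mu>(2)[OF t] \<nu>(2)[OF \<mu>t] by linarith
  qed
  ultimately show ?thesis unfolding J1_nhd_def
    by (intro CollectI conjI zy(1) bexI[where x = "\<lambda>t. \<nu> (\<mu> t)"]) blast+
qed

end

section \<open>Measurability of random step paths\<close>

text \<open>Sampling a path at the times \<open>0, 1/n, 2/n, \<dots>, n\<close> gives a path that is determined by finitely many values.\<close>

definition grid_time :: "nat \<Rightarrow> real \<Rightarrow> real" where
  "grid_time n t = min (real_of_int \<lfloor>real n * t\<rfloor> / real n) (real n)"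

definition sampled_path :: "nat \<Rightarrow> (real \<Rightarrow> 'a) \<Rightarrow> real \<Rightarrow> 'a" where
  "sampled_path n x = (\<lambda>t\<in>{0..}. x (grid_time n t))"

text \<open>The order of the comparisons with the jump times \<open>J\<close> makes the path right-continuous.\<close>

definition constant_off :: "(real \<Rightarrow> 'b) \<Rightarrow> real \<Rightarrow> real set \<Rightarrow> bool" where
  "constant_off x T J \<longleftrightarrow> finite J \<and> J \<subseteq> {0<..T} \<and>
    (\<forall>s\<in>{0..T}. \<forall>t\<in>{0..T}. (\<forall>r\<in>J. r \<le> s \<longleftrightarrow> r \<le> t) \<longrightarrow> x s = x t)"

definition step_paths :: "(real \<Rightarrow> 'b) set" where
  "step_paths = {x. \<forall>T. \<exists>J. constant_off x T J}"

lemma step_path_right: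
  assumes "x \<in> step_paths" "0 \<le> t"
  shows "\<exists>\<delta>>0. \<forall>s. t < s \<longrightarrow> s < t + \<delta> \<longrightarrow> x s = x t"
proof -
  obtain J where J: "constant_off x (t + 1) J" using assms(1) by (auto simp: step_paths_def)
  define \<delta> where "\<delta> = Min (insert 1 ((\<lambda>r. r - t) ` {r\<in>J. t < r}))"
  have fin: "finite (insert 1 ((\<lambda>r. r - t) ` {r\<in>J. t < r}))" using J by (simp add: constant_off_def)
  have "0 < \<delta>" unfolding \<delta>_def using fin by (subst Min_gr_iff) auto
  moreover have "x s = x t" if s: "t < s" "s < t + \<delta>" for s
  proof -
    have \<delta>1: "\<delta> \<le> 1" unfolding \<delta>_def using fin by (intro Min_le) auto
    have "r \<le> s \<longleftrightarrow> r \<le> t" if "r \<in> J" for r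
    proof (cases "t < r")
      case True
      then have "\<delta> \<le> r - t" unfolding \<delta>_def using that fin by (intro Min_le) auto
      then show ?thesis using s True by linarith
    qed (use s in auto)
    then show ?thesis using J s assms(2) \<delta>1 by (auto simp: constant_off_def)
  qed
  ultimately show ?thesis by blast
qed

lemma step_path_left:
  assumes "x \<in> step_paths" "0 < t"
  shows "\<exists>\<delta>>0. \<exists>u\<ge>0. \<forall>s. t - \<delta> < s \<longrightarrow> s < t \<longrightarrow> x s = x u"
proof -
  obtain J where J: "constant_off x t J" using assms(1) by (auto simp: step_paths_def)
  define \<delta> where "\<delta> = Min (insert t ((\<lambda>r. t - r) ` {r\<in>J. r < t}))"
  have fin: "finite (insert t ((\<lambda>r. t - r) ` {r\<in>J. r < t}))" using J by (simp add: constant_off_def)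
  have \<delta>: "0 < \<delta>" unfolding \<delta>_def using fin assms(2) by (subst Min_gr_iff) auto
  have \<delta>1: "\<delta> \<le> t" unfolding \<delta>_def using fin by (intro Min_le) auto
  have "x s = x (t - \<delta> / 2)" if s: "t - \<delta> < s" "s < t" for s
  proof -
    have "r \<le> s \<longleftrightarrow> r \<le> t - \<delta> / 2" if "r \<in> J" for r
    proof (cases "r < t")
      case True
      then have "\<delta> \<le> t - r" unfolding \<delta>_def using that fin by (intro Min_le) auto
      then show ?thesis using s \<delta> by linarith
    qed (use s \<delta> in auto)
    then show ?thesis using J s assms(2) \<delta>1 \<delta> by (auto simp: constant_off_def)
  qed
  moreover have "0 \<le> t - \<delta> / 2" using \<delta>1 \<delta> by linarith
  ultimately show ?thesis using \<delta> by blast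
qed

lemma (in Metric_space) step_path_cadlag:
  assumes "x \<in> step_paths" "x \<in> extensional {0..}" "\<And>t. 0 \<le> t \<Longrightarrow> x t \<in> M"
  shows "x \<in> cadlag_paths"
proof (rule cadlag_pathsI[OF assms(2,3)])
  fix t \<epsilon> :: real assume "0 \<le> t" "0 < \<epsilon>"
  then show "\<exists>\<delta>>0. \<forall>s. t < s \<longrightarrow> s < t + \<delta> \<longrightarrow> d (x s) (x t) < \<epsilon>"
    using step_path_right[OF assms(1), of t] assms(3)[of t] by (metis mdist_zero)
next
  fix t :: real assume "0 < t"
  then obtain \<delta> u where "0 < \<delta>" "0 \<le> u" "\<And>s. t - \<delta> < s \<Longrightarrow> s < t \<Longrightarrow> x s = x u"
    using step_path_left[OF assms(1)] by metis
  then show "\<exists>l\<in>M. \<forall>\<epsilon>>0. \<exists>\<delta>>0. \<forall>s. t - \<delta> < s \<longrightarrow> s < t \<longrightarrow> d (x s) l < \<epsilon>"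
    using assms(3)[of u] by (intro bexI[of _ "x u"]) auto
qed

text \<open>The identity plus a tent at each point \<open>r\<close> of \<open>J\<close>, which moves \<open>r\<close> to its next grid point. The tents are so narrow that they
  vanish at \<open>0\<close> and at the other points of \<open>J\<close>, and for large \<open>n\<close> they are so low that the sum of their slopes is small.\<close>

lemma grid_time_change:
  fixes J :: "real set"
  assumes fin: "finite J" and pos: "J \<subseteq> {0<..}" and \<epsilon>: "0 < \<epsilon>"
  shows "\<exists>k. \<forall>n\<ge>k. \<exists>\<nu>\<in>time_changes. (\<forall>t\<ge>0. \<bar>\<nu> t - t\<bar> < \<epsilon>) \<and> (\<forall>r\<in>J. \<nu> r = real_of_int \<lceil>real n * r\<rceil> / real n)"
proof -
  define D where "D = insert 1 (J \<union> (\<lambda>(r, r'). \<bar>r - r'\<bar>) ` {(r, r'). r \<in> J \<and> r' \<in> J \<and> r \<noteq> r'})"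
  have "{(r, r'). r \<in> J \<and> r' \<in> J \<and> r \<noteq> r'} \<subseteq> J \<times> J" by auto
  then have "finite {(r, r'). r \<in> J \<and> r' \<in> J \<and> r \<noteq> r'}" by (rule finite_subset) (use fin in simp)
  then have finD: "finite D" unfolding D_def using fin by simp
  define g where "g = Min D"
  have g: "0 < g" unfolding g_def using finD pos by (subst Min_gr_iff) (auto simp: D_def)
  have gr: "g \<le> r" if "r \<in> J" for r unfolding g_def using finD that by (intro Min_le) (auto simp: D_def)
  have grr: "g \<le> \<bar>r - r'\<bar>" if "r \<in> J" "r' \<in> J" "r \<noteq> r'" for r r'
    unfolding g_def using finD that by (intro Min_le) (auto simp: D_def)
  define tent where "tent r t = max 0 (1 - \<bar>t - r\<bar> / g)" for r t
  have tent01: "0 \<le> tent r t" "tent r t \<le> 1" for r t using g by (auto simp: tent_def)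
  have tent_lip: "\<bar>tent r s - tent r t\<bar> \<le> \<bar>s - t\<bar> / g" for r s t
  proof -
    have "\<bar>\<bar>s - r\<bar> / g - \<bar>t - r\<bar> / g\<bar> \<le> \<bar>s - t\<bar> / g"
      using g by (simp add: diff_divide_distrib[symmetric] abs_divide divide_right_mono)
    then show ?thesis unfolding tent_def by linarith
  qed
  have tent_self: "tent r r = 1" for r by (simp add: tent_def)
  have tent_other: "tent r t = 0" if "g \<le> \<bar>t - r\<bar>" for r t using that g by (simp add: tent_def)
  have tent0: "tent r 0 = 0" if "r \<in> J" for r
    using gr[OF that] pos that g by (intro tent_other) auto
  obtain k where k: "2 * real (card J) / g + real (card J) / \<epsilon> + 1 < real k" using reals_Archimedean2 by blast
  show ?thesis
  proof (intro exI allI impI)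
    fix n assume n: "k \<le> n"
    have n0: "2 * real (card J) / g + real (card J) / \<epsilon> + 1 < real n" using k n by linarith
    have c0: "0 \<le> 2 * real (card J) / g" "0 \<le> real (card J) / \<epsilon>" using g \<epsilon> by auto
    have np: "0 < real n" using n0 c0 by linarith
    have n1: "real (card J) / real n < \<epsilon>"
    proof -
      have "real (card J) / \<epsilon> < real n" using n0 c0 by linarith
      then show ?thesis using \<epsilon> np by (simp add: field_simps)
    qed
    have n2: "real (card J) / real n / g \<le> 1 / 2"
    proof -
      have "2 * real (card J) / g < real n" using n0 c0 by linarith
      then show ?thesis using g np by (simp add: field_simps)
    qed
    define c where "c r = real_of_int \<lceil>real n * r\<rceil> / real n - r" for r
    have c: "\<bar>c r\<bar> \<le> 1 / real n" for r
    proof -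
      have "c r = (real_of_int \<lceil>real n * r\<rceil> - real n * r) / real n" using np by (simp add: c_def field_simps)
      moreover have "\<bar>real_of_int \<lceil>real n * r\<rceil> - real n * r\<bar> \<le> 1" by linarith
      ultimately show ?thesis using np by (simp add: abs_divide divide_right_mono)
    qed
    define \<nu> where "\<nu> t = t + (\<Sum>r\<in>J. c r * tent r t)" for t
    have close: "\<bar>\<nu> t - t\<bar> < \<epsilon>" for t
    proof -
      have "\<bar>\<nu> t - t\<bar> \<le> (\<Sum>r\<in>J. \<bar>c r * tent r t\<bar>)" by (simp add: \<nu>_def sum_abs)
      also have "\<dots> \<le> (\<Sum>r\<in>J. 1 / real n * 1)"
        unfolding abs_mult using c tent01 np by (intro sum_mono mult_mono) (auto simp: abs_of_nonneg)
      finally show ?thesis using n1 by simp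
    qed
    have lip: "\<bar>(\<nu> t - t) - (\<nu> s - s)\<bar> \<le> \<bar>t - s\<bar> / 2" for s t
    proof -
      have "\<bar>(\<nu> t - t) - (\<nu> s - s)\<bar> = \<bar>\<Sum>r\<in>J. c r * (tent r t - tent r s)\<bar>"
        by (simp add: \<nu>_def sum_subtractf[symmetric] right_diff_distrib)
      also have "\<dots> \<le> (\<Sum>r\<in>J. \<bar>c r * (tent r t - tent r s)\<bar>)" by (rule sum_abs)
      also have "\<dots> \<le> (\<Sum>r\<in>J. 1 / real n * (\<bar>t - s\<bar> / g))"
        unfolding abs_mult using c tent_lip np by (intro sum_mono mult_mono) auto
      also have "\<dots> = real (card J) / real n / g * \<bar>t - s\<bar>" by simp
      also have "\<dots> \<le> 1 / 2 * \<bar>t - s\<bar>" by (intro mult_right_mono n2) simp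
      finally show ?thesis by simp
    qed
    have incr: "(t - s) / 2 \<le> \<nu> t - \<nu> s" if "s \<le> t" for s t
    proof -
      define X where "X = (\<nu> t - t) - (\<nu> s - s)"
      have "\<bar>X\<bar> \<le> (t - s) / 2" using lip[of t s] that by (simp add: X_def)
      then have "- X \<le> (t - s) / 2" by (simp only: abs_le_iff)
      then show ?thesis by (simp add: X_def field_simps)
    qed
    have \<nu>0: "\<nu> 0 = 0" using tent0 by (simp add: \<nu>_def)
    have "\<nu> \<in> time_changes"
      unfolding time_changes_def
    proof (intro CollectI conjI)
      show "strict_mono_on {0..} \<nu>"
      proof (rule strict_mono_onI)
        fix s t :: real assume "s < t"
        then show "\<nu> s < \<nu> t" using incr[of s t] by auto
      qed
      show "\<nu> ` {0..} = {0..}"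
      proof
        show "\<nu> ` {0..} \<subseteq> {0..}" using incr[of 0] \<nu>0 by force
        show "{0..} \<subseteq> \<nu> ` {0..}"
        proof
          fix v :: real assume "v \<in> {0..}"
          then have v: "0 \<le> v" by simp
          have "\<exists>t\<ge>0. t \<le> 2 * v \<and> \<nu> t = v"
          proof (rule IVT')
            show "\<nu> 0 \<le> v" "0 \<le> 2 * v" using v \<nu>0 by auto
            show "v \<le> \<nu> (2 * v)" using incr[of 0 "2 * v"] v \<nu>0 by simp
            show "continuous_on {0..2 * v} \<nu>"
              unfolding \<nu>_def tent_def using g by (intro continuous_intros) auto
          qed
          then show "v \<in> \<nu> ` {0..}" by auto
        qed
      qed
    qed
    moreover have "\<nu> r = real_of_int \<lceil>real n * r\<rceil> / real n" if r: "r \<in> J" for r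
    proof -
      have "(\<Sum>r'\<in>J. c r' * tent r' r) = (\<Sum>r'\<in>J. if r' = r then c r else 0)"
        using grr r by (intro sum.cong) (auto simp: tent_self intro!: tent_other)
      also have "\<dots> = c r" using fin r by simp
      finally show ?thesis by (simp add: \<nu>_def c_def)
    qed
    ultimately show "\<exists>\<nu>\<in>time_changes. (\<forall>t\<ge>0. \<bar>\<nu> t - t\<bar> < \<epsilon>) \<and> (\<forall>r\<in>J. \<nu> r = real_of_int \<lceil>real n * r\<rceil> / real n)"
      using close by blast
  qed
qed

lemma inverse_time_change:
  assumes "\<nu> \<in> time_changes" shows "inv_into {0..} \<nu> \<in> time_changes"
proof -
  have im: "\<nu> ` {0..} = {0..}" and mono: "\<And>s t. 0 \<le> s \<Longrightarrow> s < t \<Longrightarrow> \<nu> s < \<nu> t"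
    using assms by (auto simp: time_changes_def strict_mono_on_def)
  have inj: "inj_on \<nu> {0..}"
    using assms strict_mono_on_imp_inj_on by (auto simp: time_changes_def)
  have nn: "0 \<le> inv_into {0..} \<nu> v" if "0 \<le> v" for v using inv_into_into[of v \<nu> "{0..}"] im that by auto
  have f: "\<nu> (inv_into {0..} \<nu> v) = v" if "0 \<le> v" for v using f_inv_into_f[of v \<nu> "{0..}"] im that by auto
  have "strict_mono_on {0..} (inv_into {0..} \<nu>)"
  proof (rule strict_mono_onI)
    fix u v :: real assume "u \<in> {0..}" "v \<in> {0..}" and uv: "u < v"
    then have u: "0 \<le> u" "0 \<le> v" by auto
    show "inv_into {0..} \<nu> u < inv_into {0..} \<nu> v"
    proof (rule ccontr)
      assume "\<not> ?thesis"
      then consider "inv_into {0..} \<nu> v < inv_into {0..} \<nu> u" | "inv_into {0..} \<nu> v = inv_into {0..} \<nu> u" by linarith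
      then show False
      proof cases
        case 1
        from mono[OF nn[OF u(2)] this] show False using f[OF u(1)] f[OF u(2)] uv by simp
      next
        case 2
        then show False using f[OF u(1)] f[OF u(2)] uv by simp
      qed
    qed
  qed
  moreover have "inv_into {0..} \<nu> ` {0..} = {0..}"
  proof
    show "{0..} \<subseteq> inv_into {0..} \<nu> ` {0..}"
    proof
      fix t :: real assume "t \<in> {0..}"
      then show "t \<in> inv_into {0..} \<nu> ` {0..}" using inv_into_f_f[OF inj, of t] im by (intro image_eqI[of _ _ "\<nu> t"]) auto
    qed
  qed (use nn in auto)
  ultimately show ?thesis by (simp add: time_changes_def)
qed

context Metric_space
begin

text \<open>A time change that moves each jump to the next grid point turns a step path into its sampled version.\<close>

lemma sampled_path_close:
  assumes x: "x \<in> step_paths" "x \<in> cadlag_paths" and sampled: "\<And>n. sampled_path n x \<in> cadlag_paths"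
    and T: "0 < T" and \<epsilon>: "0 < \<epsilon>"
  shows "\<exists>k. \<forall>n\<ge>k. x \<in> J1_nhd (sampled_path n x) T \<epsilon> \<and> sampled_path n x \<in> J1_nhd x T \<epsilon>"
proof -
  obtain J where J: "constant_off x (T + 1) J" using x(1) by (auto simp: step_paths_def)
  have "finite J" "J \<subseteq> {0<..}" "0 < min \<epsilon> 1" using J \<epsilon> by (auto simp: constant_off_def)
  from grid_time_change[OF this] obtain k where k: "\<And>n. k \<le> n \<Longrightarrow> \<exists>\<nu>\<in>time_changes. (\<forall>t\<ge>0. \<bar>\<nu> t - t\<bar> < min \<epsilon> 1) \<and>
      (\<forall>r\<in>J. \<nu> r = real_of_int \<lceil>real n * r\<rceil> / real n)" by blast
  obtain k' where k': "T + 1 \<le> real k'" using real_arch_simple by blast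
  have "x \<in> J1_nhd (sampled_path n x) T \<epsilon> \<and> sampled_path n x \<in> J1_nhd x T \<epsilon>" if n: "max k k' \<le> n" for n
  proof -
    obtain \<nu> where \<nu>: "\<nu> \<in> time_changes" "\<And>t. 0 \<le> t \<Longrightarrow> \<bar>\<nu> t - t\<bar> < min \<epsilon> 1"
      "\<And>r. r \<in> J \<Longrightarrow> \<nu> r = real_of_int \<lceil>real n * r\<rceil> / real n" using k[of n] n by auto
    have im: "\<nu> ` {0..} = {0..}" and mono: "\<And>s t. 0 \<le> s \<Longrightarrow> s < t \<Longrightarrow> \<nu> s < \<nu> t"
      using \<nu>(1) by (auto simp: time_changes_def strict_mono_on_def)
    have nT: "T + 1 \<le> real n" using k' n by (meson max.boundedE of_nat_mono order_trans)
    then have np: "0 < real n" using T by linarith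
    have eq: "sampled_path n x (\<nu> t) = x t" if t: "0 \<le> t" "t \<le> T + 1" "\<nu> t \<le> T + 1" for t
    proof -
      have \<nu>t: "0 \<le> \<nu> t" using im t(1) by auto
      have fl: "real_of_int \<lfloor>real n * \<nu> t\<rfloor> \<le> real n * \<nu> t" "0 \<le> \<lfloor>real n * \<nu> t\<rfloor>" using np \<nu>t by auto
      have "real_of_int \<lfloor>real n * \<nu> t\<rfloor> / real n \<le> \<nu> t" using fl np by (simp add: field_simps)
      then have g: "grid_time n (\<nu> t) = real_of_int \<lfloor>real n * \<nu> t\<rfloor> / real n" "grid_time n (\<nu> t) \<le> T + 1"
        using nT t(3) by (auto simp: grid_time_def)
      have same: "r \<le> grid_time n (\<nu> t) \<longleftrightarrow> r \<le> t" if r: "r \<in> J" for r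
      proof -
        have r0: "0 \<le> r" using J r by (auto simp: constant_off_def)
        have "r \<le> grid_time n (\<nu> t) \<longleftrightarrow> real n * r \<le> real_of_int \<lfloor>real n * \<nu> t\<rfloor>" using np by (simp add: g field_simps)
        also have "\<dots> \<longleftrightarrow> \<lceil>real n * r\<rceil> \<le> \<lfloor>real n * \<nu> t\<rfloor>" by (simp add: ceiling_le_iff)
        also have "\<dots> \<longleftrightarrow> real_of_int \<lceil>real n * r\<rceil> \<le> real n * \<nu> t" by (simp add: le_floor_iff)
        also have "\<dots> \<longleftrightarrow> \<nu> r \<le> \<nu> t" using np by (simp add: \<nu>(3)[OF r] field_simps)
        also have "\<dots> \<longleftrightarrow> r \<le> t" using mono[OF r0, of t] mono[OF t(1), of r] by (metis linorder_not_le order_le_less)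
        finally show ?thesis .
      qed
      have "grid_time n (\<nu> t) \<in> {0..T + 1}" "t \<in> {0..T + 1}" using fl np g t by auto
      then have "x (grid_time n (\<nu> t)) = x t" using J same unfolding constant_off_def by blast
      then show ?thesis using \<nu>t by (simp add: sampled_path_def)
    qed
    have "x \<in> J1_nhd (sampled_path n x) T \<epsilon>"
      unfolding J1_nhd_def
    proof (intro CollectI conjI bexI[OF _ \<nu>(1)] ballI x(2))
      fix t assume t: "t \<in> {0..T}"
      then have \<nu>t: "\<bar>\<nu> t - t\<bar> < min \<epsilon> 1" using \<nu>(2) by auto
      then show "\<bar>\<nu> t - t\<bar> < \<epsilon>" by simp
      have "sampled_path n x (\<nu> t) = x t" by (rule eq) (use t \<nu>t in auto)
      then show "d (x t) (sampled_path n x (\<nu> t)) < \<epsilon>" using cadlag_pathsD[OF x(2), of t] t \<epsilon> by simp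
    qed
    moreover have "sampled_path n x \<in> J1_nhd x T \<epsilon>"
      unfolding J1_nhd_def
    proof (intro CollectI conjI bexI[OF _ inverse_time_change[OF \<nu>(1)]] ballI sampled)
      fix t assume t: "t \<in> {0..T}"
      define s where "s = inv_into {0..} \<nu> t"
      have s: "0 \<le> s" "\<nu> s = t" unfolding s_def using inv_into_into[of t \<nu> "{0..}"] f_inv_into_f[of t \<nu> "{0..}"] im t by auto
      have st: "\<bar>t - s\<bar> < min \<epsilon> 1" using \<nu>(2)[OF s(1)] s(2) by simp
      then show "\<bar>inv_into {0..} \<nu> t - t\<bar> < \<epsilon>" unfolding s_def[symmetric] by auto
      have "sampled_path n x (\<nu> s) = x s" by (rule eq) (use s st t in auto)
      then show "d (sampled_path n x t) (x (inv_into {0..} \<nu> t)) < \<epsilon>"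
        unfolding s_def[symmetric] using s cadlag_pathsD[OF x(2) s(1)] \<epsilon> by simp
    qed
    ultimately show ?thesis by blast
  qed
  then show ?thesis by blast
qed

text \<open>An open set is the union over \<open>m\<close> of the sets of centres of basic neighbourhoods of size \<open>1/m\<close>
  inside it, and the sampled paths, which have countably many values, detect membership in these.\<close>

lemma step_process_measurable:
  fixes Z :: "real \<Rightarrow> 'w \<Rightarrow> 'c :: countable" and Y :: "'w \<Rightarrow> real \<Rightarrow> 'a"
  assumes step: "\<And>w. w \<in> space \<Omega> \<Longrightarrow> Y w \<in> step_paths" and ext: "\<And>w. w \<in> space \<Omega> \<Longrightarrow> Y w \<in> extensional {0..}"
    and val: "\<And>w t. w \<in> space \<Omega> \<Longrightarrow> 0 \<le> t \<Longrightarrow> Y w t \<in> M"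
    and Z: "\<And>t. 0 \<le> t \<Longrightarrow> Z t \<in> \<Omega> \<rightarrow>\<^sub>M count_space UNIV"
    and YZ: "\<And>w t. w \<in> space \<Omega> \<Longrightarrow> 0 \<le> t \<Longrightarrow> Y w t = \<Phi> (Z t w)"
  shows "Y \<in> \<Omega> \<rightarrow>\<^sub>M borel_of skorohod_J1"
proof -
  have cad: "Y w \<in> cadlag_paths" if "w \<in> space \<Omega>" for w
    using step_path_cadlag[OF step ext val] that by auto
  have gt: "0 \<le> grid_time n t" if "0 \<le> t" for n t
    using that by (simp add: grid_time_def)
  have sampled_step: "sampled_path n (Y w) \<in> step_paths" if "w \<in> space \<Omega>" for n w
    unfolding step_paths_def
  proof (intro CollectI allI)
    fix T
    define J where "J = {r\<in>{0<..T}. \<exists>i::int. r = real_of_int i / real n}"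
    have "J \<subseteq> (\<lambda>i. real_of_int i / real n) ` {0..\<lceil>T * real n\<rceil>}"
    proof
      fix r assume "r \<in> J"
      then obtain i where i: "r = real_of_int i / real n" "0 < r" "r \<le> T" by (auto simp: J_def)
      then have n0: "0 < real n" by (cases "n = 0") auto
      then have e: "r * real n = real_of_int i" using i by simp
      have "0 < r * real n" "r * real n \<le> T * real n" using mult_pos_pos[OF i(2) n0] mult_right_mono[OF i(3), of "real n"] by auto
      then have "0 < real_of_int i" "real_of_int i \<le> T * real n" unfolding e by auto
      then have "i \<in> {0..\<lceil>T * real n\<rceil>}" by (auto simp: le_ceiling_iff)
      then show "r \<in> (\<lambda>i. real_of_int i / real n) ` {0..\<lceil>T * real n\<rceil>}" using i by auto
    qed
    then have finJ: "finite J" by (rule finite_subset) simp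
    have grid: "grid_time n s = grid_time n t"
      if st: "s \<in> {0..T}" "t \<in> {0..T}" and same: "\<forall>r\<in>J. r \<le> s \<longleftrightarrow> r \<le> t" for s t
    proof (cases "n = 0")
      case False
      then have np: "0 < real n" by simp
      have le: "\<lfloor>real n * u\<rfloor> \<le> \<lfloor>real n * v\<rfloor>" if uv: "u \<in> {0..T}" "v \<in> {0..T}" "\<forall>r\<in>J. r \<le> u \<longrightarrow> r \<le> v" for u v
      proof (cases "\<lfloor>real n * u\<rfloor> = 0")
        case True
        then show ?thesis using uv np by simp
      next
        case False
        define r where "r = real_of_int \<lfloor>real n * u\<rfloor> / real n"
        have "0 \<le> \<lfloor>real n * u\<rfloor>" using uv np by simp
        then have "0 < real_of_int \<lfloor>real n * u\<rfloor>" using False by linarith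
        then have "0 < r" "r \<le> u" using np by (auto simp: r_def field_simps)
        then have "r \<in> J" using uv by (auto simp: J_def r_def)
        then have "r \<le> v" using uv \<open>r \<le> u\<close> by blast
        then show ?thesis using np by (simp add: r_def field_simps le_floor_iff)
      qed
      have "\<lfloor>real n * s\<rfloor> = \<lfloor>real n * t\<rfloor>" using le[of s t] le[of t s] st same by force
      then show ?thesis by (simp add: grid_time_def)
    qed (simp add: grid_time_def)
    have "sampled_path n (Y w) s = sampled_path n (Y w) t"
      if "s \<in> {0..T}" "t \<in> {0..T}" "\<forall>r\<in>J. r \<le> s \<longleftrightarrow> r \<le> t" for s t
      using grid[OF that] that(1,2) by (simp add: sampled_path_def)
    moreover have "J \<subseteq> {0<..T}" by (auto simp: J_def)
    ultimately have "constant_off (sampled_path n (Y w)) T J"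
      unfolding constant_off_def using finJ by blast
    then show "\<exists>J. constant_off (sampled_path n (Y w)) T J" by blast
  qed
  have sampled_cad: "sampled_path n (Y w) \<in> cadlag_paths" if "w \<in> space \<Omega>" for n w
    by (rule step_path_cadlag[OF sampled_step[OF that]]) (use val[OF that] gt in \<open>auto simp: sampled_path_def\<close>)
  have sampled_meas: "{w \<in> space \<Omega>. sampled_path n (Y w) \<in> A} \<in> sets \<Omega>" for n A
  proof -
    define G where "G w = map (\<lambda>i. Z (min (real i / real n) (real n)) w) [0..<Suc (n * n)]" for w
    define H where "H zs = (\<lambda>t\<in>{0..}. \<Phi> (zs ! min (nat \<lfloor>real n * t\<rfloor>) (n * n)))" for zs
    have "sampled_path n (Y w) = H (G w)" if w: "w \<in> space \<Omega>" for w
    proof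
      fix t
      show "sampled_path n (Y w) t = H (G w) t"
      proof (cases "0 \<le> t")
        case True
        define i where "i = min (nat \<lfloor>real n * t\<rfloor>) (n * n)"
        have "min (real i / real n) (real n) = grid_time n t"
        proof (cases "n = 0")
          case False
          have "real (nat \<lfloor>real n * t\<rfloor>) = real_of_int \<lfloor>real n * t\<rfloor>" using True by simp
          then have "real i = min (real_of_int \<lfloor>real n * t\<rfloor>) (real n * real n)" by (simp add: i_def of_nat_min)
          then show ?thesis unfolding grid_time_def using False by (auto simp: min_def field_simps)
        qed (simp add: grid_time_def)
        moreover have "i < Suc (n * n)" by (simp add: i_def)
        ultimately have "G w ! i = Z (grid_time n t) w" by (simp add: G_def del: upt_Suc)
        then show ?thesis using YZ[OF w gt[OF True], of n] True by (simp add: H_def sampled_path_def i_def)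
      qed (simp add: H_def sampled_path_def)
    qed
    then have eq: "{w \<in> space \<Omega>. sampled_path n (Y w) \<in> A} = G -` {zs. H zs \<in> A} \<inter> space \<Omega>" by auto
    have "G \<in> \<Omega> \<rightarrow>\<^sub>M count_space UNIV"
      unfolding measurable_count_space_eq2_countable
    proof (intro conjI ballI)
      fix zs
      have "G -` {zs} \<inter> space \<Omega> = {w \<in> space \<Omega>. length zs = Suc (n * n) \<and> (\<forall>i\<in>{..n * n}. Z (min (real i / real n) (real n)) w = zs ! i)}"
        unfolding G_def by (auto simp: list_eq_iff_nth_eq simp del: upt_Suc)
      also have "\<dots> \<in> sets \<Omega>"
      proof (intro sets.sets_Collect_conj sets.sets_Collect_finite_All sets.sets_Collect_const)
        fix i
        have "Z (min (real i / real n) (real n)) \<in> \<Omega> \<rightarrow>\<^sub>M count_space UNIV" by (rule Z) simp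
        from measurable_sets[OF this, of "{zs ! i}"]
        show "{w \<in> space \<Omega>. Z (min (real i / real n) (real n)) w = zs ! i} \<in> sets \<Omega>"
          by (simp add: vimage_def Int_def conj_commute)
      qed auto
      finally show "G -` {zs} \<inter> space \<Omega> \<in> sets \<Omega>" .
    qed auto
    then show ?thesis unfolding eq by (rule measurable_sets) simp
  qed
  show ?thesis
    unfolding borel_of_def topspace_skorohod_J1
  proof (rule measurable_measure_of)
    show "{U. openin skorohod_J1 U} \<subseteq> Pow cadlag_paths"
      using openin_subset topspace_skorohod_J1 by blast
    show "Y \<in> space \<Omega> \<rightarrow> cadlag_paths" using cad by auto
    fix U assume "U \<in> {U. openin skorohod_J1 U}"
    then have U: "U \<subseteq> cadlag_paths" "\<And>x. x \<in> U \<Longrightarrow> \<exists>T>0. \<exists>\<epsilon>>0. J1_nhd x T \<epsilon> \<subseteq> U"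
      unfolding openin_skorohod_J1 mem_Collect_eq by blast+
    define V where "V m = {x. J1_nhd x (real (Suc m)) (1 / real (Suc m)) \<subseteq> U}" for m
    have "Y w \<in> U \<longleftrightarrow> (\<exists>m k. \<forall>n\<in>{k..}. sampled_path n (Y w) \<in> V m)" if w: "w \<in> space \<Omega>" for w
    proof
      assume "Y w \<in> U"
      then obtain T \<epsilon> where T: "0 < T" "0 < \<epsilon>" "J1_nhd (Y w) T \<epsilon> \<subseteq> U" using U(2) by blast
      obtain m where m: "T + 2 / \<epsilon> < real m" using reals_Archimedean2 by blast
      have p: "0 < real (Suc m)" by simp
      have "2 / \<epsilon> < real (Suc m)" using m T(1) by simp
      then have m2: "1 / real (Suc m) + 1 / real (Suc m) \<le> \<epsilon>" using T(2) p by (simp add: field_simps)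
      have "0 < 2 / \<epsilon>" using T(2) by simp
      then have m1: "T \<le> real (Suc m)" using m unfolding of_nat_Suc by linarith
      obtain k where k: "\<And>n. k \<le> n \<Longrightarrow> sampled_path n (Y w) \<in> J1_nhd (Y w) (real (Suc m) + 1) (1 / real (Suc m))"
        using sampled_path_close[OF step[OF w] cad[OF w] sampled_cad[OF w], of "real (Suc m) + 1" "1 / real (Suc m)"] by auto
      have "sampled_path n (Y w) \<in> V m" if n: "k \<le> n" for n
        unfolding V_def
      proof (intro CollectI subsetI)
        fix z assume z: "z \<in> J1_nhd (sampled_path n (Y w)) (real (Suc m)) (1 / real (Suc m))"
        have "z \<in> J1_nhd (Y w) (real (Suc m)) (1 / real (Suc m) + 1 / real (Suc m))"
          by (rule J1_nhd_trans[OF z k[OF n] _ cad[OF w]]) simp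
        then have "z \<in> J1_nhd (Y w) T \<epsilon>" using J1_nhd_mono[OF m1 m2] by blast
        then show "z \<in> U" using T(3) by blast
      qed
      then show "\<exists>m k. \<forall>n\<in>{k..}. sampled_path n (Y w) \<in> V m" by auto
    next
      assume "\<exists>m k. \<forall>n\<in>{k..}. sampled_path n (Y w) \<in> V m"
      then obtain m k where mk: "\<And>n. k \<le> n \<Longrightarrow> sampled_path n (Y w) \<in> V m" by auto
      obtain k' where "\<And>n. k' \<le> n \<Longrightarrow> Y w \<in> J1_nhd (sampled_path n (Y w)) (real (Suc m)) (1 / real (Suc m))"
        using sampled_path_close[OF step[OF w] cad[OF w] sampled_cad[OF w], of "real (Suc m)" "1 / real (Suc m)"] by auto
      then show "Y w \<in> U" using mk[of "max k k'"] unfolding V_def by auto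
    qed
    then have "Y -` U \<inter> space \<Omega> = {w \<in> space \<Omega>. \<exists>m k. \<forall>n\<in>{k..}. sampled_path n (Y w) \<in> V m}" by auto
    also have "\<dots> \<in> sets \<Omega>"
      by (intro sets.sets_Collect_countable_Ex sets.sets_Collect_countable_Ball sampled_meas)
    finally show "Y -` U \<inter> space \<Omega> \<in> sets \<Omega>" .
  qed
qed

end

section \<open>Weak convergence to a deterministic continuous path\<close>

text \<open>A continuous functional is almost constant on a neighbourhood of \<open>q\<close>, which the process enters with high
  probability because uniformly close paths are close in \<open>J\<^sub>1\<close>; the rest contributes little as the functional is
  bounded.\<close>

lemma (in Metric_space) converges_weakly_to_point:
  assumes prob: "\<And>n. prob_space (\<Omega> n)" and Y: "\<And>n. Y n \<in> \<Omega> n \<rightarrow>\<^sub>M borel_of skorohod_J1"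
    and q: "q \<in> cadlag_paths"
    and conv: "\<And>T \<epsilon> \<eta>. 0 < T \<Longrightarrow> 0 < \<epsilon> \<Longrightarrow> 0 < \<eta> \<Longrightarrow> \<forall>\<^sub>F n in sequentially. \<exists>A\<in>sets (\<Omega> n).
      1 - \<eta> \<le> measure (\<Omega> n) A \<and> (\<forall>w\<in>A. \<forall>t\<in>{0..T}. d (Y n w t) (q t) < \<epsilon>)"
  shows "converges_weakly skorohod_J1 \<Omega> Y (return (borel_of skorohod_J1) q)"
proof -
  have sp: "space (borel_of skorohod_J1) = cadlag_paths"
    by (simp add: borel_of_def topspace_skorohod_J1 space_measure_of_conv)
  have open_sets: "U \<in> sets (borel_of skorohod_J1)" if "openin skorohod_J1 U" for U
    unfolding borel_of_def using that openin_subset by (subst sets_measure_of) auto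
  have Ycad: "Y n w \<in> cadlag_paths" if "w \<in> space (\<Omega> n)" for n w using measurable_space[OF Y that] sp by simp
  have lim: "(\<lambda>n. \<integral>w. f (Y n w) \<partial>\<Omega> n) \<longlonglongrightarrow> (\<integral>x. f x \<partial>return (borel_of skorohod_J1) q)"
    if f: "continuous_map skorohod_J1 euclideanreal f" and bdd: "bounded (f ` topspace skorohod_J1)" for f
  proof -
    have fm: "f \<in> borel_of skorohod_J1 \<rightarrow>\<^sub>M borel"
    proof (rule borel_measurableI)
      fix S :: "real set" assume "open S"
      then have "openin skorohod_J1 {x \<in> topspace skorohod_J1. f x \<in> S}"
        using f by (simp add: openin_continuous_map_preimage)
      from open_sets[OF this] show "f -` S \<inter> space (borel_of skorohod_J1) \<in> sets (borel_of skorohod_J1)"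
        by (simp add: sp topspace_skorohod_J1 vimage_def Int_def conj_commute)
    qed
    obtain B where B: "\<And>x. x \<in> cadlag_paths \<Longrightarrow> \<bar>f x\<bar> \<le> B" "0 \<le> B"
      using bdd unfolding topspace_skorohod_J1 bounded_iff using q by (auto intro: order_trans[OF abs_ge_zero])
    have ret: "(\<integral>x. f x \<partial>return (borel_of skorohod_J1) q) = f q"
      by (rule integral_return) (use q fm in \<open>auto simp: sp\<close>)
    show ?thesis
      unfolding ret
    proof (rule tendstoI)
      fix e :: real assume e: "0 < e"
      define \<epsilon> where "\<epsilon> = e / 3"
      have \<epsilon>: "0 < \<epsilon>" using e by (simp add: \<epsilon>_def)
      have "openin skorohod_J1 {x \<in> topspace skorohod_J1. f x \<in> ball (f q) \<epsilon>}"
        by (rule openin_continuous_map_preimage[OF f]) simp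
      moreover have "q \<in> {x \<in> topspace skorohod_J1. f x \<in> ball (f q) \<epsilon>}" using q \<epsilon> by (simp add: topspace_skorohod_J1)
      ultimately obtain T \<delta> where T: "0 < T" "0 < \<delta>" "J1_nhd q T \<delta> \<subseteq> {x \<in> topspace skorohod_J1. f x \<in> ball (f q) \<epsilon>}"
        unfolding openin_skorohod_J1 by meson
      define \<eta> where "\<eta> = \<epsilon> / (2 * B + 1)"
      have \<eta>: "0 < \<eta>" unfolding \<eta>_def using B(2) \<epsilon> by simp
      show "\<forall>\<^sub>F n in sequentially. dist (\<integral>w. f (Y n w) \<partial>\<Omega> n) (f q) < e"
        using conv[OF T(1,2) \<eta>]
      proof eventually_elim
        case (elim n)
        then obtain A where A: "A \<in> sets (\<Omega> n)" "1 - \<eta> \<le> measure (\<Omega> n) A"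
          "\<And>w t. w \<in> A \<Longrightarrow> t \<in> {0..T} \<Longrightarrow> d (Y n w t) (q t) < \<delta>" by blast
        interpret prob_space "\<Omega> n" by (rule prob)
        have fY[measurable]: "(\<lambda>w. f (Y n w)) \<in> borel_measurable (\<Omega> n)"
          using measurable_compose[OF Y fm] .
        have near: "\<bar>f (Y n w) - f q\<bar> \<le> \<epsilon> + 2 * B * indicator (space (\<Omega> n) - A) w" if w: "w \<in> space (\<Omega> n)" for w
        proof (cases "w \<in> A")
          case True
          have "Y n w \<in> J1_nhd q T \<delta>" by (rule uniformly_close_in_J1_nhd[OF Ycad[OF w] T(2) A(3)[OF True]])
          then have "f (Y n w) \<in> ball (f q) \<epsilon>" using T(3) by auto
          then show ?thesis using True by (auto simp: dist_real_def)
        next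
          case False
          then show ?thesis using B(1)[OF Ycad[OF w]] B(1)[OF q] w \<epsilon> by (auto simp: abs_le_iff)
        qed
        have int: "integrable (\<Omega> n) (\<lambda>w. f (Y n w))"
          by (rule integrable_const_bound[where B = B]) (use B(1) Ycad in auto)
        have "\<bar>(\<integral>w. f (Y n w) \<partial>\<Omega> n) - f q\<bar> = \<bar>\<integral>w. f (Y n w) - f q \<partial>\<Omega> n\<bar>"
          using int by (simp add: prob_space)
        also have "\<dots> \<le> (\<integral>w. \<bar>f (Y n w) - f q\<bar> \<partial>\<Omega> n)" by (rule integral_abs_bound)
        also have "\<dots> \<le> (\<integral>w. \<epsilon> + 2 * B * indicator (space (\<Omega> n) - A) w \<partial>\<Omega> n)"
          by (rule integral_mono) (use near int A(1) in \<open>auto simp: emeasure_eq_measure\<close>)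
        also have "\<dots> = \<epsilon> + 2 * B * (1 - prob A)"
          using A(1) by (simp add: prob_space prob_compl[symmetric] emeasure_eq_measure)
        also have "\<dots> \<le> \<epsilon> + 2 * B * \<eta>" using A(2) B(2) by (intro add_left_mono mult_left_mono) auto
        also have "2 * B * \<eta> \<le> (2 * B + 1) * \<eta>" using \<eta> by (intro mult_right_mono) auto
        also have "(2 * B + 1) * \<eta> = \<epsilon>" unfolding \<eta>_def using B(2) by simp
        finally show "dist (\<integral>w. f (Y n w) \<partial>\<Omega> n) (f q) < e" using e by (simp add: dist_real_def \<epsilon>_def)
      qed
    qed
  qed
  have "prob_space (return (borel_of skorohod_J1) q)" by (rule prob_space_return) (use q sp in auto)
  then show ?thesis unfolding converges_weakly_def using Y lim by simp
qed

lemma (in Metric_space) AE_return_continuous_path: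
  assumes q: "q \<in> cadlag_paths" and closed: "closedin skorohod_J1 {q}" and "\<Psi> q"
  shows "AE x in return (borel_of skorohod_J1) q. \<Psi> x"
proof (rule AE_I)
  have sp: "space (borel_of skorohod_J1) = cadlag_paths"
    by (simp add: borel_of_def topspace_skorohod_J1 space_measure_of_conv)
  have "openin skorohod_J1 (cadlag_paths - {q})" using closed by (simp add: closedin_def topspace_skorohod_J1)
  then have A: "cadlag_paths - {q} \<in> sets (borel_of skorohod_J1)"
    unfolding borel_of_def using openin_subset by (subst sets_measure_of) auto
  then show "cadlag_paths - {q} \<in> sets (return (borel_of skorohod_J1) q)" by simp
  show "emeasure (return (borel_of skorohod_J1) q) (cadlag_paths - {q}) = 0"
    using A by (simp add: indicator_def)
  show "{x \<in> space (return (borel_of skorohod_J1) q). \<not> \<Psi> x} \<subseteq> cadlag_paths - {q}"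
    using assms(3) by (auto simp: sp)
qed

section \<open>The tasks at a server\<close>

text \<open>Tasks are named by the source of their service requirement: \<open>Residual j l\<close> for initial tasks and
  \<open>Service k\<close> for arriving ones. All requirements together form a function \<open>S\<close>, so that changing one
  requirement is a function update. The arrival times and samples stay fixed throughout.\<close>

locale jsq_data =
  fixes N :: nat and b :: enat and x0 :: "nat list" and \<tau> :: "nat \<Rightarrow> real" and L :: "nat \<Rightarrow> nat list"
begin

definition hist :: "(source \<Rightarrow> real) \<Rightarrow> nat \<Rightarrow> task list" where
  "hist S k = tasks N b x0 (\<lambda>j l. S (Residual j l)) \<tau> (\<lambda>k. S (Service k)) L k"

definition chosen :: "(source \<Rightarrow> real) \<Rightarrow> nat \<Rightarrow> nat" where
  "chosen S k = arg_min_list (\<lambda>s. queue_length (hist S k) s (arrival_time \<tau> k)) (L k)"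

definition queue_seen :: "(source \<Rightarrow> real) \<Rightarrow> nat \<Rightarrow> nat" where
  "queue_seen S k = queue_length (hist S k) (chosen S k) (arrival_time \<tau> k)"

definition admitted :: "(source \<Rightarrow> real) \<Rightarrow> nat \<Rightarrow> bool" where
  "admitted S k \<longleftrightarrow> enat (queue_seen S k) < b"

primrec arrival :: "source \<Rightarrow> real" where
  "arrival Initial = 0"
| "arrival (Residual j l) = 0"
| "arrival (Interarrival k) = 0"
| "arrival (Service k) = arrival_time \<tau> k"
| "arrival (Sample k) = 0"

primrec start :: "(source \<Rightarrow> real) \<Rightarrow> source \<Rightarrow> real" where
  "start S Initial = 0"
| "start S (Residual j l) = (\<Sum>i<l. S (Residual j i))"
| "start S (Interarrival k) = 0"
| "start S (Service k) = max (arrival_time \<tau> k) (free_from (hist S k) (chosen S k))"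
| "start S (Sample k) = 0"

definition departure :: "(source \<Rightarrow> real) \<Rightarrow> source \<Rightarrow> real" where
  "departure S z = start S z + S z"

definition tasks_at :: "(source \<Rightarrow> real) \<Rightarrow> nat \<Rightarrow> source set" where
  "tasks_at S j = {Residual j l | l. j < N \<and> l < x0 ! j} \<union> {Service k | k. admitted S k \<and> chosen S k = j}"

text \<open>The queue length at time \<open>t\<close>, and its left limit.\<close>

definition queue :: "(source \<Rightarrow> real) \<Rightarrow> nat \<Rightarrow> real \<Rightarrow> nat" where
  "queue S j t = card {z \<in> tasks_at S j. arrival z \<le> t \<and> t < departure S z}"

definition queue_left :: "(source \<Rightarrow> real) \<Rightarrow> nat \<Rightarrow> real \<Rightarrow> nat" where
  "queue_left S j t = card {z \<in> tasks_at S j. arrival z < t \<and> t \<le> departure S z}"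

text \<open>The tasks whose fate is decided before arrival \<open>k\<close>.\<close>

primrec before :: "nat \<Rightarrow> source \<Rightarrow> bool" where
  "before k Initial \<longleftrightarrow> True"
| "before k (Residual j l) \<longleftrightarrow> True"
| "before k (Interarrival m) \<longleftrightarrow> True"
| "before k (Service m) \<longleftrightarrow> m < k"
| "before k (Sample m) \<longleftrightarrow> True"

lemma hist_Suc:
  "hist S (Suc k) = (if admitted S k then hist S k @ [(chosen S k, arrival_time \<tau> k, departure S (Service k))] else hist S k)"
  by (simp add: hist_def chosen_def queue_seen_def admitted_def departure_def Let_def)

lemma hist_0: "hist S 0 = concat (map (\<lambda>j. map (\<lambda>l. (j, 0, departure S (Residual j l))) [0..<x0 ! j]) [0..<N])"
  by (simp add: hist_def departure_def atMost_Suc_eq_insert_0 lessThan_Suc_atMost[symmetric] sum.lessThan_Suc)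

lemma tasks_before_0: "{z \<in> tasks_at S j. before 0 z} = (if j < N then Residual j ` {..<x0 ! j} else {})"
  by (auto simp: tasks_at_def)

lemma tasks_before_Suc:
  "{z \<in> tasks_at S j. before (Suc k) z} =
    (if admitted S k \<and> chosen S k = j then insert (Service k) {z \<in> tasks_at S j. before k z} else {z \<in> tasks_at S j. before k z})"
  by (auto simp: tasks_at_def less_Suc_eq)

lemma finite_tasks_before: "finite {z \<in> tasks_at S j. before k z}"
  by (induction k) (auto simp: tasks_before_0 tasks_before_Suc)

lemma queue_length_append: "queue_length (h @ [(s, a, u)]) j t = queue_length h j t + (if s = j \<and> a \<le> t \<and> t < u then 1 else 0)"
  by (simp add: queue_length_def)

lemma queue_length_hist:
  "queue_length (hist S k) j t = card {z \<in> tasks_at S j. before k z \<and> arrival z \<le> t \<and> t < departure S z}"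
proof (induction k)
  case 0
  have "queue_length (hist S 0) j t = (\<Sum>j'\<leftarrow>[0..<N]. length (filter (\<lambda>(s, a, u). s = j \<and> a \<le> t \<and> t < u) (map (\<lambda>l. (j', 0, departure S (Residual j' l))) [0..<x0 ! j'])))"
    unfolding queue_length_def hist_0 by (simp add: filter_concat length_concat comp_def map_concat)
  also have "\<dots> = (\<Sum>j'<N. if j' = j then card {l. l < x0 ! j \<and> 0 \<le> t \<and> t < departure S (Residual j l)} else 0)"
    unfolding sum_list_distinct_conv_sum_set[OF distinct_upt] set_upt atLeast0LessThan
    by (intro sum.cong) (auto simp: filter_map comp_def length_filter_conv_card cong: conj_cong)
  also have "\<dots> = card {z \<in> tasks_at S j. before 0 z \<and> arrival z \<le> t \<and> t < departure S z}"
  proof (cases "j < N")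
    case True
    have "{z \<in> tasks_at S j. before 0 z \<and> arrival z \<le> t \<and> t < departure S z} = {z \<in> {z \<in> tasks_at S j. before 0 z}. arrival z \<le> t \<and> t < departure S z}"
      by auto
    also have "\<dots> = Residual j ` {l. l < x0 ! j \<and> 0 \<le> t \<and> t < departure S (Residual j l)}"
      unfolding tasks_before_0 using True by auto
    finally show ?thesis using True by (simp add: card_image inj_on_def)
  next
    case False
    then have "{z \<in> tasks_at S j. before 0 z \<and> arrival z \<le> t \<and> t < departure S z} = {}"
      using tasks_before_0[of S j] by auto
    then show ?thesis using False by (simp only: card.empty) (auto intro!: sum.neutral)
  qed
  finally show ?case .
next
  case (Suc k)
  let ?A = "\<lambda>k. {z \<in> tasks_at S j. before k z \<and> arrival z \<le> t \<and> t < departure S z}"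
  have fin: "finite (?A k)" by (rule finite_subset[OF _ finite_tasks_before[of S j k]]) auto
  have "?A (Suc k) = {z \<in> {z \<in> tasks_at S j. before (Suc k) z}. arrival z \<le> t \<and> t < departure S z}" by auto
  also have "\<dots> = (if admitted S k \<and> chosen S k = j \<and> arrival_time \<tau> k \<le> t \<and> t < departure S (Service k) then insert (Service k) (?A k) else ?A k)"
    unfolding tasks_before_Suc by auto
  finally have "card (?A (Suc k)) = card (?A k) + (if admitted S k \<and> chosen S k = j \<and> arrival_time \<tau> k \<le> t \<and> t < departure S (Service k) then 1 else 0)"
    using fin by auto
  then show ?case using Suc by (simp add: hist_Suc queue_length_append)
qed

lemma free_from_hist:
  "free_from (hist S k) j = Max (insert 0 (departure S ` {z \<in> tasks_at S j. before k z}))"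
proof -
  have "{u. \<exists>a. (j, a, u) \<in> set (hist S k)} = departure S ` {z \<in> tasks_at S j. before k z}"
  proof (induction k)
    case 0
    show ?case unfolding tasks_before_0 hist_0 by (force simp: image_iff)
  next
    case (Suc k)
    then show ?case unfolding tasks_before_Suc hist_Suc by auto
  qed
  then show ?thesis by (simp add: free_from_def)
qed

lemma queue_seen_eq:
  "queue_seen S k = card {z \<in> tasks_at S (chosen S k). before k z \<and> arrival z \<le> arrival_time \<tau> k \<and> arrival_time \<tau> k < departure S z}"
  by (simp add: queue_seen_def queue_length_hist)

lemma departure_le_free: "z \<in> tasks_at S j \<Longrightarrow> before k z \<Longrightarrow> departure S z \<le> free_from (hist S k) j"
  unfolding free_from_hist using finite_tasks_before by (intro Max_ge) auto

lemma free_from_cases: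
  obtains "free_from (hist S k) j = 0" | z where "z \<in> tasks_at S j" "before k z" "departure S z = free_from (hist S k) j"
proof -
  have "free_from (hist S k) j \<in> insert 0 (departure S ` {z \<in> tasks_at S j. before k z})"
    unfolding free_from_hist using finite_tasks_before by (intro Max_in) auto
  then show ?thesis using that by auto
qed

end

locale jsq_arrivals = jsq_data +
  assumes interarrival_pos: "\<And>k. 0 < \<tau> k" and diverge: "filterlim (arrival_time \<tau>) at_top sequentially"
begin

lemma arrival_time_strict_mono: "strict_mono (arrival_time \<tau>)"
  by (rule strict_monoI_Suc) (simp add: arrival_time_def interarrival_pos)

lemma arrival_time_less: "arrival_time \<tau> k < arrival_time \<tau> m \<longleftrightarrow> k < m"
  using arrival_time_strict_mono by (simp add: strict_mono_less)

lemma arrival_time_eq: "arrival_time \<tau> k = arrival_time \<tau> m \<longleftrightarrow> k = m"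
  using arrival_time_strict_mono by (simp add: strict_mono_eq)

lemma arrival_time_pos: "0 < arrival_time \<tau> k"
  unfolding arrival_time_def using interarrival_pos by (intro sum_pos) auto

lemma arrivals_upto: "\<exists>n. {k. arrival_time \<tau> k \<le> t} = {..<n}"
proof -
  obtain m where m: "t < arrival_time \<tau> m"
    using filterlim_at_top_dense[of "arrival_time \<tau>" sequentially] diverge by (meson eventually_sequentially order_refl)
  define n where "n = (LEAST k. t < arrival_time \<tau> k)"
  have "t < arrival_time \<tau> n" unfolding n_def by (rule LeastI[of _ m]) (rule m)
  then have "k < n" if "arrival_time \<tau> k \<le> t" for k using arrival_time_less[of k n] that by linarith
  moreover have "arrival_time \<tau> k \<le> t" if "k < n" for k using not_less_Least[of k] that unfolding n_def by force
  ultimately show ?thesis by blast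
qed

lemma finite_arrivals: "finite {k. arrival_time \<tau> k \<le> t}"
proof -
  obtain n where "{k. arrival_time \<tau> k \<le> t} = {..<n}" using arrivals_upto by blast
  then show ?thesis by (simp only: finite_lessThan)
qed

lemma before_count: "before (card {k. arrival_time \<tau> k \<le> t}) (Service m) \<longleftrightarrow> arrival_time \<tau> m \<le> t"
proof -
  obtain n where n: "{k. arrival_time \<tau> k \<le> t} = {..<n}" using arrivals_upto by blast
  then have "arrival_time \<tau> m \<le> t \<longleftrightarrow> m < n" by auto
  then show ?thesis by (simp add: n)
qed

lemma arrival_nonneg: "0 \<le> arrival z"
  using arrival_time_pos by (cases z) (auto intro: less_imp_le)

lemma tasks_at_cases:
  assumes "z \<in> tasks_at S j"
  obtains l where "z = Residual j l" "j < N" "l < x0 ! j" | k where "z = Service k" "admitted S k" "chosen S k = j"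
  using assms by (auto simp: tasks_at_def)

lemma queue_eq_queue_length:
  "queue_length (hist S (card {k. arrival_time \<tau> k \<le> t})) j t = queue S j t"
proof -
  have "before (card {k. arrival_time \<tau> k \<le> t}) z" if "z \<in> tasks_at S j" "arrival z \<le> t" for z
    using that before_count by (elim tasks_at_cases) auto
  then show ?thesis unfolding queue_length_hist queue_def by (metis (no_types, lifting))
qed

lemma occupancy_path_eq:
  assumes "0 \<le> t"
  shows "occupancy_path N b x0 (\<lambda>j l. S (Residual j l)) \<tau> (\<lambda>k. S (Service k)) L t i =
    real (card {j. j < N \<and> i \<le> queue S j t}) / real N"
  using assms queue_eq_queue_length[of S t] by (simp add: occupancy_path_def hist_def Let_def)

lemma finite_arrived: "finite {z \<in> tasks_at S j. arrival z \<le> t}"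
proof (rule finite_subset)
  show "{z \<in> tasks_at S j. arrival z \<le> t} \<subseteq> Residual j ` {..<x0 ! j} \<union> Service ` {k. arrival_time \<tau> k \<le> t}"
    by (auto elim!: tasks_at_cases)
qed (simp add: finite_arrivals)

lemma finite_arrived': "finite {z \<in> tasks_at S j. arrival z \<le> t \<and> P z}" "finite {z \<in> tasks_at S j. arrival z < t \<and> P z}"
  by (rule finite_subset[OF _ finite_arrived[of S j t]], force)+

context
  fixes S :: "source \<Rightarrow> real"
  assumes S_pos: "\<And>z. 0 < S z"
begin

lemma start_less_departure: "start S z < departure S z"
  using S_pos by (simp add: departure_def)

lemma arrival_le_start: "arrival z \<le> start S z"
  using S_pos by (cases z) (auto intro: sum_nonneg less_imp_le)

lemma arrival_less_departure: "arrival z < departure S z"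
  using arrival_le_start start_less_departure order_le_less_trans by blast

lemma finite_departed: "finite {z \<in> tasks_at S j. departure S z \<le> t \<and> P z}"
proof (rule finite_subset[OF _ finite_arrived[of S j t]])
  show "{z \<in> tasks_at S j. departure S z \<le> t \<and> P z} \<subseteq> {z \<in> tasks_at S j. arrival z \<le> t}"
  proof
    fix z assume "z \<in> {z \<in> tasks_at S j. departure S z \<le> t \<and> P z}"
    then show "z \<in> {z \<in> tasks_at S j. arrival z \<le> t}" using arrival_less_departure[of z] by simp
  qed
qed

text \<open>The services at one server do not overlap.\<close>

lemma fifo:
  assumes "z \<in> tasks_at S j" "z' \<in> tasks_at S j" "z \<noteq> z'"
  shows "departure S z \<le> start S z' \<or> departure S z' \<le> start S z"
proof -
  have residual: "departure S (Residual j l) \<le> start S (Residual j l')" if "l < l'" for l l'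
  proof -
    have "departure S (Residual j l) = (\<Sum>i<Suc l. S (Residual j i))" by (simp add: departure_def)
    also have "\<dots> \<le> (\<Sum>i<l'. S (Residual j i))" using that S_pos by (intro sum_mono2) (auto intro: less_imp_le)
    finally show ?thesis by simp
  qed
  have service: "departure S z \<le> start S (Service k)" if "z \<in> tasks_at S j" "before k z" "chosen S k = j" for z k
    using departure_le_free[OF that(1,2)] that(3) by simp
  from assms(1) show ?thesis
  proof (cases rule: tasks_at_cases)
    case (1 l)
    from assms(2) show ?thesis
    proof (cases rule: tasks_at_cases)
      case 2: (1 l')
      then show ?thesis using 1 assms(3) residual[of l l'] residual[of l' l] by (cases "l < l'") auto
    next
      case (2 k)
      then show ?thesis using service[OF assms(1), of k] 1 by auto
    qed
  next
    case k: (2 k)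
    from assms(2) show ?thesis
    proof (cases rule: tasks_at_cases)
      case (1 l')
      then show ?thesis using service[OF assms(2), of k] k by auto
    next
      case (2 k')
      then show ?thesis using service[OF assms(1), of k'] service[OF assms(2), of k] k assms(3) by (cases "k < k'") auto
    qed
  qed
qed

lemma departure_inj: "inj_on (departure S) (tasks_at S j)"
  using fifo start_less_departure by (intro inj_onI) (metis linorder_not_less)

text \<open>A task that has to wait is preceded by one whose departure starts its service.\<close>

lemma predecessor:
  assumes "z \<in> tasks_at S j" "arrival z < start S z"
  shows "\<exists>z'\<in>tasks_at S j. arrival z' \<le> arrival z \<and> departure S z' = start S z"
  using assms(1)
proof (cases rule: tasks_at_cases)
  case (1 l)
  then obtain m where m: "l = Suc m" using assms(2) by (cases l) auto
  then have "Residual j m \<in> tasks_at S j" using 1 by (auto simp: tasks_at_def)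
  then show ?thesis using 1 m by (intro bexI[of _ "Residual j m"]) (auto simp: departure_def)
next
  case (2 k)
  then have s: "start S z = free_from (hist S k) j" and gt: "arrival_time \<tau> k < free_from (hist S k) j"
    using assms(2) by auto
  show ?thesis
  proof (cases rule: free_from_cases[of S k j])
    case 1
    then show ?thesis using gt arrival_time_pos[of k] by simp
  next
    case 3: (2 z')
    have "arrival z' \<le> arrival_time \<tau> k"
      using 3(1,2)
    proof (cases rule: tasks_at_cases)
      case (2 m)
      then show ?thesis using 3(2) arrival_time_less[of m k] by simp
    qed (use arrival_time_pos[of k] in auto)
    then show ?thesis using 3 s 2 by (intro bexI[of _ z']) auto
  qed
qed

text \<open>A server with a nonempty queue serves exactly one task: of the tasks present, the one with the earliest
  start has started, or else its predecessor would be present as well.\<close>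

lemma busy_server:
  assumes "0 \<le> s"
  shows "card {z \<in> tasks_at S j. start S z \<le> s \<and> s < departure S z} = (if queue S j s = 0 then 0 else 1)"
proof -
  let ?P = "{z \<in> tasks_at S j. arrival z \<le> s \<and> s < departure S z}"
  let ?A = "{z \<in> tasks_at S j. start S z \<le> s \<and> s < departure S z}"
  have fin: "finite ?P" by (rule finite_arrived')
  have sub: "?A \<subseteq> ?P" using arrival_le_start by (force intro: order_trans)
  have unique: "z = z'" if "z \<in> ?A" "z' \<in> ?A" for z z'
    using fifo[of z j z'] that by fastforce
  show ?thesis
  proof (cases "?P = {}")
    case True
    then have "?A = {}" using sub by blast
    with True show ?thesis by (simp only: queue_def card.empty) simp
  next
    case False
    define z where "z = arg_min_on (start S) ?P"
    have z: "z \<in> ?P" unfolding z_def using fin False by (rule arg_min_if_finite)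
    have min: "start S z \<le> start S z'" if "z' \<in> ?P" for z'
      unfolding z_def by (rule arg_min_least[OF fin False that])
    have "start S z \<le> s"
    proof (rule ccontr)
      assume "\<not> start S z \<le> s"
      then obtain z' where z': "z' \<in> tasks_at S j" "arrival z' \<le> arrival z" "departure S z' = start S z"
        using predecessor[of z j] z by auto
      then have "z' \<in> ?P" using z \<open>\<not> start S z \<le> s\<close> by auto
      then show False using min[of z'] start_less_departure[of z'] z'(3) by simp
    qed
    then have "z \<in> ?A" using z by auto
    then have "?A = {z}" using unique by blast
    then show ?thesis using False fin by (simp add: queue_def)
  qed
qed

section \<open>Level crossings of a queue\<close>

lemma queue_jump:
  assumes s: "0 < s"
  shows "int (queue S j s) = int (queue_left S j s) - (if \<exists>z\<in>tasks_at S j. departure S z = s then 1 else 0)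
    + (if \<exists>k. Service k \<in> tasks_at S j \<and> arrival_time \<tau> k = s then 1 else 0)"
    and "\<And>k. Service k \<in> tasks_at S j \<Longrightarrow> arrival_time \<tau> k = s \<Longrightarrow>
      int (queue_seen S k) = int (queue_left S j s) - (if \<exists>z\<in>tasks_at S j. departure S z = s then 1 else 0)"
    and "\<exists>z\<in>tasks_at S j. departure S z = s \<Longrightarrow> 1 \<le> queue_left S j s"
proof -
  let ?A = "{z \<in> tasks_at S j. arrival z < s \<and> s \<le> departure S z}"
  let ?B = "{z \<in> tasks_at S j. arrival z < s \<and> s < departure S z}"
  let ?D = "\<exists>z\<in>tasks_at S j. departure S z = s"
  let ?U = "\<exists>k. Service k \<in> tasks_at S j \<and> arrival_time \<tau> k = s"
  have finA: "finite ?A" and finB: "finite ?B" by (rule finite_arrived')+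
  have cardA: "card ?A = card ?B + (if ?D then 1 else 0)"
  proof (cases ?D)
    case True
    then obtain z where z: "z \<in> tasks_at S j" "departure S z = s" by blast
    have unique: "z' = z" if "z' \<in> tasks_at S j" "departure S z' = s" for z'
      using inj_onD[OF departure_inj[of j], of z' z] that z by simp
    have "?A = insert z ?B"
    proof (intro equalityI subsetI)
      fix z' assume "z' \<in> ?A"
      then show "z' \<in> insert z ?B" using unique[of z'] by (cases "departure S z' = s") auto
    next
      fix z' assume "z' \<in> insert z ?B"
      then show "z' \<in> ?A" using z arrival_less_departure[of z] by auto
    qed
    then show ?thesis using finB True z by simp
  next
    case False
    then have "?A = ?B" by force
    then show ?thesis using False by simp
  qed
  then show "1 \<le> queue_left S j s" if ?D using that by (simp add: queue_left_def)
  have nores: "arrival z \<noteq> s \<or> (\<exists>k. z = Service k \<and> arrival_time \<tau> k = s)" for z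
    using s by (cases z) auto
  have cardB: "card {z \<in> tasks_at S j. arrival z \<le> s \<and> s < departure S z} = card ?B + (if ?U then 1 else 0)"
  proof (cases ?U)
    case True
    then obtain k where k: "Service k \<in> tasks_at S j" "arrival_time \<tau> k = s" by blast
    have "{z \<in> tasks_at S j. arrival z \<le> s \<and> s < departure S z} = insert (Service k) ?B"
    proof (intro equalityI subsetI)
      fix z assume "z \<in> {z \<in> tasks_at S j. arrival z \<le> s \<and> s < departure S z}"
      moreover have "z = Service k" if "arrival z = s" using nores[of z] that k arrival_time_eq by metis
      ultimately show "z \<in> insert (Service k) ?B" by (cases "arrival z = s") auto
    next
      fix z assume "z \<in> insert (Service k) ?B"
      then show "z \<in> {z \<in> tasks_at S j. arrival z \<le> s \<and> s < departure S z}"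
        using k arrival_less_departure[of "Service k"] by auto
    qed
    then show ?thesis using finB True k by simp
  next
    case False
    have "arrival z \<le> s \<longleftrightarrow> arrival z < s" if "z \<in> tasks_at S j" for z
      using nores[of z] False that by (auto simp: order_le_less)
    then have "{z \<in> tasks_at S j. arrival z \<le> s \<and> s < departure S z} = ?B" by blast
    then show ?thesis using False by simp
  qed
  show "int (queue S j s) = int (queue_left S j s) - (if ?D then 1 else 0) + (if ?U then 1 else 0)"
    using cardA cardB by (simp add: queue_def queue_left_def)
  fix k assume k: "Service k \<in> tasks_at S j" "arrival_time \<tau> k = s"
  have "{z \<in> tasks_at S j. before k z \<and> arrival z \<le> s \<and> s < departure S z} = ?B"
  proof -
    have "before k z \<and> arrival z \<le> s \<longleftrightarrow> arrival z < s" if "z \<in> tasks_at S j" for z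
      using that
    proof (cases rule: tasks_at_cases)
      case (2 m)
      then show ?thesis using k arrival_time_less[of m k] arrival_time_eq[of m k] by auto
    qed (use s in auto)
    then show ?thesis by blast
  qed
  moreover have "chosen S k = j" using k(1) by (auto simp: tasks_at_def)
  ultimately have "queue_seen S k = card ?B" using k(2) by (simp add: queue_seen_eq)
  then show "int (queue_seen S k) = int (queue_left S j s) - (if ?D then 1 else 0)"
    using cardA by (simp add: queue_left_def)
qed

definition event_times :: "nat \<Rightarrow> real \<Rightarrow> real set" where
  "event_times j t = departure S ` {z \<in> tasks_at S j. departure S z \<le> t} \<union>
     arrival_time \<tau> ` {k. Service k \<in> tasks_at S j \<and> arrival_time \<tau> k \<le> t}"

lemma finite_event_times: "finite (event_times j t)"
  unfolding event_times_def using finite_departed[of j t "\<lambda>_. True"] finite_arrivals[of t]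
  by (auto intro: finite_subset[OF _ finite_arrivals[of t]])

lemma event_times_subset: "event_times j t \<subseteq> {0<..t}"
proof -
  have "0 < departure S z" for z using arrival_nonneg[of z] arrival_less_departure[of z] by linarith
  then show ?thesis unfolding event_times_def using arrival_time_pos by auto
qed

lemma queue_left_eq_queue:
  assumes "0 \<le> s" "s < s'" "s' \<le> t" "event_times j t \<inter> {s<..<s'} = {}"
  shows "queue_left S j s' = queue S j s"
proof -
  have "arrival z < s' \<and> s' \<le> departure S z \<longleftrightarrow> arrival z \<le> s \<and> s < departure S z" if z: "z \<in> tasks_at S j" for z
  proof -
    have "departure S z \<notin> {s<..<s'}"
      using assms z unfolding event_times_def by force
    moreover have "arrival z \<notin> {s<..<s'}"
      using z
    proof (cases rule: tasks_at_cases)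
      case (2 k)
      then show ?thesis using assms z unfolding event_times_def by force
    qed (use assms in auto)
    ultimately show ?thesis using assms(2) by auto
  qed
  then show ?thesis unfolding queue_left_def queue_def by (metis (no_types, lifting))
qed

lemma queue_eq_queue_left:
  assumes "0 < s" "s \<le> t" "s \<notin> event_times j t"
  shows "queue S j s = queue_left S j s"
  using queue_jump(1)[OF assms(1), where j = j] assms(2,3) unfolding event_times_def by (auto split: if_splits)

lemma sum_of_jumps:
  fixes F Fl :: "real \<Rightarrow> int"
  assumes "finite J" "J \<subseteq> {0<..t}" "0 \<le> t"
    and left: "\<And>s s'. 0 \<le> s \<Longrightarrow> s < s' \<Longrightarrow> s' \<le> t \<Longrightarrow> J \<inter> {s<..<s'} = {} \<Longrightarrow> Fl s' = F s"
    and cont: "\<And>s. 0 < s \<Longrightarrow> s \<le> t \<Longrightarrow> s \<notin> J \<Longrightarrow> F s = Fl s"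
  shows "F t = F 0 + (\<Sum>s\<in>J. F s - Fl s)"
  using assms
proof (induction "card J" arbitrary: J t F)
  case 0
  then have "J = {}" by simp
  then show ?case using 0(4) 0(5)[of 0 t] 0(6)[of t] by (cases "t = 0") auto
next
  case (Suc n)
  then have J: "J \<noteq> {}" by auto
  define r where "r = Max J"
  have r: "r \<in> J" "\<And>s. s \<in> J \<Longrightarrow> s \<le> r" unfolding r_def using Suc J by (auto intro: Max_in)
  have r0: "0 < r" "r \<le> t" using r Suc(4) by auto
  have "Fl r = F 0 + (\<Sum>s\<in>J - {r}. F s - Fl s)"
  proof -
    define Fr where "Fr s = (if s = r then Fl r else F s)" for s
    have "Fr r = Fr 0 + (\<Sum>s\<in>J - {r}. Fr s - Fl s)"
    proof (rule Suc(1))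
      show "n = card (J - {r})" using Suc(2,3) r(1) by simp
      show "J - {r} \<subseteq> {0<..r}" using r Suc(4) by auto
      show "Fl s' = Fr s" if "0 \<le> s" "s < s'" "s' \<le> r" "(J - {r}) \<inter> {s<..<s'} = {}" for s s'
      proof -
        have "J \<inter> {s<..<s'} = {}" using that(3,4) by (force simp: disjoint_iff)
        then show ?thesis using Suc(6)[of s s'] that r0 by (auto simp: Fr_def)
      qed
      show "Fr s = Fl s" if "0 < s" "s \<le> r" "s \<notin> J - {r}" for s
        using Suc(7)[of s] that r0 by (auto simp: Fr_def)
    qed (use Suc r0 in auto)
    moreover have "(\<Sum>s\<in>J - {r}. Fr s - Fl s) = (\<Sum>s\<in>J - {r}. F s - Fl s)"
      by (intro sum.cong) (auto simp: Fr_def)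
    ultimately show ?thesis using r0 by (simp add: Fr_def)
  qed
  moreover have "F t = F r"
  proof (cases "t = r")
    case False
    then have "t \<notin> J" using r0 r(2)[of t] by force
    moreover have "J \<inter> {r<..<t} = {}" using r(2) by force
    ultimately show ?thesis using Suc(6)[of r t] Suc(7)[of t] False r0 by auto
  qed simp
  moreover have "(\<Sum>s\<in>J. F s - Fl s) = (F r - Fl r) + (\<Sum>s\<in>J - {r}. F s - Fl s)"
    using Suc(3) r(1) by (simp add: sum.remove)
  ultimately show ?case by simp
qed

text \<open>The queue reaches level \<open>i\<close> by arrivals that see \<open>i - 1\<close> tasks, and leaves it by departures from \<open>i\<close> tasks.\<close>

lemma level_crossings:
  assumes t: "0 \<le> t" and i: "1 \<le> i"
  shows "int (if i \<le> queue S j t then 1 else 0) = int (if i \<le> queue S j 0 then 1 else 0)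
    + int (card {k. arrival_time \<tau> k \<le> t \<and> admitted S k \<and> chosen S k = j \<and> queue_seen S k = i - 1})
    - int (card {z \<in> tasks_at S j. departure S z \<le> t \<and> queue_left S j (departure S z) = i})"
proof -
  let ?J = "event_times j t"
  let ?F = "\<lambda>s. int (if i \<le> queue S j s then 1 else 0)"
  let ?Fl = "\<lambda>s. int (if i \<le> queue_left S j s then 1 else 0)"
  let ?U = "{k. arrival_time \<tau> k \<le> t \<and> admitted S k \<and> chosen S k = j \<and> queue_seen S k = i - 1}"
  let ?D = "{z \<in> tasks_at S j. departure S z \<le> t \<and> queue_left S j (departure S z) = i}"
  have jump: "?F s - ?Fl s = (if s \<in> arrival_time \<tau> ` ?U then 1 else 0) - (if s \<in> departure S ` ?D then 1 else 0)"
    if s: "s \<in> ?J" for s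
  proof -
    have s0: "0 < s" "s \<le> t" using s event_times_subset[of j t] by auto
    note qj = queue_jump[OF s0(1), where j = j]
    have d: "s \<in> departure S ` ?D \<longleftrightarrow> (\<exists>z\<in>tasks_at S j. departure S z = s) \<and> queue_left S j s = i"
      using s0 by auto
    have a: "s \<in> arrival_time \<tau> ` ?U \<longleftrightarrow> (\<exists>k. Service k \<in> tasks_at S j \<and> arrival_time \<tau> k = s) \<and>
        int (queue_left S j s) - (if \<exists>z\<in>tasks_at S j. departure S z = s then 1 else 0) = int i - 1"
    proof
      assume "s \<in> arrival_time \<tau> ` ?U"
      then obtain k where k: "arrival_time \<tau> k = s" "admitted S k" "chosen S k = j" "queue_seen S k = i - 1" by auto
      then have "Service k \<in> tasks_at S j" by (auto simp: tasks_at_def)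
      then show "(\<exists>k. Service k \<in> tasks_at S j \<and> arrival_time \<tau> k = s) \<and>
        int (queue_left S j s) - (if \<exists>z\<in>tasks_at S j. departure S z = s then 1 else 0) = int i - 1"
        using qj(2)[of k] k i by (intro conjI exI[of _ k]) auto
    next
      assume A: "(\<exists>k. Service k \<in> tasks_at S j \<and> arrival_time \<tau> k = s) \<and>
        int (queue_left S j s) - (if \<exists>z\<in>tasks_at S j. departure S z = s then 1 else 0) = int i - 1"
      then obtain k where k: "Service k \<in> tasks_at S j" "arrival_time \<tau> k = s" by blast
      then have "int (queue_seen S k) = int i - 1" using A qj(2)[OF k] by linarith
      then have "queue_seen S k = i - 1" using i by linarith
      then show "s \<in> arrival_time \<tau> ` ?U" using k s0 by (auto simp: tasks_at_def)
    qed
    show ?thesis unfolding d a using qj(1,3) i by (auto split: if_splits)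
  qed
  have "?F t = ?F 0 + (\<Sum>s\<in>?J. ?F s - ?Fl s)"
  proof (rule sum_of_jumps[OF finite_event_times event_times_subset t])
    show "?Fl s' = ?F s" if "0 \<le> s" "s < s'" "s' \<le> t" "?J \<inter> {s<..<s'} = {}" for s s'
      using queue_left_eq_queue[OF that] by simp
    show "?F s = ?Fl s" if "0 < s" "s \<le> t" "s \<notin> ?J" for s
      using queue_eq_queue_left[OF that] by simp
  qed
  also have "(\<Sum>s\<in>?J. ?F s - ?Fl s) = (\<Sum>s\<in>?J. (if s \<in> arrival_time \<tau> ` ?U then 1 else 0)) - (\<Sum>s\<in>?J. (if s \<in> departure S ` ?D then 1 else 0))"
    by (simp add: jump sum_subtractf)
  also have "(\<Sum>s\<in>?J. (if s \<in> arrival_time \<tau> ` ?U then 1 else 0)) = int (card ?U)"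
  proof -
    have "?J \<inter> arrival_time \<tau> ` ?U = arrival_time \<tau> ` ?U" by (auto simp: event_times_def tasks_at_def)
    moreover have "card (arrival_time \<tau> ` ?U) = card ?U"
      by (rule card_image) (auto simp: inj_on_def arrival_time_eq)
    ultimately show ?thesis using finite_event_times[of j t] by (simp add: sum.If_cases)
  qed
  also have "(\<Sum>s\<in>?J. (if s \<in> departure S ` ?D then 1 else 0)) = int (card ?D)"
  proof -
    have "?J \<inter> departure S ` ?D = departure S ` ?D" by (auto simp: event_times_def)
    moreover have "card (departure S ` ?D) = card ?D"
      by (rule card_image) (use departure_inj[of j] in \<open>auto simp: inj_on_def\<close>)
    ultimately show ?thesis using finite_event_times[of j t] by (simp add: sum.If_cases)
  qed
  finally show ?thesis by simp
qed

end
end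

section \<open>The balance equations of the occupancy process\<close>

context jsq_data
begin

definition level :: "(source \<Rightarrow> real) \<Rightarrow> nat \<Rightarrow> real \<Rightarrow> nat" where
  "level S i t = card {j. j < N \<and> i \<le> queue S j t}"

text \<open>An arrival overflows level \<open>i\<close> if the shortest sampled queue has length at least \<open>i\<close>.\<close>

definition overflows :: "(source \<Rightarrow> real) \<Rightarrow> nat \<Rightarrow> real \<Rightarrow> nat" where
  "overflows S i t = card {k. arrival_time \<tau> k \<le> t \<and> i \<le> queue_seen S k}"

definition departures_from :: "(source \<Rightarrow> real) \<Rightarrow> nat \<Rightarrow> nat \<Rightarrow> real \<Rightarrow> source set" where
  "departures_from S i j t = {z \<in> tasks_at S j. departure S z \<le> t \<and> queue_left S j (departure S z) = i}"

definition level_seen :: "(source \<Rightarrow> real) \<Rightarrow> nat \<Rightarrow> nat \<Rightarrow> nat" where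
  "level_seen S i k = card {j. j < N \<and> i \<le> queue_length (hist S k) j (arrival_time \<tau> k)}"

text \<open>The unlikely overflows: those that happen although a fraction of at least \<open>\<epsilon>\<close> of the queues is shorter.\<close>

definition bad_overflows :: "(source \<Rightarrow> real) \<Rightarrow> real \<Rightarrow> nat \<Rightarrow> real \<Rightarrow> nat set" where
  "bad_overflows S \<epsilon> i t = {k. arrival_time \<tau> k \<le> t \<and> i \<le> queue_seen S k \<and> real (level_seen S i k) \<le> (1 - \<epsilon>) * real N}"

end

context jsq_arrivals
begin

lemma finite_arrivals': "finite {k. arrival_time \<tau> k \<le> t \<and> P k}"
  by (rule finite_subset[OF _ finite_arrivals[of t]]) auto

lemma overflows_0: "overflows S 0 t = card {k. arrival_time \<tau> k \<le> t}"
  by (simp add: overflows_def)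

lemma overflows_mono: "s \<le> t \<Longrightarrow> overflows S i s \<le> overflows S i t"
  unfolding overflows_def by (intro card_mono finite_arrivals') auto

lemma overflows_le_0: "overflows S i t \<le> overflows S 0 t"
  unfolding overflows_def by (intro card_mono finite_arrivals') auto

lemma overflows_increment:
  assumes "s \<le> t" shows "overflows S i t - overflows S i s \<le> overflows S 0 t - overflows S 0 s"
proof -
  have split: "overflows S i t = overflows S i s + card {k. arrival_time \<tau> k \<le> t \<and> s < arrival_time \<tau> k \<and> i \<le> queue_seen S k}" for i
    unfolding overflows_def using assms
    by (subst card_Un_disjoint[symmetric]) (auto intro!: finite_arrivals' arg_cong[where f = card])
  show ?thesis using split[of i] split[of 0] by (auto intro!: card_mono finite_arrivals')
qed

text \<open>At the last overflow that is not bad, if there is one, level \<open>i\<close> is almost full, and all later overflows are bad.\<close>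

lemma overflow_barrier:
  assumes t: "0 \<le> t"
  shows "overflows S i t \<le> card (bad_overflows S \<epsilon> i t) \<or>
    (\<exists>s\<in>{0..t}. (1 - \<epsilon>) * real N < real (level S i s) \<and> overflows S i t \<le> overflows S i s + card (bad_overflows S \<epsilon> i t))"
proof -
  let ?V = "{k. arrival_time \<tau> k \<le> t \<and> i \<le> queue_seen S k}"
  let ?B = "bad_overflows S \<epsilon> i t"
  have finV: "finite ?V" by (rule finite_arrivals')
  have BV: "?B \<subseteq> ?V" by (auto simp: bad_overflows_def)
  then have finB: "finite ?B" using finV finite_subset by blast
  show ?thesis
  proof (cases "?V - ?B = {}")
    case True
    then have "card ?V \<le> card ?B" by (intro card_mono finB) auto
    then show ?thesis by (simp add: overflows_def)
  next
    case False
    define k where "k = Max (?V - ?B)"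
    have k: "k \<in> ?V - ?B" unfolding k_def using finV False by (intro Max_in) auto
    have kmax: "m \<le> k" if "m \<in> ?V - ?B" for m unfolding k_def using finV that by (intro Max_ge) auto
    let ?s = "arrival_time \<tau> k"
    have "level_seen S i k \<le> level S i ?s"
      unfolding level_seen_def level_def
    proof (rule card_mono)
      have "queue_length (hist S k) j ?s \<le> queue S j ?s" for j
        unfolding queue_length_hist queue_def by (rule card_mono[OF finite_arrived'(1)]) auto
      then show "{j. j < N \<and> i \<le> queue_length (hist S k) j ?s} \<subseteq> {j. j < N \<and> i \<le> queue S j ?s}"
        using order_trans by blast
    qed simp
    moreover have "(1 - \<epsilon>) * real N < real (level_seen S i k)" using k by (auto simp: bad_overflows_def)
    ultimately have "(1 - \<epsilon>) * real N < real (level S i ?s)" by (meson of_nat_le_iff order_less_le_trans)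
    moreover have "overflows S i t \<le> overflows S i ?s + card ?B"
    proof -
      have "?V \<subseteq> {m. arrival_time \<tau> m \<le> ?s \<and> i \<le> queue_seen S m} \<union> ?B"
      proof
        fix m assume m: "m \<in> ?V"
        show "m \<in> {m. arrival_time \<tau> m \<le> ?s \<and> i \<le> queue_seen S m} \<union> ?B"
        proof (cases "m \<in> ?B")
          case False
          then have "m \<le> k" using kmax m by auto
          then have "arrival_time \<tau> m \<le> ?s" using arrival_time_less[of k m] by linarith
          then show ?thesis using m by auto
        qed simp
      qed
      then have "card ?V \<le> card ({m. arrival_time \<tau> m \<le> ?s \<and> i \<le> queue_seen S m} \<union> ?B)"
        by (rule card_mono[rotated]) (use finB finite_arrivals' in auto)
      also have "\<dots> \<le> overflows S i ?s + card ?B" unfolding overflows_def by (rule card_Un_le)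
      finally show ?thesis by (simp add: overflows_def)
    qed
    moreover have "?s \<in> {0..t}" using k arrival_time_pos[of k] by auto
    ultimately show ?thesis by blast
  qed
qed

lemma queue_constant_off:
  assumes "\<And>z. 0 < S z"
  shows "constant_off (\<lambda>t. map (\<lambda>j. queue S j t) [0..<N]) T (\<Union>j<N. event_times S j T)"
  unfolding constant_off_def
proof (intro conjI ballI impI)
  show "finite (\<Union>j<N. event_times S j T)" using finite_event_times[OF assms] by auto
  show "(\<Union>j<N. event_times S j T) \<subseteq> {0<..T}" using event_times_subset[where S = S, OF assms] by blast
  fix s t assume st: "s \<in> {0..T}" "t \<in> {0..T}" and same: "\<forall>r\<in>\<Union>j<N. event_times S j T. r \<le> s \<longleftrightarrow> r \<le> t"
  have "queue S j s = queue S j t" if j: "j < N" for j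
  proof -
    have "(arrival z \<le> s \<and> s < departure S z) = (arrival z \<le> t \<and> t < departure S z)" if z: "z \<in> tasks_at S j" for z
    proof -
      have "departure S z \<le> s \<longleftrightarrow> departure S z \<le> t"
      proof (cases "departure S z \<le> T")
        case True
        then have "departure S z \<in> (\<Union>j<N. event_times S j T)"
          using z j unfolding event_times_def[OF assms] by auto
        then show ?thesis using same by blast
      qed (use st in auto)
      moreover have "arrival z \<le> s \<longleftrightarrow> arrival z \<le> t"
        using z
      proof (cases rule: tasks_at_cases)
        case (2 k)
        show ?thesis
        proof (cases "arrival_time \<tau> k \<le> T")
          case True
          then have "arrival_time \<tau> k \<in> (\<Union>j<N. event_times S j T)"
            using z j 2 unfolding event_times_def[OF assms] by auto
          then have "arrival_time \<tau> k \<le> s \<longleftrightarrow> arrival_time \<tau> k \<le> t" using same by blast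
          then show ?thesis using 2 by simp
        qed (use st 2 in auto)
      qed (use st in auto)
      ultimately show ?thesis by auto
    qed
    then show ?thesis unfolding queue_def by (metis (no_types, lifting))
  qed
  then show "map (\<lambda>j. queue S j s) [0..<N] = map (\<lambda>j. queue S j t) [0..<N]" by simp
qed

context
  fixes S :: "source \<Rightarrow> real"
  assumes S_pos: "\<And>z. 0 < S z"
begin

lemma finite_departures_from: "finite (departures_from S i j t)"
  unfolding departures_from_def by (rule finite_departed[OF S_pos])

lemma level_eq_sum: "int (level S i t) = (\<Sum>j<N. int (if i \<le> queue S j t then 1 else 0))"
proof -
  have "int (level S i t) = (\<Sum>j\<in>{j\<in>{..<N}. i \<le> queue S j t}. 1)" by (simp add: level_def)
  also have "\<dots> = (\<Sum>j<N. int (if i \<le> queue S j t then 1 else 0))" by (subst sum.inter_filter) (auto intro!: sum.cong)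
  finally show ?thesis .
qed

lemma level_change:
  assumes "0 \<le> t" "1 \<le> i"
  shows "int (level S i t) = int (level S i 0) + int (card {k. arrival_time \<tau> k \<le> t \<and> admitted S k \<and> chosen S k < N \<and> queue_seen S k = i - 1})
    - int (\<Sum>j<N. card (departures_from S i j t))"
proof -
  let ?U = "\<lambda>j. {k. arrival_time \<tau> k \<le> t \<and> admitted S k \<and> chosen S k = j \<and> queue_seen S k = i - 1}"
  have "card {k. arrival_time \<tau> k \<le> t \<and> admitted S k \<and> chosen S k < N \<and> queue_seen S k = i - 1} = card (\<Union>j<N. ?U j)"
    by (intro arg_cong[where f = card]) auto
  also have "\<dots> = (\<Sum>j<N. card (?U j))"
    by (rule card_UN_disjoint) (auto intro!: finite_arrivals')
  finally have U: "int (card {k. arrival_time \<tau> k \<le> t \<and> admitted S k \<and> chosen S k < N \<and> queue_seen S k = i - 1}) = (\<Sum>j<N. int (card (?U j)))"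
    by simp
  show ?thesis
    unfolding level_eq_sum U level_crossings[where S = S, OF S_pos assms] departures_from_def[symmetric]
    by (simp add: sum.distrib sum_subtractf)
qed

text \<open>An arrival enters level \<open>i\<close> iff it overflows level \<open>i - 1\<close> but not level \<open>i\<close>; it is admitted because of \<open>i \<le> b\<close>.\<close>

lemma level_balance:
  assumes "0 \<le> t" "1 \<le> i" "enat i \<le> b" and valid: "\<And>k. chosen S k < N"
  shows "int (level S i t) = int (level S i 0) + int (overflows S (i - 1) t) - int (overflows S i t)
    - int (\<Sum>j<N. card (departures_from S i j t))"
proof -
  have "{k. arrival_time \<tau> k \<le> t \<and> admitted S k \<and> chosen S k < N \<and> queue_seen S k = i - 1} = {k. arrival_time \<tau> k \<le> t \<and> queue_seen S k = i - 1}"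
  proof -
    have "enat (i - 1) < b" using assms(2,3) by (metis diff_less enat_ord_simps(2) less_le_trans less_numeral_extra(1) linorder_not_le not_one_le_zero zero_less_iff_neq_zero)
    then show ?thesis using valid by (auto simp: admitted_def)
  qed
  moreover have "overflows S (i - 1) t = overflows S i t + card {k. arrival_time \<tau> k \<le> t \<and> queue_seen S k = i - 1}"
    unfolding overflows_def using assms(2)
    by (subst card_Un_disjoint[symmetric]) (auto intro!: finite_arrivals' arg_cong[where f = card])
  ultimately show ?thesis using level_change[OF assms(1,2)] by simp
qed

text \<open>Every arrival that enters a level above \<open>m\<close> overflows level \<open>m\<close>; the departures only help.\<close>

lemma level_tail:
  assumes t: "0 \<le> t"
  shows "(\<Sum>i\<in>{m<..J}. level S i t) \<le> (\<Sum>i\<in>{m<..J}. level S i 0) + overflows S m t"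
proof -
  let ?U = "\<lambda>i. {k. arrival_time \<tau> k \<le> t \<and> admitted S k \<and> chosen S k < N \<and> queue_seen S k = i - 1}"
  have "level S i t \<le> level S i 0 + card (?U i)" if "i \<in> {m<..J}" for i
  proof -
    have "1 \<le> i" using that by simp
    from level_change[OF t this] show ?thesis by linarith
  qed
  then have "(\<Sum>i\<in>{m<..J}. level S i t) \<le> (\<Sum>i\<in>{m<..J}. level S i 0 + card (?U i))" by (rule sum_mono)
  also have "\<dots> = (\<Sum>i\<in>{m<..J}. level S i 0) + card (\<Union>i\<in>{m<..J}. ?U i)"
    by (subst card_UN_disjoint) (auto intro!: finite_arrivals' simp: sum.distrib)
  also have "card (\<Union>i\<in>{m<..J}. ?U i) \<le> overflows S m t"
    unfolding overflows_def by (intro card_mono finite_arrivals') auto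
  finally show ?thesis by simp
qed

lemma queue_0:
  assumes "j < N" shows "queue S j 0 = x0 ! j"
proof -
  have "{z \<in> tasks_at S j. arrival z \<le> 0 \<and> 0 < departure S z} = Residual j ` {..<x0 ! j}"
  proof (intro equalityI subsetI)
    fix z assume "z \<in> {z \<in> tasks_at S j. arrival z \<le> 0 \<and> 0 < departure S z}"
    then have "z \<in> tasks_at S j" "arrival z \<le> 0" by auto
    then show "z \<in> Residual j ` {..<x0 ! j}"
    proof (cases rule: tasks_at_cases)
      case (2 k)
      then show ?thesis using arrival_time_pos[of k] \<open>arrival z \<le> 0\<close> by simp
    qed auto
  next
    fix z assume "z \<in> Residual j ` {..<x0 ! j}"
    then show "z \<in> {z \<in> tasks_at S j. arrival z \<le> 0 \<and> 0 < departure S z}"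
      using assms arrival_less_departure[where S = S, OF S_pos, of z] by (auto simp: tasks_at_def)
  qed
  then show ?thesis by (simp add: queue_def card_image inj_on_def)
qed

lemma queue_le_buffer:
  assumes j: "j < N" and x0: "enat (x0 ! j) \<le> b" and t: "0 \<le> t"
  shows "enat (queue S j t) \<le> b"
proof (cases b)
  case (enat n)
  then have nb: "\<not> enat n < b" and x0n: "x0 ! j \<le> n" using x0 by auto
  have "card {k. arrival_time \<tau> k \<le> t \<and> admitted S k \<and> chosen S k = j \<and> queue_seen S k = Suc n - 1} = 0"
    using nb by (auto simp: admitted_def card_eq_0_iff)
  moreover have "\<not> Suc n \<le> queue S j 0" using x0n queue_0[OF j] by simp
  ultimately have "int (if Suc n \<le> queue S j t then 1 else 0) \<le> 0"
    using level_crossings[where S = S and j = j and i = "Suc n", OF S_pos t] by simp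
  then have "enat (queue S j t) \<le> enat n" by (simp split: if_splits)
  then show ?thesis using enat by metis
qed simp

end

section \<open>Causality\<close>

text \<open>Shorten the service requirement of the task \<open>z\<close> to \<open>x\<close>, so that it leaves at time \<open>v\<close> instead of later. Nothing that
  happens before time \<open>v\<close> changes. In the comparison, all times from \<open>v\<close> on are
  identified.\<close>

definition agree_before :: "real \<Rightarrow> real \<Rightarrow> real \<Rightarrow> bool" where
  "agree_before v u u' \<longleftrightarrow> u = u' \<or> v \<le> u \<and> v \<le> u'"

lemma start_cong_Service:
  "(\<And>z. z \<noteq> Service k \<Longrightarrow> S z = S' z) \<Longrightarrow> start S (Service k) = start S' (Service k)"
proof -
  assume eq: "\<And>z. z \<noteq> Service k \<Longrightarrow> S z = S' z"
  have "m \<le> k \<Longrightarrow> hist S m = hist S' m" for m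
  proof (induction m)
    case 0
    show ?case using eq by (simp add: hist_def cong: map_cong)
  next
    case (Suc m)
    then have h: "hist S m = hist S' m" by simp
    then have c: "chosen S m = chosen S' m" by (simp add: chosen_def)
    then have "admitted S m = admitted S' m" using h by (simp add: admitted_def queue_seen_def)
    moreover have "departure S (Service m) = departure S' (Service m)"
      using h c eq[of "Service m"] Suc by (simp add: departure_def)
    ultimately show ?case using h c by (simp add: hist_Suc)
  qed
  then have "hist S k = hist S' k" by simp
  then show ?thesis by (simp add: chosen_def)
qed

context
  fixes S S' :: "source \<Rightarrow> real" and z :: source and x v :: real
  assumes S_pos: "\<And>z. 0 < S z" and x: "0 < x" "x < S z" and z: "(\<exists>j l. z = Residual j l) \<or> (\<exists>k. z = Service k)"
    and S'_eq: "S' = S(z := x)" and v_eq: "v = start S z + x"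
begin

lemma shortened: "S' z = x" "z' \<noteq> z \<Longrightarrow> S' z' = S z'" "S' z' \<le> S z'" "0 < S' z'"
  using x S_pos by (auto simp: S'_eq)

lemma start_changed: "start S' z = start S z"
  using z by (auto intro!: sum.cong start_cong_Service simp: S'_eq)

lemma departure_changed: "departure S' z = v" "v < departure S z"
  using x by (auto simp: departure_def start_changed shortened v_eq)

lemma agree_start_residual: "agree_before v (start S (Residual j l)) (start S' (Residual j l))"
proof (cases "\<exists>l0<l. z = Residual j l0")
  case True
  then obtain l0 where l0: "l0 < l" "z = Residual j l0" by blast
  have "v = (\<Sum>i<Suc l0. S' (Residual j i))"
    using departure_changed(1) l0 by (simp add: departure_def)
  also have "\<dots> \<le> (\<Sum>i<l. S' (Residual j i))" using l0 shortened(4) by (intro sum_mono2) (auto intro: less_imp_le)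
  finally have 1: "v \<le> start S' (Residual j l)" by simp
  have "start S' (Residual j l) \<le> start S (Residual j l)" using shortened(3) by (auto intro!: sum_mono)
  with 1 show ?thesis by (simp add: agree_before_def)
next
  case False
  then have "S (Residual j i) = S' (Residual j i)" if "i < l" for i using shortened(2)[of "Residual j i"] that by auto
  then have "start S (Residual j l) = start S' (Residual j l)" by simp
  then show ?thesis by (simp add: agree_before_def)
qed

lemma agree_departure:
  assumes "agree_before v (start S z') (start S' z')"
  shows "z' \<noteq> z \<Longrightarrow> departure S z' = departure S' z' \<or> v < departure S z' \<and> v < departure S' z'"
    and "agree_before v (departure S z') (departure S' z')"
proof -
  show 1: "departure S z' = departure S' z' \<or> v < departure S z' \<and> v < departure S' z'" if "z' \<noteq> z"
  proof (cases "start S z' = start S' z'")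
    case True
    then show ?thesis using that shortened(2)[of z'] by (simp add: departure_def)
  next
    case False
    then have "v \<le> start S z'" "v \<le> start S' z'" using assms by (auto simp: agree_before_def)
    then show ?thesis using S_pos[of z'] shortened(4)[of z'] unfolding departure_def by linarith
  qed
  show "agree_before v (departure S z') (departure S' z')"
    using 1 departure_changed by (cases "z' = z") (auto simp: agree_before_def)
qed

lemma agree_Max:
  assumes fin: "finite A" and agree: "\<And>a. a \<in> A \<Longrightarrow> agree_before v (f a) (g a)"
  shows "agree_before v (Max (insert 0 (f ` A))) (Max (insert 0 (g ` A)))"
proof -
  have *: "Max (insert 0 (f ` A)) = Max (insert 0 (g ` A))"
    if "Max (insert 0 (f ` A)) < v" "\<And>a. a \<in> A \<Longrightarrow> agree_before v (f a) (g a)" for f g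
  proof -
    have "f a < v" if "a \<in> A" for a
      using Max_ge[of "insert 0 (f ` A)" "f a"] that \<open>Max (insert 0 (f ` A)) < v\<close> fin by auto
    then have "f a = g a" if "a \<in> A" for a
      using \<open>\<And>a. a \<in> A \<Longrightarrow> agree_before v (f a) (g a)\<close>[OF that] that unfolding agree_before_def by (metis linorder_not_le)
    then have "f ` A = g ` A" by (rule image_cong[OF refl])
    then show ?thesis by (simp only:)
  qed
  have "agree_before v (g a) (f a)" if "a \<in> A" for a using agree[OF that] by (auto simp: agree_before_def)
  then show ?thesis using *[of f g] *[of g f] agree unfolding agree_before_def by (metis linorder_not_le)
qed

text \<open>Up to the arrival \<open>k\<close>, departure times matter only through their comparison with earlier times or as starts of
  services, and both are unaffected before \<open>v\<close>.\<close>

lemma causal_arrivals: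
  assumes "arrival_time \<tau> k < v"
  shows "chosen S k = chosen S' k \<and> queue_seen S k = queue_seen S' k \<and> admitted S k = admitted S' k \<and>
    agree_before v (start S (Service k)) (start S' (Service k))"
  using assms
proof (induction k rule: less_induct)
  case (less k)
  have IH: "chosen S m = chosen S' m \<and> queue_seen S m = queue_seen S' m \<and> admitted S m = admitted S' m \<and>
      agree_before v (start S (Service m)) (start S' (Service m))" if "m < k" for m
    using less.IH[OF that] less.prems arrival_time_less[of m k] that by (meson less_trans)
  have same: "{z' \<in> tasks_at S j. before k z'} = {z' \<in> tasks_at S' j. before k z'}" for j
    using IH by (auto simp: tasks_at_def)
  have agree: "agree_before v (departure S z') (departure S' z')" if "z' \<in> tasks_at S j" "before k z'" for j z'
    using that(1)
  proof (cases rule: tasks_at_cases)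
    case (1 l)
    then show ?thesis using agree_departure(2)[OF agree_start_residual] by (simp only:)
  next
    case (2 m)
    then have "m < k" using that(2) by simp
    then show ?thesis using agree_departure(2) IH[of m] 2 by blast
  qed
  have ql: "queue_length (hist S k) j (arrival_time \<tau> k) = queue_length (hist S' k) j (arrival_time \<tau> k)" for j
  proof -
    have "arrival_time \<tau> k < departure S z' \<longleftrightarrow> arrival_time \<tau> k < departure S' z'" if "z' \<in> tasks_at S j" "before k z'" for z'
      using agree[OF that] less.prems by (auto simp: agree_before_def)
    then have "{z' \<in> tasks_at S j. before k z' \<and> arrival z' \<le> arrival_time \<tau> k \<and> arrival_time \<tau> k < departure S z'} =
        {z' \<in> tasks_at S' j. before k z' \<and> arrival z' \<le> arrival_time \<tau> k \<and> arrival_time \<tau> k < departure S' z'}"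
      using same[of j] by blast
    then show ?thesis by (simp add: queue_length_hist)
  qed
  then have c: "chosen S k = chosen S' k" by (simp add: chosen_def)
  moreover from this have q: "queue_seen S k = queue_seen S' k" using ql by (simp add: queue_seen_def)
  moreover have "agree_before v (start S (Service k)) (start S' (Service k))"
  proof -
    have "agree_before v (free_from (hist S k) (chosen S k)) (free_from (hist S' k) (chosen S k))"
      unfolding free_from_hist same[symmetric] by (rule agree_Max[OF finite_tasks_before]) (use agree in blast)
    then show ?thesis using c less.prems by (auto simp: agree_before_def)
  qed
  ultimately show ?case by (simp add: admitted_def)
qed

lemma causal_tasks:
  assumes "arrival z' < v"
  shows "z' \<in> tasks_at S j \<longleftrightarrow> z' \<in> tasks_at S' j"
    and "z' \<in> tasks_at S j \<Longrightarrow> agree_before v (start S z') (start S' z')"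
proof -
  show "z' \<in> tasks_at S j \<longleftrightarrow> z' \<in> tasks_at S' j"
    using assms causal_arrivals by (auto simp: tasks_at_def)
  assume "z' \<in> tasks_at S j"
  then show "agree_before v (start S z') (start S' z')"
  proof (cases rule: tasks_at_cases)
    case (1 l)
    then show ?thesis using agree_start_residual by (simp only:)
  next
    case (2 k)
    then have "arrival_time \<tau> k < v" using assms by simp
    then show ?thesis using causal_arrivals 2 by blast
  qed
qed

lemma causal_departure:
  assumes "z' \<in> tasks_at S j" "arrival z' < v"
  shows "agree_before v (departure S z') (departure S' z')"
    and "z' \<noteq> z \<Longrightarrow> departure S z' = departure S' z' \<or> v < departure S z' \<and> v < departure S' z'"
  using agree_departure[OF causal_tasks(2)[OF assms(2,1)]] by blast+

lemma causal_queue: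
  assumes "s < v" shows "queue S j s = queue S' j s"
proof -
  have "z' \<in> tasks_at S j \<and> s < departure S z' \<longleftrightarrow> z' \<in> tasks_at S' j \<and> s < departure S' z'" if "arrival z' \<le> s" for z'
    using causal_tasks(1)[of z' j] causal_departure(1)[of z' j] that assms by (auto simp: agree_before_def)
  then have "{z' \<in> tasks_at S j. arrival z' \<le> s \<and> s < departure S z'} = {z' \<in> tasks_at S' j. arrival z' \<le> s \<and> s < departure S' z'}"
    by blast
  then show ?thesis by (simp add: queue_def)
qed

lemma causal_queue_left:
  assumes "s \<le> v" shows "queue_left S j s = queue_left S' j s"
proof -
  have "z' \<in> tasks_at S j \<and> s \<le> departure S z' \<longleftrightarrow> z' \<in> tasks_at S' j \<and> s \<le> departure S' z'" if "arrival z' < s" for z'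
    using causal_tasks(1)[of z' j] causal_departure(1)[of z' j] that assms by (auto simp: agree_before_def)
  then have "{z' \<in> tasks_at S j. arrival z' < s \<and> s \<le> departure S z'} = {z' \<in> tasks_at S' j. arrival z' < s \<and> s \<le> departure S' z'}"
    by blast
  then show ?thesis by (simp add: queue_left_def)
qed

lemma causal_departures_from:
  assumes "z' \<noteq> z" "v \<le> t" "z' \<in> tasks_at S j \<Longrightarrow> departure S z' \<noteq> v"
  shows "z' \<in> departures_from S' i j t \<and> departure S' z' \<le> v \<longleftrightarrow> z' \<in> departures_from S i j v"
    and "z' \<in> departures_from S i j v \<Longrightarrow> departure S' z' < v"
proof -
  have *: "departure S' z' = departure S z'" if "z' \<in> tasks_at S j" "arrival z' < v" "departure S z' \<le> v \<or> departure S' z' \<le> v"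
    using causal_departure(2)[OF that(1,2) assms(1)] that(3) by auto
  have a: "arrival z' < departure S z'" "arrival z' < departure S' z'"
    using arrival_less_departure[where S = S, OF S_pos] arrival_less_departure[where S = S', OF shortened(4)] by blast+
  show "z' \<in> departures_from S' i j t \<and> departure S' z' \<le> v \<longleftrightarrow> z' \<in> departures_from S i j v"
  proof
    assume l: "z' \<in> departures_from S' i j t \<and> departure S' z' \<le> v"
    then have 1: "arrival z' < v" using a by (auto simp: departures_from_def)
    then have "z' \<in> tasks_at S j" using l causal_tasks(1)[of z' j] by (auto simp: departures_from_def)
    then show "z' \<in> departures_from S i j v"
      using l * 1 causal_queue_left[of "departure S' z'" j] by (auto simp: departures_from_def)
  next
    assume r: "z' \<in> departures_from S i j v"
    then have 1: "arrival z' < v" "z' \<in> tasks_at S j" using a by (auto simp: departures_from_def)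
    then show "z' \<in> departures_from S' i j t \<and> departure S' z' \<le> v"
      using r * causal_tasks(1)[of z' j] causal_queue_left[of "departure S z'" j] assms(2) by (auto simp: departures_from_def)
  qed
  show "departure S' z' < v" if r: "z' \<in> departures_from S i j v"
  proof -
    have 1: "arrival z' < v" "z' \<in> tasks_at S j" "departure S z' \<le> v" using a r by (auto simp: departures_from_def)
    then show ?thesis using * assms(3) by auto
  qed
qed

end
end

section \<open>The compensated departure count\<close>

instance source :: countable by countable_datatype

lemma measurable_card_countable:
  fixes A :: "'w \<Rightarrow> 'c :: countable set"
  assumes "\<And>c. {w \<in> space M. c \<in> A w} \<in> sets M"
  shows "(\<lambda>w. card (A w)) \<in> M \<rightarrow>\<^sub>M count_space UNIV"
proof -
  have "(\<lambda>w. card (to_nat ` A w)) \<in> M \<rightarrow>\<^sub>M count_space UNIV"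
  proof (rule measurable_card)
    fix i :: nat
    have "{w \<in> space M. i \<in> to_nat ` A w} = (\<Union>c\<in>{c. to_nat c = i}. {w \<in> space M. c \<in> A w})" by auto
    also have "\<dots> \<in> sets M" by (intro sets.countable_UN'' assms) auto
    finally show "{w \<in> space M. i \<in> to_nat ` A w} \<in> sets M" .
  qed
  moreover have "card (to_nat ` A w) = card (A w)" for w by (rule card_image) simp
  ultimately show ?thesis by simp
qed

text \<open>The product rule for \<open>C\<^sup>2\<close>: the difference of both sides has increments of second order.\<close>

lemma integral_square:
  fixes c :: "real \<Rightarrow> real"
  assumes c: "c \<in> borel_measurable borel" and B: "\<And>s. 0 \<le> s \<Longrightarrow> \<bar>c s\<bar> \<le> B" and t: "0 \<le> t"
  defines "C \<equiv> \<lambda>t. LINT s:{0..t}|lborel. c s"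
  assumes Cm: "C \<in> borel_measurable borel"
  shows "(C t)\<^sup>2 = 2 * (LINT s:{0..t}|lborel. C s * c s)"
proof -
  have B0: "0 \<le> B" using B[of 0] by simp
  have dC: "C v - C u = (LINT s:{u..v}|lborel. c s)" if "0 \<le> u" "u \<le> v" for u v
    unfolding C_def by (rule LINT_split[OF c B that])
  have lip: "\<bar>C v - C u\<bar> \<le> B * \<bar>v - u\<bar>" if "0 \<le> u" "0 \<le> v" for u v
  proof -
    have *: "\<bar>C v - C u\<bar> \<le> B * (v - u)" if "0 \<le> u" "u \<le> v" for u v
      unfolding dC[OF that] by (rule LINT_abs_le[OF c]) (use B that in auto)
    show ?thesis using *[of u v] *[of v u] that by (cases "u \<le> v") (auto simp: abs_minus_commute)
  qed
  have C0: "C 0 = 0" unfolding C_def by (rule LINT_point)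
  have CB: "\<bar>C s\<bar> \<le> B * r" if "0 \<le> s" "s \<le> r" for s r
  proof -
    have "\<bar>C s\<bar> \<le> B * s" using lip[of 0 s] that C0 by simp
    also have "\<dots> \<le> B * r" using that B0 by (intro mult_left_mono) auto
    finally show ?thesis .
  qed
  have Ccm: "(\<lambda>s. C s * c s) \<in> borel_measurable borel" using Cm c by measurable
  have ci: "set_integrable lborel {u..v} c" if "0 \<le> u" for u v
    by (rule set_integrable_bounded[OF c B]) (use that in auto)
  have Cci: "set_integrable lborel {u..v} (\<lambda>s. C s * c s)" if "0 \<le> u" for u v
  proof (rule set_integrable_bounded[OF Ccm])
    fix s assume s: "s \<in> {u..v}"
    then have "\<bar>C s\<bar> * \<bar>c s\<bar> \<le> (B * v) * B" using that B0 by (intro mult_mono CB B) auto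
    then show "\<bar>C s * c s\<bar> \<le> (B * v) * B" by (simp add: abs_mult)
  qed
  define f where "f t = (C t)\<^sup>2 - 2 * (LINT s:{0..t}|lborel. C s * c s)" for t
  have incr: "\<bar>f v - f u\<bar> \<le> 4 * B\<^sup>2 * (v - u)\<^sup>2" if uv: "0 \<le> u" "u \<le> v" for u v
  proof -
    have "(LINT s:{0..v}|lborel. C s * c s) - (LINT s:{0..u}|lborel. C s * c s) = (LINT s:{u..v}|lborel. C s * c s)"
    proof -
      have "integral {0..u} (\<lambda>s. C s * c s) + integral {u..v} (\<lambda>s. C s * c s) = integral {0..v} (\<lambda>s. C s * c s)"
        by (intro Henstock_Kurzweil_Integration.integral_combine uv set_borel_integral_eq_integral(1)[OF Cci]) simp
      then show ?thesis using Cci uv by (simp add: set_borel_integral_eq_integral(2))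
    qed
    also have "\<dots> = C u * (C v - C u) + (LINT s:{u..v}|lborel. (C s - C u) * c s)"
    proof -
      have "set_integrable lborel {u..v} (\<lambda>s. C u * c s)" using ci uv by simp
      then have "(LINT s:{u..v}|lborel. C s * c s - C u * c s) = (LINT s:{u..v}|lborel. C s * c s) - C u * (LINT s:{u..v}|lborel. c s)"
        using Cci uv by (subst set_integral_diff) auto
      then show ?thesis using dC[OF uv] by (simp add: algebra_simps)
    qed
    finally have "f v - f u = (C v - C u)\<^sup>2 - 2 * (LINT s:{u..v}|lborel. (C s - C u) * c s)"
      unfolding f_def by (simp add: power2_eq_square algebra_simps)
    moreover have "\<bar>(C v - C u)\<^sup>2\<bar> \<le> B\<^sup>2 * (v - u)\<^sup>2"
      using power_mono[OF lip[of u v], of 2] uv by (simp add: power_mult_distrib)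
    moreover have "\<bar>LINT s:{u..v}|lborel. (C s - C u) * c s\<bar> \<le> (B * (v - u) * B) * (v - u)"
    proof (rule LINT_abs_le)
      fix s assume s: "s \<in> {u..v}"
      have "\<bar>C s - C u\<bar> \<le> B * \<bar>s - u\<bar>" by (rule lip) (use s uv in auto)
      also have "\<dots> \<le> B * (v - u)" using s B0 by (intro mult_left_mono) auto
      finally have "\<bar>C s - C u\<bar> * \<bar>c s\<bar> \<le> (B * (v - u)) * B"
        using B[of s] s uv by (intro mult_mono) auto
      then show "\<bar>(C s - C u) * c s\<bar> \<le> B * (v - u) * B" by (simp add: abs_mult)
    qed (use Cm c uv in measurable)
    moreover have "(B * (v - u) * B) * (v - u) = B\<^sup>2 * (v - u)\<^sup>2" by (simp add: power2_eq_square)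
    moreover have "0 \<le> B\<^sup>2 * (v - u)\<^sup>2" "0 \<le> (C v - C u)\<^sup>2" by simp_all
    ultimately show ?thesis by linarith
  qed
  have "f t = f 0"
  proof (rule constant_if_quadratic_increments[where T = t])
    fix s assume s: "s \<in> {0..t}"
    show "\<exists>C. \<exists>\<epsilon>>0. \<forall>r\<in>{0..t}. \<bar>r - s\<bar> < \<epsilon> \<longrightarrow> \<bar>f r - f s\<bar> \<le> C * (r - s)\<^sup>2"
    proof (intro exI conjI ballI impI)
      fix r assume "r \<in> {0..t}"
      then show "\<bar>f r - f s\<bar> \<le> 4 * B\<^sup>2 * (r - s)\<^sup>2"
        using incr[of s r] incr[of r s] s by (cases "s \<le> r") (auto simp: abs_minus_commute power2_commute)
    qed (rule zero_less_one)
  qed (use t in auto)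
  moreover have "f 0 = 0" using LINT_point[of 0 "\<lambda>s. C s * c s"] C0 by (simp add: f_def)
  ultimately show ?thesis by (simp add: f_def)
qed

text \<open>The square of a count, as a sum over the counted points of odd numbers \<open>2 r + 1\<close>, where \<open>r\<close> is the rank. Ties count half.\<close>

lemma square_eq_sum_ranks:
  fixes f :: "'a \<Rightarrow> real"
  assumes "finite A"
  shows "(real (card A))\<^sup>2 = (\<Sum>a\<in>A. \<Sum>a'\<in>A. if f a' < f a then 2 else if f a' = f a then 1 else 0)" (is "_ = ?R")
proof -
  let ?g = "\<lambda>a a'. (if f a' < f a then 2 else if f a' = f a then 1 else 0) :: real"
  have "?R = (\<Sum>a\<in>A. \<Sum>a'\<in>A. ?g a' a)" by (rule sum.swap)
  then have "2 * ?R = (\<Sum>a\<in>A. \<Sum>a'\<in>A. ?g a a' + ?g a' a)" by (simp add: sum.distrib)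
  also have "\<dots> = (\<Sum>a\<in>A. \<Sum>a'\<in>A. 2)" by (intro sum.cong refl) auto
  finally show ?thesis by (simp add: power2_eq_square)
qed

context jsq_data
begin

definition counted :: "(source \<Rightarrow> real) \<Rightarrow> nat \<Rightarrow> real \<Rightarrow> source set" where
  "counted S i t = (\<Union>j<N. departures_from S i j t)"

definition at_level :: "(source \<Rightarrow> real) \<Rightarrow> nat \<Rightarrow> real \<Rightarrow> nat" where
  "at_level S i s = card {j. j < N \<and> queue S j s = i}"

definition time_at_level :: "(source \<Rightarrow> real) \<Rightarrow> nat \<Rightarrow> real \<Rightarrow> real" where
  "time_at_level S i t = (LINT s:{0..t}|lborel. real (at_level S i s))"

text \<open>Twice the number of earlier departures plus the number of simultaneous ones, \<open>z\<close> included, so that the sum of the ranks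
  is the square of the number of departures.\<close>

definition rank_of :: "(source \<Rightarrow> real) \<Rightarrow> nat \<Rightarrow> real \<Rightarrow> source \<Rightarrow> real" where
  "rank_of S i t z = 2 * real (card {z' \<in> counted S i t. departure S z' < departure S z}) +
     real (card {z' \<in> counted S i t. departure S z' = departure S z})"

end

context jsq_arrivals
begin

lemma tasks_at_disjoint: "z \<in> tasks_at S j \<Longrightarrow> z \<in> tasks_at S j' \<Longrightarrow> j = j'"
  by (auto simp: tasks_at_def)

lemma counted_iff: "z \<in> tasks_at S j \<Longrightarrow> j < N \<Longrightarrow> z \<in> counted S i t \<longleftrightarrow> z \<in> departures_from S i j t"
  using tasks_at_disjoint by (auto simp: counted_def departures_from_def)

lemma counted_subset: "z \<in> counted S i t \<Longrightarrow> \<exists>j<N. z \<in> tasks_at S j"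
  by (auto simp: counted_def departures_from_def)

lemma counted_departure: "z \<in> counted S i t \<Longrightarrow> departure S z \<le> t"
  by (auto simp: counted_def departures_from_def)

lemma counted_mono: "s \<le> t \<Longrightarrow> z \<in> counted S i s \<longleftrightarrow> z \<in> counted S i t \<and> departure S z \<le> s"
  by (auto simp: counted_def departures_from_def)

lemma queue_borel: "(\<lambda>s. queue S j s) \<in> borel \<rightarrow>\<^sub>M count_space UNIV"
  unfolding queue_def by (rule measurable_card_countable) auto

lemma at_level_borel: "(\<lambda>s. at_level S i s) \<in> borel \<rightarrow>\<^sub>M count_space UNIV"
proof -
  have [measurable]: "(\<lambda>s. queue S j s) \<in> borel \<rightarrow>\<^sub>M count_space UNIV" for j by (rule queue_borel)
  show ?thesis unfolding at_level_def by measurable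
qed

lemma at_level_real_borel: "(\<lambda>s. real (at_level S i s)) \<in> borel_measurable borel"
  using measurable_compose[OF at_level_borel, of real borel] by simp

lemma at_level_le: "at_level S i s \<le> N"
  unfolding at_level_def using card_mono[of "{..<N}" "{j. j < N \<and> queue S j s = i}"] by auto

lemma time_at_level_increment:
  assumes "0 \<le> s" "s \<le> t"
  shows "time_at_level S i t - time_at_level S i s = (LINT r:{s..t}|lborel. real (at_level S i r))"
    and "0 \<le> time_at_level S i t - time_at_level S i s" and "time_at_level S i t - time_at_level S i s \<le> real N * (t - s)"
proof -
  show 1: "time_at_level S i t - time_at_level S i s = (LINT r:{s..t}|lborel. real (at_level S i r))"
    unfolding time_at_level_def
    by (rule LINT_split[OF at_level_real_borel, where B = "real N"]) (use assms at_level_le in auto)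
  show "0 \<le> time_at_level S i t - time_at_level S i s"
    unfolding 1 set_lebesgue_integral_def by (intro Bochner_Integration.integral_nonneg) auto
  have "\<bar>LINT r:{s..t}|lborel. real (at_level S i r)\<bar> \<le> real N * (t - s)"
    by (rule LINT_abs_le[OF at_level_real_borel]) (use assms at_level_le in auto)
  then show "time_at_level S i t - time_at_level S i s \<le> real N * (t - s)" unfolding 1 by linarith
qed

lemma time_at_level_0: "time_at_level S i 0 = 0"
  unfolding time_at_level_def by (rule LINT_point)

lemma time_at_level_bounds: "0 \<le> t \<Longrightarrow> 0 \<le> time_at_level S i t" "0 \<le> t \<Longrightarrow> time_at_level S i t \<le> real N * t"
  using time_at_level_increment(2,3)[of 0 t S i] time_at_level_0[of S i] by auto

lemma time_at_level_neg: "t < 0 \<Longrightarrow> time_at_level S i t = 0"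
  by (simp add: time_at_level_def set_lebesgue_integral_def)

lemma time_at_level_nonneg: "0 \<le> time_at_level S i t"
  using time_at_level_bounds(1)[of t S i] time_at_level_neg[of t S i] by (cases "0 \<le> t") auto

lemma time_at_level_borel: "time_at_level S i \<in> borel_measurable borel"
proof (rule borel_measurable_mono)
  show "mono (time_at_level S i)"
  proof (rule monoI)
    fix s t :: real assume "s \<le> t"
    then show "time_at_level S i s \<le> time_at_level S i t"
      using time_at_level_increment(2)[of s t S i] time_at_level_neg[of s S i] time_at_level_nonneg[of S i t] by (cases "0 \<le> s") auto
  qed
qed

lemma counted_borel: "(\<lambda>s. real (card (counted S i s))) \<in> borel_measurable borel"
proof -
  have "(\<lambda>s. card (counted S i s)) \<in> borel \<rightarrow>\<^sub>M count_space UNIV"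
    unfolding counted_def departures_from_def by (rule measurable_card_countable) auto
  from measurable_compose[OF this, of real borel] show ?thesis by simp
qed

lemma rank_of_eq_sum:
  assumes "finite (counted S i t)"
  shows "rank_of S i t z = (\<Sum>z'\<in>counted S i t. if departure S z' < departure S z then 2 else if departure S z' = departure S z then 1 else 0)"
proof -
  let ?A = "counted S i t"
  have "(\<Sum>z'\<in>?A. if departure S z' < departure S z then 2 else if departure S z' = departure S z then 1 else 0) =
    (\<Sum>z'\<in>?A. 2 * of_bool (departure S z' < departure S z) + of_bool (departure S z' = departure S z) :: real)"
    by (intro sum.cong) auto
  also have "\<dots> = rank_of S i t z"
    unfolding rank_of_def sum.distrib sum_distrib_left[symmetric] of_bool_def
    using assms by (simp add: sum.If_cases Int_def)
  finally show ?thesis by simp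
qed

context
  fixes S :: "source \<Rightarrow> real"
  assumes S_pos: "\<And>z. 0 < S z"
begin

lemma finite_counted: "finite (counted S i t)"
  unfolding counted_def using finite_departures_from[where S = S, OF S_pos] by auto

lemma card_counted: "card (counted S i t) = (\<Sum>j<N. card (departures_from S i j t))"
  unfolding counted_def using finite_departures_from[where S = S, OF S_pos] tasks_at_disjoint
  by (intro card_UN_disjoint) (auto simp: departures_from_def)

text \<open>The square of the compensated count is expanded with nonnegative terms on both sides, so that their expectations
  may be computed separately. The mixed term is split at the departure times: the part of \<open>time_at_level\<close> before a departure
  is known when the task departs, and the part after it is an integral of the number of past departures.\<close>

lemma compensated_square:
  assumes t: "0 \<le> t"
  shows "(real (card (counted S i t)) - time_at_level S i t)\<^sup>2 + 2 * (\<Sum>z\<in>counted S i t. time_at_level S i (departure S z))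
      + 2 * (LINT s:{0..t}|lborel. real (card (counted S i s)) * real (at_level S i s))
    = (\<Sum>z\<in>counted S i t. rank_of S i t z) + 2 * (LINT s:{0..t}|lborel. time_at_level S i s * real (at_level S i s))"
proof -
  let ?A = "counted S i t" and ?C = "time_at_level S i" and ?c = "\<lambda>s. real (at_level S i s)"
  have D2: "(real (card ?A))\<^sup>2 = (\<Sum>z\<in>?A. rank_of S i t z)"
    unfolding rank_of_eq_sum[OF finite_counted] by (rule square_eq_sum_ranks[OF finite_counted])
  have C2: "(?C t)\<^sup>2 = 2 * (LINT s:{0..t}|lborel. ?C s * ?c s)"
    using integral_square[OF at_level_real_borel, of S i "real N" t, folded time_at_level_def] at_level_le time_at_level_borel t
    by (simp add: time_at_level_def[abs_def])
  have dep0: "0 \<le> departure S z" for z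
    using arrival_nonneg[of z] arrival_less_departure[where S = S, OF S_pos, of z] by linarith
  have "real (card ?A) * ?C t = (\<Sum>z\<in>?A. ?C (departure S z)) + (\<Sum>z\<in>?A. LINT s:{departure S z..t}|lborel. ?c s)"
  proof -
    have "real (card ?A) * ?C t = (\<Sum>z\<in>?A. ?C t)" by simp
    also have "\<dots> = (\<Sum>z\<in>?A. ?C (departure S z) + (LINT s:{departure S z..t}|lborel. ?c s))"
    proof (rule sum.cong[OF refl])
      fix z assume "z \<in> ?A"
      from time_at_level_increment(1)[OF dep0 counted_departure[OF this], of S i]
      show "?C t = ?C (departure S z) + (LINT s:{departure S z..t}|lborel. ?c s)" by simp
    qed
    finally show ?thesis by (simp add: sum.distrib)
  qed
  also have "(\<Sum>z\<in>?A. LINT s:{departure S z..t}|lborel. ?c s) = (LINT s:{0..t}|lborel. real (card (counted S i s)) * ?c s)"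
  proof -
    have int: "integrable lborel (\<lambda>s. indicat_real {departure S z..t} s *\<^sub>R ?c s)" for z
      using set_integrable_bounded[OF at_level_real_borel, of "departure S z" t S i "real N"] at_level_le
      by (simp add: set_integrable_def)
    have "(\<Sum>z\<in>?A. LINT s:{departure S z..t}|lborel. ?c s) = (LINT s|lborel. (\<Sum>z\<in>?A. indicat_real {departure S z..t} s *\<^sub>R ?c s))"
      unfolding set_lebesgue_integral_def by (rule Bochner_Integration.integral_sum[symmetric]) (rule int)
    also have "\<dots> = (LINT s:{0..t}|lborel. real (card (counted S i s)) * ?c s)"
      unfolding set_lebesgue_integral_def
    proof (rule Bochner_Integration.integral_cong[OF refl])
      fix s
      show "(\<Sum>z\<in>?A. indicat_real {departure S z..t} s *\<^sub>R ?c s) = indicat_real {0..t} s *\<^sub>R (real (card (counted S i s)) * ?c s)"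
      proof (cases "s \<in> {0..t}")
        case True
        have "counted S i s = {z \<in> ?A. departure S z \<le> s}" using counted_mono[of s t] True by auto
        then have "real (card (counted S i s)) = (\<Sum>z\<in>?A. of_bool (departure S z \<le> s))"
          using finite_counted[of i t] by (simp add: of_bool_def sum.If_cases Int_def)
        then show ?thesis using True by (simp add: sum_distrib_right indicator_def)
      next
        case False
        then have "indicat_real {departure S z..t} s = 0" for z using dep0[of z] by (auto simp: indicator_def)
        then show ?thesis using False by simp
      qed
    qed
    finally show ?thesis .
  qed
  finally show ?thesis using D2 C2 by (simp add: power2_diff algebra_simps)
qed

definition task_sources :: "source set" where
  "task_sources = {z. (\<exists>j l. z = Residual j l) \<or> (\<exists>k. z = Service k)}"

lemma tasks_at_sources: "z \<in> tasks_at S j \<Longrightarrow> z \<in> task_sources"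
  by (auto simp: tasks_at_def task_sources_def)

text \<open>Integrating a functional over the shortened service requirements amounts to integrating over the times at which
  some server is busy: at unit speed, a requirement shortened to \<open>x\<close> is completed at time \<open>start + x\<close>, and the service periods
  of the tasks at one server partition its busy time. By causality, the functionals below depend only on the original path
  before that time, as \<open>pred\<close> requires.\<close>

lemma sum_over_shortenings:
  fixes \<psi> :: "(source \<Rightarrow> real) \<Rightarrow> source \<Rightarrow> real" and g :: "real \<Rightarrow> real"
  assumes t: "0 \<le> t" and i: "1 \<le> i"
    and K: "finite K" "K \<subseteq> task_sources" "\<And>z j. j < N \<Longrightarrow> z \<in> tasks_at S j \<Longrightarrow> arrival z \<le> t \<Longrightarrow> z \<in> K"
    and g: "g \<in> borel_measurable borel" "\<And>s. 0 \<le> g s"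
    and none: "\<And>z x. z \<in> task_sources \<Longrightarrow> 0 < x \<Longrightarrow> x < S z \<Longrightarrow> (\<forall>j<N. z \<notin> tasks_at S j) \<or> t < start S z + x \<Longrightarrow> \<psi> (S(z := x)) z = 0"
    and pred: "\<And>z j x. j < N \<Longrightarrow> z \<in> tasks_at S j \<Longrightarrow> 0 < x \<Longrightarrow> x < S z \<Longrightarrow> start S z + x \<le> t \<Longrightarrow>
      start S z + x \<notin> (\<Union>j<N. event_times S j t) \<Longrightarrow>
      \<psi> (S(z := x)) z = (if queue S j (start S z + x) = i then g (start S z + x) else 0)"
  shows "(\<Sum>z\<in>K. \<integral>\<^sup>+x. ennreal (\<psi> (S(z := x)) z) * indicator {0<..<S z} x \<partial>lborel)
    = (\<integral>\<^sup>+s. ennreal (real (at_level S i s) * g s) * indicator {0..t} s \<partial>lborel)"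
proof -
  let ?ev = "\<Union>j<N. event_times S j t"
  have finev: "finite ?ev" using finite_event_times[where S = S, OF S_pos] by auto
  define h where "h z s = (\<Sum>j<N. if z \<in> tasks_at S j \<and> start S z \<le> s \<and> s < departure S z \<and> s \<in> {0..t} \<and> queue S j s = i then g s else 0)" for z s
  have qm[measurable]: "(\<lambda>s. queue S j s) \<in> borel \<rightarrow>\<^sub>M count_space UNIV" for j by (rule queue_borel)
  note g(1)[measurable]
  have hm[measurable]: "h z \<in> borel_measurable borel" for z unfolding h_def by measurable
  have h0: "0 \<le> h z s" for z s unfolding h_def using g(2) by (intro sum_nonneg) auto
  have h_at: "h z s = (if start S z \<le> s \<and> s < departure S z \<and> s \<in> {0..t} \<and> queue S j s = i then g s else 0)"
    if "z \<in> tasks_at S j" "j < N" for z j s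
  proof -
    have "h z s = (\<Sum>j'<N. if j' = j then (if start S z \<le> s \<and> s < departure S z \<and> s \<in> {0..t} \<and> queue S j s = i then g s else 0) else 0)"
      unfolding h_def
    proof (rule sum.cong[OF refl])
      fix j'
      have "z \<in> tasks_at S j' \<longleftrightarrow> j' = j" using tasks_at_disjoint[of z S j j'] that(1) by blast
      then show "(if z \<in> tasks_at S j' \<and> start S z \<le> s \<and> s < departure S z \<and> s \<in> {0..t} \<and> queue S j' s = i then g s else 0) =
        (if j' = j then (if start S z \<le> s \<and> s < departure S z \<and> s \<in> {0..t} \<and> queue S j s = i then g s else 0) else 0)"
        by (simp cong: if_cong)
    qed
    then show ?thesis using that(2) by (simp add: sum.delta)
  qed
  have one: "(\<integral>\<^sup>+x. ennreal (\<psi> (S(z := x)) z) * indicator {0<..<S z} x \<partial>lborel) = (\<integral>\<^sup>+s. ennreal (h z s) \<partial>lborel)"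
    if z: "z \<in> K" for z
  proof -
    have "(\<integral>\<^sup>+s. ennreal (h z s) \<partial>lborel) = (\<integral>\<^sup>+s. ennreal (h z s) \<partial>distr lborel borel ((+) (start S z)))"
      by (simp add: lborel_distr_plus)
    also have "\<dots> = (\<integral>\<^sup>+x. ennreal (h z (start S z + x)) \<partial>lborel)" by (subst nn_integral_distr) auto
    also have "\<dots> = (\<integral>\<^sup>+x. ennreal (\<psi> (S(z := x)) z) * indicator {0<..<S z} x \<partial>lborel)"
    proof (rule nn_integral_cong_AE)
      have "finite (insert 0 ((\<lambda>s. s - start S z) ` ?ev))" using finev by auto
      then have "AE x in lborel. x \<notin> insert 0 ((\<lambda>s. s - start S z) ` ?ev)"
        by (intro AE_not_in finite_imp_null_set_lborel)
      then show "AE x in lborel. ennreal (h z (start S z + x)) = ennreal (\<psi> (S(z := x)) z) * indicator {0<..<S z} x"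
      proof eventually_elim
        case (elim x)
        have x0: "x \<noteq> 0" using elim by blast
        have "x \<in> (\<lambda>s. s - start S z) ` ?ev" if "start S z + x \<in> ?ev"
          using that by (rule image_eqI[rotated]) simp
        then have ne: "start S z + x \<notin> ?ev" using elim by blast
        have zs: "z \<in> task_sources" using K(2) z by blast
        have st: "0 \<le> start S z" using arrival_nonneg[of z] arrival_le_start[where S = S, OF S_pos, of z] by linarith
        show ?case
        proof (cases "\<exists>j<N. z \<in> tasks_at S j")
          case False
          then have "h z (start S z + x) = 0" by (auto simp: h_def)
          moreover have "\<psi> (S(z := x)) z = 0" if "x \<in> {0<..<S z}" using none[OF zs, of x] that False by auto
          ultimately show ?thesis by (auto simp: indicator_def)
        next
          case True
          then obtain j where j: "j < N" "z \<in> tasks_at S j" by blast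
          show ?thesis
          proof (cases "x \<in> {0<..<S z}")
            case False
            then have "\<not> (start S z \<le> start S z + x \<and> start S z + x < departure S z)" using x0 by (auto simp: departure_def)
            then have "h z (start S z + x) = 0" unfolding h_at[OF j(2,1)] by auto
            then show ?thesis using False by simp
          next
            case True
            show ?thesis
            proof (cases "start S z + x \<le> t")
              case le: True
              then show ?thesis using pred[OF j _ _ le ne] True st by (auto simp: h_at[OF j(2,1)] departure_def)
            next
              case gt: False
              then have "\<psi> (S(z := x)) z = 0" using none[OF zs, of x] True by auto
              then show ?thesis using gt by (simp add: h_at[OF j(2,1)])
            qed
          qed
        qed
      qed
    qed
    finally show ?thesis by simp
  qed
  have total: "(\<Sum>z\<in>K. h z s) = real (at_level S i s) * g s * indicator {0..t} s" for s
  proof (cases "s \<in> {0..t}")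
    case False
    then have "h z s = 0" for z unfolding h_def by (intro sum.neutral) auto
    then show ?thesis using False by simp
  next
    case True
    have "(\<Sum>z\<in>K. h z s) = (\<Sum>j<N. \<Sum>z\<in>K. if z \<in> tasks_at S j \<and> start S z \<le> s \<and> s < departure S z \<and> s \<in> {0..t} \<and> queue S j s = i then g s else 0)"
      unfolding h_def by (rule sum.swap)
    also have "\<dots> = (\<Sum>j<N. if queue S j s = i then g s else 0)"
    proof (rule sum.cong[OF refl])
      fix j assume "j \<in> {..<N}"
      then have j: "j < N" by simp
      let ?P = "{z \<in> tasks_at S j. start S z \<le> s \<and> s < departure S z}"
      have "{z \<in> K. z \<in> tasks_at S j \<and> start S z \<le> s \<and> s < departure S z} = ?P"
      proof -
        have "z \<in> K" if "z \<in> ?P" for z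
          using K(3)[OF j, of z] that arrival_le_start[where S = S, OF S_pos, of z] True by auto
        then show ?thesis by blast
      qed
      then have "(\<Sum>z\<in>K. if z \<in> tasks_at S j \<and> start S z \<le> s \<and> s < departure S z \<and> s \<in> {0..t} \<and> queue S j s = i then g s else 0)
          = (\<Sum>z\<in>?P. if queue S j s = i then g s else 0)"
        using K(1) True by (simp add: sum.inter_filter[symmetric])
      also have "\<dots> = (if queue S j s = i then g s else 0)"
        using busy_server[where S = S, OF S_pos, of s j] True i by simp
      finally show "(\<Sum>z\<in>K. if z \<in> tasks_at S j \<and> start S z \<le> s \<and> s < departure S z \<and> s \<in> {0..t} \<and> queue S j s = i then g s else 0)
          = (if queue S j s = i then g s else 0)" .
    qed
    also have "\<dots> = real (at_level S i s) * g s"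
      unfolding at_level_def by (simp add: sum.If_cases Int_def conj_commute)
    finally show ?thesis using True by simp
  qed
  have "(\<Sum>z\<in>K. \<integral>\<^sup>+x. ennreal (\<psi> (S(z := x)) z) * indicator {0<..<S z} x \<partial>lborel) = (\<Sum>z\<in>K. \<integral>\<^sup>+s. ennreal (h z s) \<partial>lborel)"
    by (intro sum.cong one refl)
  also have "\<dots> = (\<integral>\<^sup>+s. (\<Sum>z\<in>K. ennreal (h z s)) \<partial>lborel)" by (rule nn_integral_sum[symmetric]) simp
  also have "\<dots> = (\<integral>\<^sup>+s. ennreal (real (at_level S i s) * g s) * indicator {0..t} s \<partial>lborel)"
    using h0 g(2) by (intro nn_integral_cong) (auto simp: sum_ennreal total indicator_def)
  finally show ?thesis .
qed

text \<open>Up to its new departure time, nothing but this departure differs from the original path. So the shortened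
  task leaves the queue with the length that the original queue has at that time, and its rank counts the original departures
  up to then.\<close>

lemma counted_shortened:
  assumes j: "j < N" "z \<in> tasks_at S j" and x: "0 < x" "x < S z" and v: "start S z + x \<le> t" "start S z + x \<notin> (\<Union>j<N. event_times S j t)"
  shows "z \<in> counted (S(z := x)) i t \<longleftrightarrow> queue S j (start S z + x) = i"
    and "z \<in> counted (S(z := x)) i t \<Longrightarrow> rank_of (S(z := x)) i t z = 2 * real (card (counted S i (start S z + x))) + 1"
    and "departure (S(z := x)) z = start S z + x"
    and "time_at_level (S(z := x)) i (start S z + x) = time_at_level S i (start S z + x)"
proof -
  define S' where "S' = S(z := x)"
  define v where "v = start S z + x"
  have zs: "(\<exists>j l. z = Residual j l) \<or> (\<exists>k. z = Service k)" using tasks_at_sources[OF j(2)] by (simp add: task_sources_def)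
  note causal = S_pos x zs S'_def v_def
  have v': "v \<le> t" "\<And>j. j < N \<Longrightarrow> v \<notin> event_times S j t" using v by (auto simp: v_def)
  have v0: "0 < v" unfolding v_def using arrival_nonneg[of z] arrival_le_start[where S = S, OF S_pos, of z] x by linarith
  have dep: "departure S' z = v" by (rule departure_changed(1)[OF causal])
  show "departure (S(z := x)) z = start S z + x" using dep by (simp add: S'_def v_def)
  have arr: "arrival z < v" unfolding v_def using arrival_le_start[where S = S, OF S_pos, of z] x by linarith
  have j': "z \<in> tasks_at S' j" using causal_tasks(1)[OF causal arr] j by blast
  have "queue_left S' j v = queue S j v"
    using causal_queue_left[OF causal order_refl, of j] queue_eq_queue_left[where S = S, OF S_pos v0 v'(1), of j] v'(2)[OF j(1)] by simp
  then show iff: "z \<in> counted (S(z := x)) i t \<longleftrightarrow> queue S j (start S z + x) = i"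
    using counted_iff[OF j' j(1)] dep v' j' by (simp add: S'_def[symmetric] v_def[symmetric] departures_from_def)
  have nodep: "departure S z' \<noteq> v" if "z' \<in> tasks_at S j'" "j' < N" for z' j'
    using v'(2)[OF that(2)] that v'(1) by (auto simp: event_times_def[where S = S, OF S_pos])
  have others: "z' \<in> counted S' i t \<and> departure S' z' \<le> v \<longleftrightarrow> z' \<in> counted S i v" if "z' \<noteq> z" for z'
    using causal_departures_from(1)[OF causal that v'(1)] nodep unfolding counted_def by blast
  have strict: "departure S' z' < v" if "z' \<noteq> z" "z' \<in> counted S i v" for z'
    using causal_departures_from(2)[OF causal that(1) v'(1)] nodep that(2) unfolding counted_def by blast
  have znot: "z \<notin> counted S i v"
    using counted_departure[of z S i v] departure_changed(2)[OF causal] by force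
  have pos': "0 < S' z'" for z' using S_pos x by (simp add: S'_def)
  have fin': "finite (counted S' i t)"
    unfolding counted_def using finite_departures_from[where S = S', OF pos'] by auto
  show "rank_of (S(z := x)) i t z = 2 * real (card (counted S i (start S z + x))) + 1" if c: "z \<in> counted (S(z := x)) i t"
  proof -
    have c': "z \<in> counted S' i t" using c by (simp add: S'_def)
    let ?r = "\<lambda>z'. if departure S' z' < departure S' z then 2 else if departure S' z' = departure S' z then 1 else 0 :: real"
    have "rank_of S' i t z = ?r z + (\<Sum>z'\<in>counted S' i t - {z}. ?r z')"
      unfolding rank_of_eq_sum[OF fin'] by (rule sum.remove[OF fin' c'])
    also have "(\<Sum>z'\<in>counted S' i t - {z}. ?r z') = (\<Sum>z'\<in>counted S i v. 2)"
    proof (rule sum.mono_neutral_cong_right)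
      show "counted S i v \<subseteq> counted S' i t - {z}"
      proof
        fix z' assume z': "z' \<in> counted S i v"
        then have "z' \<noteq> z" using znot by blast
        then show "z' \<in> counted S' i t - {z}" using others z' by blast
      qed
      show "\<forall>z'\<in>counted S' i t - {z} - counted S i v. ?r z' = 0"
      proof
        fix z' assume z': "z' \<in> counted S' i t - {z} - counted S i v"
        then have "\<not> departure S' z' \<le> v" using others[of z'] by blast
        then show "?r z' = 0" using dep by simp
      qed
      show "?r z' = 2" if "z' \<in> counted S i v" for z'
        using strict[of z'] that znot dep by force
    qed (use fin' in simp)
    finally show ?thesis by (simp add: S'_def[symmetric] v_def[symmetric])
  qed
  have "time_at_level S' i v = time_at_level S i v"
    unfolding time_at_level_def set_lebesgue_integral_def
  proof (rule integral_cong_AE)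
    show "AE s in lborel. indicat_real {0..v} s *\<^sub>R real (at_level S' i s) = indicat_real {0..v} s *\<^sub>R real (at_level S i s)"
      using AE_lborel_singleton[of v]
    proof eventually_elim
      case (elim s)
      have "at_level S' i s = at_level S i s" if "s < v" using causal_queue[OF causal that] by (simp add: at_level_def)
      then show ?case using elim by (auto simp: indicator_def)
    qed
  qed (use at_level_real_borel in measurable)
  then show "time_at_level (S(z := x)) i (start S z + x) = time_at_level S i (start S z + x)"
    by (simp add: S'_def v_def)
qed

lemma not_counted_shortened:
  assumes z: "z \<in> task_sources" and x: "0 < x" "x < S z" and none: "(\<forall>j<N. z \<notin> tasks_at S j) \<or> t < start S z + x"
  shows "z \<notin> counted (S(z := x)) i t"
proof
  assume c: "z \<in> counted (S(z := x)) i t"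
  have zs: "(\<exists>j l. z = Residual j l) \<or> (\<exists>k. z = Service k)" using z by (simp add: task_sources_def)
  define S' where "S' = S(z := x)"
  define v where "v = start S z + x"
  note causal = S_pos x zs S'_def v_def
  have "departure (S(z := x)) z = start S z + x"
    using departure_changed(1)[OF causal] by (simp add: S'_def v_def)
  then have "start S z + x \<le> t" using counted_departure[OF c] by simp
  moreover obtain j where "j < N" "z \<in> tasks_at (S(z := x)) j" using counted_subset[OF c] by blast
  moreover have "arrival z < v" unfolding v_def using arrival_le_start[where S = S, OF S_pos, of z] x by linarith
  ultimately show False using causal_tasks(1)[OF causal, of z j] none by (force simp: S'_def)
qed

lemma sum_ranks_shortened:
  assumes "0 \<le> t" "1 \<le> i" "finite K" "K \<subseteq> task_sources"
    and "\<And>z j. j < N \<Longrightarrow> z \<in> tasks_at S j \<Longrightarrow> arrival z \<le> t \<Longrightarrow> z \<in> K"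
  shows "(\<Sum>z\<in>K. \<integral>\<^sup>+x. ennreal (if z \<in> counted (S(z := x)) i t then rank_of (S(z := x)) i t z else 0) * indicator {0<..<S z} x \<partial>lborel)
    = (\<integral>\<^sup>+s. ennreal (real (at_level S i s) * (2 * real (card (counted S i s)) + 1)) * indicator {0..t} s \<partial>lborel)"
  by (rule sum_over_shortenings[where \<psi> = "\<lambda>S z. if z \<in> counted S i t then rank_of S i t z else 0", OF assms(1-4)])
    (use assms(5) counted_borel counted_shortened(1,2) not_counted_shortened in \<open>auto\<close>)

lemma sum_times_shortened:
  assumes "0 \<le> t" "1 \<le> i" "finite K" "K \<subseteq> task_sources"
    and "\<And>z j. j < N \<Longrightarrow> z \<in> tasks_at S j \<Longrightarrow> arrival z \<le> t \<Longrightarrow> z \<in> K"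
  shows "(\<Sum>z\<in>K. \<integral>\<^sup>+x. ennreal (if z \<in> counted (S(z := x)) i t then time_at_level (S(z := x)) i (departure (S(z := x)) z) else 0) * indicator {0<..<S z} x \<partial>lborel)
    = (\<integral>\<^sup>+s. ennreal (real (at_level S i s) * time_at_level S i s) * indicator {0..t} s \<partial>lborel)"
  by (rule sum_over_shortenings[where \<psi> = "\<lambda>S z. if z \<in> counted S i t then time_at_level S i (departure S z) else 0", OF assms(1-4)])
    (use assms(5) time_at_level_borel time_at_level_nonneg counted_shortened(1,3,4) not_counted_shortened in \<open>auto\<close>)

end
end

section \<open>Measurability of the path functionals\<close>

text \<open>The data may be random variables on any measurable space, which will be the underlying probability space,
  its product with the real line as the time set, or its product with the range of a single requirement.\<close>

locale random_data =
  fixes \<M> :: "'v measure" and N :: nat and b :: enat and x0 :: "'v \<Rightarrow> nat list" and \<tau> :: "'v \<Rightarrow> nat \<Rightarrow> real"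
    and L :: "'v \<Rightarrow> nat \<Rightarrow> nat list" and S :: "'v \<Rightarrow> source \<Rightarrow> real"
  assumes x0_measurable[measurable]: "x0 \<in> \<M> \<rightarrow>\<^sub>M count_space UNIV"
    and \<tau>_measurable[measurable]: "\<And>k. (\<lambda>w. \<tau> w k) \<in> borel_measurable \<M>"
    and L_measurable[measurable]: "\<And>k. (\<lambda>w. L w k) \<in> \<M> \<rightarrow>\<^sub>M count_space UNIV"
    and S_measurable[measurable]: "\<And>z. (\<lambda>w. S w z) \<in> borel_measurable \<M>"

lemma arg_min_list_measurable:
  fixes f :: "nat \<Rightarrow> 'v \<Rightarrow> nat"
  assumes f[measurable]: "\<And>s. f s \<in> \<M> \<rightarrow>\<^sub>M count_space UNIV" and L[measurable]: "L \<in> \<M> \<rightarrow>\<^sub>M count_space UNIV"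
  shows "(\<lambda>w. arg_min_list (\<lambda>s. f s w) (L w)) \<in> \<M> \<rightarrow>\<^sub>M count_space UNIV"
proof -
  have "(\<lambda>w. arg_min_list (\<lambda>s. f s w) ls) \<in> \<M> \<rightarrow>\<^sub>M count_space UNIV" for ls
  proof (induction ls rule: induct_list012)
    case 1
    have "arg_min_list (g :: nat \<Rightarrow> nat) [] = undefined" for g
      by (rule arg_min_list.elims[OF refl, of g "[]"]) auto
    then show ?case by simp
  next
    case (3 x y zs)
    note m = 3(2)
    have fm: "(\<lambda>w. f (arg_min_list (\<lambda>s. f s w) (y # zs)) w) \<in> \<M> \<rightarrow>\<^sub>M count_space UNIV"
      by (rule measurable_compose_countable[where f = f and g = "\<lambda>w. arg_min_list (\<lambda>s. f s w) (y # zs)", OF f m])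
    have "(\<lambda>w. if u w \<le> v w then x else m w) \<in> \<M> \<rightarrow>\<^sub>M count_space UNIV"
      if [measurable]: "u \<in> \<M> \<rightarrow>\<^sub>M count_space UNIV" "v \<in> \<M> \<rightarrow>\<^sub>M count_space UNIV" "m \<in> \<M> \<rightarrow>\<^sub>M count_space UNIV"
      for u v m :: "'v \<Rightarrow> nat"
    proof -
      have "(\<lambda>w. if real (u w) \<le> real (v w) then x else m w) \<in> \<M> \<rightarrow>\<^sub>M count_space UNIV" by measurable
      then show ?thesis by simp
    qed
    from this[OF f[of x] fm m] show ?case unfolding arg_min_list.simps Let_def .
  qed simp
  from measurable_compose_countable[where f = "\<lambda>ls w. arg_min_list (\<lambda>s. f s w) ls" and g = L, OF this L] show ?thesis .
qed

context random_data
begin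

abbreviation "hist w \<equiv> jsq_data.hist N b (x0 w) (\<tau> w) (L w) (S w)"
abbreviation "chosen w \<equiv> jsq_data.chosen N b (x0 w) (\<tau> w) (L w) (S w)"
abbreviation "queue_seen w \<equiv> jsq_data.queue_seen N b (x0 w) (\<tau> w) (L w) (S w)"
abbreviation "admitted w \<equiv> jsq_data.admitted N b (x0 w) (\<tau> w) (L w) (S w)"
abbreviation "departure w \<equiv> jsq_data.departure N b (x0 w) (\<tau> w) (L w) (S w)"
abbreviation "tasks_at w \<equiv> jsq_data.tasks_at N b (x0 w) (\<tau> w) (L w) (S w)"
abbreviation "queue w \<equiv> jsq_data.queue N b (x0 w) (\<tau> w) (L w) (S w)"
abbreviation "queue_left w \<equiv> jsq_data.queue_left N b (x0 w) (\<tau> w) (L w) (S w)"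
abbreviation "counted w \<equiv> jsq_data.counted N b (x0 w) (\<tau> w) (L w) (S w)"
abbreviation "at_level w \<equiv> jsq_data.at_level N b (x0 w) (\<tau> w) (L w) (S w)"
abbreviation "time_at_level w \<equiv> jsq_data.time_at_level N b (x0 w) (\<tau> w) (L w) (S w)"
abbreviation "rank_of w \<equiv> jsq_data.rank_of N b (x0 w) (\<tau> w) (L w) (S w)"
abbreviation "level_seen w \<equiv> jsq_data.level_seen N b (x0 w) (\<tau> w) (L w) (S w)"
abbreviation "bad_overflows w \<equiv> jsq_data.bad_overflows N b (x0 w) (\<tau> w) (L w) (S w)"

lemma arrival_measurable[measurable]: "(\<lambda>w. jsq_data.arrival (\<tau> w) z) \<in> borel_measurable \<M>"
  by (cases z) (simp_all add: jsq_data.arrival.simps arrival_time_def)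

lemma arrival_time_measurable[measurable]: "(\<lambda>w. arrival_time (\<tau> w) k) \<in> borel_measurable \<M>"
  unfolding arrival_time_def by measurable

lemma departure_residual_measurable[measurable]: "(\<lambda>w. departure w (Residual j l)) \<in> borel_measurable \<M>"
  unfolding jsq_data.departure_def jsq_data.start.simps by measurable

text \<open>What the induction over the arrivals has to establish about arrival \<open>m\<close>.\<close>

definition known :: "nat \<Rightarrow> bool" where
  "known m \<longleftrightarrow> (\<lambda>w. chosen w m) \<in> \<M> \<rightarrow>\<^sub>M count_space UNIV \<and> Measurable.pred \<M> (\<lambda>w. admitted w m) \<and>
    (\<lambda>w. departure w (Service m)) \<in> borel_measurable \<M>"

lemma measurable_before:
  assumes k: "\<And>m. m < k \<Longrightarrow> known m"
  shows "Measurable.pred \<M> (\<lambda>w. z \<in> tasks_at w j \<and> jsq_data.before k z)"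
    and "jsq_data.before k z \<Longrightarrow> (\<exists>j l. z = Residual j l) \<or> (\<exists>k. z = Service k) \<Longrightarrow> (\<lambda>w. departure w z) \<in> borel_measurable \<M>"
proof -
  show "Measurable.pred \<M> (\<lambda>w. z \<in> tasks_at w j \<and> jsq_data.before k z)"
  proof (cases z)
    case (Residual j' l)
    have "(\<lambda>w. l < x0 w ! j) \<in> \<M> \<rightarrow>\<^sub>M count_space UNIV"
      by (rule measurable_compose[OF x0_measurable]) simp
    then have [measurable]: "Measurable.pred \<M> (\<lambda>w. l < x0 w ! j)" .
    have "(z \<in> tasks_at w j \<and> jsq_data.before k z) \<longleftrightarrow> j' = j \<and> j < N \<and> l < x0 w ! j" for w
      using Residual by (auto simp: jsq_data.tasks_at_def jsq_data.before.simps)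
    then show ?thesis by simp
  next
    case (Service m)
    have eq: "(z \<in> tasks_at w j \<and> jsq_data.before k z) \<longleftrightarrow> m < k \<and> admitted w m \<and> chosen w m = j" for w
      using Service by (auto simp: jsq_data.tasks_at_def jsq_data.before.simps)
    show ?thesis
    proof (cases "m < k")
      case True
      then have [measurable]: "(\<lambda>w. chosen w m) \<in> \<M> \<rightarrow>\<^sub>M count_space UNIV" "Measurable.pred \<M> (\<lambda>w. admitted w m)"
        using k by (auto simp: known_def)
      show ?thesis unfolding eq by measurable
    qed (simp add: eq)
  qed (simp_all add: jsq_data.tasks_at_def)
  show "(\<lambda>w. departure w z) \<in> borel_measurable \<M>"
    if b: "jsq_data.before k z" and z: "(\<exists>j l. z = Residual j l) \<or> (\<exists>k. z = Service k)"
    using z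
  proof (elim disjE exE)
    fix m assume m: "z = Service m"
    then have "known m" using b k by (simp add: jsq_data.before.simps)
    then show ?thesis using m by (simp add: known_def)
  qed simp
qed

lemma departure_pred:
  assumes k: "\<And>m. m < k \<Longrightarrow> known m" and P: "\<And>f. f \<in> borel_measurable \<M> \<Longrightarrow> Measurable.pred \<M> (\<lambda>w. P w (f w))"
  shows "Measurable.pred \<M> (\<lambda>w. (z \<in> tasks_at w j \<and> jsq_data.before k z) \<and> P w (departure w z))"
proof (cases "jsq_data.before k z \<and> ((\<exists>j l. z = Residual j l) \<or> (\<exists>k. z = Service k))")
  case True
  then have "Measurable.pred \<M> (\<lambda>w. P w (departure w z))" using measurable_before(2)[OF k] P by blast
  moreover have "Measurable.pred \<M> (\<lambda>w. z \<in> tasks_at w j \<and> jsq_data.before k z)"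
    by (rule measurable_before(1)) (rule k)
  ultimately show ?thesis unfolding pred_def by (rule sets.sets_Collect_conj)
next
  case False
  then have "((z \<in> tasks_at w j \<and> jsq_data.before k z) \<and> P w (departure w z)) = False" for w
    by (auto simp: jsq_data.tasks_at_def)
  then show ?thesis by (simp only: measurable_const UNIV_I space_count_space)
qed

lemma queue_length_measurable:
  assumes k: "\<And>m. m < k \<Longrightarrow> known m" and f[measurable]: "f \<in> borel_measurable \<M>"
  shows "(\<lambda>w. queue_length (hist w k) j (f w)) \<in> \<M> \<rightarrow>\<^sub>M count_space UNIV"
  unfolding jsq_data.queue_length_hist
proof (rule measurable_card_countable)
  fix z
  have "Measurable.pred \<M> (\<lambda>w. (z \<in> tasks_at w j \<and> jsq_data.before k z) \<and> (jsq_data.arrival (\<tau> w) z \<le> f w \<and> f w < departure w z))"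
    by (rule departure_pred[where P = "\<lambda>w u. jsq_data.arrival (\<tau> w) z \<le> f w \<and> f w < u", OF k]) measurable
  then show "{w \<in> space \<M>. z \<in> {z \<in> tasks_at w j. jsq_data.before k z \<and> jsq_data.arrival (\<tau> w) z \<le> f w \<and> f w < departure w z}} \<in> sets \<M>"
    by (simp add: pred_def conj_assoc)
qed

lemma free_from_measurable:
  assumes k: "\<And>m. m < k \<Longrightarrow> known m"
  shows "(\<lambda>w. free_from (hist w k) j) \<in> borel_measurable \<M>"
  unfolding borel_measurable_iff_le
proof
  fix c
  have eq: "free_from (hist w k) j \<le> c \<longleftrightarrow> 0 \<le> c \<and> (\<forall>z. \<not> ((z \<in> tasks_at w j \<and> jsq_data.before k z) \<and> c < departure w z))" for w
  proof -
    have fin: "finite (insert 0 (departure w ` {z \<in> tasks_at w j. jsq_data.before k z}))"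
      by (simp add: jsq_data.finite_tasks_before)
    show ?thesis unfolding jsq_data.free_from_hist Max_le_iff[OF fin insert_not_empty] by (auto simp: not_less)
  qed
  have "Measurable.pred \<M> (\<lambda>w. 0 \<le> c \<and> (\<forall>z. \<not> ((z \<in> tasks_at w j \<and> jsq_data.before k z) \<and> c < departure w z)))"
  proof -
    have "Measurable.pred \<M> (\<lambda>w. (z \<in> tasks_at w j \<and> jsq_data.before k z) \<and> c < departure w z)" for z
      by (rule departure_pred[where P = "\<lambda>w u. c < u", OF k]) measurable
    then have "{w \<in> space \<M>. \<not> ((z \<in> tasks_at w j \<and> jsq_data.before k z) \<and> c < departure w z)} \<in> sets \<M>" for z
      unfolding pred_def by (rule sets.sets_Collect_neg)
    note all = sets.sets_Collect_countable_All[OF this]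
    show ?thesis unfolding pred_def by (rule sets.sets_Collect_conj[OF all sets.sets_Collect_const])
  qed
  then show "{w \<in> space \<M>. free_from (hist w k) j \<le> c} \<in> sets \<M>" unfolding eq pred_def .
qed

lemma queue_seen_measurable_aux:
  assumes k: "\<And>m. m < k \<Longrightarrow> known m"
  shows "(\<lambda>w. chosen w k) \<in> \<M> \<rightarrow>\<^sub>M count_space UNIV" "(\<lambda>w. queue_seen w k) \<in> \<M> \<rightarrow>\<^sub>M count_space UNIV"
proof -
  show c: "(\<lambda>w. chosen w k) \<in> \<M> \<rightarrow>\<^sub>M count_space UNIV"
    unfolding jsq_data.chosen_def by (intro arg_min_list_measurable queue_length_measurable k) measurable
  show "(\<lambda>w. queue_seen w k) \<in> \<M> \<rightarrow>\<^sub>M count_space UNIV"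
    unfolding jsq_data.queue_seen_def
    by (rule measurable_compose_countable[where f = "\<lambda>j w. queue_length (hist w k) j (arrival_time (\<tau> w) k)", OF queue_length_measurable[OF k] c]) measurable
qed

lemma known: "known k"
proof (induction k rule: less_induct)
  case (less k)
  have c[measurable]: "(\<lambda>w. chosen w k) \<in> \<M> \<rightarrow>\<^sub>M count_space UNIV"
    and q[measurable]: "(\<lambda>w. queue_seen w k) \<in> \<M> \<rightarrow>\<^sub>M count_space UNIV"
    using queue_seen_measurable_aux less by blast+
  have "(\<lambda>w. free_from (hist w k) (chosen w k)) \<in> borel_measurable \<M>"
    by (rule measurable_compose_countable[where f = "\<lambda>j w. free_from (hist w k) j", OF free_from_measurable c]) (use less in blast)
  then have "(\<lambda>w. departure w (Service k)) \<in> borel_measurable \<M>"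
    unfolding jsq_data.departure_def jsq_data.start.simps by measurable
  moreover have "Measurable.pred \<M> (\<lambda>w. admitted w k)"
    unfolding jsq_data.admitted_def by (rule measurable_compose[OF q]) simp
  ultimately show ?case using c by (simp add: known_def)
qed

lemma chosen_measurable[measurable]: "(\<lambda>w. chosen w k) \<in> \<M> \<rightarrow>\<^sub>M count_space UNIV"
  and queue_seen_measurable[measurable]: "(\<lambda>w. queue_seen w k) \<in> \<M> \<rightarrow>\<^sub>M count_space UNIV"
  using queue_seen_measurable_aux known by blast+

lemma task_pred:
  assumes P: "\<And>f. f \<in> borel_measurable \<M> \<Longrightarrow> Measurable.pred \<M> (\<lambda>w. P w (f w))"
  shows "Measurable.pred \<M> (\<lambda>w. z \<in> tasks_at w j \<and> P w (departure w z))"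
proof -
  obtain k where k: "jsq_data.before k z" by (cases z) (auto simp: jsq_data.before.simps)
  show ?thesis using departure_pred[where k = k and z = z and j = j and P = P, OF known P] k by simp
qed

lemma queue_measurable:
  assumes f[measurable]: "f \<in> borel_measurable \<M>"
  shows "(\<lambda>w. queue w j (f w)) \<in> \<M> \<rightarrow>\<^sub>M count_space UNIV"
  unfolding jsq_data.queue_def
proof (rule measurable_card_countable)
  fix z
  have "Measurable.pred \<M> (\<lambda>w. z \<in> tasks_at w j \<and> jsq_data.arrival (\<tau> w) z \<le> f w \<and> f w < departure w z)"
    by (rule task_pred[where P = "\<lambda>w u. jsq_data.arrival (\<tau> w) z \<le> f w \<and> f w < u"]) measurable
  then show "{w \<in> space \<M>. z \<in> {z \<in> tasks_at w j. jsq_data.arrival (\<tau> w) z \<le> f w \<and> f w < departure w z}} \<in> sets \<M>"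
    by (simp add: pred_def)
qed

lemma queue_left_measurable:
  assumes f[measurable]: "f \<in> borel_measurable \<M>"
  shows "(\<lambda>w. queue_left w j (f w)) \<in> \<M> \<rightarrow>\<^sub>M count_space UNIV"
  unfolding jsq_data.queue_left_def
proof (rule measurable_card_countable)
  fix z
  have "Measurable.pred \<M> (\<lambda>w. z \<in> tasks_at w j \<and> jsq_data.arrival (\<tau> w) z < f w \<and> f w \<le> departure w z)"
  proof (rule task_pred[where P = "\<lambda>w u. jsq_data.arrival (\<tau> w) z < f w \<and> f w \<le> u"])
    fix u :: "'v \<Rightarrow> real" assume u: "u \<in> borel_measurable \<M>"
    show "Measurable.pred \<M> (\<lambda>w. jsq_data.arrival (\<tau> w) z < f w \<and> f w \<le> u w)"
      unfolding pred_def by (intro sets.sets_Collect_conj borel_measurable_less borel_measurable_le f u arrival_measurable)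
  qed
  then show "{w \<in> space \<M>. z \<in> {z \<in> tasks_at w j. jsq_data.arrival (\<tau> w) z < f w \<and> f w \<le> departure w z}} \<in> sets \<M>"
    by (simp add: pred_def)
qed

lemma counted_pred:
  assumes P: "\<And>f. f \<in> borel_measurable \<M> \<Longrightarrow> Measurable.pred \<M> (\<lambda>w. P w (f w))"
  shows "Measurable.pred \<M> (\<lambda>w. z \<in> counted w i t \<and> P w (departure w z))"
proof -
  have "(z \<in> counted w i t \<and> P w (departure w z)) \<longleftrightarrow>
      (\<exists>j\<in>{..<N}. z \<in> tasks_at w j \<and> (departure w z \<le> t \<and> queue_left w j (departure w z) = i \<and> P w (departure w z)))" for w
    by (auto simp: jsq_data.counted_def jsq_data.departures_from_def)
  moreover have "Measurable.pred \<M> (\<lambda>w. \<exists>j\<in>{..<N}. z \<in> tasks_at w j \<and> (departure w z \<le> t \<and> queue_left w j (departure w z) = i \<and> P w (departure w z)))"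
  proof (intro pred_intros_finite task_pred[where P = "\<lambda>w u. u \<le> t \<and> queue_left w j u = i \<and> P w u" for j])
    fix j and f :: "'v \<Rightarrow> real" assume [measurable]: "f \<in> borel_measurable \<M>"
    have [measurable]: "Measurable.pred \<M> (\<lambda>w. P w (f w))" by (rule P) measurable
    have [measurable]: "(\<lambda>w. queue_left w j (f w)) \<in> \<M> \<rightarrow>\<^sub>M count_space UNIV" by (rule queue_left_measurable) measurable
    show "Measurable.pred \<M> (\<lambda>w. f w \<le> t \<and> queue_left w j (f w) = i \<and> P w (f w))" by measurable
  qed auto
  ultimately show ?thesis by simp
qed

lemma counted_measurable[measurable]: "Measurable.pred \<M> (\<lambda>w. z \<in> counted w i t)"
  using counted_pred[where P = "\<lambda>_ _. True"] by simp

lemma card_counted_measurable[measurable]: "(\<lambda>w. card (counted w i t)) \<in> \<M> \<rightarrow>\<^sub>M count_space UNIV"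
  by (rule measurable_card_countable) (use counted_measurable in \<open>simp add: pred_def\<close>)

lemma departure_measurable:
  assumes "(\<exists>j l. z = Residual j l) \<or> (\<exists>k. z = Service k)"
  shows "(\<lambda>w. departure w z) \<in> borel_measurable \<M>"
proof -
  obtain k where k: "jsq_data.before k z" by (cases z) (auto simp: jsq_data.before.simps)
  then show ?thesis using measurable_before(2)[OF known _ assms] by blast
qed

lemma rank_of_measurable:
  assumes z: "(\<exists>j l. z = Residual j l) \<or> (\<exists>k. z = Service k)"
  shows "(\<lambda>w. rank_of w i t z) \<in> borel_measurable \<M>"
proof -
  have [measurable]: "(\<lambda>w. card {z' \<in> counted w i t. departure w z' < departure w z}) \<in> \<M> \<rightarrow>\<^sub>M count_space UNIV"
  proof (rule measurable_card_countable)
    fix z'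
    have "Measurable.pred \<M> (\<lambda>w. z' \<in> counted w i t \<and> departure w z' < departure w z)"
      by (rule counted_pred[where P = "\<lambda>w u. u < departure w z"])
        (unfold pred_def, intro borel_measurable_less departure_measurable z)
    then show "{w \<in> space \<M>. z' \<in> {z' \<in> counted w i t. departure w z' < departure w z}} \<in> sets \<M>" by (simp add: pred_def)
  qed
  have [measurable]: "(\<lambda>w. card {z' \<in> counted w i t. departure w z' = departure w z}) \<in> \<M> \<rightarrow>\<^sub>M count_space UNIV"
  proof (rule measurable_card_countable)
    fix z'
    have "Measurable.pred \<M> (\<lambda>w. z' \<in> counted w i t \<and> departure w z' = departure w z)"
      by (rule counted_pred[where P = "\<lambda>w u. u = departure w z"])
        (unfold pred_def, intro borel_measurable_eq departure_measurable z)
    then show "{w \<in> space \<M>. z' \<in> {z' \<in> counted w i t. departure w z' = departure w z}} \<in> sets \<M>" by (simp add: pred_def)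
  qed
  show ?thesis unfolding jsq_data.rank_of_def by measurable
qed

lemma at_level_measurable:
  assumes [measurable]: "f \<in> borel_measurable \<M>"
  shows "(\<lambda>w. at_level w i (f w)) \<in> \<M> \<rightarrow>\<^sub>M count_space UNIV"
proof -
  have [measurable]: "(\<lambda>w. queue w j (f w)) \<in> \<M> \<rightarrow>\<^sub>M count_space UNIV" for j by (rule queue_measurable) measurable
  show ?thesis unfolding jsq_data.at_level_def by measurable
qed

lemma level_seen_measurable[measurable]: "(\<lambda>w. level_seen w i k) \<in> \<M> \<rightarrow>\<^sub>M count_space UNIV"
proof -
  have [measurable]: "(\<lambda>w. queue_length (hist w k) j (arrival_time (\<tau> w) k)) \<in> \<M> \<rightarrow>\<^sub>M count_space UNIV" for j
    by (rule queue_length_measurable[OF known]) measurable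
  show ?thesis unfolding jsq_data.level_seen_def by measurable
qed

lemma random_data_times: "random_data (\<M> \<Otimes>\<^sub>M (borel :: real measure)) (\<lambda>p. x0 (fst p)) (\<lambda>p. \<tau> (fst p)) (\<lambda>p. L (fst p)) (\<lambda>p. S (fst p))"
  by unfold_locales measurable

end

lemma (in random_data) at_level_joint_measurable:
  "(\<lambda>p. real (at_level (fst p) i (snd p))) \<in> borel_measurable (\<M> \<Otimes>\<^sub>M (borel :: real measure))"
proof -
  interpret T: random_data "\<M> \<Otimes>\<^sub>M (borel :: real measure)" N b "\<lambda>p. x0 (fst p)" "\<lambda>p. \<tau> (fst p)" "\<lambda>p. L (fst p)" "\<lambda>p. S (fst p)"
    by (rule random_data_times)
  have "(\<lambda>p. at_level (fst p) i (snd p)) \<in> \<M> \<Otimes>\<^sub>M (borel :: real measure) \<rightarrow>\<^sub>M count_space UNIV"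
    by (rule T.at_level_measurable) measurable
  from measurable_compose[OF this, of real borel] show ?thesis by simp
qed

lemma (in random_data) card_counted_joint_measurable:
  "(\<lambda>p. real (card (counted (fst p) i (snd p)))) \<in> borel_measurable (\<M> \<Otimes>\<^sub>M (borel :: real measure))"
proof -
  interpret T: random_data "\<M> \<Otimes>\<^sub>M (borel :: real measure)" N b "\<lambda>p. x0 (fst p)" "\<lambda>p. \<tau> (fst p)" "\<lambda>p. L (fst p)" "\<lambda>p. S (fst p)"
    by (rule random_data_times)
  have "(\<lambda>p. card (counted (fst p) i (snd p))) \<in> \<M> \<Otimes>\<^sub>M (borel :: real measure) \<rightarrow>\<^sub>M count_space UNIV"
  proof (rule measurable_card_countable)
    fix z
    have "{p \<in> space (\<M> \<Otimes>\<^sub>M borel). z \<in> counted (fst p) i (snd p)} =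
      {p \<in> space (\<M> \<Otimes>\<^sub>M borel). \<exists>j\<in>{..<N}. z \<in> tasks_at (fst p) j \<and>
        (departure (fst p) z \<le> snd p \<and> queue_left (fst p) j (departure (fst p) z) = i)}"
      by (auto simp: jsq_data.counted_def jsq_data.departures_from_def)
    moreover have "Measurable.pred (\<M> \<Otimes>\<^sub>M borel) (\<lambda>p. \<exists>j\<in>{..<N}. z \<in> tasks_at (fst p) j \<and>
        (departure (fst p) z \<le> snd p \<and> queue_left (fst p) j (departure (fst p) z) = i))"
    proof (intro pred_intros_finite T.task_pred[where P = "\<lambda>p u. u \<le> snd p \<and> queue_left (fst p) j u = i" for j])
      fix j and f :: "'v \<times> real \<Rightarrow> real" assume [measurable]: "f \<in> borel_measurable (\<M> \<Otimes>\<^sub>M borel)"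
      have [measurable]: "(\<lambda>p. queue_left (fst p) j (f p)) \<in> \<M> \<Otimes>\<^sub>M borel \<rightarrow>\<^sub>M count_space UNIV" by (rule T.queue_left_measurable) measurable
      show "Measurable.pred (\<M> \<Otimes>\<^sub>M borel) (\<lambda>p. f p \<le> snd p \<and> queue_left (fst p) j (f p) = i)" by measurable
    qed auto
    ultimately show "{p \<in> space (\<M> \<Otimes>\<^sub>M borel). z \<in> counted (fst p) i (snd p)} \<in> sets (\<M> \<Otimes>\<^sub>M borel)"
      by (simp add: pred_def)
  qed
  from measurable_compose[OF this, of real borel] show ?thesis by simp
qed

lemma (in random_data) time_at_level_measurable:
  assumes [measurable]: "f \<in> borel_measurable \<M>"
  shows "(\<lambda>w. time_at_level w i (f w)) \<in> borel_measurable \<M>"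
proof -
  note [measurable] = at_level_joint_measurable
  have "(\<lambda>p. indicat_real {0..f (fst p)} (snd p) *\<^sub>R real (at_level (fst p) i (snd p))) \<in> borel_measurable (\<M> \<Otimes>\<^sub>M lborel)"
    unfolding indicator_def atLeastAtMost_iff by measurable
  then show ?thesis
    unfolding jsq_data.time_at_level_def set_lebesgue_integral_def
    by (intro lborel.borel_measurable_lebesgue_integral) (simp add: split_beta')
qed

section \<open>Independence of the sources of randomness\<close>

context jsq_system
begin

definition source_sets :: "source \<Rightarrow> 'w set set" where
  "source_sets a = sets (case a of
          Initial \<Rightarrow> vimage_algebra (space M) x0 (count_space UNIV)
        | Residual j l \<Rightarrow> vimage_algebra (space M) (\<lambda>w. \<rho> w j l) borel
        | Interarrival k \<Rightarrow> vimage_algebra (space M) (\<lambda>w. \<tau> w k) borel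
        | Service k \<Rightarrow> vimage_algebra (space M) (\<lambda>w. \<sigma> w k) borel
        | Sample k \<Rightarrow> vimage_algebra (space M) (\<lambda>w. L w k) (count_space UNIV))"

text \<open>The information of all sources but one.\<close>

definition others :: "source \<Rightarrow> 'w measure" where
  "others a = sigma (space M) (\<Union>a'\<in>UNIV - {a}. source_sets a')"

lemma source_sets_subset: "source_sets a \<subseteq> Pow (space M)"
proof
  fix A assume "A \<in> source_sets a"
  then show "A \<in> Pow (space M)"
    unfolding source_sets_def by (cases a) (auto dest!: sets.sets_into_space)
qed

lemma space_others: "space (others a) = space M"
  unfolding others_def using source_sets_subset by (intro space_measure_of) auto

lemma sets_others: "sets (others a) = sigma_sets (space M) (\<Union>a'\<in>UNIV - {a}. source_sets a')"
  unfolding others_def using source_sets_subset by (intro sets_measure_of) auto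

lemma measurable_others:
  assumes "a' \<noteq> a" "X \<in> space M \<rightarrow> space S" "source_sets a' = sets (vimage_algebra (space M) X S)"
  shows "X \<in> others a \<rightarrow>\<^sub>M S"
proof (rule measurableI)
  fix A assume "A \<in> sets S"
  then have "X -` A \<inter> space M \<in> source_sets a'" unfolding assms(3) by (rule in_vimage_algebra)
  then show "X -` A \<inter> space (others a) \<in> sets (others a)"
    unfolding space_others sets_others using assms(1) by (intro sigma_sets.Basic) auto
qed (use assms(2) in \<open>auto simp: space_others\<close>)

lemma source_sets_simps:
  "source_sets Initial = sets (vimage_algebra (space M) x0 (count_space UNIV))"
  "source_sets (Residual j l) = sets (vimage_algebra (space M) (\<lambda>w. \<rho> w j l) borel)"
  "source_sets (Interarrival k) = sets (vimage_algebra (space M) (\<lambda>w. \<tau> w k) borel)"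
  "source_sets (Service k) = sets (vimage_algebra (space M) (\<lambda>w. \<sigma> w k) borel)"
  "source_sets (Sample k) = sets (vimage_algebra (space M) (\<lambda>w. L w k) (count_space UNIV))"
  by (simp_all add: source_sets_def)

lemma source_sets_events: "source_sets a \<subseteq> events"
  using independent unfolding indep_sets_def source_sets_def by auto

lemma id_measurable_others: "(\<lambda>w. w) \<in> M \<rightarrow>\<^sub>M others a"
  unfolding others_def
proof (rule measurable_measure_of)
  show "(\<Union>a'\<in>UNIV - {a}. source_sets a') \<subseteq> Pow (space M)" using source_sets_subset by blast
  show "(\<lambda>w. w) -` A \<inter> space M \<in> events" if "A \<in> (\<Union>a'\<in>UNIV - {a}. source_sets a')" for A
    using that source_sets_events by (auto intro!: sets.Int)
qed simp

lemma independent_of_others: "indep_set (source_sets a) (sets (others a))"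
proof -
  let ?I = "\<lambda>c. if c then {a} else UNIV - {a}"
  have "indep_sets (\<lambda>c. sigma_sets (space M) (\<Union>i\<in>?I c. source_sets i)) UNIV"
  proof (rule indep_sets_collect_sigma)
    have "(\<Union>c. ?I c) = UNIV" by auto
    then show "indep_sets source_sets (\<Union>c\<in>UNIV. ?I c)"
      using independent unfolding source_sets_def[abs_def] by simp
    show "Int_stable (source_sets i)" for i unfolding source_sets_def by (rule sets.Int_stable)
    show "disjoint_family_on ?I UNIV" by (auto simp: disjoint_family_on_def)
  qed
  then have "indep_set (sigma_sets (space M) (source_sets a)) (sets (others a))"
    unfolding indep_set_def sets_others by (rule indep_sets_cong[THEN iffD1, rotated 2]) (auto split: bool.split)
  then show ?thesis unfolding indep_set_def
    by (rule indep_sets_mono_sets) (auto split: bool.split intro: sigma_sets.Basic)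
qed

text \<open>By independence, the value of one source may be replaced by an integral over its law. The functional \<open>\<phi>\<close> must depend
  on the sample point through the other sources only, which is expressed by its measurability.\<close>

lemma resample:
  assumes X: "X \<in> M \<rightarrow>\<^sub>M S" and a: "source_sets a = sets (vimage_algebra (space M) X S)"
    and \<phi>[measurable]: "\<phi> \<in> borel_measurable (S \<Otimes>\<^sub>M others a)"
  shows "(\<integral>\<^sup>+w. \<phi> (X w, w) \<partial>M) = (\<integral>\<^sup>+w. \<integral>\<^sup>+x. \<phi> (x, w) \<partial>distr M S X \<partial>M)"
proof -
  note id = id_measurable_others[of a]
  interpret P1: prob_space "distr M S X" by (rule prob_space_distr[OF X])
  interpret P2: prob_space "distr M (others a) (\<lambda>w. w)" by (rule prob_space_distr[OF id])
  interpret P: pair_prob_space "distr M S X" "distr M (others a) (\<lambda>w. w)" ..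
  have "distr M S X \<Otimes>\<^sub>M distr M (others a) (\<lambda>w. w) = distr M (S \<Otimes>\<^sub>M others a) (\<lambda>w. (X w, w))"
  proof (rule pair_measure_eqI)
    show "sets (distr M S X \<Otimes>\<^sub>M distr M (others a) (\<lambda>w. w)) = sets (distr M (S \<Otimes>\<^sub>M others a) (\<lambda>w. (X w, w)))"
      by (simp cong: sets_pair_measure_cong)
    fix A B assume A: "A \<in> sets (distr M S X)" and B: "B \<in> sets (distr M (others a) (\<lambda>w. w))"
    have X': "X -` A \<inter> space M \<in> source_sets a" unfolding a using A by (intro in_vimage_algebra) simp
    have B': "(\<lambda>w. w) -` B \<inter> space M = B" using B sets.sets_into_space[of B "others a"] by (auto simp: space_others)
    have Bev: "B \<in> events" using measurable_sets[OF id, of B] B B' by simp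
    have "(\<lambda>w. (X w, w)) -` (A \<times> B) \<inter> space M = (X -` A \<inter> space M) \<inter> B" using B' by auto
    then show "emeasure (distr M S X) A * emeasure (distr M (others a) (\<lambda>w. w)) B =
        emeasure (distr M (S \<Otimes>\<^sub>M others a) (\<lambda>w. (X w, w))) (A \<times> B)"
      using indep_setD[OF independent_of_others X', of B] A B B' X id
      by (simp add: emeasure_distr emeasure_eq_measure ennreal_mult[symmetric])
  qed unfold_locales
  then have "(\<integral>\<^sup>+w. \<phi> (X w, w) \<partial>M) = (\<integral>\<^sup>+p. \<phi> p \<partial>(distr M S X \<Otimes>\<^sub>M distr M (others a) (\<lambda>w. w)))"
    using X id by (simp add: nn_integral_distr)
  also have "\<dots> = (\<integral>\<^sup>+w. \<integral>\<^sup>+x. \<phi> (x, w) \<partial>distr M S X \<partial>distr M (others a) (\<lambda>w. w))"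
    by (rule P.nn_integral_snd[symmetric]) (simp add: measurable_cong_sets[OF sets_pair_measure_cong[OF sets_distr sets_distr] refl])
  also have "\<dots> = (\<integral>\<^sup>+w. \<integral>\<^sup>+x. \<phi> (x, w) \<partial>distr M S X \<partial>M)"
  proof (rule nn_integral_distr[where f = "\<lambda>w. \<integral>\<^sup>+x. \<phi> (x, w) \<partial>distr M S X", OF id])
    have "(\<lambda>p. \<phi> (snd p, fst p)) \<in> borel_measurable (others a \<Otimes>\<^sub>M S)" by measurable
    then have "(\<lambda>(w, x). \<phi> (x, w)) \<in> borel_measurable (others a \<Otimes>\<^sub>M distr M S X)"
      by (simp add: split_beta' measurable_cong_sets[OF sets_pair_measure_cong[OF refl sets_distr] refl])
    then have "(\<lambda>w. \<integral>\<^sup>+x. \<phi> (x, w) \<partial>distr M S X) \<in> borel_measurable (others a)"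
      by (rule P1.borel_measurable_nn_integral)
    then show "(\<lambda>w. \<integral>\<^sup>+x. \<phi> (x, w) \<partial>distr M S X) \<in> borel_measurable (distr M (others a) (\<lambda>w. w))" by simp
  qed
  finally show ?thesis .
qed

section \<open>The compensator of the departures\<close>

primrec req :: "'w \<Rightarrow> source \<Rightarrow> real" where
  "req w Initial = 1"
| "req w (Residual j l) = \<rho> w j l"
| "req w (Interarrival k) = 1"
| "req w (Service k) = \<sigma> w k"
| "req w (Sample k) = 1"

lemma req_pos: "w \<in> space M \<Longrightarrow> 0 < req w z"
  using residual_pos service_pos by (cases z) auto

lemma arrivals: "w \<in> space M \<Longrightarrow> jsq_arrivals (\<tau> w)"
  using interarrival_pos arrivals_diverge by unfold_locales

definition task_source :: "source \<Rightarrow> bool" where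
  "task_source z \<longleftrightarrow> (\<exists>j l. z = Residual j l) \<or> (\<exists>k. z = Service k)"

lemma req_distributed:
  assumes "task_source z" shows "distributed M lborel (\<lambda>w. req w z) (exponential_density 1)"
  using assms residual service by (auto simp: task_source_def)

lemma req_source_sets:
  assumes "task_source z" shows "source_sets z = sets (vimage_algebra (space M) (\<lambda>w. req w z) borel)"
  using assms by (auto simp: task_source_def source_sets_simps)

lemma req_measurable[measurable]: "(\<lambda>w. req w z) \<in> borel_measurable M"
  using distributed_measurable[OF residual] distributed_measurable[OF service] by (cases z) simp_all

lemma \<tau>_measurable: "(\<lambda>w. \<tau> w k) \<in> borel_measurable M"
  using distributed_measurable[OF interarrival] by simp

sublocale data: random_data M N b x0 \<tau> L req
  using initial_random \<tau>_measurable sample_random by unfold_locales simp_all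

lemma req_measurable_others:
  assumes "task_source z'" "z' \<noteq> a" shows "(\<lambda>w. req w z') \<in> borel_measurable (others a)"
  by (rule measurable_others[OF assms(2) _ req_source_sets[OF assms(1)]]) auto

lemma tail_exponential: "0 \<le> x \<Longrightarrow> (\<integral>\<^sup>+s. ennreal (exponential_density 1 s) * indicator {x<..} s \<partial>lborel) = ennreal (exp (- x))"
proof -
  assume x: "0 \<le> x"
  note D = service[of 0]
  have "(\<integral>\<^sup>+s. ennreal (exponential_density 1 s) * indicator {x<..} s \<partial>lborel) = emeasure M ((\<lambda>w. \<sigma> w 0) -` {x<..} \<inter> space M)"
    by (rule distributed_emeasure[OF D, symmetric]) simp
  also have "(\<lambda>w. \<sigma> w 0) -` {x<..} \<inter> space M = {w \<in> space M. x < \<sigma> w 0}" by auto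
  also have "emeasure M \<dots> = ennreal (exp (- x))"
    using exponential_distributedD_gt[OF D x] by (simp add: emeasure_eq_measure)
  finally show ?thesis .
qed

text \<open>At each time of its service, a task departs at unit rate. Both sides equal \<open>\<integral> \<phi>(x) e\<^sup>-\<^sup>x dx\<close> in the mean:
  the left-hand side by the density of the requirement, the right-hand side by its tail.\<close>

lemma departure_rate:
  assumes z: "task_source z" and \<phi>[measurable]: "\<phi> \<in> borel_measurable (borel \<Otimes>\<^sub>M others z)"
  shows "(\<integral>\<^sup>+w. \<phi> (req w z, w) \<partial>M) = (\<integral>\<^sup>+w. \<integral>\<^sup>+x. \<phi> (x, w) * indicator {0<..<req w z} x \<partial>lborel \<partial>M)"
proof -
  let ?X = "\<lambda>w. req w z" and ?e = "\<lambda>s. ennreal (exponential_density 1 s)"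
  have e[measurable]: "?e \<in> borel_measurable borel" by measurable
  have law: "distr M borel ?X = density lborel ?e"
  proof -
    have "distr M borel ?X = distr M lborel ?X" by (rule distr_cong) simp_all
    then show ?thesis using distributed_distr_eq_density[OF req_distributed[OF z]] by simp
  qed
  have law_int: "(\<integral>\<^sup>+x. f x \<partial>distr M borel ?X) = (\<integral>\<^sup>+x. ?e x * f x \<partial>lborel)" if "f \<in> borel_measurable borel" for f
    unfolding law using that by (subst nn_integral_density) auto
  have sec[measurable]: "(\<lambda>x. \<phi> (x, w)) \<in> borel_measurable borel" if "w \<in> space M" for w
    by (rule measurable_compose[OF _ \<phi>]) (use that in \<open>simp add: space_others\<close>)
  have 1: "(\<integral>\<^sup>+w. \<phi> (?X w, w) \<partial>M) = (\<integral>\<^sup>+w. \<integral>\<^sup>+x. ?e x * \<phi> (x, w) \<partial>lborel \<partial>M)"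
    unfolding resample[OF req_measurable req_source_sets[OF z] \<phi>]
    by (rule nn_integral_cong) (simp add: law_int sec)
  define \<phi>' where "\<phi>' p = (\<integral>\<^sup>+x. \<phi> (x, snd p) * indicator {0<..<fst p} x \<partial>lborel)" for p :: "real \<times> 'w"
  have \<phi>'m: "\<phi>' \<in> borel_measurable (borel \<Otimes>\<^sub>M others z)"
    unfolding \<phi>'_def
  proof (rule lborel.borel_measurable_nn_integral)
    have "(\<lambda>q. \<phi> (snd q, snd (fst q)) * indicator {0<..<fst (fst q)} (snd q)) \<in> borel_measurable ((borel \<Otimes>\<^sub>M others z) \<Otimes>\<^sub>M lborel)"
      unfolding indicator_def greaterThanLessThan_iff by measurable
    then show "(\<lambda>(p, x). \<phi> (x, snd p) * indicator {0<..<fst p} x) \<in> borel_measurable ((borel \<Otimes>\<^sub>M others z) \<Otimes>\<^sub>M lborel)"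
      by (simp add: split_beta')
  qed
  have "(\<integral>\<^sup>+w. \<phi>' (?X w, w) \<partial>M) = (\<integral>\<^sup>+w. \<integral>\<^sup>+s. ?e s * \<phi>' (s, w) \<partial>lborel \<partial>M)"
    unfolding resample[OF req_measurable req_source_sets[OF z] \<phi>'m]
  proof (rule nn_integral_cong)
    fix w assume "w \<in> space M"
    then have "(\<lambda>s. \<phi>' (s, w)) \<in> borel_measurable borel"
      by (intro measurable_compose[OF _ \<phi>'m]) (simp add: space_others)
    then show "(\<integral>\<^sup>+s. \<phi>' (s, w) \<partial>distr M borel ?X) = (\<integral>\<^sup>+s. ?e s * \<phi>' (s, w) \<partial>lborel)" by (rule law_int)
  qed
  also have "\<dots> = (\<integral>\<^sup>+w. \<integral>\<^sup>+x. ?e x * \<phi> (x, w) \<partial>lborel \<partial>M)"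
  proof (rule nn_integral_cong)
    fix w assume w: "w \<in> space M"
    note [measurable] = sec[OF w]
    have "(\<integral>\<^sup>+s. ?e s * \<phi>' (s, w) \<partial>lborel) = (\<integral>\<^sup>+s. \<integral>\<^sup>+x. ?e s * (\<phi> (x, w) * indicator {0<..<s} x) \<partial>lborel \<partial>lborel)"
      unfolding \<phi>'_def fst_conv snd_conv by (intro nn_integral_cong nn_integral_cmult[symmetric]) measurable
    also have "\<dots> = (\<integral>\<^sup>+x. \<integral>\<^sup>+s. ?e s * (\<phi> (x, w) * indicator {0<..<s} x) \<partial>lborel \<partial>lborel)"
    proof (rule lborel_pair.Fubini')
      have "(\<lambda>p. ?e (snd p) * (\<phi> (fst p, w) * indicator {0<..<snd p} (fst p))) \<in> borel_measurable (lborel \<Otimes>\<^sub>M lborel)"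
        unfolding indicator_def greaterThanLessThan_iff by measurable
      then show "(\<lambda>(x, s). ?e s * (\<phi> (x, w) * indicator {0<..<s} x)) \<in> borel_measurable (lborel \<Otimes>\<^sub>M lborel)"
        by (simp add: split_beta')
    qed
    also have "\<dots> = (\<integral>\<^sup>+x. ?e x * \<phi> (x, w) \<partial>lborel)"
    proof (rule nn_integral_cong_AE)
      show "AE x in lborel. (\<integral>\<^sup>+s. ?e s * (\<phi> (x, w) * indicator {0<..<s} x) \<partial>lborel) = ?e x * \<phi> (x, w)"
        using AE_lborel_singleton[of 0]
      proof eventually_elim
        case (elim x)
        show ?case
        proof (cases "0 < x")
          case True
          have "(\<integral>\<^sup>+s. ?e s * (\<phi> (x, w) * indicator {0<..<s} x) \<partial>lborel) = (\<integral>\<^sup>+s. (?e s * indicator {x<..} s) * \<phi> (x, w) \<partial>lborel)"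
            using True by (intro nn_integral_cong) (auto simp: indicator_def)
          also have "\<dots> = ennreal (exp (- x)) * \<phi> (x, w)"
            using tail_exponential[of x] True by (subst nn_integral_multc) auto
          finally show ?thesis using True by (simp add: exponential_density_def)
        next
          case False
          then show ?thesis using elim by (simp add: exponential_density_def)
        qed
      qed
    qed
    finally show "(\<integral>\<^sup>+s. ?e s * \<phi>' (s, w) \<partial>lborel) = (\<integral>\<^sup>+x. ?e x * \<phi> (x, w) \<partial>lborel)" .
  qed
  finally show ?thesis unfolding 1 by (simp add: \<phi>'_def)
qed

end

context jsq_system
begin

text \<open>On this event, all tasks up to time \<open>t\<close> belong to a fixed finite set, which makes the expectations below finite. It
  depends on no service requirement, so it is not affected by the shortenings.\<close>

definition bounded_input :: "real \<Rightarrow> nat \<Rightarrow> 'w \<Rightarrow> bool" where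
  "bounded_input t n w \<longleftrightarrow> (\<forall>j<N. x0 w ! j \<le> n) \<and> t < arrival_time (\<tau> w) n"

definition tasks_upto :: "nat \<Rightarrow> source set" where
  "tasks_upto n = (\<lambda>(j, l). Residual j l) ` ({..<N} \<times> {..<n}) \<union> Service ` {..<n}"

lemma finite_tasks_upto: "finite (tasks_upto n)"
  by (simp add: tasks_upto_def)

lemma task_source_upto: "z \<in> tasks_upto n \<Longrightarrow> task_source z"
  by (auto simp: tasks_upto_def task_source_def)

lemma tasks_upto_complete:
  assumes w: "w \<in> space M" and g: "bounded_input t n w" and j: "j < N" and z: "z \<in> data.tasks_at w j" and a: "jsq_data.arrival (\<tau> w) z \<le> t"
  shows "z \<in> tasks_upto n"
proof -
  interpret A: jsq_arrivals N b "x0 w" "\<tau> w" "L w" by (rule arrivals[OF w])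
  from z show ?thesis
  proof (cases rule: A.tasks_at_cases)
    case (1 l)
    then show ?thesis using g j by (force simp: tasks_upto_def bounded_input_def)
  next
    case (2 k)
    then have "arrival_time (\<tau> w) k < arrival_time (\<tau> w) n" using a g by (auto simp: bounded_input_def)
    then have "k < n" by (simp add: A.arrival_time_less)
    then show ?thesis using 2 by (auto simp: tasks_upto_def)
  qed
qed

lemma data_measurable_others:
  assumes "task_source z"
  shows "x0 \<in> others z \<rightarrow>\<^sub>M count_space UNIV" "(\<lambda>w. \<tau> w k) \<in> borel_measurable (others z)"
    "(\<lambda>w. L w k) \<in> others z \<rightarrow>\<^sub>M count_space UNIV"
proof -
  show "x0 \<in> others z \<rightarrow>\<^sub>M count_space UNIV"
    by (rule measurable_others[of Initial]) (use assms in \<open>auto simp: source_sets_simps task_source_def\<close>)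
  show "(\<lambda>w. \<tau> w k) \<in> borel_measurable (others z)"
    by (rule measurable_others[of "Interarrival k"]) (use assms in \<open>auto simp: source_sets_simps task_source_def\<close>)
  show "(\<lambda>w. L w k) \<in> others z \<rightarrow>\<^sub>M count_space UNIV"
    by (rule measurable_others[of "Sample k"]) (use assms in \<open>auto simp: source_sets_simps task_source_def\<close>)
qed

lemma shortened_data:
  assumes "task_source z"
  shows "random_data (borel \<Otimes>\<^sub>M others z) (\<lambda>p. x0 (snd p)) (\<lambda>p. \<tau> (snd p)) (\<lambda>p. L (snd p)) (\<lambda>p. (req (snd p))(z := fst p))"
proof
  note [measurable] = data_measurable_others[OF assms]
  show "(\<lambda>p. x0 (snd p)) \<in> borel \<Otimes>\<^sub>M others z \<rightarrow>\<^sub>M count_space UNIV" by measurable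
  show "(\<lambda>p. \<tau> (snd p) k) \<in> borel_measurable (borel \<Otimes>\<^sub>M others z)" for k by measurable
  show "(\<lambda>p. L (snd p) k) \<in> borel \<Otimes>\<^sub>M others z \<rightarrow>\<^sub>M count_space UNIV" for k by measurable
  show "(\<lambda>p. ((req (snd p))(z := fst p)) z') \<in> borel_measurable (borel \<Otimes>\<^sub>M others z)" for z'
  proof (cases "z' = z")
    case False
    have [measurable]: "(\<lambda>w. req w z') \<in> borel_measurable (others z)"
    proof (cases "task_source z'")
      case True
      then show ?thesis using req_measurable_others False by blast
    next
      case ns: False
      then show ?thesis by (cases z') (auto simp: task_source_def)
    qed
    show ?thesis using False by simp
  qed simp
qed

lemma bounded_input_measurable:
  assumes [measurable]: "x0 \<in> K \<rightarrow>\<^sub>M count_space UNIV" "\<And>k. (\<lambda>w. \<tau> w k) \<in> borel_measurable K"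
  shows "Measurable.pred K (bounded_input t n)"
proof -
  have [measurable]: "Measurable.pred K (\<lambda>w. x0 w ! j \<le> n)" for j
    by (rule measurable_compose[OF assms(1)]) simp
  have [measurable]: "(\<lambda>w. arrival_time (\<tau> w) n) \<in> borel_measurable K" unfolding arrival_time_def by measurable
  have "Measurable.pred K (\<lambda>w. (\<forall>j\<in>{..<N}. x0 w ! j \<le> n) \<and> t < arrival_time (\<tau> w) n)" by measurable
  then show ?thesis unfolding bounded_input_def[abs_def] by simp
qed

lemma sum_departure_rates:
  fixes \<psi> :: "'w \<Rightarrow> (source \<Rightarrow> real) \<Rightarrow> source \<Rightarrow> real"
  assumes \<psi>: "\<And>z. task_source z \<Longrightarrow> (\<lambda>p. \<psi> (snd p) ((req (snd p))(z := fst p)) z) \<in> borel_measurable (borel \<Otimes>\<^sub>M others z)"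
  shows "(\<integral>\<^sup>+w. of_bool (bounded_input t n w) * (\<Sum>z\<in>tasks_upto n. ennreal (\<psi> w (req w) z)) \<partial>M) =
    (\<integral>\<^sup>+w. of_bool (bounded_input t n w) * (\<Sum>z\<in>tasks_upto n. \<integral>\<^sup>+x. ennreal (\<psi> w ((req w)(z := x)) z) * indicator {0<..<req w z} x \<partial>lborel) \<partial>M)"
proof -
  define g :: "'w \<Rightarrow> ennreal" where "g w = of_bool (bounded_input t n w)" for w
  define \<phi> where "\<phi> z p = g (snd p) * ennreal (\<psi> (snd p) ((req (snd p))(z := fst p)) z)" for z and p :: "real \<times> 'w"
  have \<phi>m: "\<phi> z \<in> borel_measurable (borel \<Otimes>\<^sub>M others z)" if z: "task_source z" for z
  proof -
    have [measurable]: "Measurable.pred (others z) (bounded_input t n)"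
      by (rule bounded_input_measurable) (use data_measurable_others[OF z] in auto)
    note [measurable] = \<psi>[OF z]
    show ?thesis unfolding \<phi>_def g_def by measurable
  qed
  have \<phi>m1: "(\<lambda>w. \<phi> z (req w z, w)) \<in> borel_measurable M" if z: "task_source z" for z
  proof (rule measurable_compose[OF _ \<phi>m[OF z]])
    note [measurable] = id_measurable_others[of z]
    show "(\<lambda>w. (req w z, w)) \<in> M \<rightarrow>\<^sub>M borel \<Otimes>\<^sub>M others z" by (rule measurable_Pair) measurable
  qed
  have \<phi>m2: "(\<lambda>w. \<integral>\<^sup>+x. \<phi> z (x, w) * indicator {0<..<req w z} x \<partial>lborel) \<in> borel_measurable M" if z: "task_source z" for z
  proof (rule lborel.borel_measurable_nn_integral)
    note id_measurable_others[of z, measurable]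
    have "(\<lambda>q. (snd q, fst q)) \<in> M \<Otimes>\<^sub>M lborel \<rightarrow>\<^sub>M borel \<Otimes>\<^sub>M others z"
      by (rule measurable_Pair) (use measurable_compose[OF measurable_fst id_measurable_others[of z]] in auto)
    from measurable_compose[OF this \<phi>m[OF z]]
    have [measurable]: "(\<lambda>q. \<phi> z (snd q, fst q)) \<in> borel_measurable (M \<Otimes>\<^sub>M lborel)" .
    have "(\<lambda>q. \<phi> z (snd q, fst q) * indicator {0<..<req (fst q) z} (snd q)) \<in> borel_measurable (M \<Otimes>\<^sub>M lborel)"
      unfolding indicator_def greaterThanLessThan_iff by measurable
    then show "(\<lambda>(w, x). \<phi> z (x, w) * indicator {0<..<req w z} x) \<in> borel_measurable (M \<Otimes>\<^sub>M lborel)"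
      by (simp add: split_beta')
  qed
  have "(\<integral>\<^sup>+w. g w * (\<Sum>z\<in>tasks_upto n. ennreal (\<psi> w (req w) z)) \<partial>M) = (\<integral>\<^sup>+w. (\<Sum>z\<in>tasks_upto n. \<phi> z (req w z, w)) \<partial>M)"
    by (intro nn_integral_cong) (simp add: \<phi>_def sum_distrib_left)
  also have "\<dots> = (\<Sum>z\<in>tasks_upto n. \<integral>\<^sup>+w. \<phi> z (req w z, w) \<partial>M)"
    by (rule nn_integral_sum) (use \<phi>m1 task_source_upto in blast)
  also have "\<dots> = (\<Sum>z\<in>tasks_upto n. \<integral>\<^sup>+w. \<integral>\<^sup>+x. \<phi> z (x, w) * indicator {0<..<req w z} x \<partial>lborel \<partial>M)"
    by (intro sum.cong refl departure_rate \<phi>m task_source_upto)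
  also have "\<dots> = (\<integral>\<^sup>+w. (\<Sum>z\<in>tasks_upto n. \<integral>\<^sup>+x. \<phi> z (x, w) * indicator {0<..<req w z} x \<partial>lborel) \<partial>M)"
    by (rule nn_integral_sum[symmetric]) (use \<phi>m2 task_source_upto in blast)
  also have "\<dots> = (\<integral>\<^sup>+w. g w * (\<Sum>z\<in>tasks_upto n. \<integral>\<^sup>+x. ennreal (\<psi> w ((req w)(z := x)) z) * indicator {0<..<req w z} x \<partial>lborel) \<partial>M)"
    by (intro nn_integral_cong) (simp add: \<phi>_def g_def)
  finally show ?thesis unfolding g_def .
qed

lemma nn_integral_eq_LINT:
  fixes f :: "real \<Rightarrow> real"
  assumes "f \<in> borel_measurable borel" "\<And>s. s \<in> {0..t} \<Longrightarrow> 0 \<le> f s \<and> f s \<le> B"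
  shows "(\<integral>\<^sup>+s. ennreal (f s) * indicator {0..t} s \<partial>lborel) = ennreal (LINT s:{0..t}|lborel. f s)"
proof -
  have "set_integrable lborel {0..t} f"
    by (rule set_integrable_bounded[where B = B]) (use assms in \<open>force simp: abs_le_iff\<close>)+
  moreover have "(\<integral>\<^sup>+s. ennreal (f s) * indicator {0..t} s \<partial>lborel) = (\<integral>\<^sup>+s. ennreal (indicat_real {0..t} s *\<^sub>R f s) \<partial>lborel)"
    by (intro nn_integral_cong) (auto simp: indicator_def)
  ultimately show ?thesis
    unfolding set_lebesgue_integral_def set_integrable_def
    by (simp only:, intro nn_integral_eq_integral) (use assms(2) in \<open>auto simp: indicator_def\<close>)
qed

text \<open>The time \<open>C\<close> that queues spend at level \<open>i\<close>, with density \<open>c\<close>, compensates the number \<open>D\<close> of departures from level \<open>i\<close>.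
  The identity for the departure rates turns the sum of the ranks into \<open>\<integral> c (2 D + 1)\<close> and the sum of the values of \<open>C\<close> at the
  departures into \<open>\<integral> c C\<close>. In the expansion of \<open>(D - C)\<^sup>2\<close> everything then cancels except \<open>\<integral> c = C t \<le> N t\<close>.\<close>

lemma compensated_second_moment:
  assumes i: "1 \<le> i" and t: "0 \<le> t"
  shows "(\<integral>\<^sup>+w. of_bool (bounded_input t n w) * ennreal ((real (card (data.counted w i t)) - data.time_at_level w i t)\<^sup>2) \<partial>M) \<le> ennreal (real N * t)"
proof -
  let ?g = "\<lambda>w. of_bool (bounded_input t n w) :: ennreal"
  let ?D = "\<lambda>w s. real (card (data.counted w i s))" and ?C = "\<lambda>w s. data.time_at_level w i s" and ?c = "\<lambda>w s. real (data.at_level w i s)"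
  let ?K = "tasks_upto n"
  define \<psi>1 where "\<psi>1 w S z = (if z \<in> jsq_data.counted N b (x0 w) (\<tau> w) (L w) S i t then jsq_data.rank_of N b (x0 w) (\<tau> w) (L w) S i t z else 0)" for w S z
  define \<psi>2 where "\<psi>2 w S z = (if z \<in> jsq_data.counted N b (x0 w) (\<tau> w) (L w) S i t
    then jsq_data.time_at_level N b (x0 w) (\<tau> w) (L w) S i (jsq_data.departure N b (x0 w) (\<tau> w) (L w) S z) else 0)" for w S z
  define XD where "XD w = (\<integral>\<^sup>+s. ennreal (?c w s * ?D w s) * indicator {0..t} s \<partial>lborel)" for w
  define XC where "XC w = (\<integral>\<^sup>+s. ennreal (?c w s * ?C w s) * indicator {0..t} s \<partial>lborel)" for w
  have m1: "(\<lambda>p. \<psi>1 (snd p) ((req (snd p))(z := fst p)) z) \<in> borel_measurable (borel \<Otimes>\<^sub>M others z)" if z: "task_source z" for z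
  proof -
    interpret R: random_data "borel \<Otimes>\<^sub>M others z" N b "\<lambda>p. x0 (snd p)" "\<lambda>p. \<tau> (snd p)" "\<lambda>p. L (snd p)" "\<lambda>p. (req (snd p))(z := fst p)"
      by (rule shortened_data[OF z])
    show ?thesis unfolding \<psi>1_def
      by (intro measurable_If borel_measurable_const R.rank_of_measurable R.counted_measurable[unfolded pred_def]) (use z in \<open>simp add: task_source_def\<close>)
  qed
  have m2: "(\<lambda>p. \<psi>2 (snd p) ((req (snd p))(z := fst p)) z) \<in> borel_measurable (borel \<Otimes>\<^sub>M others z)" if z: "task_source z" for z
  proof -
    interpret R: random_data "borel \<Otimes>\<^sub>M others z" N b "\<lambda>p. x0 (snd p)" "\<lambda>p. \<tau> (snd p)" "\<lambda>p. L (snd p)" "\<lambda>p. (req (snd p))(z := fst p)"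
      by (rule shortened_data[OF z])
    show ?thesis unfolding \<psi>2_def
      by (intro measurable_If borel_measurable_const R.time_at_level_measurable R.departure_measurable R.counted_measurable[unfolded pred_def]) (use z in \<open>simp add: task_source_def\<close>)
  qed
  have path: "ennreal ((?D w t - ?C w t)\<^sup>2) + 2 * ?g w * (\<Sum>z\<in>?K. ennreal (\<psi>2 w (req w) z)) + 2 * XD w = ?g w * (\<Sum>z\<in>?K. ennreal (\<psi>1 w (req w) z)) + 2 * XC w"
    "?g w * (\<Sum>z\<in>?K. \<integral>\<^sup>+x. ennreal (\<psi>1 w ((req w)(z := x)) z) * indicator {0<..<req w z} x \<partial>lborel) = 2 * XD w + ennreal (?C w t)"
    "?g w * (\<Sum>z\<in>?K. \<integral>\<^sup>+x. ennreal (\<psi>2 w ((req w)(z := x)) z) * indicator {0<..<req w z} x \<partial>lborel) = XC w"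
    "XD w \<le> ennreal (real N * real (card ?K) * t)" "XC w \<le> ennreal (real N * (real N * t) * t)" "ennreal (?C w t) \<le> ennreal (real N * t)"
    if w: "w \<in> space M" and g: "bounded_input t n w" for w
  proof -
    interpret A: jsq_arrivals N b "x0 w" "\<tau> w" "L w" by (rule arrivals[OF w])
    note pos = req_pos[OF w]
    have complete: "\<And>z j. j < N \<Longrightarrow> z \<in> A.tasks_at (req w) j \<Longrightarrow> A.arrival z \<le> t \<Longrightarrow> z \<in> ?K"
      using tasks_upto_complete[OF w g] by blast
    have Ksub: "?K \<subseteq> A.task_sources"
      using task_source_upto by (auto simp: task_source_def A.task_sources_def[where S = "req w", OF pos])
    have cK: "A.counted (req w) i s \<subseteq> ?K" if "s \<le> t" for s
    proof
      fix z assume z: "z \<in> A.counted (req w) i s"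
      then obtain j where "j < N" "z \<in> A.tasks_at (req w) j" using A.counted_subset by blast
      moreover have "A.arrival z \<le> t"
        using A.arrival_less_departure[where S = "req w", OF pos, of z] A.counted_departure[OF z] that by linarith
      ultimately show "z \<in> ?K" by (rule complete)
    qed
    have Dle: "?D w s \<le> real (card ?K)" if "s \<in> {0..t}" for s
      using card_mono[OF finite_tasks_upto cK[of s]] that by auto
    have Cle: "0 \<le> ?C w s \<and> ?C w s \<le> real N * t" if "s \<in> {0..t}" for s
    proof -
      have "?C w s \<le> real N * s" using A.time_at_level_bounds(2)[of s "req w" i] that by auto
      also have "\<dots> \<le> real N * t" using that by (intro mult_left_mono) auto
      finally show ?thesis using A.time_at_level_nonneg by auto
    qed
    have cle: "?c w s \<le> real N" for s using A.at_level_le by auto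
    note bm = A.at_level_real_borel[of "req w" i] A.counted_borel[of "req w" i] A.time_at_level_borel[of "req w" i]
    have cD: "0 \<le> ?c w s * ?D w s \<and> ?c w s * ?D w s \<le> real N * real (card ?K)" if "s \<in> {0..t}" for s
      using cle[of s] Dle[OF that] by (auto intro!: mult_mono)
    have cC: "0 \<le> ?c w s * ?C w s \<and> ?c w s * ?C w s \<le> real N * (real N * t)" if "s \<in> {0..t}" for s
      using cle[of s] Cle[OF that] by (auto intro!: mult_mono)
    have cDm: "(\<lambda>s. ?c w s * ?D w s) \<in> borel_measurable borel" and cCm: "(\<lambda>s. ?c w s * ?C w s) \<in> borel_measurable borel"
      using bm by (auto intro!: borel_measurable_times)
    have XD_eq: "XD w = ennreal (LINT s:{0..t}|lborel. ?c w s * ?D w s)" unfolding XD_def by (rule nn_integral_eq_LINT[OF cDm cD])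
    have XC_eq: "XC w = ennreal (LINT s:{0..t}|lborel. ?c w s * ?C w s)" unfolding XC_def by (rule nn_integral_eq_LINT[OF cCm cC])
    have LD0: "0 \<le> (LINT s:{0..t}|lborel. ?c w s * ?D w s)" "0 \<le> (LINT s:{0..t}|lborel. ?c w s * ?C w s)"
      unfolding set_lebesgue_integral_def using A.time_at_level_nonneg by (auto intro!: Bochner_Integration.integral_nonneg)
    have "\<bar>LINT s:{0..t}|lborel. ?c w s * ?D w s\<bar> \<le> real N * real (card ?K) * (t - 0)"
      by (rule LINT_abs_le[OF cDm]) (use cD t in auto)
    then show "XD w \<le> ennreal (real N * real (card ?K) * t)" unfolding XD_eq by (intro ennreal_leI) auto
    have "\<bar>LINT s:{0..t}|lborel. ?c w s * ?C w s\<bar> \<le> real N * (real N * t) * (t - 0)"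
      by (rule LINT_abs_le[OF cCm]) (use cC t in auto)
    then show "XC w \<le> ennreal (real N * (real N * t) * t)" unfolding XC_eq by (intro ennreal_leI) auto
    show "ennreal (?C w t) \<le> ennreal (real N * t)" by (intro ennreal_leI) (use Cle[of t] t in auto)
    have rank0: "0 \<le> A.rank_of (req w) i t z" for z unfolding A.rank_of_def by simp
    have sumK: "(\<Sum>z\<in>?K. ennreal (if z \<in> A.counted (req w) i t then g z else 0)) = ennreal (\<Sum>z\<in>A.counted (req w) i t. g z)"
      if "\<And>z. 0 \<le> g z" for g :: "source \<Rightarrow> real"
    proof -
      have "(\<Sum>z\<in>?K. ennreal (if z \<in> A.counted (req w) i t then g z else 0)) = ennreal (\<Sum>z\<in>?K. if z \<in> A.counted (req w) i t then g z else 0)"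
        using that by (intro sum_ennreal) auto
      also have "(\<Sum>z\<in>?K. if z \<in> A.counted (req w) i t then g z else 0) = (\<Sum>z\<in>A.counted (req w) i t. g z)"
        using cK[of t] finite_tasks_upto by (intro sum.mono_neutral_cong_right) auto
      finally show ?thesis .
    qed
    have S1: "(\<Sum>z\<in>?K. ennreal (\<psi>1 w (req w) z)) = ennreal (\<Sum>z\<in>A.counted (req w) i t. A.rank_of (req w) i t z)"
      unfolding \<psi>1_def by (rule sumK[OF rank0])
    have S2: "(\<Sum>z\<in>?K. ennreal (\<psi>2 w (req w) z)) = ennreal (\<Sum>z\<in>A.counted (req w) i t. A.time_at_level (req w) i (A.departure (req w) z))"
      unfolding \<psi>2_def by (rule sumK[OF A.time_at_level_nonneg])
    have Sn: "0 \<le> (\<Sum>z\<in>A.counted (req w) i t. A.rank_of (req w) i t z)" "0 \<le> (\<Sum>z\<in>A.counted (req w) i t. A.time_at_level (req w) i (A.departure (req w) z))"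
      using rank0 A.time_at_level_nonneg by (auto intro!: sum_nonneg)
    have two: "(2::ennreal) = ennreal 2" by simp
    note sq = A.compensated_square[where S = "req w" and i = i, OF pos t]
    show "ennreal ((?D w t - ?C w t)\<^sup>2) + 2 * ?g w * (\<Sum>z\<in>?K. ennreal (\<psi>2 w (req w) z)) + 2 * XD w = ?g w * (\<Sum>z\<in>?K. ennreal (\<psi>1 w (req w) z)) + 2 * XC w"
      unfolding S1 S2 XD_eq XC_eq two using g sq Sn LD0
      by (simp add: ennreal_mult[symmetric] ennreal_plus[symmetric] mult.commute del: ennreal_plus ennreal_numeral)
    show "?g w * (\<Sum>z\<in>?K. \<integral>\<^sup>+x. ennreal (\<psi>1 w ((req w)(z := x)) z) * indicator {0<..<req w z} x \<partial>lborel) = 2 * XD w + ennreal (?C w t)"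
    proof -
      have "(\<Sum>z\<in>?K. \<integral>\<^sup>+x. ennreal (\<psi>1 w ((req w)(z := x)) z) * indicator {0<..<req w z} x \<partial>lborel)
          = (\<integral>\<^sup>+s. ennreal (?c w s * (2 * ?D w s + 1)) * indicator {0..t} s \<partial>lborel)"
        unfolding \<psi>1_def by (rule A.sum_ranks_shortened[where S = "req w", OF pos t i finite_tasks_upto Ksub complete])
      also have "\<dots> = (\<integral>\<^sup>+s. 2 * (ennreal (?c w s * ?D w s) * indicator {0..t} s) + ennreal (?c w s) * indicator {0..t} s \<partial>lborel)"
      proof (rule nn_integral_cong)
        fix s
        have "ennreal (?c w s * (2 * ?D w s + 1)) = 2 * ennreal (?c w s * ?D w s) + ennreal (?c w s)"
          unfolding two by (simp add: ennreal_mult[symmetric] ennreal_plus[symmetric] algebra_simps del: ennreal_plus ennreal_numeral)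
        then show "ennreal (?c w s * (2 * ?D w s + 1)) * indicator {0..t} s = 2 * (ennreal (?c w s * ?D w s) * indicator {0..t} s) + ennreal (?c w s) * indicator {0..t} s"
          by (simp add: indicator_def)
      qed
      also have "\<dots> = 2 * XD w + (\<integral>\<^sup>+s. ennreal (?c w s) * indicator {0..t} s \<partial>lborel)"
        unfolding XD_def using bm cDm by (subst nn_integral_add) (auto simp: nn_integral_cmult)
      also have "(\<integral>\<^sup>+s. ennreal (?c w s) * indicator {0..t} s \<partial>lborel) = ennreal (?C w t)"
        unfolding A.time_at_level_def by (rule nn_integral_eq_LINT[OF bm(1), where B = "real N"]) (use cle in auto)
      finally have E: "(\<Sum>z\<in>?K. \<integral>\<^sup>+x. ennreal (\<psi>1 w ((req w)(z := x)) z) * indicator {0<..<req w z} x \<partial>lborel) = 2 * XD w + ennreal (?C w t)" .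
      have "?g w = 1" using g by simp
      then show ?thesis by (simp only: E mult_1_left)
    qed
    show "?g w * (\<Sum>z\<in>?K. \<integral>\<^sup>+x. ennreal (\<psi>2 w ((req w)(z := x)) z) * indicator {0<..<req w z} x \<partial>lborel) = XC w"
      unfolding \<psi>2_def XC_def using g A.sum_times_shortened[where S = "req w", OF pos t i finite_tasks_upto Ksub complete] by simp
  qed
  have wm[measurable]: "Measurable.pred M (bounded_input t n)"
    by (rule bounded_input_measurable) (use initial_random \<tau>_measurable in auto)
  have jc: "(\<lambda>p. real (data.at_level (fst p) i (snd p))) \<in> borel_measurable (M \<Otimes>\<^sub>M (borel :: real measure))"
    and jD: "(\<lambda>p. real (card (data.counted (fst p) i (snd p)))) \<in> borel_measurable (M \<Otimes>\<^sub>M (borel :: real measure))"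
    by (rule data.at_level_joint_measurable data.card_counted_joint_measurable)+
  have jC: "(\<lambda>p. data.time_at_level (fst p) i (snd p)) \<in> borel_measurable (M \<Otimes>\<^sub>M (borel :: real measure))"
  proof -
    interpret T: random_data "M \<Otimes>\<^sub>M (borel :: real measure)" N b "\<lambda>p. x0 (fst p)" "\<lambda>p. \<tau> (fst p)" "\<lambda>p. L (fst p)" "\<lambda>p. req (fst p)"
      by (rule data.random_data_times)
    show ?thesis by (rule T.time_at_level_measurable) measurable
  qed
  note [measurable] = jc jD jC
  have XDm[measurable]: "XD \<in> borel_measurable M"
    unfolding XD_def
  proof (rule lborel.borel_measurable_nn_integral)
    have "(\<lambda>p. ennreal (?c (fst p) (snd p) * ?D (fst p) (snd p)) * indicator {0..t} (snd p)) \<in> borel_measurable (M \<Otimes>\<^sub>M lborel)" by measurable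
    then show "(\<lambda>(w, s). ennreal (?c w s * ?D w s) * indicator {0..t} s) \<in> borel_measurable (M \<Otimes>\<^sub>M lborel)" by (simp add: split_beta')
  qed
  have XCm[measurable]: "XC \<in> borel_measurable M"
    unfolding XC_def
  proof (rule lborel.borel_measurable_nn_integral)
    have "(\<lambda>p. ennreal (?c (fst p) (snd p) * ?C (fst p) (snd p)) * indicator {0..t} (snd p)) \<in> borel_measurable (M \<Otimes>\<^sub>M lborel)" by measurable
    then show "(\<lambda>(w, s). ennreal (?c w s * ?C w s) * indicator {0..t} s) \<in> borel_measurable (M \<Otimes>\<^sub>M lborel)" by (simp add: split_beta')
  qed
  have Cm[measurable]: "(\<lambda>w. ?C w t) \<in> borel_measurable M" by (rule data.time_at_level_measurable) measurable
  have Dm[measurable]: "(\<lambda>w. ?D w t) \<in> borel_measurable M" by measurable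
  have \<psi>m[measurable]: "(\<lambda>w. \<psi>1 w (req w) z) \<in> borel_measurable M" "(\<lambda>w. \<psi>2 w (req w) z) \<in> borel_measurable M" if z: "task_source z" for z
  proof -
    have P: "(\<lambda>w. (req w z, w)) \<in> M \<rightarrow>\<^sub>M borel \<Otimes>\<^sub>M others z"
      by (rule measurable_Pair) (use id_measurable_others in auto)
    from measurable_compose[OF P m1[OF z]] measurable_compose[OF P m2[OF z]]
    show "(\<lambda>w. \<psi>1 w (req w) z) \<in> borel_measurable M" "(\<lambda>w. \<psi>2 w (req w) z) \<in> borel_measurable M" by simp_all
  qed
  have sm: "(\<lambda>w. \<Sum>z\<in>?K. ennreal (\<psi>1 w (req w) z)) \<in> borel_measurable M" "(\<lambda>w. \<Sum>z\<in>?K. ennreal (\<psi>2 w (req w) z)) \<in> borel_measurable M"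
    using \<psi>m task_source_upto by (auto intro!: borel_measurable_sum measurable_compose[OF _ measurable_ennreal])
  define IA where "IA = (\<integral>\<^sup>+w. ?g w * ennreal ((?D w t - ?C w t)\<^sup>2) \<partial>M)"
  define ID where "ID = (\<integral>\<^sup>+w. ?g w * XD w \<partial>M)"
  define IC where "IC = (\<integral>\<^sup>+w. ?g w * XC w \<partial>M)"
  define IW where "IW = (\<integral>\<^sup>+w. ?g w * ennreal (?C w t) \<partial>M)"
  have P1: "(\<integral>\<^sup>+w. ?g w * (\<Sum>z\<in>?K. ennreal (\<psi>1 w (req w) z)) \<partial>M) = 2 * ID + IW"
  proof -
    have "(\<integral>\<^sup>+w. ?g w * (\<Sum>z\<in>?K. ennreal (\<psi>1 w (req w) z)) \<partial>M) = (\<integral>\<^sup>+w. 2 * (?g w * XD w) + ?g w * ennreal (?C w t) \<partial>M)"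
    proof (rule trans[OF sum_departure_rates[where \<psi> = \<psi>1]])
      show "(\<integral>\<^sup>+w. ?g w * (\<Sum>z\<in>?K. \<integral>\<^sup>+x. ennreal (\<psi>1 w ((req w)(z := x)) z) * indicator {0<..<req w z} x \<partial>lborel) \<partial>M) = (\<integral>\<^sup>+w. 2 * (?g w * XD w) + ?g w * ennreal (?C w t) \<partial>M)"
      proof (rule nn_integral_cong)
        fix w assume w: "w \<in> space M"
        show "?g w * (\<Sum>z\<in>?K. \<integral>\<^sup>+x. ennreal (\<psi>1 w ((req w)(z := x)) z) * indicator {0<..<req w z} x \<partial>lborel) = 2 * (?g w * XD w) + ?g w * ennreal (?C w t)"
          using path(2)[OF w] by (cases "bounded_input t n w") auto
      qed
    qed (rule m1)
    also have "\<dots> = 2 * ID + IW" unfolding ID_def IW_def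
      by (subst nn_integral_add) (auto simp: nn_integral_cmult)
    finally show ?thesis .
  qed
  have P2: "(\<integral>\<^sup>+w. ?g w * (\<Sum>z\<in>?K. ennreal (\<psi>2 w (req w) z)) \<partial>M) = IC"
  proof (rule trans[OF sum_departure_rates[where \<psi> = \<psi>2]])
    show "(\<integral>\<^sup>+w. ?g w * (\<Sum>z\<in>?K. \<integral>\<^sup>+x. ennreal (\<psi>2 w ((req w)(z := x)) z) * indicator {0<..<req w z} x \<partial>lborel) \<partial>M) = IC"
      unfolding IC_def
    proof (rule nn_integral_cong)
      fix w assume w: "w \<in> space M"
      show "?g w * (\<Sum>z\<in>?K. \<integral>\<^sup>+x. ennreal (\<psi>2 w ((req w)(z := x)) z) * indicator {0<..<req w z} x \<partial>lborel) = ?g w * XC w"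
        using path(3)[OF w] by (cases "bounded_input t n w") auto
    qed
  qed (rule m2)
  have "IA + 2 * IC + 2 * ID = (\<integral>\<^sup>+w. ?g w * ennreal ((?D w t - ?C w t)\<^sup>2) + 2 * (?g w * (\<Sum>z\<in>?K. ennreal (\<psi>2 w (req w) z))) + 2 * (?g w * XD w) \<partial>M)"
    unfolding IA_def P2[symmetric] ID_def using sm by (simp add: nn_integral_add nn_integral_cmult)
  also have "\<dots> = (\<integral>\<^sup>+w. ?g w * (\<Sum>z\<in>?K. ennreal (\<psi>1 w (req w) z)) + 2 * (?g w * XC w) \<partial>M)"
  proof (rule nn_integral_cong)
    fix w assume w: "w \<in> space M"
    show "?g w * ennreal ((?D w t - ?C w t)\<^sup>2) + 2 * (?g w * (\<Sum>z\<in>?K. ennreal (\<psi>2 w (req w) z))) + 2 * (?g w * XD w) =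
        ?g w * (\<Sum>z\<in>?K. ennreal (\<psi>1 w (req w) z)) + 2 * (?g w * XC w)"
      using path(1)[OF w] by (cases "bounded_input t n w") auto
  qed
  also have "\<dots> = (2 * ID + IW) + 2 * IC"
    unfolding P1[symmetric] IC_def using sm by (simp add: nn_integral_add nn_integral_cmult)
  finally have eq: "(2 * IC + 2 * ID) + IA = (2 * IC + 2 * ID) + IW" by (simp add: ac_simps)
  have fin: "ID < \<infinity>" "IC < \<infinity>"
  proof -
    have "ID \<le> (\<integral>\<^sup>+w. ennreal (real N * real (card ?K) * t) \<partial>M)"
      unfolding ID_def using path(4) by (intro nn_integral_mono) (auto simp: of_bool_def)
    also have "\<dots> < \<infinity>" by (simp add: emeasure_space_1 ennreal_mult_less_top)
    finally show "ID < \<infinity>" .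
    have "IC \<le> (\<integral>\<^sup>+w. ennreal (real N * (real N * t) * t) \<partial>M)"
      unfolding IC_def using path(5) by (intro nn_integral_mono) (auto simp: of_bool_def)
    also have "\<dots> < \<infinity>" by (simp add: emeasure_space_1 ennreal_mult_less_top)
    finally show "IC < \<infinity>" .
  qed
  have "IA = IW" using eq fin by (auto simp: ennreal_add_left_cancel ennreal_mult_eq_top_iff)
  also have "IW \<le> (\<integral>\<^sup>+w. ennreal (real N * t) \<partial>M)"
    unfolding IW_def using path(6) by (intro nn_integral_mono) (auto simp: of_bool_def)
  also have "\<dots> = ennreal (real N * t)" by (simp add: emeasure_space_1)
  finally show ?thesis unfolding IA_def .
qed

end

section \<open>Laws of large numbers\<close>

context jsq_system
begin

lemma N_pos: "1 \<le> N"
  using d_pos d_le by simp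

lemma bounded_input_mono:
  assumes "w \<in> space M" "bounded_input t n w" "n \<le> m"
  shows "bounded_input t m w"
proof -
  interpret A: jsq_arrivals N b "x0 w" "\<tau> w" "L w" by (rule arrivals[OF assms(1)])
  have "arrival_time (\<tau> w) n \<le> arrival_time (\<tau> w) m" using A.arrival_time_less[of m n] assms(3) by linarith
  then show ?thesis using assms(2,3) unfolding bounded_input_def by (meson order_trans order_less_le_trans)
qed

lemma bounded_input_eventually:
  assumes "w \<in> space M"
  shows "\<exists>n. bounded_input t n w"
proof -
  interpret A: jsq_arrivals N b "x0 w" "\<tau> w" "L w" by (rule arrivals[OF assms])
  obtain m where m: "{k. arrival_time (\<tau> w) k \<le> t} = {..<m}" using A.arrivals_upto by blast
  define n where "n = Max (insert m ((\<lambda>j. x0 w ! j) ` {..<N}))"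
  have "x0 w ! j \<le> n" if "j < N" for j unfolding n_def using that by (intro Max_ge) auto
  moreover have "m \<le> n" unfolding n_def by (intro Max_ge) auto
  then have "n \<notin> {k. arrival_time (\<tau> w) k \<le> t}" unfolding m by simp
  then have "t < arrival_time (\<tau> w) n" by simp
  ultimately show ?thesis by (auto simp: bounded_input_def)
qed

text \<open>Markov's inequality on the events \<open>bounded_input t n\<close>, which exhaust the probability space as \<open>n \<rightarrow> \<infinity>\<close>.\<close>

lemma departures_concentrate:
  assumes i: "1 \<le> i" and t: "0 \<le> t" and \<epsilon>: "0 < \<epsilon>"
  shows "prob {w \<in> space M. \<epsilon> * real N \<le> \<bar>real (card (data.counted w i t)) - data.time_at_level w i t\<bar>} \<le> t / (\<epsilon>\<^sup>2 * real N)"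
proof -
  let ?Y = "\<lambda>w. real (card (data.counted w i t)) - data.time_at_level w i t"
  define A where "A n = {w \<in> space M. \<epsilon> * real N \<le> \<bar>?Y w\<bar> \<and> bounded_input t n w}" for n
  have [measurable]: "(\<lambda>w. data.time_at_level w i t) \<in> borel_measurable M" by (rule data.time_at_level_measurable) measurable
  have [measurable]: "Measurable.pred M (bounded_input t n)" for n
    by (rule bounded_input_measurable) (use initial_random \<tau>_measurable in auto)
  have Am[measurable]: "A n \<in> events" for n unfolding A_def by measurable
  have N: "0 < real N" using N_pos by simp
  have bound: "prob (A n) \<le> t / (\<epsilon>\<^sup>2 * real N)" for n
  proof -
    have "ennreal ((\<epsilon> * real N)\<^sup>2) * emeasure M (A n) = (\<integral>\<^sup>+w. ennreal ((\<epsilon> * real N)\<^sup>2) * indicator (A n) w \<partial>M)"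
      by (simp add: nn_integral_cmult_indicator)
    also have "\<dots> \<le> (\<integral>\<^sup>+w. of_bool (bounded_input t n w) * ennreal ((?Y w)\<^sup>2) \<partial>M)"
    proof (rule nn_integral_mono)
      fix w
      show "ennreal ((\<epsilon> * real N)\<^sup>2) * indicator (A n) w \<le> of_bool (bounded_input t n w) * ennreal ((?Y w)\<^sup>2)"
      proof (cases "w \<in> A n")
        case True
        then have "(\<epsilon> * real N)\<^sup>2 \<le> (?Y w)\<^sup>2" using \<epsilon> N by (simp add: A_def abs_le_square_iff[symmetric])
        then show ?thesis using True by (auto simp: A_def intro!: ennreal_leI)
      qed simp
    qed
    also have "\<dots> \<le> ennreal (real N * t)" by (rule compensated_second_moment[OF i t])
    finally have "(\<epsilon> * real N)\<^sup>2 * prob (A n) \<le> real N * t"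
      using N t by (simp add: emeasure_eq_measure ennreal_mult[symmetric])
    then have "real N * (\<epsilon>\<^sup>2 * real N * prob (A n)) \<le> real N * t" by (simp add: power2_eq_square mult_ac)
    then have "\<epsilon>\<^sup>2 * real N * prob (A n) \<le> t" using N by simp
    then show ?thesis using \<epsilon> N by (simp add: pos_le_divide_eq mult.commute)
  qed
  have "incseq A" using bounded_input_mono by (auto simp: incseq_def A_def)
  then have "(\<lambda>n. prob (A n)) \<longlonglongrightarrow> prob (\<Union>n. A n)" by (intro finite_Lim_measure_incseq) auto
  moreover have "(\<Union>n. A n) = {w \<in> space M. \<epsilon> * real N \<le> \<bar>?Y w\<bar>}"
    using bounded_input_eventually by (auto simp: A_def)
  ultimately show ?thesis using bound by (intro LIMSEQ_le_const2) auto
qed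

lemma interarrivals_independent: "indep_vars (\<lambda>_. borel) (\<lambda>k w. \<tau> w k) UNIV"
  unfolding indep_vars_def2
proof (intro conjI ballI)
  show "random_variable borel (\<lambda>w. \<tau> w k)" for k by (rule \<tau>_measurable)
  have F: "{(\<lambda>w. \<tau> w k) -` A \<inter> space M |A. A \<in> sets borel} = source_sets (Interarrival k)" for k
    unfolding source_sets_simps by (subst sets_vimage_algebra2) auto
  show "indep_sets (\<lambda>k. {(\<lambda>w. \<tau> w k) -` A \<inter> space M |A. A \<in> sets borel}) UNIV"
    unfolding F
  proof (rule indep_setsI)
    show "source_sets (Interarrival k) \<subseteq> events" for k by (rule source_sets_events)
    fix A and J :: "nat set" assume J: "J \<noteq> {}" "finite J" "\<forall>j\<in>J. A j \<in> source_sets (Interarrival j)"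
    define A' where "A' a = (case a of Interarrival k \<Rightarrow> A k | _ \<Rightarrow> {})" for a
    have ind: "indep_sets source_sets UNIV" using independent unfolding source_sets_def[abs_def] .
    have "prob (\<Inter>a\<in>Interarrival ` J. A' a) = (\<Prod>a\<in>Interarrival ` J. prob (A' a))"
      by (rule indep_setsD[OF ind]) (use J in \<open>auto simp: A'_def\<close>)
    then show "prob (\<Inter>j\<in>J. A j) = (\<Prod>j\<in>J. prob (A j))"
      by (simp add: A'_def prod.reindex inj_on_def)
  qed
qed

lemma arrival_time_deviation:
  assumes a: "0 < a"
  shows "prob {w \<in> space M. a \<le> \<bar>arrival_time (\<tau> w) k - (real k + 1) / rate\<bar>} \<le> (real k + 1) / (rate * a)\<^sup>2"
proof -
  have "distributed M lborel (\<lambda>w. \<Sum>i\<in>{..k}. \<tau> w i) (erlang_density (card {..k} - 1) rate)"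
    by (rule exponential_distributed_sum[OF _ _ rate_pos interarrival])
      (use indep_vars_subset[OF interarrivals_independent] in auto)
  then have D: "distributed M lborel (\<lambda>w. arrival_time (\<tau> w) k) (erlang_density k rate)" by (simp add: arrival_time_def)
  have E: "expectation (\<lambda>w. arrival_time (\<tau> w) k) = (real k + 1) / rate"
  proof -
    have "fact (k + 1) / (fact k * rate ^ 1) = ((real k + 1) * fact k) / (rate * fact k)" by (simp add: mult.commute)
    also have "\<dots> = (real k + 1) / rate" by (rule nonzero_mult_divide_mult_cancel_right) simp
    finally show ?thesis using erlang_ith_moment[OF rate_pos D, of 1] by simp
  qed
  have V: "variance (\<lambda>w. arrival_time (\<tau> w) k) = (real k + 1) / rate\<^sup>2"
    using erlang_distributed_variance[OF rate_pos D] by (simp add: algebra_simps)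
  have "prob {w \<in> space M. a \<le> \<bar>arrival_time (\<tau> w) k - expectation (\<lambda>w. arrival_time (\<tau> w) k)\<bar>} \<le> variance (\<lambda>w. arrival_time (\<tau> w) k) / a\<^sup>2"
    by (rule Chebyshev_inequality) (use erlang_ith_moment_integrable[OF rate_pos D, of 2] a in auto)
  then show ?thesis unfolding V unfolding E by (simp add: power_mult_distrib)
qed

abbreviation "arrivals_by w t \<equiv> card {k. arrival_time (\<tau> w) k \<le> t}"

lemma arrivals_by_gt:
  assumes "w \<in> space M" shows "k < arrivals_by w t \<longleftrightarrow> arrival_time (\<tau> w) k \<le> t"
proof -
  interpret A: jsq_arrivals N b "x0 w" "\<tau> w" "L w" by (rule arrivals[OF assms])
  show ?thesis using A.before_count[of t k] by (simp add: jsq_data.before.simps)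
qed

lemma arrivals_by_measurable[measurable]: "(\<lambda>w. arrivals_by w t) \<in> M \<rightarrow>\<^sub>M count_space UNIV"
  by (rule measurable_card) (use data.arrival_time_measurable in measurable)

text \<open>The arrivals deviate from their mean only if one of two arrival times deviates from its mean.\<close>

lemma arrivals_concentrate:
  assumes t: "0 \<le> t" and \<epsilon>: "0 < \<epsilon>" and N: "2 \<le> \<epsilon> * real N"
  shows "prob {w \<in> space M. \<epsilon> * real N \<le> \<bar>real (arrivals_by w t) - rate * t\<bar>} \<le> 8 * (rate * t + \<epsilon> * real N + 2) / (\<epsilon> * real N)\<^sup>2"
proof -
  let ?e = "\<epsilon> * real N"
  define m where "m = nat \<lceil>rate * t + ?e\<rceil> - 1"
  define l where "l = nat \<lfloor>rate * t - ?e\<rfloor>"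
  have r: "0 < rate" "0 \<le> rate * t" using rate_pos t by auto
  have m: "rate * t + ?e \<le> real m + 1" "real m \<le> rate * t + ?e"
  proof -
    have c: "1 \<le> \<lceil>rate * t + ?e\<rceil>" using N r by (simp add: le_ceiling_iff)
    then have "real (nat \<lceil>rate * t + ?e\<rceil>) = real_of_int \<lceil>rate * t + ?e\<rceil>" by simp
    moreover have "1 \<le> nat \<lceil>rate * t + ?e\<rceil>" using c by linarith
    ultimately have "real m + 1 = real_of_int \<lceil>rate * t + ?e\<rceil>" by (simp add: m_def of_nat_diff)
    then show "rate * t + ?e \<le> real m + 1" "real m \<le> rate * t + ?e" by linarith+
  qed
  define a where "a = ?e / (2 * rate)"
  have a: "0 < a" "rate * a = ?e / 2" using N r by (auto simp: a_def)
  let ?B = "\<lambda>k. {w \<in> space M. a \<le> \<bar>arrival_time (\<tau> w) k - (real k + 1) / rate\<bar>}"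
  have Bm: "?B k \<in> events" for k using data.arrival_time_measurable[of k] by measurable
  have B: "prob (?B k) \<le> 4 * (real k + 1) / ?e\<^sup>2" for k
    using arrival_time_deviation[OF a(1), of k] unfolding a(2) by (simp add: power_divide algebra_simps)
  have sub: "{w \<in> space M. ?e \<le> \<bar>real (arrivals_by w t) - rate * t\<bar>} \<subseteq> ?B m \<union> (if ?e \<le> rate * t then ?B l else {})"
  proof
    fix w assume "w \<in> {w \<in> space M. ?e \<le> \<bar>real (arrivals_by w t) - rate * t\<bar>}"
    then have w: "w \<in> space M" and dev: "?e \<le> \<bar>real (arrivals_by w t) - rate * t\<bar>" by auto
    show "w \<in> ?B m \<union> (if ?e \<le> rate * t then ?B l else {})"
    proof (cases "rate * t + ?e \<le> real (arrivals_by w t)")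
      case True
      have "real m < real (arrivals_by w t)"
      proof -
        have "\<lceil>rate * t + ?e\<rceil> \<le> int (arrivals_by w t)" using True by (simp add: ceiling_le_iff)
        moreover have "1 \<le> \<lceil>rate * t + ?e\<rceil>" using N r by (simp add: le_ceiling_iff)
        ultimately show ?thesis unfolding m_def by linarith
      qed
      then have "arrival_time (\<tau> w) m \<le> t" using arrivals_by_gt[OF w] by simp
      moreover have "t + a \<le> (real m + 1) / rate"
      proof -
        have "rate * (t + a) \<le> real m + 1" using m(1) a(2) N by (simp add: distrib_left)
        then show ?thesis using r by (simp add: pos_le_divide_eq mult.commute)
      qed
      ultimately show ?thesis using w by auto
    next
      case False
      then have le: "real (arrivals_by w t) \<le> rate * t - ?e" using dev by linarith
      then have pos: "?e \<le> rate * t" by linarith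
      then have l: "real l \<le> rate * t - ?e" unfolding l_def by linarith
      have "arrivals_by w t \<le> l" using le unfolding l_def by (simp add: le_nat_iff le_floor_iff)
      then have "t < arrival_time (\<tau> w) l" using arrivals_by_gt[OF w, of l t] by auto
      moreover have "(real l + 1) / rate \<le> t - a"
      proof -
        have "real l + 1 \<le> rate * (t - a)" using l a(2) N by (simp add: right_diff_distrib)
        then show ?thesis using r by (simp add: pos_divide_le_eq mult.commute)
      qed
      ultimately show ?thesis using w pos by auto
    qed
  qed
  have "prob {w \<in> space M. ?e \<le> \<bar>real (arrivals_by w t) - rate * t\<bar>} \<le> prob (?B m \<union> (if ?e \<le> rate * t then ?B l else {}))"
    by (rule finite_measure_mono[OF sub]) (use Bm in auto)
  also have "\<dots> \<le> prob (?B m) + prob (if ?e \<le> rate * t then ?B l else {})"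
    by (rule measure_Un_le) (use Bm in auto)
  also have "\<dots> \<le> 4 * (rate * t + ?e + 2) / ?e\<^sup>2 + 4 * (rate * t + ?e + 2) / ?e\<^sup>2"
  proof (rule add_mono)
    show "prob (?B m) \<le> 4 * (rate * t + ?e + 2) / ?e\<^sup>2"
      using m by (intro order_trans[OF B] divide_right_mono) auto
    show "prob (if ?e \<le> rate * t then ?B l else {}) \<le> 4 * (rate * t + ?e + 2) / ?e\<^sup>2"
    proof (cases "?e \<le> rate * t")
      case True
      then have "real l \<le> rate * t - ?e" unfolding l_def by linarith
      then have "4 * (real l + 1) / ?e\<^sup>2 \<le> 4 * (rate * t + ?e + 2) / ?e\<^sup>2"
        using N by (intro divide_right_mono) auto
      then show ?thesis using B[of l] True by auto
    qed (use r N in auto)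
  qed
  finally show ?thesis by simp
qed

section \<open>The sampled servers\<close>

abbreviation "samples \<equiv> {s. length s = d \<and> distinct s \<and> set s \<subseteq> {..<N}}"

lemma finite_samples: "finite samples"
  by (rule finite_subset[OF _ finite_lists_length_eq[of "{..<N}" d]]) auto

lemma card_distinct_lists: "finite B \<Longrightarrow> d \<le> card B \<Longrightarrow> card {s. length s = d \<and> distinct s \<and> set s \<subseteq> B} = (\<Prod>i<d. card B - i)"
proof -
  assume B: "finite B" "d \<le> card B"
  have "card {s. length s = d \<and> distinct s \<and> set s \<subseteq> B} = \<Prod>{card B - d + 1..card B}"
    by (rule card_lists_distinct_length_eq[OF B])
  also have "\<dots> = (\<Prod>i<d. card B - i)"
    by (rule prod.reindex_bij_witness[of _ "\<lambda>i. card B - i" "\<lambda>x. card B - x"]) (use B in auto)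
  finally show ?thesis .
qed

lemma samples_nonempty: "samples \<noteq> {}" "0 < card samples"
proof -
  have "card samples = (\<Prod>i<d. N - i)" using card_distinct_lists[of "{..<N}"] d_le by simp
  also have "\<dots> > 0" using d_le by (intro prod_pos) auto
  finally show "0 < card samples" .
  then show "samples \<noteq> {}" using card_gt_0_iff by blast
qed

text \<open>Sampling without replacement from a set that contains a fraction of at most \<open>p\<close> of the servers: each further
  draw hits it with probability \<open>(card B - i) / (N - i) \<le> p\<close>.\<close>

lemma sample_in_set_le:
  assumes B: "B \<subseteq> {..<N}" "real (card B) \<le> p * real N"
  shows "measure (measure_pmf (pmf_of_set samples)) {s. set s \<subseteq> B} \<le> p ^ d"
proof -
  have fin: "finite B" using B(1) finite_subset by blast
  have p0: "0 \<le> p" using B(2) N_pos by (smt (verit, best) mult_nonneg_nonneg of_nat_0_le_iff mult_neg_pos of_nat_0_less_iff zero_less_one order_less_le_trans of_nat_1 of_nat_mono)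
  have "measure (measure_pmf (pmf_of_set samples)) {s. set s \<subseteq> B} = real (card (samples \<inter> {s. set s \<subseteq> B})) / real (card samples)"
    by (rule measure_pmf_of_set[OF samples_nonempty(1) finite_samples])
  also have "samples \<inter> {s. set s \<subseteq> B} = {s. length s = d \<and> distinct s \<and> set s \<subseteq> B}" using B(1) by auto
  also have "real (card {s. length s = d \<and> distinct s \<and> set s \<subseteq> B}) / real (card samples) \<le> p ^ d"
  proof (cases "d \<le> card B")
    case False
    have "{s. length s = d \<and> distinct s \<and> set s \<subseteq> B} = {}"
      using False card_mono[OF fin] by (auto simp: distinct_card[symmetric])
    then show ?thesis using p0 by (simp only: card.empty) simp
  next
    case True
    have BN: "card B \<le> N" using card_mono[OF _ B(1)] by simp
    have "real (card {s. length s = d \<and> distinct s \<and> set s \<subseteq> B}) / real (card samples) = (\<Prod>i<d. real (card B - i) / real (N - i))"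
      using card_distinct_lists[OF fin True] card_distinct_lists[of "{..<N}"] d_le by (simp add: prod_dividef)
    also have "\<dots> \<le> (\<Prod>i<d. p)"
    proof (rule prod_mono)
      fix i assume "i \<in> {..<d}"
      then have i: "i < card B" "i < N" using True BN by auto
      have "real (card B - i) * real N \<le> real (card B) * real (N - i)"
      proof -
        have "real i * real (card B) \<le> real i * real N" using BN by (intro mult_left_mono) auto
        then show ?thesis using i by (simp add: of_nat_diff algebra_simps)
      qed
      also have "\<dots> \<le> p * real N * real (N - i)" using B(2) by (intro mult_right_mono) auto
      finally have "real N * real (card B - i) \<le> real N * (p * real (N - i))" by (simp add: mult_ac)
      then have "real (card B - i) \<le> p * real (N - i)" using N_pos by simp
      then show "0 \<le> real (card B - i) / real (N - i) \<and> real (card B - i) / real (N - i) \<le> p"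
        using i by (simp add: pos_divide_le_eq)
    qed
    finally show ?thesis by simp
  qed
  finally show ?thesis .
qed

lemma hist_cong_samples:
  assumes "\<And>m. m < k \<Longrightarrow> l m = l' m"
  shows "jsq_data.hist N b xs u l S k = jsq_data.hist N b xs u l' S k"
  using assms
proof (induction k)
  case (Suc k)
  then have h: "jsq_data.hist N b xs u l S k = jsq_data.hist N b xs u l' S k" by simp
  then show ?case using Suc.prems[of k] unfolding jsq_data.hist_Suc
    by (simp add: jsq_data.admitted_def jsq_data.queue_seen_def jsq_data.chosen_def jsq_data.departure_def jsq_data.start.simps)
qed (simp add: jsq_data.hist_def)

text \<open>The sample is independent of the queue lengths at the arrival. A bad overflow requires that it consists of
  servers from the set of at most \<open>(1 - \<epsilon>) N\<close> servers with long queues.\<close>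

lemma bad_overflow_unlikely:
  assumes \<epsilon>: "\<epsilon> \<le> 1"
  shows "prob {w \<in> space M. i \<le> data.queue_seen w k \<and> real (data.level_seen w i k) \<le> (1 - \<epsilon>) * real N} \<le> (1 - \<epsilon>) ^ d"
proof -
  let ?O = "others (Sample k)"
  let ?L = "\<lambda>p :: nat list \<times> 'w. (L (snd p))(k := fst p)"
  have [measurable]: "x0 \<in> ?O \<rightarrow>\<^sub>M count_space UNIV"
    by (rule measurable_others[of Initial]) (auto simp: source_sets_simps)
  have [measurable]: "(\<lambda>w. \<tau> w m) \<in> borel_measurable ?O" for m
    by (rule measurable_others[of "Interarrival m"]) (auto simp: source_sets_simps)
  have Lm: "(\<lambda>w. L w m) \<in> ?O \<rightarrow>\<^sub>M count_space UNIV" if "m \<noteq> k" for m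
    by (rule measurable_others[of "Sample m"]) (use that in \<open>auto simp: source_sets_simps\<close>)
  have [measurable]: "(\<lambda>w. req w z) \<in> borel_measurable ?O" for z
  proof (cases "task_source z")
    case True
    then show ?thesis by (intro req_measurable_others) (auto simp: task_source_def)
  next
    case False
    then show ?thesis by (cases z) (auto simp: task_source_def)
  qed
  interpret R: random_data "count_space UNIV \<Otimes>\<^sub>M ?O" N b "\<lambda>p. x0 (snd p)" "\<lambda>p. \<tau> (snd p)" ?L "\<lambda>p. req (snd p)"
  proof
    show "(\<lambda>p. ?L p m) \<in> count_space UNIV \<Otimes>\<^sub>M ?O \<rightarrow>\<^sub>M count_space UNIV" for m
      using measurable_compose[OF measurable_snd Lm[of m], of "count_space UNIV"] by (cases "m = k") auto
  qed measurable
  define bad where "bad p \<longleftrightarrow> i \<le> R.queue_seen p k \<and> real (R.level_seen p i k) \<le> (1 - \<epsilon>) * real N" for p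
  have bm[measurable]: "Measurable.pred (count_space UNIV \<Otimes>\<^sub>M ?O) bad" unfolding bad_def by measurable
  have Lk: "(\<lambda>w. L w k) \<in> M \<rightarrow>\<^sub>M count_space UNIV" by (rule sample_random)
  have law: "distr M (count_space UNIV) (\<lambda>w. L w k) = measure_pmf (pmf_of_set samples)" by (rule sample)
  let ?A = "{w \<in> space M. i \<le> data.queue_seen w k \<and> real (data.level_seen w i k) \<le> (1 - \<epsilon>) * real N}"
  have Am: "?A \<in> events" by measurable
  have "emeasure M ?A = (\<integral>\<^sup>+w. indicator ?A w \<partial>M)" using Am by simp
  also have "\<dots> = (\<integral>\<^sup>+w. of_bool (bad (L w k, w)) \<partial>M)"
    by (intro nn_integral_cong) (auto simp: bad_def indicator_def)
  also have "\<dots> = (\<integral>\<^sup>+w. \<integral>\<^sup>+s. of_bool (bad (s, w)) \<partial>distr M (count_space UNIV) (\<lambda>w. L w k) \<partial>M)"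
    by (rule resample[OF Lk, of "Sample k" "\<lambda>p. of_bool (bad p)"]) (auto simp: source_sets_simps)
  also have "\<dots> \<le> (\<integral>\<^sup>+w. ennreal ((1 - \<epsilon>) ^ d) \<partial>M)"
  proof (rule nn_integral_mono)
    fix w assume "w \<in> space M"
    define h where "h = data.hist w k"
    define q where "q s = queue_length h s (arrival_time (\<tau> w) k)" for s
    define B where "B = {j. j < N \<and> i \<le> q j}"
    have h: "R.hist (s, w) k = h" for s unfolding h_def fst_conv snd_conv by (rule hist_cong_samples) simp
    have seen: "R.queue_seen (s, w) k = q (arg_min_list q s)" "R.level_seen (s, w) i k = card B" for s
      using h[of s] unfolding jsq_data.queue_seen_def jsq_data.chosen_def jsq_data.level_seen_def B_def q_def by simp_all
    show "(\<integral>\<^sup>+s. of_bool (bad (s, w)) \<partial>distr M (count_space UNIV) (\<lambda>w. L w k)) \<le> ennreal ((1 - \<epsilon>) ^ d)"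
    proof (cases "real (card B) \<le> (1 - \<epsilon>) * real N")
      case False
      then show ?thesis unfolding bad_def seen using \<epsilon> by simp
    next
      case True
      have "(\<integral>\<^sup>+s. of_bool (bad (s, w)) \<partial>measure_pmf (pmf_of_set samples)) \<le> (\<integral>\<^sup>+s. indicator {s. set s \<subseteq> B} s \<partial>measure_pmf (pmf_of_set samples))"
      proof (rule nn_integral_mono_AE, rule AE_pmfI)
        fix s assume "s \<in> set_pmf (pmf_of_set samples)"
        then have s: "length s = d" "set s \<subseteq> {..<N}" using set_pmf_of_set[OF samples_nonempty(1) finite_samples] by auto
        have ne: "s \<noteq> []" using s(1) d_pos by auto
        have "set s \<subseteq> B" if "bad (s, w)"
        proof
          fix j assume j: "j \<in> set s"
          have "i \<le> Min (q ` set s)" using that f_arg_min_list_f[OF ne, of q] unfolding bad_def seen by simp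
          also have "\<dots> \<le> q j" using j by (intro Min_le) auto
          finally show "j \<in> B" using j s(2) by (auto simp: B_def)
        qed
        then show "of_bool (bad (s, w)) \<le> (indicator {s. set s \<subseteq> B} s :: ennreal)" by (auto simp: indicator_def)
      qed
      also have "\<dots> = ennreal (measure (measure_pmf (pmf_of_set samples)) {s. set s \<subseteq> B})"
        by (simp add: measure_pmf.emeasure_eq_measure)
      also have "\<dots> \<le> ennreal ((1 - \<epsilon>) ^ d)"
        by (intro ennreal_leI sample_in_set_le) (use True in \<open>auto simp: B_def\<close>)
      finally show ?thesis unfolding law .
    qed
  qed
  also have "\<dots> = ennreal ((1 - \<epsilon>) ^ d)" by (simp add: emeasure_space_1)
  finally show ?thesis using \<epsilon> by (simp add: emeasure_eq_measure)
qed

lemma chosen_valid: "AE w in M. \<forall>k. data.chosen w k < N"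
proof -
  have "AE w in M. L w k \<in> samples" for k
  proof -
    have "AE s in measure_pmf (pmf_of_set samples). s \<in> samples"
      by (rule AE_pmfI) (use set_pmf_of_set[OF samples_nonempty(1) finite_samples] in auto)
    then have "AE s in distr M (count_space UNIV) (\<lambda>w. L w k). s \<in> samples" unfolding sample .
    then show ?thesis by (subst (asm) AE_distr_iff[OF sample_random]) auto
  qed
  then have "AE w in M. \<forall>k. L w k \<in> samples" by (simp add: AE_all_countable)
  then show ?thesis
  proof eventually_elim
    case (elim w)
    have "data.chosen w k < N" for k
    proof -
      have "length (L w k) = d" using elim by blast
      then have "L w k \<noteq> []" using d_pos by auto
      then have "data.chosen w k \<in> set (L w k)" unfolding jsq_data.chosen_def by (rule arg_min_list_in)
      then show ?thesis using elim by blast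
    qed
    then show ?case by blast
  qed
qed

text \<open>Up to time \<open>t\<close> there are unlikely to be more than \<open>n\<close> arrivals, and among \<open>n\<close> arrivals few bad overflows.\<close>

lemma bad_overflows_few:
  assumes \<epsilon>: "\<epsilon> \<le> 1" and a: "0 < a"
  shows "prob {w \<in> space M. a \<le> real (card (data.bad_overflows w \<epsilon> i t))} \<le> prob {w \<in> space M. n < arrivals_by w t} + real n * (1 - \<epsilon>) ^ d / a"
proof -
  let ?A = "\<lambda>k. {w \<in> space M. i \<le> data.queue_seen w k \<and> real (data.level_seen w i k) \<le> (1 - \<epsilon>) * real N}"
  have Am[measurable]: "?A k \<in> events" for k by measurable
  let ?Y = "\<lambda>w. \<Sum>k<n. indicat_real (?A k) w"
  have "prob {w \<in> space M. a \<le> ?Y w} \<le> expectation ?Y / a"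
    by (rule integral_Markov_inequality_measure[where A = "space M"]) (use a Am in \<open>auto intro!: sum_nonneg simp: emeasure_eq_measure\<close>)
  also have "expectation ?Y = (\<Sum>k<n. prob (?A k))" using Am by (simp add: emeasure_eq_measure)
  also have "(\<Sum>k<n. prob (?A k)) / a \<le> (\<Sum>k<n. (1 - \<epsilon>) ^ d) / a"
    using a by (intro divide_right_mono sum_mono bad_overflow_unlikely[OF \<epsilon>]) auto
  finally have few: "prob {w \<in> space M. a \<le> ?Y w} \<le> real n * (1 - \<epsilon>) ^ d / a" by simp
  have "{w \<in> space M. a \<le> real (card (data.bad_overflows w \<epsilon> i t))} \<subseteq> {w \<in> space M. n < arrivals_by w t} \<union> {w \<in> space M. a \<le> ?Y w}"
  proof
    fix w assume "w \<in> {w \<in> space M. a \<le> real (card (data.bad_overflows w \<epsilon> i t))}"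
    then have w: "w \<in> space M" and bad: "a \<le> real (card (data.bad_overflows w \<epsilon> i t))" by auto
    show "w \<in> {w \<in> space M. n < arrivals_by w t} \<union> {w \<in> space M. a \<le> ?Y w}"
    proof (cases "n < arrivals_by w t")
      case False
      have "data.bad_overflows w \<epsilon> i t \<subseteq> {k. k < n \<and> w \<in> ?A k}"
      proof
        fix k assume k: "k \<in> data.bad_overflows w \<epsilon> i t"
        then have "k < arrivals_by w t" using arrivals_by_gt[OF w, of k t] by (simp add: jsq_data.bad_overflows_def)
        then show "k \<in> {k. k < n \<and> w \<in> ?A k}" using k False w by (simp add: jsq_data.bad_overflows_def)
      qed
      then have "real (card (data.bad_overflows w \<epsilon> i t)) \<le> real (card {k. k < n \<and> w \<in> ?A k})"
        by (intro of_nat_mono card_mono) auto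
      also have "\<dots> = ?Y w" by (simp add: indicator_def sum.If_cases Int_def)
      finally show ?thesis using bad w by auto
    qed (use w in auto)
  qed
  then have "prob {w \<in> space M. a \<le> real (card (data.bad_overflows w \<epsilon> i t))} \<le> prob ({w \<in> space M. n < arrivals_by w t} \<union> {w \<in> space M. a \<le> ?Y w})"
    by (rule finite_measure_mono) measurable
  also have "\<dots> \<le> prob {w \<in> space M. n < arrivals_by w t} + prob {w \<in> space M. a \<le> ?Y w}"
    by (rule measure_Un_le) measurable
  finally show ?thesis using few by linarith
qed

end

section \<open>From counts to approximate solutions\<close>

lemma close_between_grid_points:
  fixes f g :: "real \<Rightarrow> real"
  assumes f: "\<And>s t. 0 \<le> s \<Longrightarrow> s \<le> t \<Longrightarrow> f s \<le> f t"
    and g: "\<And>s t. 0 \<le> s \<Longrightarrow> s \<le> t \<Longrightarrow> 0 \<le> g t - g s \<and> g t - g s \<le> B * (t - s)" and B: "0 \<le> B"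
    and grid: "\<And>k :: nat. real k * h \<le> T + h \<Longrightarrow> \<bar>f (real k * h) - g (real k * h)\<bar> \<le> e" and h: "0 < h"
    and t: "t \<in> {0..T}"
  shows "\<bar>f t - g t\<bar> \<le> e + B * h"
proof -
  define k where "k = nat \<lfloor>t / h\<rfloor>"
  have "0 \<le> t / h" using t h by simp
  then have k: "real k \<le> t / h" "t / h \<le> real k + 1" unfolding k_def by linarith+
  define a where "a = real k * h"
  have a: "0 \<le> a" "a \<le> t" "t \<le> a + h"
    using k h by (simp_all add: a_def pos_le_divide_eq pos_divide_le_eq algebra_simps)
  have ah: "real (Suc k) * h = a + h" by (simp add: a_def algebra_simps)
  have e: "\<bar>f a - g a\<bar> \<le> e" "\<bar>f (a + h) - g (a + h)\<bar> \<le> e"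
    using grid[of k] grid[of "Suc k"] a t h unfolding ah by (simp_all add: a_def[symmetric])
  have inc: "f a \<le> f t" "f t \<le> f (a + h)" using f a by auto
  have "g t - g a \<le> B * (t - a)" "g (a + h) - g t \<le> B * (a + h - t)" using g[of a t] g[of t "a + h"] a t by auto
  moreover have "B * (t - a) \<le> B * h" "B * (a + h - t) \<le> B * h" using a by (intro mult_left_mono B; simp)+
  moreover have "0 \<le> g t - g a" "0 \<le> g (a + h) - g t" using g[of a t] g[of t "a + h"] a t by auto
  ultimately show ?thesis using e inc by linarith
qed

context jsq_arrivals
begin

definition occupancy :: "(source \<Rightarrow> real) \<Rightarrow> real \<Rightarrow> nat \<Rightarrow> real" where
  "occupancy S = (\<lambda>t\<in>{0..}. \<lambda>i. real (level S i t) / real N)"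

lemma occupancy_nonneg_time: "0 \<le> t \<Longrightarrow> occupancy S t i = real (level S i t) / real N"
  by (simp add: occupancy_def)

lemma occupancy_eq_path:
  "occupancy S = occupancy_path N b x0 (\<lambda>j l. S (Residual j l)) \<tau> (\<lambda>k. S (Service k)) L"
proof
  fix t show "occupancy S t = occupancy_path N b x0 (\<lambda>j l. S (Residual j l)) \<tau> (\<lambda>k. S (Service k)) L t"
  proof (cases "0 \<le> t")
    case True
    then show ?thesis by (intro ext) (simp add: occupancy_nonneg_time occupancy_path_eq level_def)
  qed (simp add: occupancy_def occupancy_path_def)
qed

lemma occupancy_borel: "(\<lambda>t. occupancy S t i) \<in> borel_measurable borel"
proof -
  have [measurable]: "(\<lambda>s. queue S j s) \<in> borel \<rightarrow>\<^sub>M count_space UNIV" for j by (rule queue_borel)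
  have [measurable]: "(\<lambda>s. level S i s) \<in> borel \<rightarrow>\<^sub>M count_space UNIV" unfolding level_def by measurable
  have "(\<lambda>t. occupancy S t i) = (\<lambda>t. if 0 \<le> t then real (level S i t) / real N else undefined i)"
    by (auto simp: occupancy_def)
  then show ?thesis by simp
qed

lemma level_le: "level S i t \<le> N"
  unfolding level_def using card_mono[of "{..<N}" "{j. j < N \<and> i \<le> queue S j t}"] by auto

lemma level_diff: "real (level S i t) - real (level S (i + 1) t) = real (at_level S i t)"
proof -
  have U: "{j. j < N \<and> i \<le> queue S j t} = {j. j < N \<and> queue S j t = i} \<union> {j. j < N \<and> i + 1 \<le> queue S j t}" by force
  have "level S i t = at_level S i t + level S (i + 1) t"
    unfolding level_def at_level_def U by (rule card_Un_disjoint) auto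
  then show ?thesis by simp
qed

context
  fixes S :: "source \<Rightarrow> real"
  assumes S_pos: "\<And>z. 0 < S z" and N: "1 \<le> N" and buffer: "\<And>j. j < N \<Longrightarrow> enat (x0 ! j) \<le> b"
begin

lemma occupancy_in_states:
  assumes t: "0 \<le> t" shows "occupancy S t \<in> occupancy_states b"
proof -
  define m where "m = Max (insert 0 ((\<lambda>j. queue S j t) ` {..<N}))"
  have m: "queue S j t \<le> m" if "j < N" for j unfolding m_def using that by (intro Max_ge) auto
  have above: "level S i t = 0" if "\<And>j. j < N \<Longrightarrow> queue S j t < i" for i
    unfolding level_def using that by (auto simp: card_eq_0_iff not_le)
  have "level S (Suc i) t \<le> level S i t" for i
    unfolding level_def by (rule card_mono) auto
  moreover have "level S i t = 0" if "b < enat i" for i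
  proof (rule above)
    fix j assume "j < N"
    then have "enat (queue S j t) < enat i"
      using queue_le_buffer[where S = S, OF S_pos _ buffer t] that by (meson order_le_less_trans)
    then show "queue S j t < i" by simp
  qed
  moreover have "summable (\<lambda>i. real (level S i t) / real N)"
    by (rule summable_finite[of "{..m}"]) (use above m in \<open>auto simp: not_le intro: order_le_less_trans\<close>)
  moreover have "level S 0 t = N" by (simp add: level_def)
  ultimately show ?thesis
    using N t level_le[of S _ t] by (auto simp: occupancy_states_def occupancy_def divide_right_mono)
qed

text \<open>The balance equation for the counts, divided by \<open>N\<close>, is the fluid equation up to the compensated departures
  and the initial error. The laws of large numbers are used only at the multiples of \<open>\<eta>\<close> and so concern finitely many events;
  the counts and their compensators are monotone, which controls them between these times.\<close>

lemma near_solution_of_counts: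
  assumes q0: "q0 \<in> occupancy_states b" and lam: "lam \<le> 1" and T: "0 \<le> T"
    and \<eta>: "0 < \<eta>" "\<eta> \<le> 1" "\<eta> * (T + 4) \<le> \<delta>" and valid: "\<And>k. chosen S k < N"
    and rate: "0 \<le> rate" "\<bar>rate / real N - lam\<bar> \<le> \<eta>"
    and initial: "l1_dist (occupancy S 0) q0 \<le> \<eta>"
    and arr: "\<And>k :: nat. real k * \<eta> \<le> T + \<eta> \<Longrightarrow> \<bar>real (card {m. arrival_time \<tau> m \<le> real k * \<eta>}) - rate * (real k * \<eta>)\<bar> \<le> \<eta> * real N"
    and dep: "\<And>k i. real k * \<eta> \<le> T + \<eta> \<Longrightarrow> i \<in> {1..n} \<Longrightarrow> \<bar>real (card (counted S i (real k * \<eta>))) - time_at_level S i (real k * \<eta>)\<bar> \<le> \<eta> * real N"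
    and bad: "\<And>i. i \<in> {1..n} \<Longrightarrow> real (card (bad_overflows S \<eta> i T)) \<le> \<eta> * real N"
  shows "near_solution b lam q0 T n \<delta> (occupancy S) (\<lambda>i t. real (overflows S i t) / real N)"
proof -
  let ?x = "occupancy S" and ?y = "\<lambda>i t. real (overflows S i t) / real N"
  have N0: "0 < real N" using N by simp
  have \<eta>\<delta>: "\<eta> * T + 4 * \<eta> \<le> \<delta>" using \<eta>(3) by (simp add: algebra_simps)
  have \<eta>T: "0 \<le> \<eta> * T" using \<eta> T by simp
  have init_sum: "(\<lambda>i. \<bar>?x 0 i - q0 i\<bar>) summable_on UNIV" by (rule l1_dist_summable[OF occupancy_in_states q0]) simp
  have init_finite: "(\<Sum>i\<in>I. \<bar>?x 0 i - q0 i\<bar>) \<le> \<eta>" if "finite I" for I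
    using finite_sum_le_infsum[OF init_sum that] initial by (simp add: l1_dist_def)
  have init: "\<bar>?x 0 i - q0 i\<bar> \<le> \<eta>" for i using init_finite[of "{i}"] by simp
  have D: "\<bar>real (card (counted S i t)) - time_at_level S i t\<bar> \<le> 2 * \<eta> * real N" if t: "t \<in> {0..T}" and i: "i \<in> {1..n}" for i t
  proof -
    have "\<bar>real (card (counted S i t)) - time_at_level S i t\<bar> \<le> \<eta> * real N + real N * \<eta>"
    proof (rule close_between_grid_points[where f = "\<lambda>t. real (card (counted S i t))" and g = "time_at_level S i", OF _ _ _ dep[OF _ i] \<eta>(1) t])
      fix s u :: real assume su: "0 \<le> s" "s \<le> u"
      have "counted S i s \<subseteq> counted S i u" using counted_mono[OF su(2), of _ S i] by blast
      then show "real (card (counted S i s)) \<le> real (card (counted S i u))"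
        using card_mono[OF finite_counted[where S = S, OF S_pos]] by simp
      show "0 \<le> time_at_level S i u - time_at_level S i s \<and> time_at_level S i u - time_at_level S i s \<le> real N * (u - s)"
        using time_at_level_increment[OF su] by simp
    qed simp
    then show ?thesis by (simp add: algebra_simps)
  qed
  have balance: "\<bar>?x t i - (q0 i + ?y (i - 1) t - ?y i t - (LINT s:{0..t}|lborel. ?x s i - ?x s (i + 1)))\<bar> \<le> 3 * \<eta>"
    if t: "t \<in> {0..T}" and i: "1 \<le> i" "i \<le> n" "enat i \<le> b" for i t
  proof -
    have I: "(LINT s:{0..t}|lborel. ?x s i - ?x s (i + 1)) = time_at_level S i t / real N"
    proof -
      have "(LINT s:{0..t}|lborel. ?x s i - ?x s (i + 1)) = (LINT s:{0..t}|lborel. real (at_level S i s) / real N)"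
        by (rule set_lebesgue_integral_cong)
          (auto simp: occupancy_nonneg_time level_diff[symmetric] diff_divide_distrib)
      also have "\<dots> = time_at_level S i t / real N" unfolding time_at_level_def by (rule set_integral_divide_zero)
      finally show ?thesis .
    qed
    have "real_of_int (int (level S i t)) = real_of_int (int (level S i 0) + int (overflows S (i - 1) t) - int (overflows S i t) - int (card (counted S i t)))"
      using level_balance[where S = S, OF S_pos _ i(1,3) valid, of t] t card_counted[where S = S, OF S_pos, of i t] by simp
    then have "real (level S i t) = real (level S i 0) + real (overflows S (i - 1) t) - real (overflows S i t) - real (card (counted S i t))"
      by simp
    then have "?x t i = ?x 0 i + ?y (i - 1) t - ?y i t - real (card (counted S i t)) / real N"
      using t by (simp add: occupancy_nonneg_time add_divide_distrib diff_divide_distrib)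
    then have E: "?x t i - (q0 i + ?y (i - 1) t - ?y i t - (LINT s:{0..t}|lborel. ?x s i - ?x s (i + 1)))
        = (?x 0 i - q0 i) - (real (card (counted S i t)) - time_at_level S i t) / real N"
      unfolding I by (simp add: diff_divide_distrib)
    have "\<bar>(real (card (counted S i t)) - time_at_level S i t) / real N\<bar> \<le> 2 * \<eta>"
      using D[OF t, of i] i N0 by (simp add: abs_divide pos_divide_le_eq)
    then show ?thesis unfolding E using init[of i] by linarith
  qed
  have arrivals: "\<bar>?y 0 t - lam * t\<bar> \<le> \<delta>" if t: "t \<in> {0..T}" for t
  proof -
    have "\<bar>real (overflows S 0 t) - rate * t\<bar> \<le> \<eta> * real N + rate * \<eta>"
    proof (rule close_between_grid_points[where f = "\<lambda>t. real (overflows S 0 t)" and g = "\<lambda>t. rate * t", OF _ _ rate(1) _ \<eta>(1) t])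
      show "real (overflows S 0 s) \<le> real (overflows S 0 u)" if "s \<le> u" for s u using overflows_mono[OF that] by simp
      show "0 \<le> rate * u - rate * s \<and> rate * u - rate * s \<le> rate * (u - s)" if "s \<le> u" for s u
        using rate(1) that by (simp add: right_diff_distrib mult_left_mono)
      show "\<bar>real (overflows S 0 (real k * \<eta>)) - rate * (real k * \<eta>)\<bar> \<le> \<eta> * real N" if "real k * \<eta> \<le> T + \<eta>" for k
        using arr[OF that] by (simp add: overflows_0)
    qed
    then have "\<bar>(real (overflows S 0 t) - rate * t) / real N\<bar> \<le> (\<eta> * real N + rate * \<eta>) / real N"
      using N0 by (simp add: abs_divide divide_right_mono)
    also have "\<dots> = \<eta> + rate / real N * \<eta>" using N0 by (simp add: add_divide_distrib)
    also have "\<dots> \<le> \<eta> + 2 * \<eta>" using rate(2) lam \<eta> by (intro add_left_mono mult_right_mono) auto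
    finally have "\<bar>?y 0 t - rate / real N * t\<bar> \<le> 3 * \<eta>" by (simp add: diff_divide_distrib)
    moreover have "\<bar>rate / real N * t - lam * t\<bar> \<le> \<eta> * T"
    proof -
      have "\<bar>rate / real N * t - lam * t\<bar> = \<bar>(rate / real N - lam) * t\<bar>" by (simp only: left_diff_distrib)
      also have "\<dots> = \<bar>rate / real N - lam\<bar> * t" using t by (simp only: abs_mult) simp
      also have "\<dots> \<le> \<eta> * T" using rate(2) t \<eta> by (intro mult_mono) auto
      finally show ?thesis .
    qed
    ultimately show ?thesis using \<eta>\<delta> \<eta>(1) by linarith
  qed
  have overflow: "0 \<le> ?y i s \<and> ?y i s \<le> ?y 0 s \<and> ?y i s \<le> ?y i t \<and> ?y i t - ?y i s \<le> ?y 0 t - ?y 0 s" if "s \<le> t" for i s t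
  proof -
    have "overflows S i t - overflows S i s \<le> overflows S 0 t - overflows S 0 s" by (rule overflows_increment[OF that])
    then have "real (overflows S i t) - real (overflows S i s) \<le> real (overflows S 0 t) - real (overflows S 0 s)"
      using overflows_mono[OF that, of S i] overflows_mono[OF that, of S 0] by linarith
    then have "?y i t - ?y i s \<le> ?y 0 t - ?y 0 s"
      using N0 by (simp add: diff_divide_distrib[symmetric] divide_right_mono)
    then show ?thesis using overflows_le_0[of S i s] overflows_mono[OF that, of S i] N0 by (simp add: divide_right_mono)
  qed
  have barrier: "?y i t \<le> \<delta> \<or> (\<exists>s\<in>{0..t}. 1 - \<delta> \<le> ?x s i \<and> ?y i t \<le> ?y i s + \<delta>)"
    if t: "t \<in> {0..T}" and i: "1 \<le> i" "i \<le> n" for i t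
  proof -
    have "bad_overflows S \<eta> i t \<subseteq> bad_overflows S \<eta> i T" using t by (auto simp: bad_overflows_def)
    moreover have "finite (bad_overflows S \<eta> i T)" unfolding bad_overflows_def by (rule finite_arrivals')
    ultimately have "card (bad_overflows S \<eta> i t) \<le> card (bad_overflows S \<eta> i T)" by (intro card_mono)
    then have few: "real (card (bad_overflows S \<eta> i t)) \<le> \<eta> * real N" using bad[of i] i by simp
    have \<eta>d: "\<eta> \<le> \<delta>" using \<eta>\<delta> \<eta>T \<eta>(1) by linarith
    show ?thesis
    proof (cases "overflows S i t \<le> card (bad_overflows S \<eta> i t)")
      case True
      then have "?y i t \<le> \<eta>" using few N0 by (simp add: pos_divide_le_eq)
      then show ?thesis using \<eta>d by simp
    next
      case False
      then obtain s where s: "s \<in> {0..t}" "(1 - \<eta>) * real N < real (level S i s)"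
        "overflows S i t \<le> overflows S i s + card (bad_overflows S \<eta> i t)"
        using overflow_barrier[of t S i \<eta>] t by auto
      have "1 - \<eta> \<le> ?x s i" using s(1,2) N0 by (simp add: occupancy_nonneg_time pos_le_divide_eq)
      moreover have "?y i t \<le> ?y i s + \<eta>"
      proof -
        have "real (overflows S i t) \<le> real (overflows S i s) + \<eta> * real N" using s(3) few by linarith
        then show ?thesis using N0 by (simp add: divide_simps)
      qed
      ultimately show ?thesis using s(1) \<eta>d by (intro disjI2 bexI[of _ s]) auto
    qed
  qed
  have tail: "(\<Sum>i\<in>{m<..J}. ?x t i) \<le> (\<Sum>i. q0 (i + m + 1)) + \<delta> + ?y m t" if t: "t \<in> {0..T}" for t m J
  proof -
    have "real (\<Sum>i\<in>{m<..J}. level S i t) \<le> real ((\<Sum>i\<in>{m<..J}. level S i 0) + overflows S m t)"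
      using level_tail[where S = S, OF S_pos, of t m J] t by (intro of_nat_mono) auto
    then have "(\<Sum>i\<in>{m<..J}. real (level S i t)) / real N \<le> ((\<Sum>i\<in>{m<..J}. real (level S i 0)) + real (overflows S m t)) / real N"
      using N0 by (intro divide_right_mono) auto
    then have "(\<Sum>i\<in>{m<..J}. ?x t i) \<le> (\<Sum>i\<in>{m<..J}. ?x 0 i) + ?y m t"
      using t by (simp add: occupancy_nonneg_time sum_divide_distrib add_divide_distrib)
    also have "(\<Sum>i\<in>{m<..J}. ?x 0 i) \<le> (\<Sum>i\<in>{m<..J}. q0 i + \<bar>?x 0 i - q0 i\<bar>)" by (intro sum_mono) linarith
    also have "\<dots> \<le> (\<Sum>i\<in>{m<..J}. q0 i) + \<eta>" using init_finite[of "{m<..J}"] by (simp add: sum.distrib)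
    also have "(\<Sum>i\<in>{m<..J}. q0 i) = (\<Sum>i<J - m. q0 (i + m + 1))"
      by (rule sum.reindex_bij_witness[of _ "\<lambda>i. i + m + 1" "\<lambda>i. i - m - 1"]) auto
    also have "\<dots> \<le> (\<Sum>i. q0 (i + m + 1))"
    proof (rule sum_le_suminf)
      show "summable (\<lambda>i. q0 (i + m + 1))"
        using summable_ignore_initial_segment[OF occupancy_states_bounds(5)[OF q0], of "m + 1"] by (simp add: add.assoc)
    qed (use occupancy_states_bounds[OF q0] in auto)
    finally show ?thesis using \<eta>\<delta> \<eta>T \<eta>(1) by linarith
  qed
  show ?thesis
    unfolding near_solution_def
  proof (intro conjI allI impI ballI, goal_cases)
    case (1 i) then show ?case by (rule occupancy_borel)
  next
    case (2 t) then show ?case by (intro occupancy_in_states) auto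
  next
    case (3 t i)
    have "3 * \<eta> \<le> \<delta>" using \<eta>\<delta> \<eta>T \<eta>(1) by linarith
    then show ?case using 3 by (intro order_trans[OF balance]) auto
  next
    case (4 t) then show ?case by (rule arrivals)
  next
    case (5 i s t) then show ?case using overflow[of s t i] by auto
  next
    case (6 i s t) then show ?case using overflow[of s t i] by auto
  next
    case (7 i s t) then show ?case using overflow[of s t i] by auto
  next
    case (8 i s t) then show ?case using overflow[of s t i] by auto
  next
    case (9 t i) then show ?case using barrier[of t i] by blast
  next
    case (10 t m J) then show ?case using tail[of t m J] by blast
  qed
qed

lemma occupancy_step_path: "occupancy S \<in> step_paths"
proof -
  have "constant_off (occupancy S) T (\<Union>j<N. event_times S j T)" for T
    unfolding constant_off_def
  proof (intro conjI ballI impI)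
    note c = queue_constant_off[where S = S, OF S_pos, of T, unfolded constant_off_def]
    show "finite (\<Union>j<N. event_times S j T)" "(\<Union>j<N. event_times S j T) \<subseteq> {0<..T}" using c by blast+
    fix s t assume st: "s \<in> {0..T}" "t \<in> {0..T}" and same: "\<forall>r\<in>\<Union>j<N. event_times S j T. r \<le> s \<longleftrightarrow> r \<le> t"
    have "map (\<lambda>j. queue S j s) [0..<N] = map (\<lambda>j. queue S j t) [0..<N]"
      by (rule c[THEN conjunct2, THEN conjunct2, rule_format, OF st]) (use same in blast)
    then have "queue S j s = queue S j t" if "j < N" for j using that by auto
    then have "level S i s = level S i t" for i unfolding level_def by (intro arg_cong[where f = card]) auto
    then show "occupancy S s = occupancy S t" using st by (simp add: occupancy_def)
  qed
  then show ?thesis by (auto simp: step_paths_def)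
qed

end

end
context jsq_system
begin

abbreviation "trajectory w \<equiv> occupancy_path N b (x0 w) (\<rho> w) (\<tau> w) (\<sigma> w) (L w)"

lemma path_eq_occupancy:
  assumes w: "w \<in> space M"
  shows "jsq_arrivals.occupancy N b (x0 w) (\<tau> w) (L w) (req w) = trajectory w"
proof -
  interpret A: jsq_arrivals N b "x0 w" "\<tau> w" "L w" by (rule arrivals[OF w])
  show ?thesis using A.occupancy_eq_path[of "req w"] by simp
qed

lemma path_eq_queues:
  assumes w: "w \<in> space M" and t: "0 \<le> t"
  shows "trajectory w t = (\<lambda>i. real (card {j. j < N \<and> i \<le> map (\<lambda>j. data.queue w j t) [0..<N] ! j}) / real N)"
proof -
  interpret A: jsq_arrivals N b "x0 w" "\<tau> w" "L w" by (rule arrivals[OF w])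
  have "{j. j < N \<and> i \<le> map (\<lambda>j. data.queue w j t) [0..<N] ! j} = {j. j < N \<and> i \<le> data.queue w j t}" for i by auto
  then show ?thesis unfolding path_eq_occupancy[OF w, symmetric] A.occupancy_def using t by (simp add: A.level_def)
qed

lemma path_occupancy:
  assumes w: "w \<in> space M"
  shows "trajectory w \<in> step_paths" "trajectory w \<in> extensional {0..}" "0 \<le> t \<Longrightarrow> trajectory w t \<in> occupancy_states b"
proof -
  interpret A: jsq_arrivals N b "x0 w" "\<tau> w" "L w" by (rule arrivals[OF w])
  note P = path_eq_occupancy[OF w, symmetric] and C = req_pos[OF w] N_pos initial_le[OF w]
  show "trajectory w \<in> step_paths" unfolding P by (rule A.occupancy_step_path[where S = "req w", OF C])
  show "trajectory w \<in> extensional {0..}" by (simp add: occupancy_path_def)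
  show "trajectory w t \<in> occupancy_states b" if "0 \<le> t" unfolding P by (rule A.occupancy_in_states[where S = "req w", OF C that])
qed

lemma path_measurable: "trajectory \<in> M \<rightarrow>\<^sub>M borel_of (skorohod_occupancy b)"
proof (rule Metric_space.step_process_measurable[OF Metric_space_occupancy_states,
    where Z = "\<lambda>t w. map (\<lambda>j. data.queue w j t) [0..<N]"])
  show "(\<lambda>w. map (\<lambda>j. data.queue w j t) [0..<N]) \<in> M \<rightarrow>\<^sub>M count_space UNIV" for t
    unfolding measurable_count_space_eq2_countable
  proof (intro conjI ballI)
    fix v
    have [measurable]: "(\<lambda>w. data.queue w j t) \<in> M \<rightarrow>\<^sub>M count_space UNIV" for j by (rule data.queue_measurable) measurable
    have "(\<lambda>w. map (\<lambda>j. data.queue w j t) [0..<N]) -` {v} \<inter> space M = {w \<in> space M. length v = N \<and> (\<forall>j\<in>{..<N}. data.queue w j t = v ! j)}"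
    proof (intro equalityI subsetI)
      fix w assume "w \<in> {w \<in> space M. length v = N \<and> (\<forall>j\<in>{..<N}. data.queue w j t = v ! j)}"
      then have "w \<in> space M" "map (\<lambda>j. data.queue w j t) [0..<N] = v" by (auto intro!: nth_equalityI)
      then show "w \<in> (\<lambda>w. map (\<lambda>j. data.queue w j t) [0..<N]) -` {v} \<inter> space M" by blast
    qed auto
    also have "\<dots> \<in> events" by measurable
    finally show "(\<lambda>w. map (\<lambda>j. data.queue w j t) [0..<N]) -` {v} \<inter> space M \<in> events" .
  qed simp
qed (use path_occupancy path_eq_queues in auto)

lemma initial_event: "{w \<in> space M. P (trajectory w 0)} \<in> events"
proof -
  have "trajectory w 0 = (\<lambda>i. real (card {j. j < N \<and> i \<le> x0 w ! j}) / real N)" if w: "w \<in> space M" for w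
  proof -
    interpret A: jsq_arrivals N b "x0 w" "\<tau> w" "L w" by (rule arrivals[OF w])
    have "{j. j < N \<and> i \<le> map (\<lambda>j. data.queue w j 0) [0..<N] ! j} = {j. j < N \<and> i \<le> x0 w ! j}" for i
      using A.queue_0[where S = "req w", OF req_pos[OF w]] by auto
    then show ?thesis using path_eq_queues[OF w, of 0] by simp
  qed
  then have "{w \<in> space M. P (trajectory w 0)} = {w \<in> space M. x0 w \<in> {v. P (\<lambda>i. real (card {j. j < N \<and> i \<le> v ! j}) / real N)}}" by auto
  also have "\<dots> \<in> events" using initial_random by measurable
  finally show ?thesis .
qed

end

section \<open>Convergence to the fluid path\<close>

locale jsq_sequence =
  fixes M :: "nat \<Rightarrow> 'w measure"
    and d :: "nat \<Rightarrow> nat" and b :: enat and rate :: "nat \<Rightarrow> real" and lam :: real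
    and x0 :: "nat \<Rightarrow> 'w \<Rightarrow> nat list"
    and \<rho> :: "nat \<Rightarrow> 'w \<Rightarrow> nat \<Rightarrow> nat \<Rightarrow> real"
    and \<tau> \<sigma> :: "nat \<Rightarrow> 'w \<Rightarrow> nat \<Rightarrow> real"
    and L :: "nat \<Rightarrow> 'w \<Rightarrow> nat \<Rightarrow> nat list"
    and qinf :: "nat \<Rightarrow> real"
  assumes system: "\<And>N. 1 \<le> N \<Longrightarrow> jsq_system (M N) N (d N) b (rate N) (x0 N) (\<rho> N) (\<tau> N) (\<sigma> N) (L N)"
    and load: "(\<lambda>N. rate N / real N) \<longlonglongrightarrow> lam" "lam < 1"
    and choices: "filterlim d at_top sequentially"
    and qinf: "qinf \<in> occupancy_states b"
    and initial: "\<And>\<epsilon>. 0 < \<epsilon> \<Longrightarrow> (\<lambda>N. measure (M N) {w \<in> space (M N).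
      \<epsilon> < l1_dist (occupancy_path N b (x0 N w) (\<rho> N w) (\<tau> N w) (\<sigma> N w) (L N w) 0) qinf}) \<longlonglongrightarrow> 0"
begin

abbreviation "q N w \<equiv> occupancy_path N b (x0 N w) (\<rho> N w) (\<tau> N w) (\<sigma> N w) (L N w)"
abbreviation "reqs N w \<equiv> jsq_system.req (\<rho> N) (\<sigma> N) w"
abbreviation "arrivals_until N w t \<equiv> card {k. arrival_time (\<tau> N w) k \<le> t}"
abbreviation "chosen N w \<equiv> jsq_data.chosen N b (x0 N w) (\<tau> N w) (L N w) (reqs N w)"
abbreviation "counted N w \<equiv> jsq_data.counted N b (x0 N w) (\<tau> N w) (L N w) (reqs N w)"
abbreviation "time_at_level N w \<equiv> jsq_data.time_at_level N b (x0 N w) (\<tau> N w) (L N w) (reqs N w)"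
abbreviation "bad_overflows N w \<equiv> jsq_data.bad_overflows N b (x0 N w) (\<tau> N w) (L N w) (reqs N w)"

lemma lam_nonneg: "0 \<le> lam"
proof (rule LIMSEQ_le_const[OF load(1)], intro exI[of _ 1] allI impI)
  fix N :: nat assume "1 \<le> N"
  then show "0 \<le> rate N / real N" using jsq_system.rate_pos[OF system] by (simp add: less_imp_le)
qed

definition unlikely :: "(nat \<Rightarrow> 'w \<Rightarrow> bool) \<Rightarrow> bool" where
  "unlikely E \<longleftrightarrow> (\<forall>N\<ge>1. {w \<in> space (M N). E N w} \<in> sets (M N)) \<and> (\<lambda>N. measure (M N) {w \<in> space (M N). E N w}) \<longlonglongrightarrow> 0"

lemma unlikelyI:
  assumes "\<And>N. 1 \<le> N \<Longrightarrow> {w \<in> space (M N). E N w} \<in> sets (M N)"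
    and "\<forall>\<^sub>F N in sequentially. measure (M N) {w \<in> space (M N). E N w} \<le> f N" and "f \<longlonglongrightarrow> 0"
  shows "unlikely E"
  unfolding unlikely_def
proof
  show "(\<lambda>N. measure (M N) {w \<in> space (M N). E N w}) \<longlonglongrightarrow> 0"
    by (rule tendsto_sandwich[OF _ assms(2) tendsto_const assms(3)]) simp
qed (use assms(1) in blast)

lemma unlikely_disj:
  assumes "unlikely E" "unlikely F" shows "unlikely (\<lambda>N w. E N w \<or> F N w)"
proof (rule unlikelyI)
  let ?p = "\<lambda>E N. measure (M N) {w \<in> space (M N). E N w}"
  have eq: "{w \<in> space (M N). E N w \<or> F N w} = {w \<in> space (M N). E N w} \<union> {w \<in> space (M N). F N w}" for N by auto
  show "{w \<in> space (M N). E N w \<or> F N w} \<in> sets (M N)" if "1 \<le> N" for N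
    unfolding eq using assms that by (auto simp: unlikely_def)
  show "\<forall>\<^sub>F N in sequentially. measure (M N) {w \<in> space (M N). E N w \<or> F N w} \<le> ?p E N + ?p F N"
    using eventually_ge_at_top[of 1] unfolding eq
    by eventually_elim (rule measure_Un_le; use assms in \<open>simp add: unlikely_def\<close>)
  show "(\<lambda>N. ?p E N + ?p F N) \<longlonglongrightarrow> 0" using tendsto_add[of "?p E" 0 _ "?p F" 0] assms by (simp add: unlikely_def)
qed

lemma unlikely_Bex:
  assumes "finite I" "\<And>i. i \<in> I \<Longrightarrow> unlikely (E i)" shows "unlikely (\<lambda>N w. \<exists>i\<in>I. E i N w)"
  using assms
proof (induction I rule: finite_induct)
  case (insert i I)
  then show ?case using unlikely_disj[of "E i" "\<lambda>N w. \<exists>i\<in>I. E i N w"] by simp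
qed (simp add: unlikely_def)

lemma unlikely_initial: "0 < \<eta> \<Longrightarrow> unlikely (\<lambda>N w. \<eta> < l1_dist (q N w 0) qinf)"
  using initial jsq_system.initial_event[OF system, where P = "\<lambda>x. \<eta> < l1_dist x qinf"] by (simp add: unlikely_def)

lemma unlikely_invalid: "unlikely (\<lambda>N w. \<not> (\<forall>k. chosen N w k < N))"
proof (rule unlikelyI[where f = "\<lambda>_. 0"])
  have E: "{w \<in> space (M N). \<not> (\<forall>k. chosen N w k < N)} \<in> sets (M N) \<and>
      measure (M N) {w \<in> space (M N). \<not> (\<forall>k. chosen N w k < N)} = 0" if N: "1 \<le> N" for N
  proof -
    interpret jsq_system "M N" N "d N" b "rate N" "x0 N" "\<rho> N" "\<tau> N" "\<sigma> N" "L N" by (rule system[OF N])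
    have m: "{w \<in> space (M N). \<not> (\<forall>k. data.chosen w k < N)} \<in> events" by measurable
    moreover have "prob {w \<in> space (M N). \<not> (\<forall>k. data.chosen w k < N)} = 0"
      using chosen_valid by (subst prob_eq_0[OF m]) (auto elim: AE_mp)
    ultimately show ?thesis by simp
  qed
  then show "\<And>N. 1 \<le> N \<Longrightarrow> {w \<in> space (M N). \<not> (\<forall>k. chosen N w k < N)} \<in> sets (M N)" by blast
  show "\<forall>\<^sub>F N in sequentially. measure (M N) {w \<in> space (M N). \<not> (\<forall>k. chosen N w k < N)} \<le> 0"
    using eventually_ge_at_top[of 1] by eventually_elim (use E in simp)
qed simp

lemma unlikely_departures:
  assumes "0 < \<eta>" "1 \<le> i" "0 \<le> t"
  shows "unlikely (\<lambda>N w. \<eta> * real N \<le> \<bar>real (card (counted N w i t)) - time_at_level N w i t\<bar>)"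
proof (rule unlikelyI[where f = "\<lambda>N. t / (\<eta>\<^sup>2 * real N)"])
  fix N :: nat assume N: "1 \<le> N"
  interpret jsq_system "M N" N "d N" b "rate N" "x0 N" "\<rho> N" "\<tau> N" "\<sigma> N" "L N" by (rule system[OF N])
  have [measurable]: "(\<lambda>w. data.time_at_level w i t) \<in> borel_measurable (M N)" by (rule data.time_at_level_measurable) measurable
  show "{w \<in> space (M N). \<eta> * real N \<le> \<bar>real (card (counted N w i t)) - time_at_level N w i t\<bar>} \<in> events" by measurable
next
  show "\<forall>\<^sub>F N in sequentially. measure (M N) {w \<in> space (M N). \<eta> * real N \<le> \<bar>real (card (counted N w i t)) - time_at_level N w i t\<bar>} \<le> t / (\<eta>\<^sup>2 * real N)"
    using eventually_ge_at_top[of 1] by eventually_elim (rule jsq_system.departures_concentrate[OF system assms(2,3,1)])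
  show "(\<lambda>N. t / (\<eta>\<^sup>2 * real N)) \<longlonglongrightarrow> 0" using assms by real_asymp
qed

lemma unlikely_arrivals:
  assumes "0 < \<eta>" "0 \<le> t"
  shows "unlikely (\<lambda>N w. \<eta> * real N \<le> \<bar>real (arrivals_until N w t) - rate N * t\<bar>)"
proof (rule unlikelyI[where f = "\<lambda>N. (rate N / real N) * (8 * t / (\<eta>\<^sup>2 * real N)) + 8 * (\<eta> * real N + 2) / (\<eta> * real N)\<^sup>2"])
  fix N :: nat assume N: "1 \<le> N"
  interpret jsq_system "M N" N "d N" b "rate N" "x0 N" "\<rho> N" "\<tau> N" "\<sigma> N" "L N" by (rule system[OF N])
  show "{w \<in> space (M N). \<eta> * real N \<le> \<bar>real (arrivals_until N w t) - rate N * t\<bar>} \<in> events" by measurable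
next
  have "\<forall>\<^sub>F N in sequentially. 2 \<le> \<eta> * real N" using assms by real_asymp
  then show "\<forall>\<^sub>F N in sequentially. measure (M N) {w \<in> space (M N). \<eta> * real N \<le> \<bar>real (arrivals_until N w t) - rate N * t\<bar>}
      \<le> (rate N / real N) * (8 * t / (\<eta>\<^sup>2 * real N)) + 8 * (\<eta> * real N + 2) / (\<eta> * real N)\<^sup>2"
    using eventually_ge_at_top[of 1]
  proof eventually_elim
    case (elim N)
    have "8 * (rate N * t + \<eta> * real N + 2) / (\<eta> * real N)\<^sup>2 = (rate N / real N) * (8 * t / (\<eta>\<^sup>2 * real N)) + 8 * (\<eta> * real N + 2) / (\<eta> * real N)\<^sup>2"
      using elim(2) assms by (simp add: field_simps power2_eq_square)
    then show ?case using jsq_system.arrivals_concentrate[OF system[OF elim(2)] assms(2,1) elim(1)] by simp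
  qed
  have 1: "(\<lambda>N. 8 * t / (\<eta>\<^sup>2 * real N)) \<longlonglongrightarrow> 0" using assms by real_asymp
  have 2: "(\<lambda>N. 8 * (\<eta> * real N + 2) / (\<eta> * real N)\<^sup>2) \<longlonglongrightarrow> 0" using assms by real_asymp
  show "(\<lambda>N. (rate N / real N) * (8 * t / (\<eta>\<^sup>2 * real N)) + 8 * (\<eta> * real N + 2) / (\<eta> * real N)\<^sup>2) \<longlonglongrightarrow> 0"
    using tendsto_add[OF tendsto_mult[OF load(1) 1] 2] by simp
qed

text \<open>There are at most \<open>(t + 2) N\<close> arrivals, each of which overflows badly with probability at most \<open>(1 - \<eta>)\<^sup>d\<close>.\<close>

lemma unlikely_bad_overflows:
  assumes \<eta>: "0 < \<eta>" "\<eta> \<le> 1" and t: "0 \<le> t"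
  shows "unlikely (\<lambda>N w. \<eta> * real N \<le> real (card (bad_overflows N w \<eta> i t)))"
proof -
  define p where "p N = measure (M N) {w \<in> space (M N). 1 * real N \<le> \<bar>real (arrivals_until N w t) - rate N * t\<bar>}" for N
  have "unlikely (\<lambda>N w. 1 * real N \<le> \<bar>real (arrivals_until N w t) - rate N * t\<bar>)"
    by (rule unlikely_arrivals[OF zero_less_one t])
  then have p: "p \<longlonglongrightarrow> 0" unfolding p_def unlikely_def by (rule conjunct2)
  show ?thesis
  proof (rule unlikelyI[where f = "\<lambda>N. p N + (t + 2) / \<eta> * (1 - \<eta>) ^ d N"])
    fix N :: nat assume N: "1 \<le> N"
    interpret jsq_system "M N" N "d N" b "rate N" "x0 N" "\<rho> N" "\<tau> N" "\<sigma> N" "L N" by (rule system[OF N])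
    have "(\<lambda>w. card (data.bad_overflows w \<eta> i t)) \<in> M N \<rightarrow>\<^sub>M count_space UNIV"
      unfolding jsq_data.bad_overflows_def by (rule measurable_card_countable) (use data.queue_seen_measurable in measurable)
    then show "{w \<in> space (M N). \<eta> * real N \<le> real (card (bad_overflows N w \<eta> i t))} \<in> events" by measurable
  next
    have "\<forall>\<^sub>F N in sequentially. rate N / real N < 1" using order_tendstoD(2)[OF load] .
    then show "\<forall>\<^sub>F N in sequentially. measure (M N) {w \<in> space (M N). \<eta> * real N \<le> real (card (bad_overflows N w \<eta> i t))} \<le> p N + (t + 2) / \<eta> * (1 - \<eta>) ^ d N"
      using eventually_ge_at_top[of 1]
    proof eventually_elim
      case (elim N)
      interpret jsq_system "M N" N "d N" b "rate N" "x0 N" "\<rho> N" "\<tau> N" "\<sigma> N" "L N" by (rule system[OF elim(2)])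
      have N: "1 \<le> real N" using elim(2) by simp
      define n where "n = nat \<lceil>(t + 1) * real N\<rceil>"
      have n: "(t + 1) * real N \<le> real n" "real n \<le> (t + 2) * real N"
      proof -
        have "0 \<le> (t + 1) * real N" using t by simp
        then have "real n = real_of_int \<lceil>(t + 1) * real N\<rceil>" by (simp add: n_def)
        then have "(t + 1) * real N \<le> real n" "real n \<le> (t + 1) * real N + 1" by linarith+
        then show "(t + 1) * real N \<le> real n" "real n \<le> (t + 2) * real N" using N by (simp_all add: algebra_simps)
      qed
      have "prob {w \<in> space (M N). n < arrivals_by w t} \<le> p N"
        unfolding p_def
      proof (rule finite_measure_mono)
        have "rate N * t \<le> real N * t" using elim N t by (intro mult_right_mono) (auto simp: divide_simps)
        then show "{w \<in> space (M N). n < arrivals_by w t} \<subseteq> {w \<in> space (M N). 1 * real N \<le> \<bar>real (arrivals_by w t) - rate N * t\<bar>}"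
          using n(1) by (auto simp: algebra_simps)
      qed measurable
      moreover have "real n * (1 - \<eta>) ^ d N / (\<eta> * real N) \<le> (t + 2) / \<eta> * (1 - \<eta>) ^ d N"
      proof -
        have "real n * (1 - \<eta>) ^ d N / (\<eta> * real N) \<le> (t + 2) * real N * (1 - \<eta>) ^ d N / (\<eta> * real N)"
          using \<eta> n(2) by (intro divide_right_mono mult_right_mono) auto
        also have "\<dots> = (t + 2) / \<eta> * (1 - \<eta>) ^ d N" using N \<eta> by (simp add: field_simps)
        finally show ?thesis .
      qed
      ultimately show ?case
        using bad_overflows_few[OF \<eta>(2), of "\<eta> * real N" i t n] \<eta>(1) N by (simp add: add_mono)
    qed
    have "(\<lambda>N. (1 - \<eta>) ^ d N) \<longlonglongrightarrow> 0"
      by (rule filterlim_compose[OF LIMSEQ_realpow_zero choices]) (use \<eta> in auto)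
    from tendsto_add[OF p tendsto_mult_right_zero[OF this, of "(t + 2) / \<eta>"]]
    show "(\<lambda>N. p N + (t + 2) / \<eta> * (1 - \<eta>) ^ d N) \<longlonglongrightarrow> 0" by simp
  qed
qed

text \<open>The exceptional event is a finite union of unlikely events.\<close>

lemma likely_near_solution:
  assumes T: "0 \<le> T" and \<delta>: "0 < \<delta>" and \<epsilon>: "0 < \<epsilon>"
  shows "\<forall>\<^sub>F N in sequentially. \<exists>A\<in>sets (M N). 1 - \<epsilon> < measure (M N) A \<and> (\<forall>w\<in>A. \<exists>y. near_solution b lam qinf T n \<delta> (q N w) y)"
proof -
  define \<eta> where "\<eta> = min 1 (\<delta> / (T + 4))"
  have \<eta>: "0 < \<eta>" "\<eta> \<le> 1" "\<eta> * (T + 4) \<le> \<delta>"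
    using T \<delta> by (auto simp: \<eta>_def min_def pos_le_divide_eq)
  define K where "K = {k :: nat. real k * \<eta> \<le> T + \<eta>}"
  have K: "finite K"
  proof (rule finite_subset)
    show "K \<subseteq> {..nat \<lceil>(T + \<eta>) / \<eta>\<rceil>}" using \<eta>(1) by (auto simp: K_def pos_le_divide_eq[symmetric]) linarith
  qed simp
  define E where "E N w \<longleftrightarrow> (\<eta> < l1_dist (q N w 0) qinf \<or> \<not> (\<forall>k. chosen N w k < N)) \<or>
    (\<exists>k\<in>K. \<eta> * real N \<le> \<bar>real (arrivals_until N w (real k * \<eta>)) - rate N * (real k * \<eta>)\<bar>) \<or>
    (\<exists>i\<in>{1..n}. (\<exists>k\<in>K. \<eta> * real N \<le> \<bar>real (card (counted N w i (real k * \<eta>))) - time_at_level N w i (real k * \<eta>)\<bar>) \<or>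
       \<eta> * real N \<le> real (card (bad_overflows N w \<eta> i T)))" for N w
  have "unlikely (\<lambda>N w. E N w)"
    unfolding E_def
    by (intro unlikely_disj unlikely_Bex unlikely_initial unlikely_invalid unlikely_arrivals unlikely_departures unlikely_bad_overflows K \<eta> T)
      (use \<eta> in auto)
  then have meas: "\<And>N. 1 \<le> N \<Longrightarrow> {w \<in> space (M N). E N w} \<in> sets (M N)"
    and small: "\<forall>\<^sub>F N in sequentially. measure (M N) {w \<in> space (M N). E N w} < \<epsilon>"
    using \<epsilon> by (auto simp: unlikely_def intro: order_tendstoD)
  have rates: "\<forall>\<^sub>F N in sequentially. \<bar>rate N / real N - lam\<bar> < \<eta>"
    using tendstoD[OF load(1) \<eta>(1)] by (simp add: dist_real_def)
  show ?thesis
    using small rates eventually_ge_at_top[of 1]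
  proof eventually_elim
    case (elim N)
    interpret jsq_system "M N" N "d N" b "rate N" "x0 N" "\<rho> N" "\<tau> N" "\<sigma> N" "L N" by (rule system[OF elim(3)])
    let ?A = "{w \<in> space (M N). \<not> E N w}"
    have "?A = space (M N) - {w \<in> space (M N). E N w}" by auto
    then have "?A \<in> events" "1 - \<epsilon> < prob ?A" using prob_compl[OF meas[OF elim(3)]] meas[OF elim(3)] elim(1) by auto
    moreover have "\<exists>y. near_solution b lam qinf T n \<delta> (q N w) y" if "w \<in> ?A" for w
    proof -
      have w: "w \<in> space (M N)" and good: "\<not> E N w" using that by auto
      interpret A: jsq_arrivals N b "x0 N w" "\<tau> N w" "L N w" by (rule arrivals[OF w])
      have "near_solution b lam qinf T n \<delta> (A.occupancy (req w)) (\<lambda>i t. real (A.overflows (req w) i t) / real N)"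
      proof (rule A.near_solution_of_counts[where S = "req w", OF req_pos[OF w] N_pos initial_le[OF w] qinf _ T \<eta>])
        show "lam \<le> 1" "0 \<le> rate N" "\<bar>rate N / real N - lam\<bar> \<le> \<eta>" using load(2) rate_pos elim(2) by auto
        show "l1_dist (A.occupancy (req w) 0) qinf \<le> \<eta>" unfolding path_eq_occupancy[OF w] using good by (simp add: E_def not_less)
        have "\<bar>real (arrivals_by w (real k * \<eta>)) - rate N * (real k * \<eta>)\<bar> < \<eta> * real N" if "k \<in> K" for k
          using good that unfolding E_def not_le[symmetric] by blast
        then show "\<bar>real (arrivals_by w (real k * \<eta>)) - rate N * (real k * \<eta>)\<bar> \<le> \<eta> * real N" if "real k * \<eta> \<le> T + \<eta>" for k
          using that by (simp add: K_def less_imp_le)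
        have "\<bar>real (card (data.counted w i (real k * \<eta>))) - data.time_at_level w i (real k * \<eta>)\<bar> < \<eta> * real N" if "k \<in> K" "i \<in> {1..n}" for k i
          using good that unfolding E_def not_le[symmetric] by blast
        then show "\<bar>real (card (data.counted w i (real k * \<eta>))) - data.time_at_level w i (real k * \<eta>)\<bar> \<le> \<eta> * real N"
          if "real k * \<eta> \<le> T + \<eta>" "i \<in> {1..n}" for k i
          using that by (simp add: K_def less_imp_le)
      qed (use good in \<open>auto simp: E_def not_le intro: less_imp_le\<close>)
      then show ?thesis unfolding path_eq_occupancy[OF w] by blast
    qed
    ultimately show ?case by blast
  qed
qed

text \<open>Sample points of good events for larger and larger systems give the fluid path as a limit.\<close>

lemma fluid_path_exists: "\<exists>x y. fluid_path b lam qinf x y"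
proof -
  have "\<exists>X Y. near_solution b lam qinf (real n) n (1 / real (n + 4)) X Y" for n
  proof -
    have "\<forall>\<^sub>F N in sequentially. \<exists>A\<in>sets (M N). 1 - 1 < measure (M N) A \<and> (\<forall>w\<in>A. \<exists>y. near_solution b lam qinf (real n) n (1 / real (n + 4)) (q N w) y)"
      by (rule likely_near_solution) auto
    then obtain N A where A: "0 < measure (M N) A" "\<forall>w\<in>A. \<exists>y. near_solution b lam qinf (real n) n (1 / real (n + 4)) (q N w) y"
      by (auto simp: eventually_sequentially)
    have "A \<noteq> {}" using A(1) by auto
    then show ?thesis using A(2) by blast
  qed
  then obtain X Y where "\<And>n. near_solution b lam qinf (real n) n (1 / real (n + 4)) (X n) (Y n)" by metis
  from near_solution_limit[OF lam_nonneg qinf this]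
  obtain x y where "x \<in> extensional {0..}" "\<And>T n \<delta>. 0 < \<delta> \<Longrightarrow> near_solution b lam qinf T n \<delta> x y" by blast
  then have "fluid_path b lam qinf x y" using lam_nonneg load(2) qinf by unfold_locales
  then show ?thesis by blast
qed

end

lemma (in fluid_path) path_cadlag: "x \<in> Metric_space.cadlag_paths (occupancy_states b) l1_dist"
proof (rule Metric_space.cadlag_pathsI[OF Metric_space_occupancy_states x_ext path_occ])
  fix t \<epsilon> :: real assume t: "0 \<le> t" and \<epsilon>: "0 < \<epsilon>"
  obtain \<delta> where \<delta>: "0 < \<delta>" "\<And>s. 0 \<le> s \<Longrightarrow> \<bar>s - t\<bar> < \<delta> \<Longrightarrow> l1_dist (x s) (x t) < \<epsilon>"
    using path_continuous[OF t \<epsilon>] by blast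
  show "\<exists>\<delta>>0. \<forall>s. t < s \<longrightarrow> s < t + \<delta> \<longrightarrow> l1_dist (x s) (x t) < \<epsilon>"
    by (rule exI[of _ \<delta>]) (use \<delta> t in auto)
next
  fix t :: real assume t: "0 < t"
  show "\<exists>l\<in>occupancy_states b. \<forall>\<epsilon>>0. \<exists>\<delta>>0. \<forall>s. t - \<delta> < s \<longrightarrow> s < t \<longrightarrow> l1_dist (x s) l < \<epsilon>"
  proof (rule bexI[of _ "x t"], intro allI impI)
    fix \<epsilon> :: real assume "0 < \<epsilon>"
    then obtain \<delta> where \<delta>: "0 < \<delta>" "\<And>s. 0 \<le> s \<Longrightarrow> \<bar>s - t\<bar> < \<delta> \<Longrightarrow> l1_dist (x s) (x t) < \<epsilon>"
      using path_continuous[of t \<epsilon>] t by auto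
    show "\<exists>\<delta>>0. \<forall>s. t - \<delta> < s \<longrightarrow> s < t \<longrightarrow> l1_dist (x s) (x t) < \<epsilon>"
      by (rule exI[of _ "min \<delta> t"]) (use \<delta> t in auto)
  qed (use path_occ t in auto)
qed

lemma (in jsq_sequence) converges_to_fluid_path:
  assumes x: "fluid_path b lam qinf x y" and r: "strict_mono r" "1 \<le> r 0"
  shows "converges_weakly (skorohod_occupancy b) (\<lambda>n. M (r n)) (\<lambda>n. q (r n)) (return (borel_of (skorohod_occupancy b)) x)"
proof (rule Metric_space.converges_weakly_to_point[OF Metric_space_occupancy_states])
  interpret fluid_path b lam qinf x y by (rule x)
  have r1: "1 \<le> r n" for n using strict_mono_leD[OF r(1), of 0 n] r(2) by simp
  show "prob_space (M (r n))" for n using system[OF r1] by (simp add: jsq_system_def)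
  show "q (r n) \<in> M (r n) \<rightarrow>\<^sub>M borel_of (skorohod_occupancy b)" for n by (rule jsq_system.path_measurable[OF system[OF r1]])
  show "x \<in> Metric_space.cadlag_paths (occupancy_states b) l1_dist" by (rule path_cadlag)
  fix T \<epsilon> \<eta> :: real assume T: "0 < T" and \<epsilon>: "0 < \<epsilon>" and \<eta>: "0 < \<eta>"
  obtain n \<delta> where \<delta>: "0 < \<delta>" "\<And>x' y'. near_solution b lam qinf T n \<delta> x' y' \<Longrightarrow> \<forall>t\<in>{0..T}. l1_dist (x' t) (x t) < \<epsilon>"
    using near_solution_converges[of T \<epsilon>] T \<epsilon> by auto
  show "\<forall>\<^sub>F m in sequentially. \<exists>A\<in>sets (M (r m)). 1 - \<eta> \<le> measure (M (r m)) A \<and> (\<forall>w\<in>A. \<forall>t\<in>{0..T}. l1_dist (q (r m) w t) (x t) < \<epsilon>)"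
    using eventually_subseq[OF r(1) likely_near_solution[OF less_imp_le[OF T] \<delta>(1) \<eta>, of n]]
  proof eventually_elim
    case (elim m)
    then obtain A where "A \<in> sets (M (r m))" "1 - \<eta> < measure (M (r m)) A"
      "\<And>w. w \<in> A \<Longrightarrow> \<exists>y. near_solution b lam qinf T n \<delta> (q (r m) w) y" by blast
    then show ?case using \<delta>(2) by (intro bexI[of _ A]) (auto intro: less_imp_le)
  qed
qed

theorem theorem2p1:
  fixes M :: "nat \<Rightarrow> 'w measure"
    and d :: "nat \<Rightarrow> nat" and b :: enat and rate :: "nat \<Rightarrow> real" and lam :: real
    and x0 :: "nat \<Rightarrow> 'w \<Rightarrow> nat list"
    and \<rho> :: "nat \<Rightarrow> 'w \<Rightarrow> nat \<Rightarrow> nat \<Rightarrow> real"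
    and \<tau> \<sigma> :: "nat \<Rightarrow> 'w \<Rightarrow> nat \<Rightarrow> real"
    and L :: "nat \<Rightarrow> 'w \<Rightarrow> nat \<Rightarrow> nat list"
    and qinf :: "nat \<Rightarrow> real"
    and q :: "nat \<Rightarrow> 'w \<Rightarrow> real \<Rightarrow> nat \<Rightarrow> real"
  defines "q \<equiv> \<lambda>N \<omega>. occupancy_path N b (x0 N \<omega>) (\<rho> N \<omega>) (\<tau> N \<omega>) (\<sigma> N \<omega>) (L N \<omega>)"
  assumes system:
      "\<And>N. 1 \<le> N \<Longrightarrow> jsq_system (M N) N (d N) b (rate N) (x0 N) (\<rho> N) (\<tau> N) (\<sigma> N) (L N)"
    and load: "(\<lambda>N. rate N / real N) \<longlonglongrightarrow> lam" "lam < 1"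
    and choices: "filterlim d at_top sequentially"
    and qinf: "qinf \<in> occupancy_states b"
    and initial: "\<And>\<epsilon>. 0 < \<epsilon> \<Longrightarrow>
      (\<lambda>N. measure (M N) {\<omega> \<in> space (M N). \<epsilon> < l1_dist (q N \<omega> 0) qinf}) \<longlonglongrightarrow> 0"
  shows "\<forall>r::nat \<Rightarrow> nat. strict_mono r \<and> 1 \<le> r 0 \<longrightarrow>
    (\<exists>s P. strict_mono s \<and>
       converges_weakly (skorohod_occupancy b) (\<lambda>n. M (r (s n))) (\<lambda>n. q (r (s n))) P \<and>
       (AE x in P. fluid_solution b lam qinf x))"
proof (intro allI impI)
  fix r :: "nat \<Rightarrow> nat" assume r: "strict_mono r \<and> 1 \<le> r 0"
  interpret seq: jsq_sequence M d b rate lam x0 \<rho> \<tau> \<sigma> L qinf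
    by (rule jsq_sequence.intro[OF system load choices qinf initial[unfolded q_def]])
  obtain x y where x: "fluid_path b lam qinf x y" using seq.fluid_path_exists by blast
  interpret fluid_path b lam qinf x y by (rule x)
  have "closedin (skorohod_occupancy b) {x}"
    by (rule Metric_space.closedin_continuous_path[OF Metric_space_occupancy_states path_cadlag]) (rule path_continuous)
  then have "AE x in return (borel_of (skorohod_occupancy b)) x. fluid_solution b lam qinf x"
    using Metric_space.AE_return_continuous_path[OF Metric_space_occupancy_states path_cadlag, where \<Psi> = "fluid_solution b lam qinf"] fluid_solution
    by blast
  moreover have "converges_weakly (skorohod_occupancy b) (\<lambda>n. M (r (id n))) (\<lambda>n. q (r (id n))) (return (borel_of (skorohod_occupancy b)) x)"
    using seq.converges_to_fluid_path[OF x, of r] r unfolding q_def by simp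
  ultimately show "\<exists>s P. strict_mono s \<and>
       converges_weakly (skorohod_occupancy b) (\<lambda>n. M (r (s n))) (\<lambda>n. q (r (s n))) P \<and>
       (AE x in P. fluid_solution b lam qinf x)"
    using strict_mono_id by blast
qed

end
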